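(* Let $G=(V,E)$ be a 2-edge-connected graph and let $x^*\in\textsc{Subtour}(G)$. Then one can find, in time polynomial in the size of $G$, connectors $F_1,\ldots,F_\ell$ of $G$ and multipliers $\lambda_1,\ldots,\lambda_\ell$ such that (a) $x^*\ge\sum_{i=1}^{\ell}\lambda_i\chi^{F_i}$, where $\sum_i\lambda_i=1$ and $\lambda_i>0$ for all $i$; and (b) for every $i$ and every 2-edge cut $D$ of $G$, the number of edges of $F_i$ (counted with multiplicity) in $D$ is even.
   Context: $\textsc{Subtour}(G)=\{x\in\mathbb{R}^E: x(\delta(S))\ge 2 \text{ for all } \emptyset\ne S\subsetneq V,\ x\ge 0\}$, where $\delta(S)$ is the set of edges with exactly one endpoint in $S$ and $x(D)=\sum_{e\in D}x_e$. A connector of $G$ is a multiset $F$ of edges of $G$ containing at most two copies of each edge such that $(V,F)$ is connected and spanning; $\chi^F\in\mathbb{Z}^E$ is its incidence vector counting multiplicities. A 2-edge cut of $G$ is a set $\delta(S)$, $\emptyset\ne S\subsetneq V$, with $|\delta(S)|=2$. *)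

theory Defs
  imports Complex_Main "HOL-Library.Multiset" "HOL-Computational_Algebra.Polynomial"
begin

section \<open>Graphs, cuts, connectors\<close>

text \<open>Edges have an identity of their own, so parallel edges are allowed; loops are not.\<close>

record ('v, 'e) graph =
  verts :: "'v set"
  edges :: "'e set"
  ends  :: "'e \<Rightarrow> 'v set"

definition finite_graph :: "('v, 'e) graph \<Rightarrow> bool" where
  "finite_graph G \<longleftrightarrow>
     finite (verts G) \<and> verts G \<noteq> {} \<and> finite (edges G) \<and>
     (\<forall>e\<in>edges G. ends G e \<subseteq> verts G \<and> card (ends G e) = 2)"

definition delta :: "('v, 'e) graph \<Rightarrow> 'v set \<Rightarrow> 'e set" where
  "delta G S = {e \<in> edges G. card (ends G e \<inter> S) = 1}"

definition adjacent_via :: "('v, 'e) graph \<Rightarrow> 'e set \<Rightarrow> 'v \<Rightarrow> 'v \<Rightarrow> bool" where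
  "adjacent_via G A u v \<longleftrightarrow> (\<exists>e\<in>A. ends G e = {u, v})"

definition spanning_connected :: "('v, 'e) graph \<Rightarrow> 'e set \<Rightarrow> bool" where
  "spanning_connected G A \<longleftrightarrow> (\<forall>u\<in>verts G. \<forall>v\<in>verts G. (adjacent_via G A)\<^sup>*\<^sup>* u v)"

definition two_edge_connected :: "('v, 'e) graph \<Rightarrow> bool" where
  "two_edge_connected G \<longleftrightarrow>
     spanning_connected G (edges G) \<and> (\<forall>e\<in>edges G. spanning_connected G (edges G - {e}))"

definition two_edge_cut :: "('v, 'e) graph \<Rightarrow> 'e set \<Rightarrow> bool" where
  "two_edge_cut G D \<longleftrightarrow> (\<exists>S. S \<noteq> {} \<and> S \<subset> verts G \<and> D = delta G S \<and> card D = 2)"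

text \<open>Only the values of \<open>x\<close> on the edges of the graph matter.\<close>

definition subtour :: "('v, 'e) graph \<Rightarrow> ('e \<Rightarrow> real) set" where
  "subtour G = {x. (\<forall>S. S \<noteq> {} \<and> S \<subset> verts G \<longrightarrow> (\<Sum>e\<in>delta G S. x e) \<ge> 2) \<and>
                   (\<forall>e\<in>edges G. x e \<ge> 0)}"

definition connector :: "('v, 'e) graph \<Rightarrow> 'e multiset \<Rightarrow> bool" where
  "connector G F \<longleftrightarrow>
     set_mset F \<subseteq> edges G \<and> (\<forall>e. count F e \<le> 2) \<and> spanning_connected G (set_mset F)"

definition incidence :: "'e multiset \<Rightarrow> 'e \<Rightarrow> real" where
  "incidence F e = real (count F e)"


section \<open>A random access machine with real registers\<close>

text \<open>
  Since \<open>x\<close> is a real vector and the running time is measured in the size of the graph alone,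
  arithmetic on reals has unit cost. To keep the unit cost realistic, naturals (indices and
  counters) can only be added and subtracted, and reals can only be added, subtracted, compared,
  and multiplied or divided by naturals. There are no real constants besides naturals and no
  rounding. After \<open>t\<close> steps the naturals have \<open>O(t + log size)\<close> bits, and on rational input all
  real cells have a common denominator that grows by a factor of \<open>O(t + log size)\<close> bits per step;
  hence a polynomial number of steps on rational input amounts to polynomial time on a Turing
  machine, in the size of the graph and the encoding length of \<open>x\<close>.

  Memory consists of named arrays, unbounded and indexed from 0; scalars are stored at index 0.
\<close>

record state =
  nat_mem  :: "string \<Rightarrow> nat \<Rightarrow> nat"
  real_mem :: "string \<Rightarrow> nat \<Rightarrow> real"

datatype nexp =
    NConst nat
  | NCell string nexp
  | NAdd nexp nexp
  | NSub nexp nexp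

datatype rexp =
    ROfNat nexp
  | RCell string nexp
  | RAdd rexp rexp
  | RSub rexp rexp
  | RMul rexp nexp
  | RDiv rexp nexp

datatype bexp =
    NLess nexp nexp
  | RLess rexp rexp
  | BNot bexp
  | BAnd bexp bexp

datatype com =
    Skip
  | NAssign string nexp nexp
  | RAssign string nexp rexp
  | Seq com com
  | Cond bexp com com
  | While bexp com

fun nval :: "nexp \<Rightarrow> state \<Rightarrow> nat" where
  "nval (NConst k) s = k"
| "nval (NCell a i) s = nat_mem s a (nval i s)"
| "nval (NAdd i j) s = nval i s + nval j s"
| "nval (NSub i j) s = nval i s - nval j s"

text \<open>Division by zero yields zero.\<close>

fun rval :: "rexp \<Rightarrow> state \<Rightarrow> real" where
  "rval (ROfNat i) s = real (nval i s)"
| "rval (RCell a i) s = real_mem s a (nval i s)"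
| "rval (RAdd r r') s = rval r s + rval r' s"
| "rval (RSub r r') s = rval r s - rval r' s"
| "rval (RMul r i) s = rval r s * real (nval i s)"
| "rval (RDiv r i) s = rval r s / real (nval i s)"

fun bval :: "bexp \<Rightarrow> state \<Rightarrow> bool" where
  "bval (NLess i j) s \<longleftrightarrow> nval i s < nval j s"
| "bval (RLess r r') s \<longleftrightarrow> rval r s < rval r' s"
| "bval (BNot b) s \<longleftrightarrow> \<not> bval b s"
| "bval (BAnd b b') s \<longleftrightarrow> bval b s \<and> bval b' s"

definition nat_write :: "string \<Rightarrow> nat \<Rightarrow> nat \<Rightarrow> state \<Rightarrow> state" where
  "nat_write a i k s = s\<lparr>nat_mem := (nat_mem s)(a := (nat_mem s a)(i := k))\<rparr>"

definition real_write :: "string \<Rightarrow> nat \<Rightarrow> real \<Rightarrow> state \<Rightarrow> state" where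
  "real_write a i r s = s\<lparr>real_mem := (real_mem s)(a := (real_mem s a)(i := r))\<rparr>"

text \<open>
  \<open>exec c s t s'\<close>: started in \<open>s\<close>, program \<open>c\<close> terminates in \<open>s'\<close> after \<open>t\<close> steps. Assignments and
  tests count as one step each: the expressions of a program are fixed, so their size only
  contributes a constant factor.
\<close>

inductive exec :: "com \<Rightarrow> state \<Rightarrow> nat \<Rightarrow> state \<Rightarrow> bool" where
  Skip: "exec Skip s 1 s"
| NAssign: "exec (NAssign a i j) s 1 (nat_write a (nval i s) (nval j s) s)"
| RAssign: "exec (RAssign a i r) s 1 (real_write a (nval i s) (rval r s) s)"
| Seq: "exec c s t s' \<Longrightarrow> exec c' s' t' s'' \<Longrightarrow> exec (Seq c c') s (t + t') s''"
| CondTrue: "bval b s \<Longrightarrow> exec c s t s' \<Longrightarrow> exec (Cond b c c') s (1 + t) s'"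
| CondFalse: "\<not> bval b s \<Longrightarrow> exec c' s t s' \<Longrightarrow> exec (Cond b c c') s (1 + t) s'"
| WhileFalse: "\<not> bval b s \<Longrightarrow> exec (While b c) s 1 s"
| WhileTrue: "bval b s \<Longrightarrow> exec c s t s' \<Longrightarrow> exec (While b c) s' t' s'' \<Longrightarrow>
    exec (While b c) s (1 + t + t') s''"

inductive_cases exec_elims:
  "exec Skip s t s'" "exec (NAssign a i j) s t s'" "exec (RAssign a i r) s t s'"
  "exec (Seq c c') s t s'" "exec (Cond b c c') s t s'" "exec (While b c) s t s'"

lemma exec_deterministic:
  "exec c s t s' \<Longrightarrow> exec c s u s'' \<Longrightarrow> u = t \<and> s'' = s'"
proof (induction arbitrary: u s'' rule: exec.induct)
  case (Seq c s t s' c' t' sf)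
  show ?case
  proof (rule exec_elims(4)[OF Seq.prems])
    fix t1 s1 t2
    assume u: "u = t1 + t2" and "exec c s t1 s1" and w: "exec c' s1 t2 s''"
    then have "t1 = t \<and> s1 = s'" using Seq.IH(1) by blast
    with u w Seq.IH(2) show ?thesis by auto
  qed
next
  case (CondTrue b s c t s' c')
  show ?case
  proof (rule exec_elims(5)[OF CondTrue.prems])
    fix t1
    assume "u = Suc t1" "exec c s t1 s''"
    with CondTrue.IH show ?thesis by simp
  qed (use CondTrue.hyps(1) in simp)
next
  case (CondFalse b s c' t s' c)
  show ?case
  proof (rule exec_elims(5)[OF CondFalse.prems])
    fix t1
    assume "u = Suc t1" "exec c' s t1 s''"
    with CondFalse.IH show ?thesis by simp
  qed (use CondFalse.hyps(1) in simp)
next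
  case (WhileFalse b s c)
  show ?case
    by (rule exec_elims(6)[OF WhileFalse.prems]) (simp_all add: WhileFalse.hyps)
next
  case (WhileTrue b s c t s' t' sf)
  show ?case
  proof (rule exec_elims(6)[OF WhileTrue.prems])
    fix t1 s1 t2
    assume u: "u = Suc (t1 + t2)" and "exec c s t1 s1" and w: "exec (While b c) s1 t2 s''"
    then have "t1 = t \<and> s1 = s'" using WhileTrue.IH(1) by blast
    with u w WhileTrue.IH(2) show ?thesis by auto
  qed (use WhileTrue.hyps(1) in simp)
qed (erule exec_elims(1-3), simp)+


section \<open>Input and output format\<close>

text \<open>
  The vertices are \<open>0, \<dots>, n - 1\<close> and the edges \<open>0, \<dots>, m - 1\<close>. The two endpoints of an edge are
  listed in arbitrary order.
\<close>

definition presents ::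
  "nat \<Rightarrow> nat \<Rightarrow> (nat \<Rightarrow> nat) \<Rightarrow> (nat \<Rightarrow> nat) \<Rightarrow> (nat, nat) graph \<Rightarrow> bool" where
  "presents n m end1 end2 G \<longleftrightarrow>
     verts G = {..<n} \<and> edges G = {..<m} \<and> (\<forall>e<m. ends G e = {end1 e, end2 e})"

definition input_state ::
  "nat \<Rightarrow> nat \<Rightarrow> (nat \<Rightarrow> nat) \<Rightarrow> (nat \<Rightarrow> nat) \<Rightarrow> (nat \<Rightarrow> real) \<Rightarrow> state" where
  "input_state n m end1 end2 x =
     \<lparr>nat_mem = (\<lambda>a i.
        if a = ''n'' \<and> i = 0 then n
        else if a = ''m'' \<and> i = 0 then m
        else if a = ''end1'' \<and> i < m then end1 i
        else if a = ''end2'' \<and> i < m then end2 i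
        else 0),
      real_mem = (\<lambda>a i. if a = ''x'' \<and> i < m then x i else 0)\<rparr>"

text \<open>The multisets are stored one after the other in array \<open>F\<close> as vectors of \<open>m\<close> multiplicities.\<close>

definition outputs ::
  "state \<Rightarrow> nat \<Rightarrow> nat \<Rightarrow> (nat \<Rightarrow> nat multiset) \<Rightarrow> (nat \<Rightarrow> real) \<Rightarrow> bool" where
  "outputs s m l F \<mu> \<longleftrightarrow>
     nat_mem s ''l'' 0 = l \<and>
     (\<forall>i<l. real_mem s ''lambda'' i = \<mu> i \<and>
            (\<forall>e<m. nat_mem s ''F'' (i * m + e) = count (F i) e))"

end

theory Submission
  imports Defs
begin

text \<open>
  The constraints of the subtour polytope make \<open>x\<close>, summed over parallel edges, a weighting of vertex
  pairs in which all cuts weigh at least 2. Vertices \<open>n - 1, \<dots>, 1\<close> are removed one after the other by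
  splitting off: for each pair \<open>u, w\<close>, as much weight as possible is moved from the pairs \<open>vu\<close> and
  \<open>vw\<close> to \<open>uw\<close> without creating a cut of weight less than 2 that separates two vertices other than
  \<open>v\<close>. By uncrossing, the remaining weight at \<open>v\<close> can then be dropped. The amounts come
  from a minimum cut computation by maximum adjacency orderings, so no flows are needed.

  Undoing these steps turns the one-vertex tree into a convex combination of spanning trees below the
  weighting: undoing one splitting adds one edge at \<open>v\<close> instead of two, and what is saved suffices to
  attach \<open>v\<close> to the trees it is still missing from. Every step needs a modification of trees up
  to a certain total weight, which splits at most one tree, so the number of trees stays polynomial.

  Tree links are then replaced by edges, and edges are added until edge \<open>e\<close> has total weight exactly
  \<open>min (x e) 1\<close>. An edge \<open>f\<close> with \<open>x f < 1\<close> is the only such edge among those forming 2-edge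
  cuts with it, because \<open>x e + x f \<ge> 2\<close> for each such cut \<open>{e, f}\<close>. Where \<open>f\<close> is absent, all its partners are doubled;
  this makes the parities right and costs a partner \<open>e\<close> the weight \<open>1 - x f \<le> x e - 1\<close>.
\<close>

section \<open>Programs with bounded loops\<close>

text \<open>The constant 2 of the cut constraints is spent twice at each vertex v. On removal, sets
  of cut weight exactly 2 stop the splitting and are the ones that get uncrossed. On reinsertion the
  weight of v is at least 2: if the total amount split off is s, undoing it leaves v with at most s
  children on average, and 2 s is at most the weight of v. After counting the parents of v as well,
  the weight left at v therefore covers the trees in which v is still isolated.

  The obstacle is that the time bound may depend on the graph only, although x is an arbitrary real
  vector. The size of the family is thus counted by operations: one for each pair below each vertex,
  one for each possible parent, and two for each edge, which stays below (n + m + 2)^3.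

  Edges need total weight exactly \<open>min (x e) 1\<close>, not just at most that, because an edge
  is doubled in precisely the members that lack its partner, and the weight of these members has to
  be known.

  Since naturals cannot be multiplied, row offsets come from a table filled by repeated addition,
  and the cube is found by counting.\<close>

datatype prog =
    PSkip
  | PNat string nexp nexp
  | PReal string nexp rexp
  | PSeq prog prog (infixr ";;" 60)
  | PIf bexp prog prog
  | PFor string string prog

abbreviation nvar :: "string \<Rightarrow> nexp" where "nvar a \<equiv> NCell a (NConst 0)"
abbreviation rvar :: "string \<Rightarrow> rexp" where "rvar a \<equiv> RCell a (NConst 0)"
abbreviation nset :: "string \<Rightarrow> nexp \<Rightarrow> prog" where "nset a e \<equiv> PNat a (NConst 0) e"
abbreviation rset :: "string \<Rightarrow> rexp \<Rightarrow> prog" where "rset a e \<equiv> PReal a (NConst 0) e"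

primrec comp :: "prog \<Rightarrow> com" where
  "comp PSkip = Skip"
| "comp (PNat a i e) = NAssign a i e"
| "comp (PReal a i e) = RAssign a i e"
| "comp (p ;; q) = Seq (comp p) (comp q)"
| "comp (PIf b p q) = Cond b (comp p) (comp q)"
| "comp (PFor i a p) =
     Seq (NAssign i (NConst 0) (NConst 0))
       (While (NLess (nvar i) (nvar a))
         (Seq (comp p) (NAssign i (NConst 0) (NAdd (nvar i) (NConst 1)))))"

primrec iter :: "(nat \<Rightarrow> 'a \<Rightarrow> 'a) \<Rightarrow> nat \<Rightarrow> 'a \<Rightarrow> 'a" where
  "iter f 0 s = s"
| "iter f (Suc k) s = f k (iter f k s)"

text \<open>A total function, so that correctness is shown by rewriting and \<open>exec\<close>
  enters only through \<open>exec_comp\<close>. A loop reads its bound once and sets its counter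
  before each round; this matches the compiled \<open>While\<close> as long as the body writes
  neither of them. The final write is the counter value at which the test fails.\<close>

primrec run :: "prog \<Rightarrow> state \<Rightarrow> state" where
  "run PSkip s = s"
| "run (PNat a i e) s = nat_write a (nval i s) (nval e s) s"
| "run (PReal a i e) s = real_write a (nval i s) (rval e s) s"
| "run (p ;; q) s = run q (run p s)"
| "run (PIf b p q) s = (if bval b s then run p s else run q s)"
| "run (PFor i a p) s =
     nat_write i 0 (nat_mem s a 0)
       (iter (\<lambda>k t. run p (nat_write i 0 k t)) (nat_mem s a 0) s)"

primrec nwrites :: "prog \<Rightarrow> string set" where
  "nwrites PSkip = {}"
| "nwrites (PNat a i e) = {a}"
| "nwrites (PReal a i e) = {}"
| "nwrites (p ;; q) = nwrites p \<union> nwrites q"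
| "nwrites (PIf b p q) = nwrites p \<union> nwrites q"
| "nwrites (PFor i a p) = insert i (nwrites p)"

primrec rwrites :: "prog \<Rightarrow> string set" where
  "rwrites PSkip = {}"
| "rwrites (PNat a i e) = {}"
| "rwrites (PReal a i e) = {a}"
| "rwrites (p ;; q) = rwrites p \<union> rwrites q"
| "rwrites (PIf b p q) = rwrites p \<union> rwrites q"
| "rwrites (PFor i a p) = rwrites p"

primrec bounds :: "prog \<Rightarrow> string set" where
  "bounds PSkip = {}"
| "bounds (PNat a i e) = {}"
| "bounds (PReal a i e) = {}"
| "bounds (p ;; q) = bounds p \<union> bounds q"
| "bounds (PIf b p q) = bounds p \<union> bounds q"
| "bounds (PFor i a p) = insert a (bounds p)"

primrec wf_loops :: "prog \<Rightarrow> bool" where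
  "wf_loops PSkip \<longleftrightarrow> True"
| "wf_loops (PNat a i e) \<longleftrightarrow> True"
| "wf_loops (PReal a i e) \<longleftrightarrow> True"
| "wf_loops (p ;; q) \<longleftrightarrow> wf_loops p \<and> wf_loops q"
| "wf_loops (PIf b p q) \<longleftrightarrow> wf_loops p \<and> wf_loops q"
| "wf_loops (PFor i a p) \<longleftrightarrow> i \<notin> nwrites p \<and> wf_loops p"

text \<open>To be evaluated at a common bound of all loop lengths. A round costs its body, the test
  and the increment; the initial assignment and the failing test give the other 2. Branches are
  added instead of maximised, so that the result remains a polynomial.\<close>

primrec cost :: "prog \<Rightarrow> nat poly" where
  "cost PSkip = 1"
| "cost (PNat a i e) = 1"
| "cost (PReal a i e) = 1"
| "cost (p ;; q) = cost p + cost q"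
| "cost (PIf b p q) = 1 + (cost p + cost q)"
| "cost (PFor i a p) = [:2:] + [:0, 1:] * (cost p + [:2:])"

section \<open>Effect of programs on the memory and their running time\<close>

lemma nat_mem_nat_write [simp]:
  "nat_mem (nat_write a i k s) = (nat_mem s)(a := (nat_mem s a)(i := k))"
  and real_mem_nat_write [simp]: "real_mem (nat_write a i k s) = real_mem s"
  and nat_mem_real_write [simp]: "nat_mem (real_write a i r s) = nat_mem s"
  and real_mem_real_write [simp]:
  "real_mem (real_write a i r s) = (real_mem s)(a := (real_mem s a)(i := r))"
  by (simp_all add: nat_write_def real_write_def)

text \<open>Keeps track of read-only arrays, so that loop invariants need to mention only what the
  loop changes.\<close>

definition frame :: "string set \<Rightarrow> string set \<Rightarrow> state \<Rightarrow> state \<Rightarrow> bool" where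
  "frame N R s t \<longleftrightarrow>
     (\<forall>a. a \<notin> N \<longrightarrow> nat_mem t a = nat_mem s a) \<and> (\<forall>a. a \<notin> R \<longrightarrow> real_mem t a = real_mem s a)"

lemma frame_nat: "frame N R s t \<Longrightarrow> a \<notin> N \<Longrightarrow> nat_mem t a = nat_mem s a"
  and frame_real: "frame N R s t \<Longrightarrow> a \<notin> R \<Longrightarrow> real_mem t a = real_mem s a"
  by (auto simp: frame_def)

lemma frame_refl: "frame N R s s"
  by (simp add: frame_def)

lemma frame_trans: "frame N R s t \<Longrightarrow> frame N R t u \<Longrightarrow> frame N R s u"
  by (simp add: frame_def)

lemma frame_mono: "frame N R s t \<Longrightarrow> N \<subseteq> N' \<Longrightarrow> R \<subseteq> R' \<Longrightarrow> frame N' R' s t"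
  by (auto simp: frame_def)

lemma frame_nat_write: "a \<in> N \<Longrightarrow> frame N R s t \<Longrightarrow> frame N R s (nat_write a i k t)"
  and frame_real_write: "a \<in> R \<Longrightarrow> frame N R s t \<Longrightarrow> frame N R s (real_write a i r t)"
  by (auto simp: frame_def)

lemma frame_iter:
  assumes "\<And>k t. frame N R t (f k t)"
  shows "frame N R s (iter f k s)"
  by (induction k) (auto intro: frame_refl frame_trans assms)

lemma run_frame: "frame (nwrites p) (rwrites p) s (run p s)"
proof (induction p arbitrary: s)
  case (PSeq p q)
  have "frame (nwrites p \<union> nwrites q) (rwrites p \<union> rwrites q) s (run p s)"
    by (rule frame_mono[OF PSeq.IH(1)]) auto
  moreover have "frame (nwrites p \<union> nwrites q) (rwrites p \<union> rwrites q) (run p s) (run q (run p s))"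
    by (rule frame_mono[OF PSeq.IH(2)]) auto
  ultimately show ?case by (simp add: frame_trans)
next
  case (PIf b p q)
  have "frame (nwrites p \<union> nwrites q) (rwrites p \<union> rwrites q) s (run p s)"
    by (rule frame_mono[OF PIf.IH(1)]) auto
  moreover have "frame (nwrites p \<union> nwrites q) (rwrites p \<union> rwrites q) s (run q s)"
    by (rule frame_mono[OF PIf.IH(2)]) auto
  ultimately show ?case by simp
next
  case (PFor i a p)
  have "frame (insert i (nwrites p)) (rwrites p) t (run p (nat_write i 0 k t))" for k t
    by (rule frame_trans[OF frame_nat_write[OF _ frame_refl] frame_mono[OF PFor.IH]]) auto
  then show ?case by (simp add: frame_nat_write frame_iter)
qed (simp_all add: frame_def)

lemma run_nat [simp]: "a \<notin> nwrites p \<Longrightarrow> nat_mem (run p s) a = nat_mem s a"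
  and run_real [simp]: "a \<notin> rwrites p \<Longrightarrow> real_mem (run p s) a = real_mem s a"
  using run_frame by (auto simp: frame_def)

text \<open>By induction on the number \<open>N - k\<close> of rounds still to run, because
  \<open>exec\<close> unfolds a loop from its front. The state after \<open>k\<close> rounds has a
  closed form in terms of \<open>iter\<close>, and the counter, untouched by the body, turns the
  form for \<open>k\<close> into that for \<open>Suc k\<close>.\<close>

lemma exec_While_count:
  assumes wf: "i \<notin> nwrites p" "a \<notin> insert i (nwrites p)" and N: "nat_mem t a 0 = N"
    and body: "\<And>t'. nat_mem t' a 0 = N \<Longrightarrow> frame (insert i (nwrites p)) (rwrites p) t t' \<Longrightarrow>
      \<exists>c. exec (comp p) t' c (run p t') \<and> c \<le> C"
    and "k \<le> N"
  shows "\<exists>c. exec (While (NLess (nvar i) (nvar a))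
            (Seq (comp p) (NAssign i (NConst 0) (NAdd (nvar i) (NConst 1)))))
          (nat_write i 0 k (iter (\<lambda>k t. run p (nat_write i 0 k t)) k t)) c
          (nat_write i 0 N (iter (\<lambda>k t. run p (nat_write i 0 k t)) N t))
        \<and> c \<le> 1 + (N - k) * (C + 2)"
  using \<open>k \<le> N\<close>
proof (induction k rule: inc_induct)
  let ?I = "\<lambda>k. iter (\<lambda>k t. run p (nat_write i 0 k t)) k t"
  have fr: "frame (insert i (nwrites p)) (rwrites p) t (?I k)" for k
    by (rule frame_iter, rule frame_trans[OF frame_nat_write[OF _ frame_refl] frame_mono[OF run_frame]]) auto
  have aN: "nat_mem (?I k) a 0 = N" for k
    using frame_nat[OF fr wf(2)] N by simp
  {
    case base
    have "exec (While (NLess (nvar i) (nvar a))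
            (Seq (comp p) (NAssign i (NConst 0) (NAdd (nvar i) (NConst 1)))))
          (nat_write i 0 N (?I N)) 1 (nat_write i 0 N (?I N))"
      by (rule exec.WhileFalse) (use wf aN in auto)
    then show ?case by force
  next
    case (step k)
    let ?s = "nat_write i 0 k (?I k)"
    obtain c where c: "exec (comp p) ?s c (run p ?s)" "c \<le> C"
      using body[of ?s] wf aN fr by (auto simp: frame_nat_write)
    have "nat_write i (nval (NConst 0) (run p ?s)) (nval (NAdd (nvar i) (NConst 1)) (run p ?s)) (run p ?s)
        = nat_write i 0 (Suc k) (?I (Suc k))"
      using wf by simp
    then have e: "exec (NAssign i (NConst 0) (NAdd (nvar i) (NConst 1))) (run p ?s) 1 (nat_write i 0 (Suc k) (?I (Suc k)))"
      using exec.NAssign by metis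
    obtain c' where c': "exec (While (NLess (nvar i) (nvar a))
            (Seq (comp p) (NAssign i (NConst 0) (NAdd (nvar i) (NConst 1)))))
          (nat_write i 0 (Suc k) (?I (Suc k))) c' (nat_write i 0 N (?I N))"
        "c' \<le> 1 + (N - Suc k) * (C + 2)"
      using step.IH by blast
    have "exec (While (NLess (nvar i) (nvar a))
            (Seq (comp p) (NAssign i (NConst 0) (NAdd (nvar i) (NConst 1)))))
          ?s (1 + (c + 1) + c') (nat_write i 0 N (?I N))"
      by (rule exec.WhileTrue[OF _ exec.Seq[OF c(1) e] c'(1)]) (use wf aN step in auto)
    moreover have "1 + (c + 1) + c' \<le> 1 + (N - k) * (C + 2)"
    proof -
      have "N - k = Suc (N - Suc k)" using step by simp
      then show ?thesis using c(2) c'(2) by simp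
    qed
    ultimately show ?case by blast
  }
qed

text \<open>\<open>W\<close> stands for everything written by a surrounding program. Since it avoids
  all loop bounds, these keep their initial values, and every loop, however deeply nested, can be
  charged at the same \<open>B\<close>.\<close>

lemma exec_comp:
  assumes "wf_loops p" "bounds p \<inter> W = {}" "nwrites p \<subseteq> W" "\<And>a. a \<in> bounds p \<Longrightarrow> nat_mem s a 0 \<le> B"
  shows "\<exists>t. exec (comp p) s t (run p s) \<and> t \<le> poly (cost p) B"
  using assms
proof (induction p arbitrary: s)
  case PSkip
  show ?case using exec.Skip by fastforce
next
  case (PNat a i e)
  show ?case using exec.NAssign by fastforce
next
  case (PReal a i e)
  show ?case using exec.RAssign by fastforce
next
  case (PSeq p q)
  from PSeq.prems obtain t where t: "exec (comp p) s t (run p s)" "t \<le> poly (cost p) B"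
    using PSeq.IH(1)[of s] by auto
  have "nat_mem (run p s) a 0 \<le> B" if "a \<in> bounds q" for a
  proof -
    have "a \<notin> nwrites p" using that PSeq.prems(2,3) by auto
    then show ?thesis using PSeq.prems(4)[of a] that by simp
  qed
  then obtain t' where t': "exec (comp q) (run p s) t' (run q (run p s))" "t' \<le> poly (cost q) B"
    using PSeq.IH(2)[of "run p s"] PSeq.prems by auto
  show ?case
    using exec.Seq[OF t(1) t'(1)] t(2) t'(2) by (auto intro!: exI[of _ "t + t'"])
next
  case (PIf b p q)
  from PIf.prems obtain t where t: "exec (comp p) s t (run p s)" "t \<le> poly (cost p) B"
    using PIf.IH(1)[of s] by auto
  from PIf.prems obtain t' where t': "exec (comp q) s t' (run q s)" "t' \<le> poly (cost q) B"
    using PIf.IH(2)[of s] by auto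
  show ?case
  proof (cases "bval b s")
    case True
    show ?thesis using exec.CondTrue[OF True t(1)] t(2) True by (auto intro!: exI[of _ "1 + t"])
  next
    case False
    show ?thesis using exec.CondFalse[OF False t'(1)] t'(2) False by (auto intro!: exI[of _ "1 + t'"])
  qed
next
  case (PFor i a p)
  let ?N = "nat_mem s a 0"
  have wf: "i \<notin> nwrites p" "a \<notin> insert i (nwrites p)" using PFor.prems by auto
  have body: "\<exists>c. exec (comp p) t' c (run p t') \<and> c \<le> poly (cost p) B"
    if "frame (insert i (nwrites p)) (rwrites p) s t'" for t'
  proof (rule PFor.IH)
    fix b assume b: "b \<in> bounds p"
    then have "b \<notin> insert i (nwrites p)" using PFor.prems(2,3) by auto
    then show "nat_mem t' b 0 \<le> B" using frame_nat[OF that] PFor.prems(4)[of b] b by simp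
  qed (use PFor.prems in auto)
  obtain c where c: "exec (While (NLess (nvar i) (nvar a))
            (Seq (comp p) (NAssign i (NConst 0) (NAdd (nvar i) (NConst 1)))))
          (nat_write i 0 0 s) c (run (PFor i a p) s)" "c \<le> 1 + ?N * (poly (cost p) B + 2)"
    using exec_While_count[OF wf refl, of s "poly (cost p) B" 0] body by auto
  have "exec (NAssign i (NConst 0) (NConst 0)) s 1 (nat_write i 0 0 s)"
    using exec.NAssign[of i "NConst 0" "NConst 0" s] by simp
  then have "exec (comp (PFor i a p)) s (1 + c) (run (PFor i a p) s)"
    using exec.Seq c(1) by (metis comp.simps(6))
  moreover have "?N * (poly (cost p) B + 2) \<le> B * (poly (cost p) B + 2)"
    using PFor.prems(4)[of a] by (intro mult_right_mono) auto
  ultimately show ?case using c(2) by (intro exI[of _ "1 + c"]) (auto simp: algebra_simps)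
qed

text \<open>The invariant rule for loops. The step may use the frame relative to the initial state,
  which supplies all facts about arrays that the body leaves alone.\<close>

lemma run_For:
  assumes "Q 0 s"
    and "\<And>k t. k < nat_mem s a 0 \<Longrightarrow> Q k t \<Longrightarrow> frame (insert i (nwrites p)) (rwrites p) s t \<Longrightarrow>
      Q (Suc k) (run p (nat_write i 0 k t))"
  obtains t where "run (PFor i a p) s = nat_write i 0 (nat_mem s a 0) t"
    "Q (nat_mem s a 0) t" "frame (insert i (nwrites p)) (rwrites p) s t"
proof -
  let ?I = "\<lambda>k. iter (\<lambda>k t. run p (nat_write i 0 k t)) k s"
  have fr: "frame (insert i (nwrites p)) (rwrites p) s (?I k)" for k
    by (rule frame_iter, rule frame_trans[OF frame_nat_write[OF _ frame_refl] frame_mono[OF run_frame]]) auto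
  have "k \<le> nat_mem s a 0 \<Longrightarrow> Q k (?I k)" for k
    by (induction k) (use assms fr in auto)
  then show ?thesis using that fr by simp
qed

section \<open>Weighted cuts\<close>

text \<open>Only ordered pairs leaving \<open>X\<close> inside \<open>U\<close> are counted. The
  diagonal never contributes, which matters because contracting vertices leaves meaningless values
  there.\<close>

definition cut :: "(nat \<Rightarrow> nat \<Rightarrow> real) \<Rightarrow> nat set \<Rightarrow> nat set \<Rightarrow> real" where
  "cut w U X = (\<Sum>a\<in>U. \<Sum>b\<in>U. if a \<in> X \<and> b \<notin> X then w a b else 0)"

definition sym_nonneg :: "(nat \<Rightarrow> nat \<Rightarrow> real) \<Rightarrow> nat set \<Rightarrow> bool" where
  "sym_nonneg w U \<longleftrightarrow> (\<forall>a\<in>U. \<forall>b\<in>U. a \<noteq> b \<longrightarrow> w a b = w b a \<and> 0 \<le> w a b)"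

lemma cut_cong:
  assumes "\<And>a b. a \<in> U \<Longrightarrow> b \<in> U \<Longrightarrow> a \<noteq> b \<Longrightarrow> w a b = w' a b"
    and "\<And>a. a \<in> U \<Longrightarrow> a \<in> X \<longleftrightarrow> a \<in> Y"
  shows "cut w U X = cut w' U Y"
  unfolding cut_def by (intro sum.cong refl) (use assms in auto)

lemma cut_insert:
  assumes "finite U" "y \<notin> U"
  shows "cut w (insert y U) X = cut w U X + (if y \<in> X then \<Sum>b\<in>U. if b \<notin> X then w y b else 0
           else \<Sum>a\<in>U. if a \<in> X then w a y else 0)"
  using assms by (auto simp: cut_def sum.distrib cong: if_cong)

lemma cut_compl:
  assumes "sym_nonneg w U"
  shows "cut w U (U - X) = cut w U X"
proof -
  have "cut w U (U - X) = (\<Sum>b\<in>U. \<Sum>a\<in>U. if a \<in> U - X \<and> b \<notin> U - X then w a b else 0)"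
    unfolding cut_def by (rule sum.swap)
  also have "\<dots> = cut w U X"
    unfolding cut_def by (intro sum.cong refl) (use assms in \<open>auto simp: sym_nonneg_def\<close>)
  finally show ?thesis .
qed

lemma cut_add: "cut (\<lambda>a b. w a b + w' a b) U X = cut w U X + cut w' U X"
  unfolding cut_def sum.distrib[symmetric] by (intro sum.cong refl) auto

lemma cut_scale: "cut (\<lambda>a b. c * w a b) U X = c * cut w U X"
  unfolding cut_def by (simp add: sum_distrib_left if_distrib cong: if_cong)

lemma cut_entry:
  assumes "finite U" "p \<in> U" "q \<in> U"
  shows "cut (\<lambda>a b. of_bool (a = p \<and> b = q)) U X = of_bool (p \<in> X \<and> q \<notin> X)"
proof -
  have "cut (\<lambda>a b. of_bool (a = p \<and> b = q)) U X
      = (\<Sum>a\<in>U. \<Sum>b\<in>U. if b = q then if a = p then of_bool (p \<in> X \<and> q \<notin> X) else 0 else 0)"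
    unfolding cut_def by (intro sum.cong refl) auto
  then show ?thesis using assms by simp
qed

text \<open>True already for each ordered pair of vertices: a pair leaving the union or the
  intersection leaves \<open>X\<close> or \<open>Y\<close>, and a pair leaving both leaves
  \<open>X\<close> and \<open>Y\<close>.\<close>

lemma cut_submod:
  assumes "sym_nonneg w U"
  shows "cut w U (X \<union> Y) + cut w U (X \<inter> Y) \<le> cut w U X + cut w U Y"
  unfolding cut_def sum.distrib[symmetric]
proof (intro sum_mono)
  fix a b assume "a \<in> U" "b \<in> U"
  then have "a \<noteq> b \<Longrightarrow> 0 \<le> w a b" using assms by (auto simp: sym_nonneg_def)
  then show "(if a \<in> X \<union> Y \<and> b \<notin> X \<union> Y then w a b else 0) +
      (if a \<in> X \<inter> Y \<and> b \<notin> X \<inter> Y then w a b else 0)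
    \<le> (if a \<in> X \<and> b \<notin> X then w a b else 0) + (if a \<in> Y \<and> b \<notin> Y then w a b else 0)"
    by (cases "a = b") auto
qed

text \<open>A form in which a set and its complement look alike. Posimodularity compares the two
  differences of sets, and it can be checked pair by pair only in this form.\<close>

lemma cut_sym:
  assumes "sym_nonneg w U"
  shows "2 * cut w U X = (\<Sum>a\<in>U. \<Sum>b\<in>U. if a \<in> X \<longleftrightarrow> b \<in> X then 0 else w a b)"
proof -
  have "2 * cut w U X = cut w U X + cut w U (U - X)"
    by (simp add: cut_compl[OF assms])
  also have "\<dots> = (\<Sum>a\<in>U. \<Sum>b\<in>U. if a \<in> X \<longleftrightarrow> b \<in> X then 0 else w a b)"
    unfolding cut_def sum.distrib[symmetric] by (intro sum.cong refl) auto
  finally show ?thesis .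
qed

text \<open>The pair \<open>p\<close>, \<open>q\<close> is separated by \<open>X\<close> and by
  \<open>Y\<close> but by neither difference, so it is counted twice on the right and not at all on
  the left. For all other pairs the left side counts at most as often as the right.\<close>

lemma cut_posimodular:
  assumes w: "sym_nonneg w U" and "finite U" and p: "p \<in> U" "p \<in> X" "p \<in> Y"
    and q: "q \<in> U" "q \<notin> X" "q \<notin> Y"
  shows "cut w U (X - Y) + cut w U (Y - X) + 2 * w p q \<le> cut w U X + cut w U Y"
proof -
  let ?e = "\<lambda>(Z::nat set) a b. if a \<in> Z \<longleftrightarrow> b \<in> Z then 0 else w a b"
  let ?g = "\<lambda>a b. ?e X a b + ?e Y a b - ?e (X - Y) a b - ?e (Y - X) a b"
  let ?h = "\<lambda>a b. (if b = q then if a = p then 2 * w p q else 0 else 0) + (if b = p then if a = q then 2 * w p q else 0 else 0)"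
  have pq: "p \<noteq> q" using p q by auto
  have "(\<Sum>a\<in>U. \<Sum>b\<in>U. ?h a b) \<le> (\<Sum>a\<in>U. \<Sum>b\<in>U. ?g a b)"
  proof (intro sum_mono)
    fix a b assume ab: "a \<in> U" "b \<in> U"
    have "a \<noteq> b \<Longrightarrow> 0 \<le> w a b" "w q p = w p q" using w ab p q pq by (auto simp: sym_nonneg_def)
    then show "?h a b \<le> ?g a b" using p q pq by (cases "a = b") auto
  qed
  moreover have "(\<Sum>a\<in>U. \<Sum>b\<in>U. ?h a b) = 4 * w p q"
    using \<open>finite U\<close> p q by (simp add: sum.distrib)
  moreover have "(\<Sum>a\<in>U. \<Sum>b\<in>U. ?g a b) =
      2 * cut w U X + 2 * cut w U Y - 2 * cut w U (X - Y) - 2 * cut w U (Y - X)"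
    unfolding cut_sym[OF w] by (simp add: sum.distrib sum_subtractf)
  ultimately show ?thesis by simp
qed

section \<open>Maximum adjacency orderings\<close>

text \<open>The invariant of a maximum adjacency ordering with last vertex \<open>l\<close>, from the Stoer--Wagner
  analysis; it is stated for all cuts at once, so that a single step preserves it.\<close>

definition ma_inv :: "(nat \<Rightarrow> nat \<Rightarrow> real) \<Rightarrow> nat set \<Rightarrow> nat set \<Rightarrow> nat \<Rightarrow> bool" where
  "ma_inv w U B l \<longleftrightarrow> (\<forall>X. \<forall>y\<in>U - B. (y \<in> X) \<noteq> (l \<in> X) \<longrightarrow> (\<Sum>b\<in>B. w b y) \<le> cut w (insert y B) X)"

lemma cut_insert_sym:
  assumes "finite B" "y \<notin> B" "sym_nonneg w (insert y B)"
  shows "cut w (insert y B) X = cut w B X + (\<Sum>b\<in>B. if (b \<in> X) = (y \<in> X) then 0 else w b y)"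
proof -
  have "(if y \<in> X then \<Sum>b\<in>B. if b \<notin> X then w y b else 0 else \<Sum>a\<in>B. if a \<in> X then w a y else 0)
    = (\<Sum>b\<in>B. if (b \<in> X) = (y \<in> X) then 0 else w b y)"
    using assms by (auto simp: sym_nonneg_def intro!: sum.cong)
  then show ?thesis using cut_insert[OF assms(1,2), of w X] by simp
qed

lemma sym_nonneg_mono: "sym_nonneg w U \<Longrightarrow> V \<subseteq> U \<Longrightarrow> sym_nonneg w V"
  by (auto simp: sym_nonneg_def)

lemma ma_inv_start: "sym_nonneg w U \<Longrightarrow> v \<in> U \<Longrightarrow> ma_inv w U {v} v"
  unfolding ma_inv_def
proof (intro allI ballI impI)
  fix X y assume a: "sym_nonneg w U" "v \<in> U" "y \<in> U - {v}" "(y \<in> X) \<noteq> (v \<in> X)"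
  have "cut w (insert y {v}) X = cut w {v} X + (\<Sum>b\<in>{v}. if (b \<in> X) = (y \<in> X) then 0 else w b y)"
    by (rule cut_insert_sym) (use a in \<open>auto intro: sym_nonneg_mono\<close>)
  then show "(\<Sum>b\<in>{v}. w b y) \<le> cut w (insert y {v}) X" using a(4) by (auto simp: cut_def)
qed

text \<open>Let \<open>X\<close> separate \<open>y\<close> from \<open>l'\<close>. If
  \<open>l'\<close> is on the side of \<open>l\<close>, then \<open>X\<close> separates
  \<open>y\<close> from \<open>l\<close>, and the old bound for \<open>y\<close> only gains the edge
  between \<open>l'\<close> and \<open>y\<close>. Otherwise \<open>X\<close> separates
  \<open>l'\<close> from \<open>l\<close>; the old bound for \<open>l'\<close> dominates the weight
  from \<open>B\<close> to \<open>y\<close> by the maximal choice of \<open>l'\<close>, and again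
  that edge is added on both sides.\<close>

lemma ma_inv_step:
  assumes U: "sym_nonneg w U" "finite U" and B: "B \<subseteq> U" "l \<in> B" and l': "l' \<in> U - B"
    and max: "\<And>y. y \<in> U - B \<Longrightarrow> (\<Sum>b\<in>B. w b y) \<le> (\<Sum>b\<in>B. w b l')"
    and inv: "ma_inv w U B l"
  shows "ma_inv w U (insert l' B) l'"
  unfolding ma_inv_def
proof (intro allI ballI impI)
  fix X y assume y: "y \<in> U - insert l' B" and sep: "(y \<in> X) \<noteq> (l' \<in> X)"
  have fB: "finite B" using U B finite_subset by blast
  have l'B: "l' \<notin> B" and yB: "y \<notin> B" "y \<noteq> l'" using l' y by auto
  have sub: "insert y (insert l' B) \<subseteq> U" using y l' B by auto
  note snn = sym_nonneg_mono[OF U(1)]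
  have s: "(\<Sum>b\<in>insert l' B. w b y) = (\<Sum>b\<in>B. w b y) + w l' y"
    using fB l'B by simp
  have c3: "cut w (insert y (insert l' B)) X = cut w (insert l' B) X
      + (\<Sum>b\<in>B. if (b \<in> X) = (y \<in> X) then 0 else w b y) + w l' y"
    using cut_insert_sym[of "insert l' B" y w X] fB yB l'B snn[OF sub] sep by auto
  have nn: "0 \<le> (\<Sum>b\<in>B. if (b \<in> X) = (z \<in> X) then 0 else w b z)" if "z \<in> U - B" for z
    using U B that by (intro sum_nonneg) (auto simp: sym_nonneg_def)
  have c2: "cut w (insert l' B) X = cut w B X + (\<Sum>b\<in>B. if (b \<in> X) = (l' \<in> X) then 0 else w b l')"
    using cut_insert_sym[of B l' w X] fB l'B snn[of "insert l' B"] sub by auto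
  have c1: "cut w (insert y B) X = cut w B X + (\<Sum>b\<in>B. if (b \<in> X) = (y \<in> X) then 0 else w b y)"
    using cut_insert_sym[of B y w X] fB yB snn[of "insert y B"] sub by auto
  show "(\<Sum>b\<in>insert l' B. w b y) \<le> cut w (insert y (insert l' B)) X"
  proof (cases "(l' \<in> X) = (l \<in> X)")
    case True
    then have "(\<Sum>b\<in>B. w b y) \<le> cut w (insert y B) X"
      using inv sep y unfolding ma_inv_def by auto
    then show ?thesis using s c1 c2 c3 nn[OF l'] by linarith
  next
    case False
    then have "(\<Sum>b\<in>B. w b l') \<le> cut w (insert l' B) X"
      using inv l' unfolding ma_inv_def by auto
    moreover have "(\<Sum>b\<in>B. w b y) \<le> (\<Sum>b\<in>B. w b l')" using max y by auto
    moreover have "y \<in> U - B" using y by auto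
    ultimately show ?thesis using s c3 nn[of y] by linarith
  qed
qed

text \<open>Contracting \<open>t\<close> into \<open>s\<close> preserves the cuts that keep the two
  together: \<open>t\<close> is put on the side of \<open>s\<close>. The weights are compared off
  the diagonal only, where the contraction is meaningful.\<close>

lemma cut_merge:
  assumes U: "sym_nonneg w U" "finite U" and st: "s \<in> U" "t \<in> U" "s \<noteq> t"
    and m: "\<And>a b. a \<in> U - {t} \<Longrightarrow> b \<in> U - {t} \<Longrightarrow> a \<noteq> b \<Longrightarrow>
      w' a b = w a b + (if a = s then w t b else 0) + (if b = s then w a t else 0)"
  shows "cut w' (U - {t}) Y = cut w U (if s \<in> Y then insert t Y else Y - {t})"
proof -
  let ?Y = "if s \<in> Y then insert t Y else Y - {t}" and ?V = "U - {t}"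
  have V: "finite ?V" "s \<in> ?V" using U st by auto
  have "cut w' ?V Y = (\<Sum>a\<in>?V. \<Sum>b\<in>?V. (if a \<in> Y \<and> b \<notin> Y then w a b else 0)
      + (if a = s then if a \<in> Y \<and> b \<notin> Y then w t b else 0 else 0)
      + (if b = s then if a \<in> Y \<and> b \<notin> Y then w a t else 0 else 0))"
    unfolding cut_def
  proof (intro sum.cong refl)
    fix a b assume ab: "a \<in> ?V" "b \<in> ?V"
    show "(if a \<in> Y \<and> b \<notin> Y then w' a b else 0) = (if a \<in> Y \<and> b \<notin> Y then w a b else 0)
      + (if a = s then if a \<in> Y \<and> b \<notin> Y then w t b else 0 else 0)
      + (if b = s then if a \<in> Y \<and> b \<notin> Y then w a t else 0 else 0)"
    proof (cases "a = b")
      case False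
      then show ?thesis using m[OF ab] by auto
    qed auto
  qed
  also have "\<dots> = cut w ?V Y + (\<Sum>b\<in>?V. if s \<in> Y \<and> b \<notin> Y then w t b else 0)
      + (\<Sum>a\<in>?V. if a \<in> Y \<and> s \<notin> Y then w a t else 0)"
  proof -
    have "(\<Sum>a\<in>?V. \<Sum>b\<in>?V. if a = s then if a \<in> Y \<and> b \<notin> Y then w t b else 0 else 0)
        = (\<Sum>b\<in>?V. \<Sum>a\<in>?V. if a = s then if a \<in> Y \<and> b \<notin> Y then w t b else 0 else 0)"
      by (rule sum.swap)
    also have "\<dots> = (\<Sum>b\<in>?V. if s \<in> Y \<and> b \<notin> Y then w t b else 0)"
      by (rule sum.cong[OF refl]) (use V in simp)
    finally have 1: "(\<Sum>a\<in>?V. \<Sum>b\<in>?V. if a = s then if a \<in> Y \<and> b \<notin> Y then w t b else 0 else 0)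
        = (\<Sum>b\<in>?V. if s \<in> Y \<and> b \<notin> Y then w t b else 0)" .
    have 2: "(\<Sum>a\<in>?V. \<Sum>b\<in>?V. if b = s then if a \<in> Y \<and> b \<notin> Y then w a t else 0 else 0)
        = (\<Sum>a\<in>?V. if a \<in> Y \<and> s \<notin> Y then w a t else 0)"
      by (rule sum.cong[OF refl]) (use V in simp)
    show ?thesis unfolding sum.distrib 1 2 cut_def ..
  qed
  also have "\<dots> = cut w (insert t ?V) ?Y"
  proof -
    have "cut w ?V ?Y = cut w ?V Y" by (rule cut_cong) auto
    moreover have "(if t \<in> ?Y then \<Sum>b\<in>?V. if b \<notin> ?Y then w t b else 0 else \<Sum>a\<in>?V. if a \<in> ?Y then w a t else 0)
       = (\<Sum>b\<in>?V. if s \<in> Y \<and> b \<notin> Y then w t b else 0) + (\<Sum>a\<in>?V. if a \<in> Y \<and> s \<notin> Y then w a t else 0)"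
      by (cases "s \<in> Y") (auto intro!: sum.cong)
    ultimately show ?thesis using cut_insert[of ?V t w ?Y] V by simp
  qed
  also have "insert t ?V = U" using st by auto
  finally show ?thesis .
qed

text \<open>One phase of the minimum cut computation: cuts that separate \<open>s\<close> from \<open>t\<close> are at least as
  large as the cut of \<open>t\<close> alone, all others survive the contraction of \<open>s\<close> and \<open>t\<close>. The vertex \<open>v\<close>
  is never contracted, which excludes the cut of \<open>v\<close> alone.\<close>

lemma phase_cuts:
  assumes w: "sym_nonneg w (insert v A)" and "finite A" "v \<notin> A" and st: "s \<in> A" "t \<in> A" "s \<noteq> t"
    and inv: "ma_inv w (insert v A) (insert v A - {t}) s"
    and m: "\<And>a b. a \<in> insert v A - {t} \<Longrightarrow> b \<in> insert v A - {t} \<Longrightarrow> a \<noteq> b \<Longrightarrow>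
      w' a b = w a b + (if a = s then w t b else 0) + (if b = s then w a t else 0)"
    and z: "z = (\<Sum>b\<in>insert v A - {t}. w b t)"
  shows "(\<forall>Y. Y \<noteq> {} \<and> Y \<subset> A \<longrightarrow> \<beta> \<le> cut w (insert v A) Y) \<longleftrightarrow>
    \<beta> \<le> z \<and> (\<forall>Y. Y \<noteq> {} \<and> Y \<subset> A - {t} \<longrightarrow> \<beta> \<le> cut w' (insert v (A - {t})) Y)"
proof -
  let ?U = "insert v A"
  have U': "?U - {t} = insert v (A - {t})" using assms by auto
  have mg: "cut w' (insert v (A - {t})) Y = cut w ?U (if s \<in> Y then insert t Y else Y - {t})" for Y
    using cut_merge[OF w _ _ _ st(3) m, where Y = Y] assms unfolding U' by auto
  have zt: "cut w ?U {t} = z"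
  proof -
    have "insert t (?U - {t}) = ?U" using st by auto
    moreover have "cut w (insert t (?U - {t})) {t} = cut w (?U - {t}) {t} + z"
      unfolding z using cut_insert_sym[of "?U - {t}" t w "{t}"] calculation w \<open>finite A\<close>
      by (auto intro!: sum.cong)
    moreover have "cut w (?U - {t}) {t} = 0" unfolding cut_def by (intro sum.neutral ballI) auto
    ultimately show ?thesis by simp
  qed
  \<comment> \<open>\<open>t\<close> is the only vertex outside the ordering, so at this point the
    invariant speaks about cuts of the whole vertex set.\<close>
  have sep: "z \<le> cut w ?U Y" if "(t \<in> Y) \<noteq> (s \<in> Y)" for Y
  proof -
    have e: "insert t (?U - {t}) = ?U" "t \<in> ?U - (?U - {t})" using st by auto
    have "(\<Sum>b\<in>?U - {t}. w b t) \<le> cut w (insert t (?U - {t})) Y"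
      using inv that e(2) unfolding ma_inv_def by blast
    then show ?thesis unfolding e(1) z .
  qed
  show ?thesis (is "?l = ?r")
  proof
    assume l: ?l
    have "{t} \<subset> A" using st by auto
    then have "\<beta> \<le> z" using l zt by auto
    moreover have "\<beta> \<le> cut w' (insert v (A - {t})) Y" if Y: "Y \<noteq> {}" "Y \<subset> A - {t}" for Y
    proof -
      have "(if s \<in> Y then insert t Y else Y - {t}) \<subset> A"
        using Y st by (cases "s \<in> Y") auto
      moreover have "(if s \<in> Y then insert t Y else Y - {t}) \<noteq> {}" using Y by auto
      ultimately show ?thesis using l unfolding mg by blast
    qed
    ultimately show ?r by blast
  next
    assume r: ?r
    show ?l
    proof (intro allI impI, elim conjE)
      fix Y assume Y: "Y \<noteq> {}" "Y \<subset> A"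
      show "\<beta> \<le> cut w ?U Y"
      proof (cases "(t \<in> Y) = (s \<in> Y)")
        case False
        then show ?thesis using sep[OF False] r by linarith
      next
        case True
        have e: "(if s \<in> Y - {t} then insert t (Y - {t}) else Y - {t} - {t}) = Y"
          using True st by auto
        \<comment> \<open>\<open>Y\<close> cannot be \<open>{t}\<close>, since it does not separate
          \<open>t\<close> from \<open>s\<close>.\<close>
        have "Y - {t} \<noteq> {}" using True Y st by auto
        moreover have "Y - {t} \<subset> A - {t}" using Y True st by blast
        ultimately have "\<beta> \<le> cut w' (insert v (A - {t})) (Y - {t})"
          using r[THEN conjunct2, rule_format, OF conjI] by simp
        then show ?thesis unfolding mg e .
      qed
    qed
  qed
qed

section \<open>Splitting off\<close>

text \<open>Written as a linear combination of single entries, so that its cuts follow from the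
  linearity of \<open>cut\<close>.\<close>

definition split_pair :: "(nat \<Rightarrow> nat \<Rightarrow> real) \<Rightarrow> nat \<Rightarrow> nat \<Rightarrow> nat \<Rightarrow> real \<Rightarrow> nat \<Rightarrow> nat \<Rightarrow> real" where
  "split_pair W v u w \<alpha> a b = W a b + \<alpha> *
     (of_bool (a = u \<and> b = w) + of_bool (a = w \<and> b = u)
      - (of_bool (a = v \<and> b = u) + of_bool (a = u \<and> b = v) + of_bool (a = v \<and> b = w) + of_bool (a = w \<and> b = v)))"

text \<open>By complementation it is enough to look at sets avoiding \<open>v\<close>. The full set
  below \<open>v\<close> is left out because its cut is that of \<open>v\<close> alone, which
  splitting off is meant to lower.\<close>

definition good :: "(nat \<Rightarrow> nat \<Rightarrow> real) \<Rightarrow> nat \<Rightarrow> bool" where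
  "good W v \<longleftrightarrow> (\<forall>X. X \<noteq> {} \<and> X \<subset> {..<v} \<longrightarrow> 2 \<le> cut W {..v} X)"

text \<open>These are the only obstacles to splitting off more at the pair: a weight is exhausted,
  or one of the cuts that would drop has reached 2.\<close>

definition blocked :: "(nat \<Rightarrow> nat \<Rightarrow> real) \<Rightarrow> nat \<Rightarrow> nat \<Rightarrow> nat \<Rightarrow> bool" where
  "blocked W v u w \<longleftrightarrow> W v u = 0 \<or> W v w = 0 \<or>
     (\<exists>X. u \<in> X \<and> w \<in> X \<and> X \<subset> {..<v} \<and> cut W {..v} X = 2)"

text \<open>A set containing just one of the two ends loses \<open>\<alpha>\<close> on the way to
  \<open>v\<close> and gains it on the new pair. A set containing both loses on both ways to
  \<open>v\<close> and gains nothing.\<close>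

lemma cut_split_pair:
  assumes "u < v" "w < v" "u \<noteq> w" "X \<subseteq> {..<v}"
  shows "cut (split_pair W v u w \<alpha>) {..v} X = cut W {..v} X - (if u \<in> X \<and> w \<in> X then 2 * \<alpha> else 0)"
proof -
  have diff: "cut (\<lambda>a b. f a b - g a b) {..v} X = cut f {..v} X - cut g {..v} X" for f g
    using cut_add[of "\<lambda>a b. f a b - g a b" g] by simp
  have "v \<notin> X" using assms by auto
  then show ?thesis
    using assms unfolding split_pair_def
    by (simp add: cut_add cut_scale cut_entry diff algebra_simps)
qed

text \<open>Splitting at one pair does not release another: zero weights stay zero, and a set of cut
  weight 2 can only drop, which \<open>good\<close> forbids. Hence a single pass over all pairs
  blocks all of them.\<close>

lemma blocked_split_pair:
  assumes "good (split_pair W v u w \<alpha>) v" "u < v" "w < v" "u \<noteq> w" "0 \<le> \<alpha>" "good W v"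
    "blocked W v a b" "a < v" "b < v" "a \<noteq> b"
    "0 \<le> W v u - \<alpha>" "0 \<le> W v w - \<alpha>" "0 \<le> W v a" "0 \<le> W v b"
  shows "blocked (split_pair W v u w \<alpha>) v a b"
proof -
  let ?W = "split_pair W v u w \<alpha>"
  have z: "?W v c = 0" if "c < v" "W v c = 0" for c
  proof -
    \<comment> \<open>A zero weight at an end of the pair bounds the amount by zero.\<close>
    have "\<alpha> = 0" if "c = u \<or> c = w" using that \<open>W v c = 0\<close> assms(5,11,12) by auto
    then show ?thesis using that assms(2-4) unfolding split_pair_def
      by (cases "c = u"; cases "c = w") simp_all
  qed
  show ?thesis
  proof (cases "W v a = 0 \<or> W v b = 0")
    case True
    then show ?thesis using z[of a] z[of b] assms unfolding blocked_def by blast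
  next
    case False
    then obtain X where X: "a \<in> X" "b \<in> X" "X \<subset> {..<v}" "cut W {..v} X = 2"
      using assms unfolding blocked_def by blast
    then have "cut ?W {..v} X \<le> 2" using cut_split_pair[of u v w X] assms by auto
    moreover have "2 \<le> cut ?W {..v} X" using assms(1) X unfolding good_def by blast
    ultimately have "cut ?W {..v} X = 2" by linarith
    then show ?thesis using X unfolding blocked_def by blast
  qed
qed

lemma sym_nonneg_split_pair:
  assumes "sym_nonneg W {..v}" "u < v" "w < v" "u \<noteq> w" "0 \<le> \<alpha>" "\<alpha> \<le> W v u" "\<alpha> \<le> W v w"
  shows "sym_nonneg (split_pair W v u w \<alpha>) {..v}"
  unfolding sym_nonneg_def
proof (intro ballI impI)
  fix a b assume ab: "a \<in> {..v}" "b \<in> {..v}" "a \<noteq> b"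
  have W: "W a b = W b a" "0 \<le> W a b" "W u v = W v u" "W w v = W v w"
    using assms(1) ab \<open>u < v\<close> \<open>w < v\<close> unfolding sym_nonneg_def by auto
  have [simp]: "u \<noteq> v" "w \<noteq> v" "v \<noteq> u" "v \<noteq> w" "w \<noteq> u" using assms by auto
  consider "a = v" "b \<noteq> v" | "b = v" "a \<noteq> v" | "a \<noteq> v" "b \<noteq> v" using ab(3) by blast
  then show "split_pair W v u w \<alpha> a b = split_pair W v u w \<alpha> b a \<and> 0 \<le> split_pair W v u w \<alpha> a b"
  proof cases
    case 1
    then show ?thesis using W assms(4,6,7) unfolding split_pair_def
      by (cases "b = u"; cases "b = w") simp_all
  next
    case 2
    then show ?thesis using W assms(4,6,7) unfolding split_pair_def
      by (cases "a = u"; cases "a = w") simp_all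
  next
    case 3
    then show ?thesis using W assms(4,5) unfolding split_pair_def by auto
  qed
qed

text \<open>The maximal amount that can be split off is found by splitting off the minimum \<open>\<alpha>\<close> of the two
  weights and correcting by half of the violation \<open>2 - c\<close>: exactly the cuts containing both \<open>u\<close> and
  \<open>w\<close> drop, all by the same amount.\<close>

lemma split_amount:
  assumes W: "sym_nonneg W {..v}" "good W v" and uw: "u < v" "w < v" "u \<noteq> w"
    and \<alpha>: "\<alpha> = min (W v u) (W v w)"
    and c: "\<And>\<beta>. \<beta> \<le> c \<longleftrightarrow> \<beta> \<le> 2 \<and> (\<forall>X. X \<noteq> {} \<and> X \<subset> {..<v} \<longrightarrow> \<beta> \<le> cut (split_pair W v u w \<alpha>) {..v} X)"
    and \<gamma>: "\<gamma> = \<alpha> + (c - 2) / 2"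
  shows "0 \<le> \<gamma>" "\<gamma> \<le> \<alpha>" "good (split_pair W v u w \<gamma>) v" "blocked (split_pair W v u w \<gamma>) v u w"
proof -
  let ?T = "\<lambda>\<alpha>. split_pair W v u w \<alpha>"
  have g2: "2 * \<gamma> = 2 * \<alpha> + (c - 2)" unfolding \<gamma> by simp
  have c2: "c \<le> 2" using c[of c] by blast
  have a0: "0 \<le> \<alpha>" using W uw unfolding \<alpha> sym_nonneg_def by auto
  have cc: "c \<le> cut (?T \<alpha>) {..v} X" if "X \<noteq> {}" "X \<subset> {..<v}" for X
    using c[of c] that by blast
  \<comment> \<open>Every cut was at least 2 and drops by at most twice \<open>\<alpha>\<close>;
    this makes the corrected amount nonnegative.\<close>
  have "2 - 2 * \<alpha> \<le> c"
    unfolding c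
  proof (intro conjI allI impI, goal_cases)
    case 1 show ?case using a0 by simp
  next
    case (2 X)
    then have "2 \<le> cut W {..v} X" using W unfolding good_def by blast
    moreover have "cut (?T \<alpha>) {..v} X = cut W {..v} X - (if u \<in> X \<and> w \<in> X then 2 * \<alpha> else 0)"
      using 2 uw by (intro cut_split_pair) auto
    ultimately show ?case using a0 by (simp split: if_splits)
  qed
  then show g0: "0 \<le> \<gamma>" unfolding \<gamma> by (simp add: field_simps)
  show ga: "\<gamma> \<le> \<alpha>" using c2 unfolding \<gamma> by simp
  show gd: "good (?T \<gamma>) v"
    unfolding good_def
  proof (intro allI impI, elim conjE)
    fix X assume X: "X \<noteq> {}" "X \<subset> {..<v}"
    then have W2: "2 \<le> cut W {..v} X" using W unfolding good_def by blast
    have "cut (?T \<delta>) {..v} X = cut W {..v} X - (if u \<in> X \<and> w \<in> X then 2 * \<delta> else 0)" for \<delta>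
      using X uw by (intro cut_split_pair) auto
    from this[of \<alpha>] this[of \<gamma>] show "2 \<le> cut (?T \<gamma>) {..v} X"
      using cc[OF X] W2 g2 by (cases "u \<in> X \<and> w \<in> X") auto
  qed
  show "blocked (?T \<gamma>) v u w"
  proof (cases "c = 2")
    case True
    then have "\<gamma> = \<alpha>" unfolding \<gamma> by simp
    then have "?T \<gamma> v u = 0 \<or> ?T \<gamma> v w = 0"
      using uw unfolding \<alpha> split_pair_def by (auto simp: min_def)
    then show ?thesis unfolding blocked_def by blast
  next
    case False
    let ?C = "cut (?T \<alpha>) {..v} ` {X. X \<noteq> {} \<and> X \<subset> {..<v}}"
    have fin: "finite ?C" by (rule finite_imageI, rule finite_subset[of _ "Pow {..<v}"]) auto
    \<comment> \<open>\<open>c\<close> is given only through the numbers below it. Testing the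
      minimum itself identifies the two, so \<open>c\<close>, if not 2, is the cut of some
      set.\<close>
    have "Min (insert 2 ?C) \<le> c"
      unfolding c using fin by auto
    then have eq: "c = Min (insert 2 ?C)"
      using fin c2 cc by (intro antisym) auto
    have "Min (insert 2 ?C) \<in> insert 2 ?C" by (rule Min_in) (use fin in auto)
    then have "c \<in> insert 2 ?C" unfolding eq[symmetric] .
    then obtain X where X: "X \<noteq> {}" "X \<subset> {..<v}" "cut (?T \<alpha>) {..v} X = c" using False by auto
    have "2 \<le> cut W {..v} X" using X W unfolding good_def by blast
    \<comment> \<open>The cut of \<open>X\<close> was at least 2 before and is below 2 now, and only
      sets containing both ends drop.\<close>
    then have uX: "u \<in> X \<and> w \<in> X"
      using cut_split_pair[of u v w X W \<alpha>] X uw c2 False by (auto split: if_splits)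
    then have "cut (?T \<gamma>) {..v} X = 2"
      using cut_split_pair[of u v w X W \<alpha>] cut_split_pair[of u v w X W \<gamma>] X uw g2 by auto
    then show ?thesis using uX X unfolding blocked_def by blast
  qed
qed

lemma cut_lessThan:
  assumes "v \<notin> X"
  shows "cut W {..v} X = cut W {..<v} X + (\<Sum>a<v. if a \<in> X then W a v else 0)"
proof -
  have "{..v} = insert v {..<v}" by auto
  then show ?thesis using cut_insert[of "{..<v}" v W X] assms by simp
qed

text \<open>A largest set \<open>Z\<close> of cut weight 2 around one neighbour \<open>u\<close> of
  \<open>v\<close> contains all neighbours of \<open>v\<close>; otherwise it could be uncrossed with
  such a set around \<open>u\<close> and a missed neighbour. Then the rest of the vertices has no
  weight to \<open>v\<close>, so its cut is still at least 2 without \<open>v\<close>. But this cut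
  is also that of \<open>Z\<close> without \<open>v\<close>, which is 2 minus the positive weight
  from \<open>Z\<close> to \<open>v\<close>.\<close>

theorem splitting_off:
  assumes W: "sym_nonneg W {..v}" and g: "good W v"
    and bl: "\<And>u w. u < w \<Longrightarrow> w < v \<Longrightarrow> blocked W v u w"
    and X: "X \<noteq> {}" "X \<subset> {..<v}"
  shows "2 \<le> cut W {..<v} X"
proof -
  let ?N = "{u. u < v \<and> W v u \<noteq> 0}"
  have gd: "2 \<le> cut W {..v} Y" if "Y \<noteq> {}" "Y \<subset> {..<v}" for Y
    using g that unfolding good_def by blast
  have sy: "W v u = W u v" "0 \<le> W u v" if "u < v" for u using W that by (auto simp: sym_nonneg_def)
  have bl': "\<exists>Z. u \<in> Z \<and> w \<in> Z \<and> Z \<subset> {..<v} \<and> cut W {..v} Z = 2"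
    if "u \<in> ?N" "w \<in> ?N" "u \<noteq> w" for u w
  proof -
    have "blocked W v (min u w) (max u w)" using bl[of "min u w" "max u w"] that by (auto simp: min_def max_def)
    then have "blocked W v u w" unfolding blocked_def min_def max_def by (auto split: if_splits)
    then show ?thesis using that unfolding blocked_def by auto
  qed
  \<comment> \<open>A set without positive weight to \<open>v\<close> has the same cut with and
    without \<open>v\<close>.\<close>
  have nb: "2 \<le> cut W {..<v} Y" if "Y \<noteq> {}" "Y \<subset> {..<v}" "Y \<inter> ?N = {}" for Y
  proof -
    have "(\<Sum>a<v. if a \<in> Y then W a v else 0) = 0"
      using that sy by (intro sum.neutral) auto
    moreover have "2 \<le> cut W {..v} Y" using g that unfolding good_def by blast
    moreover have "v \<notin> Y" using that by auto
    ultimately show ?thesis using cut_lessThan[of v Y W] by simp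
  qed
  have W': "sym_nonneg W {..<v}" using W by (rule sym_nonneg_mono) auto
  show ?thesis
  proof (rule ccontr)
    assume less: "\<not> ?thesis"
    then have "X \<inter> ?N \<noteq> {}" using nb X by blast
    then obtain u where u: "u \<in> X" "u \<in> ?N" by blast
    have "({..<v} - X) \<inter> ?N \<noteq> {}"
    proof
      assume "({..<v} - X) \<inter> ?N = {}"
      then have "2 \<le> cut W {..<v} ({..<v} - X)" using X by (intro nb) auto
      then show False using less cut_compl[OF W'] by simp
    qed
    then obtain w where w: "w \<notin> X" "w \<in> ?N" by blast
    let ?T = "{Z. u \<in> Z \<and> Z \<subset> {..<v} \<and> cut W {..v} Z = 2}"
    have finT: "finite ?T" by (rule finite_subset[of _ "Pow {..<v}"]) auto
    have "?T \<noteq> {}" using bl'[of u w] u w by blast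
    \<comment> \<open>Uncrossing enlarges a set of cut weight 2, so one of largest cardinality is
      chosen to contradict.\<close>
    obtain Z where Z: "Z \<in> ?T" and Zmax: "\<And>Z'. Z' \<in> ?T \<Longrightarrow> card Z' \<le> card Z"
    proof -
      have "Max (card ` ?T) \<in> card ` ?T" using finT \<open>?T \<noteq> {}\<close> by (intro Max_in) auto
      then obtain Z where Z: "Max (card ` ?T) = card Z" "Z \<in> ?T" by (rule imageE)
      have "card Z' \<le> card Z" if "Z' \<in> ?T" for Z'
        unfolding Z(1)[symmetric] by (rule Max_ge) (use finT that in \<open>simp_all only: finite_imageI imageI\<close>)
      then show thesis using that Z(2) by blast
    qed
    have "?N \<subseteq> Z"
    proof (rule ccontr)
      assume "\<not> ?N \<subseteq> Z"
      then obtain y where y: "y \<in> ?N" "y \<notin> Z" by blast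
      then obtain Z' where Z': "u \<in> Z'" "y \<in> Z'" "Z' \<subset> {..<v}" "cut W {..v} Z' = 2"
        using bl'[of u y] u Z by auto
      show False
      \<comment> \<open>When the union is everything below \<open>v\<close>, its cut is that of
        \<open>v\<close> alone, for which no lower bound is available; the differences are uncrossed
        instead, with the positive weight between \<open>u\<close> and \<open>v\<close> as
        slack.\<close>
      proof (cases "Z \<union> Z' = {..<v}")
        case False
        have "Z \<union> Z' \<subset> {..<v}" using Z Z' False by auto
        have "2 \<le> cut W {..v} (Z \<union> Z')" by (rule gd) (use Z \<open>Z \<union> Z' \<subset> {..<v}\<close> in blast)+
        moreover have "2 \<le> cut W {..v} (Z \<inter> Z')" by (rule gd) (use Z Z' in blast)+
        ultimately have "cut W {..v} (Z \<union> Z') = 2"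
          using cut_submod[OF W, of Z Z'] Z Z' by auto
        then have "card (Z \<union> Z') \<le> card Z" using Zmax Z Z' False by auto
        moreover have "card Z < card (Z \<union> Z')"
          by (rule psubset_card_mono) (use y Z' Z in \<open>auto intro: finite_subset\<close>)
        ultimately show False by simp
      next
        case True
        have "Z - Z' \<noteq> {}" using True Z' by auto
        then have 1: "2 \<le> cut W {..v} (Z - Z')" by (rule gd) (use Z \<open>Z - Z' \<noteq> {}\<close> in blast)+
        have 2: "2 \<le> cut W {..v} (Z' - Z)" by (rule gd) (use Z' y in blast)+
        have "cut W {..v} (Z - Z') + cut W {..v} (Z' - Z) + 2 * W u v \<le> cut W {..v} Z + cut W {..v} Z'"
          by (rule cut_posimodular[OF W]) (use u Z Z' in auto)
        then have "W u v \<le> 0" using 1 2 Z Z' by auto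
        then show False using u sy[of u] by auto
      qed
    qed
    then have "2 \<le> cut W {..<v} ({..<v} - Z)" using Z by (intro nb) auto
    then have "2 \<le> cut W {..<v} Z" using cut_compl[OF W'] by simp
    moreover have "cut W {..v} Z = cut W {..<v} Z + (\<Sum>a<v. if a \<in> Z then W a v else 0)"
      using Z by (intro cut_lessThan) auto
    moreover have "0 < (\<Sum>a<v. if a \<in> Z then W a v else 0)"
      by (rule sum_pos2[of _ u]) (use u Z sy in auto, metis order_less_le)
    ultimately show False using Z by auto
  qed
qed

section \<open>Trees as parent functions\<close>

definition reach :: "(nat \<Rightarrow> nat) \<Rightarrow> nat \<Rightarrow> nat \<Rightarrow> bool" where
  "reach p a b \<longleftrightarrow> (\<exists>j. (p ^^ j) a = b)"

text \<open>Fixed points of \<open>p\<close>, such as the root, are linked to themselves, so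
  statements about links are restricted to distinct vertices.\<close>

definition link :: "(nat \<Rightarrow> nat) \<Rightarrow> nat \<Rightarrow> nat \<Rightarrow> bool" where
  "link p a b \<longleftrightarrow> p a = b \<or> p b = a"

lemma reach_refl [simp]: "reach p a a"
  unfolding reach_def by (rule exI[of _ 0]) simp

lemma reach_step: "reach p (p a) b \<Longrightarrow> reach p a b"
  unfolding reach_def by (metis comp_apply funpow_Suc_right)

lemma reach_trans: "reach p a b \<Longrightarrow> reach p b c \<Longrightarrow> reach p a c"
  unfolding reach_def by (metis comp_apply funpow_add)

lemma funpow_fixed: "p a = a \<Longrightarrow> (p ^^ j) a = a"
  by (induction j) auto

lemma reach_closed: "reach p a b \<Longrightarrow> a \<in> S \<Longrightarrow> (\<And>c. c \<in> S \<Longrightarrow> p c \<in> S) \<Longrightarrow> b \<in> S"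
proof -
  assume "a \<in> S" "\<And>c. c \<in> S \<Longrightarrow> p c \<in> S"
  then have "(p ^^ j) a \<in> S" for j by (induction j) auto
  then show "reach p a b \<Longrightarrow> b \<in> S" unfolding reach_def by auto
qed

text \<open>The old path is followed until it first meets a changed vertex; up to there it is also a
  path of \<open>p'\<close>, and from there the assumption takes over. The changed vertices that
  matter are only those on old paths from \<open>a\<close>.\<close>

lemma reach_root_change:
  assumes "reach p a 0" "\<And>c. c \<in> A \<Longrightarrow> reach p a c \<Longrightarrow> reach p' c 0"
    "\<And>c. c \<notin> A \<Longrightarrow> p' c = p c"
  shows "reach p' a 0"
proof -
  obtain j where "(p ^^ j) a = 0" using assms(1) unfolding reach_def by blast
  then show ?thesis using assms(2)
  proof (induction j arbitrary: a)
    case (Suc j)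
    show ?case
    proof (cases "a \<in> A")
      case True
      then show ?thesis using Suc.prems(2) by simp
    next
      case False
      have "(p ^^ j) (p a) = 0" using Suc.prems(1) by (simp add: funpow_swap1)
      then have "reach p' (p a) 0"
        using Suc.IH Suc.prems(2) reach_step by blast
      then show ?thesis using assms(3)[OF False] reach_step by metis
    qed
  qed simp
qed

text \<open>If \<open>w\<close> returns to itself after \<open>Suc k\<close> steps and is at the
  root after \<open>j\<close>, then after \<open>j * Suc k\<close> steps it is both \<open>w\<close>
  and \<open>0\<close>, as the root is a fixed point.\<close>

lemma reach_acyclic:
  assumes "reach p (p w) w" "reach p w 0" "p 0 = 0"
  shows "w = 0"
proof -
  obtain k where "(p ^^ k) (p w) = w" using assms(1) unfolding reach_def by blast
  then have k: "(p ^^ Suc k) w = w" by (simp add: funpow_swap1)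
  have per: "(p ^^ (m * Suc k)) w = w" for m
    by (induction m) (use k in \<open>auto simp: funpow_add simp del: mult_Suc_right\<close>)
  obtain j where j: "(p ^^ j) w = 0" using assms(2) unfolding reach_def by blast
  have "(p ^^ (j * k + j)) w = (p ^^ (j * k)) ((p ^^ j) w)" by (simp add: funpow_add)
  also have "\<dots> = 0" unfolding j by (rule funpow_fixed[of p, OF assms(3)])
  finally show ?thesis using per[of j] by (simp add: add.commute)
qed

text \<open>Pigeonhole: along a shortest path all vertices differ. It justifies that the program
  searches an ancestor in a fixed number of rounds.\<close>

lemma reach_bounded:
  assumes "reach p a b" "a < n" "\<And>c. c < n \<Longrightarrow> p c < n"
  shows "\<exists>j<n. (p ^^ j) a = b"
proof -
  define j where "j = (LEAST j. (p ^^ j) a = b)"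
  have j: "(p ^^ j) a = b" using assms(1) unfolding reach_def j_def by (metis (mono_tags) LeastI)
  have least: "(p ^^ i) a \<noteq> b" if "i < j" for i
    using that not_less_Least unfolding j_def by blast
  have "inj_on (\<lambda>i. (p ^^ i) a) {..j}"
  proof (rule linorder_inj_onI)
    fix i k assume ik: "i < k" "k \<in> {..j}"
    show "(p ^^ i) a \<noteq> (p ^^ k) a"
    proof
      assume e: "(p ^^ i) a = (p ^^ k) a"
      have "(p ^^ (j - k + i)) a = (p ^^ (j - k)) ((p ^^ i) a)" by (simp add: funpow_add)
      also have "\<dots> = (p ^^ (j - k + k)) a" unfolding e by (simp add: funpow_add)
      also have "\<dots> = b" using ik j by simp
      finally have b: "(p ^^ (j - k + i)) a = b" .
      have "k \<le> j" using ik by simp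
      then have "j - k + i < j" using ik(1) by linarith
      then show False using least b by blast
    qed
  qed auto
  moreover have "(\<lambda>i. (p ^^ i) a) ` {..j} \<subseteq> {..<n}"
  proof -
    have "(p ^^ i) a < n" for i by (induction i) (use assms in auto)
    then show ?thesis by auto
  qed
  ultimately have "card {..j} \<le> card {..<n}" by (metis card_inj_on_le finite_lessThan)
  then show ?thesis using j by (intro exI[of _ j]) auto
qed

definition tree :: "nat \<Rightarrow> (nat \<Rightarrow> nat) \<Rightarrow> bool" where
  "tree v p \<longleftrightarrow> p 0 = 0 \<and> (\<forall>a\<le>v. p a \<le> v \<and> reach p a 0)"

text \<open>In a semitree on \<open>0, \<dots>, v\<close> the vertex \<open>v\<close> may still be isolated, encoded as \<open>p v = v\<close>.\<close>

definition semitree :: "nat \<Rightarrow> (nat \<Rightarrow> nat) \<Rightarrow> bool" where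
  "semitree v p \<longleftrightarrow> p 0 = 0 \<and> (\<forall>a<v. p a \<le> v \<and> reach p a 0) \<and> p v \<le> v \<and> (p v = v \<or> reach p v 0)"

lemma semitree_start:
  assumes "tree (v - 1) p" "0 < v"
  shows "semitree v (p(v := v))"
proof -
  have lt: "p c < v" if "c < v" for c
  proof -
    have "p c \<le> v - 1" using assms that unfolding tree_def by (simp add: le_diff_conv)
    then show ?thesis using assms by simp
  qed
  have rt: "reach (p(v := v)) a 0" if "a < v" for a
  proof (rule reach_root_change[of p a "{v}"])
    show "reach p a 0" using assms that unfolding tree_def by auto
    have "\<not> reach p a v"
      using reach_closed[of p a v "{..<v}"] that lt by auto
    then show "\<And>c. c \<in> {v} \<Longrightarrow> reach p a c \<Longrightarrow> reach (p(v := v)) c 0" by auto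
  qed auto
  have "p 0 = 0" using assms unfolding tree_def by simp
  then show ?thesis using assms(2) lt rt unfolding semitree_def by (simp add: less_imp_le)
qed

lemma semitree_end: "semitree v p \<Longrightarrow> p v \<noteq> v \<Longrightarrow> tree v p"
  unfolding semitree_def tree_def by (metis nat_less_le)

text \<open>Iterating from \<open>a\<close> ends in the fixed point \<open>0\<close>, hence cannot
  also end in the fixed point \<open>v\<close>.\<close>

lemma semitree_isolated:
  assumes "semitree v p" "0 < v" "p v = v" "a < v"
  shows "\<not> reach p a v"
proof
  assume "reach p a v"
  then obtain i where i: "(p ^^ i) a = v" unfolding reach_def by blast
  obtain j where j: "(p ^^ j) a = 0" using assms unfolding semitree_def reach_def by blast
  have "(p ^^ (j + i)) a = v" using i funpow_fixed[of p v j, OF assms(3)] by (simp add: funpow_add)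
  moreover have "(p ^^ (i + j)) a = 0"
    using j assms(1) funpow_fixed[of p 0 i] unfolding semitree_def by (simp add: funpow_add)
  ultimately show False using assms(2) by (simp add: add.commute)
qed

lemma semitree_attach:
  assumes "semitree v p" "p v = v" "u < v"
  shows "semitree v (p(v := u))"
proof -
  have v: "0 < v" using assms by auto
  have "reach (p(v := u)) a 0" if "a < v" for a
  proof (rule reach_root_change[of p a "{v}"])
    show "reach p a 0" using assms that unfolding semitree_def by auto
    show "\<And>c. c \<in> {v} \<Longrightarrow> reach p a c \<Longrightarrow> reach (p(v := u)) c 0"
      using semitree_isolated[OF assms(1) v assms(2) that] by auto
  qed auto
  moreover from this[OF assms(3)] have "reach (p(v := u)) v 0"
    using reach_step[of "p(v := u)" v 0] by simp
  ultimately show ?thesis using assms unfolding semitree_def by auto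
qed

text \<open>Undoes the splitting of \<open>v\<close> off the pair \<open>u, w\<close> in a tree that uses the pair: the child end
  is hung below \<open>v\<close>, and \<open>v\<close> below the parent end if that is needed to stay connected. The number
  of children of \<open>v\<close> grows by one only.\<close>

definition reroute :: "nat \<Rightarrow> nat \<Rightarrow> nat \<Rightarrow> nat \<Rightarrow> (nat \<Rightarrow> nat) \<Rightarrow> nat \<Rightarrow> nat" where
  "reroute n v u w p =
    (let d = if p w = u then w else u; f = if p w = u then u else w
     in p(d := v, v := if p v = v \<or> (\<exists>j<n. (p ^^ j) v = d) then f else p v))"

text \<open>Cutting the link from the child end \<open>d\<close> to the parent end \<open>f\<close>
  splits off the subtree of \<open>d\<close>, which is hung below \<open>v\<close>. This is a tree
  at once if \<open>v\<close> is attached outside that subtree. If \<open>v\<close> is isolated or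
  inside it, \<open>v\<close> becomes a child of \<open>f\<close>, which lies outside. In both cases
  \<open>v\<close> gains links to \<open>u\<close> and \<open>w\<close> only, and \<open>d\<close>
  is its only possible new child.\<close>

lemma reroute:
  assumes st: "semitree v p" and v: "0 < v" "v < n" and uw: "u < v" "w < v" "u \<noteq> w" and lk: "link p u w"
  defines "p' \<equiv> reroute n v u w p"
  shows "semitree v p'" "p' v \<noteq> v" "\<And>a. v < a \<Longrightarrow> p' a = p a"
    "\<And>a b. a < v \<Longrightarrow> b < v \<Longrightarrow> a \<noteq> b \<Longrightarrow> link p' a b \<Longrightarrow> link p a b"
    "\<not> link p' u w"
    "\<And>a. a < v \<Longrightarrow> link p' v a \<Longrightarrow> link p v a \<or> a = u \<or> a = w"
    "card {a. a < v \<and> p' a = v} \<le> card {a. a < v \<and> p a = v} + 1"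
proof -
  define d where "d = (if p w = u then w else u)"
  define f where "f = (if p w = u then u else w)"
  define h where "h \<longleftrightarrow> p v = v \<or> (\<exists>j<n. (p ^^ j) v = d)"
  have p': "p' = p(d := v, v := if h then f else p v)"
    unfolding p'_def reroute_def d_def f_def h_def Let_def by simp
  have df: "p d = f" "d \<noteq> f" "d < v" "f < v" "{d, f} = {u, w}"
    using lk uw unfolding link_def d_def f_def by auto
  have p0: "p 0 = 0" and rt: "\<And>a. a < v \<Longrightarrow> reach p a 0" and le: "\<And>a. a \<le> v \<Longrightarrow> p a \<le> v"
    using st unfolding semitree_def by (auto simp: nat_less_le)
  have d0: "d \<noteq> 0" using df p0 by auto
  have fd: "\<not> reach p f d" using reach_acyclic[of p d] df rt p0 d0 by auto
  have h: "h \<longleftrightarrow> p v = v \<or> reach p v d"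
  proof
    assume "p v = v \<or> reach p v d"
    then show h
    proof
      assume "reach p v d"
      then have "\<exists>j<Suc v. (p ^^ j) v = d"
        by (rule reach_bounded) (use le in \<open>auto simp: less_Suc_eq_le\<close>)
      then obtain j where "j < Suc v" "(p ^^ j) v = d" by blast
      then show h unfolding h_def using v by (intro disjI2 exI[of _ j]) auto
    qed (simp add: h_def)
  qed (auto simp: h_def reach_def)
  have rv: "reach p' v 0"
  proof (cases h)
    case True
    \<comment> \<open>The path from \<open>f\<close> to the root thus meets neither of the two
      changed vertices and survives.\<close>
    have "\<not> reach p f v"
    proof
      assume fv: "reach p f v"
      show False
      proof (cases "p v = v")
        case True
        then show False using semitree_isolated[OF st v(1) True df(4)] fv by simp
      next
        case False
        then have "reach p v d" using True h by simp
        then show False using reach_trans[OF fv] fd by simp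
      qed
    qed
    then have "reach p' f 0"
      by (intro reach_root_change[of p f "{d, v}" p']) (use rt df fd in \<open>auto simp: p'\<close>)
    then show ?thesis using reach_step[of p' v 0] True by (simp add: p')
  next
    case False
    have "reach p v 0" using False h st unfolding semitree_def by auto
    then show ?thesis
      by (rule reach_root_change[of p v "{d}" p']) (use False h in \<open>auto simp: p'\<close>)
  qed
  have rd: "reach p' d 0" using reach_step[of p' d 0] rv df by (simp add: p')
  have "reach p' a 0" if "a < v" for a
    by (rule reach_root_change[of p a "{d, v}" p']) (use rt[OF that] rv rd in \<open>auto simp: p'\<close>)
  then show "semitree v p'"
    using rv df le d0 v p0 unfolding semitree_def by (auto simp: p')
  show "p' v \<noteq> v" using df h by (auto simp: p')
  show "p' a = p a" if "v < a" for a using that df by (auto simp: p')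
  show "link p a b" if "a < v" "b < v" "a \<noteq> b" "link p' a b" for a b
    using that unfolding link_def p' by (auto split: if_splits)
  have "\<not> link p' d f"
  proof -
    have "p f \<noteq> d" using fd reach_step[of p f d] by auto
    then show ?thesis using df unfolding link_def p' by auto
  qed
  then show "\<not> link p' u w" using df(5) unfolding link_def by (auto simp: doubleton_eq_iff)
  show "link p v a \<or> a = u \<or> a = w" if "a < v" "link p' v a" for a
    using that df(5) unfolding link_def p' by (auto split: if_splits simp: doubleton_eq_iff)
  have "{a. a < v \<and> p' a = v} \<subseteq> insert d {a. a < v \<and> p a = v}"
    by (auto simp: p' split: if_splits)
  then have "card {a. a < v \<and> p' a = v} \<le> card (insert d {a. a < v \<and> p a = v})"
    by (intro card_mono) auto
  also have "\<dots> \<le> card {a. a < v \<and> p a = v} + 1"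
    by (simp add: card_insert_if)
  finally show "card {a. a < v \<and> p' a = v} \<le> card {a. a < v \<and> p a = v} + 1" .
qed

section \<open>Modifying part of a weighted family\<close>

text \<open>The expectation of \<open>g\<close> when the weights sum to 1; the constraints on the
  family are bounds on such expectations.\<close>

definition total :: "nat \<Rightarrow> (nat \<Rightarrow> real) \<Rightarrow> (nat \<Rightarrow> 'a) \<Rightarrow> ('a \<Rightarrow> real) \<Rightarrow> real" where
  "total l lam P g = (\<Sum>i<l. lam i * g (P i))"

text \<open>The family \<open>P'\<close> arises from \<open>P\<close> by splitting one member in two and replacing \<open>org i\<close> by
  \<open>f (org i)\<close> for members \<open>mv\<close> satisfying \<open>pr\<close>, of total weight \<open>r\<close> or, if there is less, all of them;
  \<open>r'\<close> is what remains of \<open>r\<close>.\<close>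

definition retake where
  "retake l lam P r pr f l' lam' P' r' \<longleftrightarrow> (\<exists>mv org.
     (\<forall>i<l'. 0 < lam' i \<and> (\<exists>j<l. org i = P j) \<and> P' i = (if mv i then f (org i) else org i) \<and> (mv i \<longrightarrow> pr (org i))) \<and>
     (\<forall>g. total l' lam' org g = total l lam P g) \<and>
     r' = r - (\<Sum>i<l'. if mv i then lam' i else 0) \<and> 0 \<le> r' \<and>
     (r' = 0 \<or> (\<forall>i<l'. pr (org i) \<longrightarrow> mv i)))"

lemma retake_all:
  assumes "retake l lam P r pr f l' lam' P' r'"
    and "\<And>j. j < l \<Longrightarrow> I (P j)" "\<And>p. I p \<Longrightarrow> pr p \<Longrightarrow> I (f p)" "i < l'"
  shows "I (P' i)"
  using assms unfolding retake_def by metis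

lemma retake_pos: "retake l lam P r pr f l' lam' P' r' \<Longrightarrow> i < l' \<Longrightarrow> 0 < lam' i"
  unfolding retake_def by blast

lemma retake_nonneg: "retake l lam P r pr f l' lam' P' r' \<Longrightarrow> 0 \<le> r'"
  unfolding retake_def by blast

text \<open>The moved members have total weight \<open>r - r'\<close>, and each changes
  \<open>g\<close> by at most \<open>c\<close>. The property \<open>I\<close> restricts the
  comparison to members of the expected shape.\<close>

lemma retake_le:
  assumes "retake l lam P r pr f l' lam' P' r'"
    and "\<And>j. j < l \<Longrightarrow> I (P j)" "\<And>p. I p \<Longrightarrow> pr p \<Longrightarrow> g (f p) \<le> g p + c"
  shows "total l' lam' P' g \<le> total l lam P g + c * (r - r')"
proof -
  from assms(1) obtain mv org where
    1: "\<And>i. i < l' \<Longrightarrow> 0 < lam' i \<and> (\<exists>j<l. org i = P j) \<and> P' i = (if mv i then f (org i) else org i) \<and> (mv i \<longrightarrow> pr (org i))"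
    and 2: "total l' lam' org g = total l lam P g"
    and 3: "r' = r - (\<Sum>i<l'. if mv i then lam' i else 0)"
    unfolding retake_def by blast
  have "total l' lam' P' g \<le> (\<Sum>i<l'. lam' i * g (org i) + c * (if mv i then lam' i else 0))"
    unfolding total_def
  proof (rule sum_mono)
    fix i assume "i \<in> {..<l'}"
    then have i: "0 < lam' i" "I (org i)" "P' i = (if mv i then f (org i) else org i)" "mv i \<Longrightarrow> pr (org i)"
      using 1[of i] assms(2) by auto
    show "lam' i * g (P' i) \<le> lam' i * g (org i) + c * (if mv i then lam' i else 0)"
    proof (cases "mv i")
      case True
      have "lam' i * g (f (org i)) \<le> lam' i * (g (org i) + c)"
        using i(1) assms(3)[OF i(2) i(4)[OF True]] by simp
      then show ?thesis using True i(3) by (simp add: algebra_simps)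
    qed (use i in simp)
  qed
  also have "\<dots> = total l' lam' org g + c * (r - r')"
    unfolding 3 total_def by (simp add: sum.distrib sum_distrib_left)
  finally show ?thesis unfolding 2 .
qed

lemma total_uminus: "total l lam P (\<lambda>p. - g p) = - total l lam P g"
  by (simp add: total_def sum_negf)

lemma retake_eq:
  assumes "retake l lam P r pr f l' lam' P' r'"
    and "\<And>j. j < l \<Longrightarrow> I (P j)" "\<And>p. I p \<Longrightarrow> pr p \<Longrightarrow> g (f p) = g p + c"
  shows "total l' lam' P' g = total l lam P g + c * (r - r')"
proof (rule antisym)
  show "total l' lam' P' g \<le> total l lam P g + c * (r - r')"
    by (rule retake_le[where I = I, OF assms(1,2)]) (auto simp: assms(3))
  have "total l' lam' P' (\<lambda>p. - g p) \<le> total l lam P (\<lambda>p. - g p) + (- c) * (r - r')"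
    by (rule retake_le[where I = I, OF assms(1,2)]) (auto simp: assms(3))
  then show "total l lam P g + c * (r - r') \<le> total l' lam' P' g"
    by (simp add: total_uminus)
qed

lemma retake_sum: "retake l lam P r pr f l' lam' P' r' \<Longrightarrow> (\<Sum>i<l'. lam' i) = (\<Sum>i<l. lam i)"
  using retake_eq[where I = "\<lambda>_. True" and g = "\<lambda>_. 1" and c = 0] by (simp add: total_def)

lemma retake_exhaust:
  assumes "retake l lam P r pr f l' lam' P' r'" "r' \<noteq> 0"
    and "\<And>j. j < l \<Longrightarrow> I (P j)" "\<And>p. I p \<Longrightarrow> pr p \<Longrightarrow> \<not> pr (f p)" "i < l'"
  shows "\<not> pr (P' i)"
  using assms unfolding retake_def by metis

lemma total_of_bool_zero: "(\<And>i. i < l \<Longrightarrow> \<not> Q (P i)) \<Longrightarrow> total l lam P (\<lambda>p. of_bool (Q p)) = 0"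
  unfolding total_def by (intro sum.neutral) auto

lemma total_mono: "(\<And>i. i < l \<Longrightarrow> 0 < lam i) \<Longrightarrow> (\<And>i. i < l \<Longrightarrow> g (P i) \<le> h (P i)) \<Longrightarrow> total l lam P g \<le> total l lam P h"
  unfolding total_def by (intro sum_mono) (auto simp: less_imp_le mult_left_mono)

text \<open>Either the requested weight was moved completely, which takes \<open>r\<close> off the
  members with the property, or the request was larger than what was there and no such member is
  left.\<close>

lemma retake_remove:
  assumes rt: "retake l lam P r pr f l' lam' P' r'" and I: "\<And>j. j < l \<Longrightarrow> I (P j)"
    and npr: "\<And>p. I p \<Longrightarrow> pr p \<Longrightarrow> \<not> pr (f p)"
  shows "total l' lam' P' (\<lambda>p. of_bool (pr p)) \<le> total l lam P (\<lambda>p. of_bool (pr p)) - r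
    \<or> (\<forall>i<l'. \<not> pr (P' i)) \<and> total l' lam' P' (\<lambda>p. of_bool (pr p)) = 0"
proof (cases "r' = 0")
  case True
  have "total l' lam' P' (\<lambda>p. of_bool (pr p)) \<le> total l lam P (\<lambda>p. of_bool (pr p)) + (-1) * (r - r')"
    by (rule retake_le[where I = I, OF rt I]) (use npr in auto)
  then show ?thesis using True by simp
next
  case False
  have "\<forall>i<l'. \<not> pr (P' i)" using retake_exhaust[where I = I, OF rt False I npr] by blast
  then show ?thesis using total_of_bool_zero[of l' pr P' lam'] by blast
qed

section \<open>Lifting a convex combination of trees\<close>

text \<open>Entries from \<open>n\<close> on are kept at zero because they become the multiplicities
  of edges later.\<close>

definition tree_inv where
  "tree_inv n v W l lam P \<longleftrightarrow>
     (\<forall>i<l. 0 < lam i \<and> tree v (P i) \<and> (\<forall>a\<ge>n. P i a = 0)) \<and> (\<Sum>i<l. lam i) = 1 \<and>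
     (\<forall>a\<le>v. \<forall>b\<le>v. a \<noteq> b \<longrightarrow> total l lam P (\<lambda>p. of_bool (link p a b)) \<le> W a b)"

text \<open>\<open>\<sigma>\<close> is the amount split off and \<open>\<tau>\<close> the part of it that is already undone.\<close>

definition undo_inv where
  "undo_inv n v W \<sigma> \<tau> l lam P \<longleftrightarrow>
     (\<forall>i<l. 0 < lam i \<and> semitree v (P i) \<and> (\<forall>a\<ge>n. P i a = 0)) \<and> (\<Sum>i<l. lam i) = 1 \<and>
     (\<forall>a<v. \<forall>b<v. a \<noteq> b \<longrightarrow> total l lam P (\<lambda>p. of_bool (link p a b)) \<le> W a b + \<sigma> a b - \<tau> a b) \<and>
     (\<forall>a<v. total l lam P (\<lambda>p. of_bool (link p v a)) \<le> (\<Sum>b<v. \<tau> a b)) \<and>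
     2 * total l lam P (\<lambda>p. real (card {a. a < v \<and> p a = v})) \<le> (\<Sum>a<v. \<Sum>b<v. \<tau> a b)"

lemma undo_start:
  assumes T: "tree_inv n (v - 1) W' l lam P" and v: "0 < v" "v < n"
    and W': "\<And>a b. a < v \<Longrightarrow> b < v \<Longrightarrow> a \<noteq> b \<Longrightarrow> W' a b = W a b + \<sigma> a b"
    and P': "\<And>i. i < l \<Longrightarrow> P' i = (P i)(v := v)"
  shows "undo_inv n v W \<sigma> (\<lambda>_ _. 0) l lam P'"
proof -
  have tr: "0 < lam i" "tree (v - 1) (P i)" "\<And>a. n \<le> a \<Longrightarrow> P i a = 0" if "i < l" for i
    using T that unfolding tree_inv_def by auto
  have lt: "P i a < v" if "i < l" "a < v" for i a
    using tr(2)[OF that(1)] that(2) v unfolding tree_def by (metis One_nat_def Suc_pred le_imp_less_Suc less_Suc_eq_le)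
  have "total l lam P' (\<lambda>p. of_bool (link p a b)) = total l lam P (\<lambda>p. of_bool (link p a b))"
    if "a < v" "b < v" for a b
    unfolding total_def using that P' by (intro sum.cong refl) (auto simp: link_def)
  then have "\<forall>a<v. \<forall>b<v. a \<noteq> b \<longrightarrow> total l lam P' (\<lambda>p. of_bool (link p a b)) \<le> W a b + \<sigma> a b - 0"
    using T W' v unfolding tree_inv_def by fastforce
  moreover have "total l lam P' (\<lambda>p. of_bool (link p v a)) = 0" if "a < v" for a
    by (rule total_of_bool_zero) (use P' lt that in \<open>fastforce simp: link_def\<close>)
  moreover have ne: "P' i a \<noteq> v" if "i < l" "a < v" for i a
    using P'[OF that(1)] lt[OF that] that by auto
  have "{a. a < v \<and> P' i a = v} = {}" if "i < l" for i
    using ne[OF that] by blast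
  then have "total l lam P' (\<lambda>p. real (card {a. a < v \<and> p a = v})) = 0"
    unfolding total_def by (intro sum.neutral ballI) (metis card.empty lessThan_iff mult_zero_right of_nat_0)
  moreover have "\<forall>i<l. 0 < lam i \<and> semitree v (P' i) \<and> (\<forall>a\<ge>n. P' i a = 0)"
    using tr P' semitree_start v by auto
  ultimately show ?thesis using T unfolding undo_inv_def tree_inv_def by simp
qed

lemma link_commute: "link p a b = link p b a"
  by (auto simp: link_def)

text \<open>Moving weight up to \<open>\<sigma> u w\<close> takes the pair back to its old capacity,
  adds at most that weight to the links of \<open>v\<close> with \<open>u\<close> and with
  \<open>w\<close>, and adds at most one child of \<open>v\<close> per moved tree. The double sum
  over \<open>\<tau>'\<close> counts the pair in both orders, whence the factor 2 in front of the
  number of children.\<close>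

lemma undo_step:
  assumes U: "undo_inv n v W \<sigma> \<tau> l lam P" and v: "v < n" and uw: "u < w" "w < v"
    and rt: "retake l lam P (\<sigma> u w) (\<lambda>p. link p u w) (reroute n v u w) l' lam' P' r'"
    and \<tau>: "\<tau> u w = 0" "\<tau> w u = 0" and \<sigma>: "\<sigma> w u = \<sigma> u w" and W: "0 \<le> W u w" "W w u = W u w"
    and \<tau>': "\<And>a b. \<tau>' a b = \<tau> a b + (if a = u \<and> b = w \<or> a = w \<and> b = u then \<sigma> u w else 0)"
  shows "undo_inv n v W \<sigma> \<tau>' l' lam' P'"
proof -
  define I where "I p \<longleftrightarrow> semitree v p \<and> (\<forall>a\<ge>n. p a = 0)" for p :: "nat \<Rightarrow> nat"
  have I: "I (P i)" if "i < l" for i using U that unfolding undo_inv_def I_def by auto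
  have U1: "total l lam P (\<lambda>p. of_bool (link p a b)) \<le> W a b + \<sigma> a b - \<tau> a b"
    if "a < v" "b < v" "a \<noteq> b" for a b using U that unfolding undo_inv_def by blast
  have v0: "0 < v" "u < v" "u \<noteq> w" using uw by auto
  note rr = reroute[OF _ v0(1) v v0(2) uw(2) v0(3)]
  have I': "I (reroute n v u w p)" if "I p" "link p u w" for p
    using rr(1,3)[of p] that v unfolding I_def by auto
  note all = retake_all[where I = I, OF rt I I']
  have le: "total l' lam' P' g \<le> total l lam P g + c * (\<sigma> u w - r')"
    if "\<And>p. I p \<Longrightarrow> link p u w \<Longrightarrow> g (reroute n v u w p) \<le> g p + c" for g c
    by (rule retake_le[where I = I, OF rt I]) (use that in auto)
  have r': "0 \<le> r'" using rt by (rule retake_nonneg)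
  have a1: "total l' lam' P' (\<lambda>p. of_bool (link p a b)) \<le> W a b + \<sigma> a b - \<tau>' a b"
    if ab: "a < v" "b < v" "a \<noteq> b" for a b
  proof (cases "a = u \<and> b = w \<or> a = w \<and> b = u")
    case False
    have "total l' lam' P' (\<lambda>p. of_bool (link p a b)) \<le> total l lam P (\<lambda>p. of_bool (link p a b)) + 0 * (\<sigma> u w - r')"
      by (rule le) (use rr(4) ab I_def in auto)
    moreover have "\<tau>' a b = \<tau> a b" unfolding \<tau>' using False by auto
    ultimately show ?thesis using U1[OF ab] by simp
  next
    case True
    have lk: "(\<lambda>p. of_bool (link p a b) :: real) = (\<lambda>p. of_bool (link p u w))"
      using True link_commute by auto
    \<comment> \<open>If the request could not be met, no tree uses the pair any more, and
      nonnegativity of the capacity is enough.\<close>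
    have "total l' lam' P' (\<lambda>p. of_bool (link p u w)) \<le> total l lam P (\<lambda>p. of_bool (link p u w)) - \<sigma> u w
       \<or> total l' lam' P' (\<lambda>p. of_bool (link p u w)) = 0"
      using retake_remove[where I = I, OF rt I] rr(5) unfolding I_def by blast
    moreover have "total l lam P (\<lambda>p. of_bool (link p u w)) \<le> W u w + \<sigma> u w"
      using U1[OF v0(2) uw(2) v0(3)] \<tau> by simp
    moreover have "W a b + \<sigma> a b - \<tau>' a b = W u w"
      using True \<tau> \<sigma> W(2) unfolding \<tau>' by auto
    ultimately show ?thesis unfolding lk using W(1) by linarith
  qed
  have row: "(\<Sum>b<v. \<tau>' a b) = (\<Sum>b<v. \<tau> a b) + (if a = u \<or> a = w then \<sigma> u w else 0)" if "a < v" for a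
  proof -
    have "(\<Sum>b<v. \<tau>' a b) = (\<Sum>b<v. \<tau> a b + (if b = w then if a = u then \<sigma> u w else 0 else 0)
        + (if b = u then if a = w then \<sigma> u w else 0 else 0))"
      unfolding \<tau>' by (intro sum.cong refl) (use v0 in auto)
    then show ?thesis using uw v0 by (simp add: sum.distrib)
  qed
  have a2: "total l' lam' P' (\<lambda>p. of_bool (link p v a)) \<le> (\<Sum>b<v. \<tau>' a b)" if a: "a < v" for a
  proof -
    let ?c = "if a = u \<or> a = w then 1 else 0 :: real"
    have "total l' lam' P' (\<lambda>p. of_bool (link p v a)) \<le> total l lam P (\<lambda>p. of_bool (link p v a)) + ?c * (\<sigma> u w - r')"
      by (rule le) (use rr(6) a I_def in auto)
    moreover have "total l lam P (\<lambda>p. of_bool (link p v a)) \<le> (\<Sum>b<v. \<tau> a b)"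
      using U a unfolding undo_inv_def by blast
    ultimately show ?thesis using row[OF a] r' by (auto split: if_splits)
  qed
  have a3: "2 * total l' lam' P' (\<lambda>p. real (card {a. a < v \<and> p a = v})) \<le> (\<Sum>a<v. \<Sum>b<v. \<tau>' a b)"
  proof -
    have "total l' lam' P' (\<lambda>p. real (card {a. a < v \<and> p a = v}))
        \<le> total l lam P (\<lambda>p. real (card {a. a < v \<and> p a = v})) + 1 * (\<sigma> u w - r')"
    proof (rule le)
      fix p assume "I p" "link p u w"
      then show "real (card {a. a < v \<and> reroute n v u w p a = v}) \<le> real (card {a. a < v \<and> p a = v}) + 1"
        using rr(7)[of p] unfolding I_def by linarith
    qed
    moreover have "(\<Sum>a<v. \<Sum>b<v. \<tau>' a b) = (\<Sum>a<v. (\<Sum>b<v. \<tau> a b)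
        + (if a = u then \<sigma> u w else 0) + (if a = w then \<sigma> u w else 0))"
      using v0 by (intro sum.cong refl) (auto simp: row)
    then have "(\<Sum>a<v. \<Sum>b<v. \<tau>' a b) = (\<Sum>a<v. \<Sum>b<v. \<tau> a b) + 2 * \<sigma> u w"
      using uw v0 by (simp add: sum.distrib)
    ultimately show ?thesis using U r' unfolding undo_inv_def by auto
  qed
  have "\<forall>i<l'. 0 < lam' i \<and> semitree v (P' i) \<and> (\<forall>a\<ge>n. P' i a = 0)"
    using all retake_pos[OF rt] unfolding I_def by blast
  moreover have "(\<Sum>i<l'. lam' i) = 1" using U retake_sum[OF rt] unfolding undo_inv_def by simp
  ultimately show ?thesis using a1 a2 a3 unfolding undo_inv_def by blast
qed

text \<open>\<open>U a\<close> is the weight of the trees using the pair \<open>v, a\<close> before any isolated \<open>v\<close> is attached.\<close>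

definition attach_inv where
  "attach_inv n v W U u l lam P \<longleftrightarrow>
     (\<forall>i<l. 0 < lam i \<and> semitree v (P i) \<and> (\<forall>a\<ge>n. P i a = 0)) \<and> (\<Sum>i<l. lam i) = 1 \<and>
     (\<forall>a<v. \<forall>b<v. a \<noteq> b \<longrightarrow> total l lam P (\<lambda>p. of_bool (link p a b)) \<le> W a b) \<and>
     (\<forall>a<v. if a < u then total l lam P (\<lambda>p. of_bool (link p v a)) \<le> W v a
            else total l lam P (\<lambda>p. of_bool (link p v a)) = U a) \<and>
     total l lam P (\<lambda>p. of_bool (p v = v)) \<le> max 0 ((\<Sum>a\<in>{u..<v}. W v a - U a))"

text \<open>Let c be the average number of children of \<open>v\<close>, i the weight of trees with
  \<open>v\<close> isolated and d the weight of \<open>v\<close>. The links at \<open>v\<close> have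
  average c + 1 - i. From 2 c \<le> d and 2 \<le> d it follows that d - (c + 1 - i) \<ge> i, so the
  free weight at \<open>v\<close> suffices to attach it wherever it is isolated.\<close>

lemma attach_start:
  assumes U: "undo_inv n v W \<sigma> \<sigma> l lam P" and v: "0 < v" "v < n"
    and \<sigma>: "\<And>a. a < v \<Longrightarrow> (\<Sum>b<v. \<sigma> a b) \<le> W v a" and two: "2 \<le> (\<Sum>a<v. W v a)"
  shows "attach_inv n v W (\<lambda>a. total l lam P (\<lambda>p. of_bool (link p v a))) 0 l lam P"
proof -
  let ?U = "\<lambda>a. total l lam P (\<lambda>p. of_bool (link p v a))"
  have st: "semitree v (P i)" "0 < lam i" if "i < l" for i using U that unfolding undo_inv_def by auto
  have one: "(\<Sum>i<l. lam i) = 1" using U unfolding undo_inv_def by blast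
  have deg: "(\<Sum>a<v. of_bool (link (P i) v a)) = real (card {a. a < v \<and> P i a = v}) + (1 - of_bool (P i v = v))"
    if i: "i < l" for i
  proof -
    \<comment> \<open>A vertex that is child and parent of \<open>v\<close> at once would close a
      cycle, so both kinds of links can be counted separately.\<close>
    have disj: "of_bool (link (P i) v a) = of_bool (P i a = v) + (of_bool (P i v = a) :: real)" if "a < v" for a
    proof -
      have "\<not> (P i a = v \<and> P i v = a)"
      proof
        assume c: "P i a = v \<and> P i v = a"
        then have "reach (P i) (P i a) a" using reach_step[of "P i" v a] by auto
        then have "a = 0" using reach_acyclic[of "P i" a] st(1)[OF i] that unfolding semitree_def by auto
        then show False using c st(1)[OF i] v unfolding semitree_def by auto
      qed
      then show ?thesis unfolding link_def by auto
    qed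
    have "(\<Sum>a<v. of_bool (link (P i) v a)) = (\<Sum>a<v. of_bool (P i a = v)) + (\<Sum>a<v. of_bool (P i v = a) :: real)"
      by (simp add: disj sum.distrib)
    moreover have "(\<Sum>a<v. of_bool (P i a = v)) = real (card {a. a < v \<and> P i a = v})"
      by (simp add: of_bool_def sum.If_cases Int_def)
    moreover have "(\<Sum>a<v. of_bool (P i v = a) :: real) = 1 - of_bool (P i v = v)"
      using st(1)[OF i] unfolding semitree_def by (auto simp: of_bool_def)
    ultimately show ?thesis by simp
  qed
  have "(\<Sum>a<v. ?U a) = (\<Sum>i<l. lam i * (\<Sum>a<v. of_bool (link (P i) v a)))"
    unfolding total_def sum_distrib_left by (rule sum.swap)
  also have "\<dots> = (\<Sum>i<l. lam i * (real (card {a. a < v \<and> P i a = v}) + (1 - of_bool (P i v = v))))"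
    by (intro sum.cong refl) (use deg in simp)
  also have "\<dots> = total l lam P (\<lambda>p. real (card {a. a < v \<and> p a = v})) + 1 - total l lam P (\<lambda>p. of_bool (p v = v))"
    unfolding total_def using one by (simp add: algebra_simps sum.distrib sum_subtractf)
  finally have sU: "(\<Sum>a<v. ?U a) = total l lam P (\<lambda>p. real (card {a. a < v \<and> p a = v})) + 1 - total l lam P (\<lambda>p. of_bool (p v = v))" .
  have "2 * total l lam P (\<lambda>p. real (card {a. a < v \<and> p a = v})) \<le> (\<Sum>a<v. \<Sum>b<v. \<sigma> a b)"
    using U unfolding undo_inv_def by blast
  also have "\<dots> \<le> (\<Sum>a<v. W v a)" by (intro sum_mono) (use \<sigma> in auto)
  finally have "total l lam P (\<lambda>p. of_bool (p v = v)) \<le> (\<Sum>a<v. W v a) - (\<Sum>a<v. ?U a)"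
    using sU two by linarith
  then have "total l lam P (\<lambda>p. of_bool (p v = v)) \<le> max 0 (\<Sum>a\<in>{0..<v}. W v a - ?U a)"
    by (simp add: sum_subtractf lessThan_atLeast0)
  then show ?thesis using U unfolding attach_inv_def undo_inv_def by auto
qed

text \<open>Either the free weight of the pair \<open>v\<close>, \<open>u\<close> is used up, or no
  tree with \<open>v\<close> isolated is left; the latter case is absorbed by the
  \<open>max 0\<close>. Other pairs keep their weight, since an isolated \<open>v\<close> has no
  children and receives a single link.\<close>

lemma attach_step:
  assumes A: "attach_inv n v W U u l lam P" and v: "0 < v" "v < n" "u < v" and r: "0 \<le> W v u - U u"
    and rt: "retake l lam P (W v u - U u) (\<lambda>p. p v = v) (\<lambda>p. p(v := u)) l' lam' P' r'"
  shows "attach_inv n v W U (Suc u) l' lam' P'"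
proof -
  define I where "I p \<longleftrightarrow> semitree v p \<and> (\<forall>a\<ge>n. p a = 0)" for p :: "nat \<Rightarrow> nat"
  have I: "I (P i)" if "i < l" for i using A that unfolding attach_inv_def I_def by auto
  have I': "I (p(v := u))" if "I p" "p v = v" for p
    using that v semitree_attach unfolding I_def by auto
  have child: "p a \<noteq> v" if "I p" "p v = v" "a < v" for p a
    using semitree_isolated[of v p a] that v reach_step[of p a v] unfolding I_def by auto
  note all = retake_all[where I = I, OF rt I I']
  have le: "total l' lam' P' g \<le> total l lam P g + c * (W v u - U u - r')"
    if "\<And>p. I p \<Longrightarrow> p v = v \<Longrightarrow> g (p(v := u)) \<le> g p + c" for g c
    by (rule retake_le[where I = I, OF rt I]) (use that in auto)
  have eq: "total l' lam' P' g = total l lam P g + c * (W v u - U u - r')"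
    if "\<And>p. I p \<Longrightarrow> p v = v \<Longrightarrow> g (p(v := u)) = g p + c" for g c
    by (rule retake_eq[where I = I, OF rt I]) (use that in auto)
  have r': "0 \<le> r'" using rt by (rule retake_nonneg)
  have a1: "total l' lam' P' (\<lambda>p. of_bool (link p a b)) \<le> W a b" if ab: "a < v" "b < v" "a \<noteq> b" for a b
  proof -
    have "total l' lam' P' (\<lambda>p. of_bool (link p a b)) = total l lam P (\<lambda>p. of_bool (link p a b)) + 0 * (W v u - U u - r')"
      by (rule eq) (use ab in \<open>auto simp: link_def\<close>)
    then show ?thesis using A ab unfolding attach_inv_def by auto
  qed
  have a2: "if a < Suc u then total l' lam' P' (\<lambda>p. of_bool (link p v a)) \<le> W v a
            else total l' lam' P' (\<lambda>p. of_bool (link p v a)) = U a" if a: "a < v" for a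
  proof (cases "a = u")
    case True
    have "total l' lam' P' (\<lambda>p. of_bool (link p v a)) \<le> total l lam P (\<lambda>p. of_bool (link p v a)) + 1 * (W v u - U u - r')"
      by (rule le) auto
    moreover have "total l lam P (\<lambda>p. of_bool (link p v a)) = U u"
      using A a True unfolding attach_inv_def by (metis nat_less_le)
    ultimately show ?thesis using True r' by simp
  next
    case False
    have "total l' lam' P' (\<lambda>p. of_bool (link p v a)) = total l lam P (\<lambda>p. of_bool (link p v a)) + 0 * (W v u - U u - r')"
      by (rule eq) (use False a child in \<open>auto simp: link_def\<close>)
    moreover have "a < Suc u \<longleftrightarrow> a < u" using False by auto
    ultimately show ?thesis using A a unfolding attach_inv_def by auto
  qed
  have "total l' lam' P' (\<lambda>p. of_bool (p v = v)) \<le> total l lam P (\<lambda>p. of_bool (p v = v)) - (W v u - U u)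
      \<or> total l' lam' P' (\<lambda>p. of_bool (p v = v)) = 0"
    using retake_remove[where I = I, OF rt I] v by fastforce
  moreover have "total l lam P (\<lambda>p. of_bool (p v = v)) \<le> max 0 (\<Sum>a\<in>{u..<v}. W v a - U a)"
    using A unfolding attach_inv_def by blast
  moreover have "(\<Sum>a\<in>{u..<v}. W v a - U a) = (W v u - U u) + (\<Sum>a\<in>{Suc u..<v}. W v a - U a)"
    using v by (simp add: sum.atLeast_Suc_lessThan)
  ultimately have a3: "total l' lam' P' (\<lambda>p. of_bool (p v = v)) \<le> max 0 (\<Sum>a\<in>{Suc u..<v}. W v a - U a)"
    using r by linarith
  have "\<forall>i<l'. 0 < lam' i \<and> semitree v (P' i) \<and> (\<forall>a\<ge>n. P' i a = 0)"
    using all retake_pos[OF rt] unfolding I_def by blast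
  moreover have "(\<Sum>i<l'. lam' i) = 1" using A retake_sum[OF rt] unfolding attach_inv_def by simp
  ultimately show ?thesis using a1 a2 a3 unfolding attach_inv_def by blast
qed

text \<open>The bound on isolated trees has become an empty sum, and all weights are positive, so
  \<open>v\<close> is isolated in no tree.\<close>

lemma attach_end:
  assumes A: "attach_inv n v W U v l lam P" and W: "\<And>a. a < v \<Longrightarrow> W a v = W v a"
  shows "tree_inv n v W l lam P"
proof -
  have pos: "0 < lam i" "semitree v (P i)" "\<And>a. n \<le> a \<Longrightarrow> P i a = 0" if "i < l" for i
    using A that unfolding attach_inv_def by auto
  have A2: "total l lam P (\<lambda>p. of_bool (link p v a)) \<le> W v a" if "a < v" for a
  proof -
    have "if a < v then total l lam P (\<lambda>p. of_bool (link p v a)) \<le> W v a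
        else total l lam P (\<lambda>p. of_bool (link p v a)) = U a"
      using A that unfolding attach_inv_def by blast
    then show ?thesis using that by simp
  qed
  have "total l lam P (\<lambda>p. of_bool (p v = v)) \<le> 0" using A unfolding attach_inv_def by simp
  moreover have nn: "0 \<le> lam i * of_bool (P i v = v)" if "i \<in> {..<l}" for i
    using pos(1)[of i] that by auto
  ultimately have "total l lam P (\<lambda>p. of_bool (p v = v)) = 0"
    unfolding total_def using sum_nonneg[of "{..<l}" "\<lambda>i. lam i * of_bool (P i v = v)"] by auto
  then have "(\<Sum>i<l. lam i * of_bool (P i v = v)) = 0" unfolding total_def .
  then have "\<forall>i\<in>{..<l}. lam i * of_bool (P i v = v) = 0"
    by (subst (asm) sum_nonneg_eq_0_iff) (use nn in auto)
  then have "lam i * of_bool (P i v = v) = 0" if "i < l" for i using that by blast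
  then have "P i v \<noteq> v" if "i < l" for i
    using pos(1)[OF that] that by (metis less_irrefl mult.right_neutral of_bool_eq(2))
  then have tr: "tree v (P i)" if "i < l" for i using semitree_end pos(2) that by blast
  have "total l lam P (\<lambda>p. of_bool (link p a b)) \<le> W a b" if ab: "a \<le> v" "b \<le> v" "a \<noteq> b" for a b
  proof -
    consider "a < v" "b < v" | "a = v" "b < v" | "b = v" "a < v" using ab by (metis le_neq_implies_less)
    then show ?thesis
    proof cases
      case 1
      then show ?thesis using A ab(3) unfolding attach_inv_def by blast
    next
      case 2
      then show ?thesis using A2 by simp
    next
      case 3
      have "(\<lambda>p. of_bool (link p a v) :: real) = (\<lambda>p. of_bool (link p v a))" using link_commute by auto
      then show ?thesis using A2[OF 3(2)] W[OF 3(2)] 3 by simp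
    qed
  qed
  moreover have "(\<Sum>i<l. lam i) = 1" using A unfolding attach_inv_def by blast
  ultimately show ?thesis using pos tr unfolding tree_inv_def by auto
qed

section \<open>From trees to connectors\<close>

text \<open>Entry \<open>n + e\<close> of a row \<open>p\<close> is the multiplicity of edge \<open>e\<close>; the entries below \<open>n\<close> are tree links
  that are not yet replaced by edges.\<close>

definition joined where
  "joined n m end1 end2 p a b \<longleftrightarrow>
     a < n \<and> b < n \<and> (link p a b \<or> (\<exists>e<m. 0 < p (n + e) \<and> {end1 e, end2 e} = {a, b}))"

text \<open>A link is deleted by making the child its own parent. From here on a row is no longer a
  tree; only connectivity by links and edges together, as in \<open>joined\<close>, is
  maintained.\<close>

definition place :: "nat \<Rightarrow> (nat \<Rightarrow> nat) \<Rightarrow> (nat \<Rightarrow> nat) \<Rightarrow> nat \<Rightarrow> (nat \<Rightarrow> nat) \<Rightarrow> nat \<Rightarrow> nat" where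
  "place n end1 end2 e p =
     p(end1 e := if p (end1 e) = end2 e then end1 e else p (end1 e),
       end2 e := if p (end2 e) = end1 e then end2 e else p (end2 e), n + e := 1)"

text \<open>Edges below \<open>k\<close> are settled with their final weight. The links still
  present on a pair must fit into the parallel edges from \<open>k\<close> on, so that none remains
  once \<open>k\<close> reaches \<open>m\<close>.\<close>

definition edge_inv where
  "edge_inv n m end1 end2 x k l lam P \<longleftrightarrow>
     (\<forall>i<l. 0 < lam i \<and> (\<forall>a<n. (joined n m end1 end2 (P i))\<^sup>*\<^sup>* a 0) \<and>
        (\<forall>e<m. P i (n + e) \<le> 1) \<and> (\<forall>e<m. k \<le> e \<longrightarrow> P i (n + e) = 0)) \<and>
     (\<Sum>i<l. lam i) = 1 \<and>
     (\<forall>a<n. \<forall>b<n. a \<noteq> b \<longrightarrow> total l lam P (\<lambda>p. of_bool (link p a b))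
        \<le> (\<Sum>e\<in>{k..<m}. if {end1 e, end2 e} = {a, b} then x e else 0)) \<and>
     (\<forall>e<k. total l lam P (\<lambda>p. real (p (n + e))) = min (x e) 1)"

lemma joined_tree:
  assumes "tree (n - 1) p" "0 < n" "a < n"
  shows "(joined n m end1 end2 p)\<^sup>*\<^sup>* a 0"
proof -
  have lt: "p a < n" if "a < n" for a
    using assms that unfolding tree_def by (metis One_nat_def Suc_pred less_Suc_eq_le)
  have "reach p a 0" using assms unfolding tree_def by simp
  then obtain j where "(p ^^ j) a = 0" unfolding reach_def by blast
  then show ?thesis using assms(3)
  proof (induction j arbitrary: a)
    case (Suc j)
    have "(p ^^ j) (p a) = 0" using Suc.prems(1) by (simp add: funpow_swap1)
    then have "(joined n m end1 end2 p)\<^sup>*\<^sup>* (p a) 0" using Suc.IH lt[OF Suc.prems(2)] by blast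
    moreover have "joined n m end1 end2 p a (p a)"
      unfolding joined_def link_def using lt Suc.prems(2) by simp
    ultimately show ?case by (rule converse_rtranclp_into_rtranclp[rotated])
  qed simp
qed

lemma edge_start:
  assumes T: "tree_inv n (n - 1) W l lam P" and n: "0 < n"
    and W: "\<And>a b. a < n \<Longrightarrow> b < n \<Longrightarrow> a \<noteq> b \<Longrightarrow> W a b = (\<Sum>e<m. if {end1 e, end2 e} = {a, b} then x e else 0)"
  shows "edge_inv n m end1 end2 x 0 l lam P"
proof -
  have "total l lam P (\<lambda>p. of_bool (link p a b)) \<le> (\<Sum>e\<in>{0..<m}. if {end1 e, end2 e} = {a, b} then x e else 0)"
    if "a < n" "b < n" "a \<noteq> b" for a b
  proof -
    have "a \<le> n - 1" "b \<le> n - 1" using that by auto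
    then have "total l lam P (\<lambda>p. of_bool (link p a b)) \<le> W a b"
      using T that(3) unfolding tree_inv_def by blast
    then show ?thesis using W[OF that] by (simp add: lessThan_atLeast0)
  qed
  moreover have "(joined n m end1 end2 (P i))\<^sup>*\<^sup>* a 0" if "i < l" "a < n" for i a
    by (rule joined_tree) (use T that n in \<open>auto simp: tree_inv_def\<close>)
  ultimately show ?thesis using T unfolding edge_inv_def tree_inv_def by simp
qed

lemma rtranclp_le: "(\<And>a b. r a b \<Longrightarrow> s a b) \<Longrightarrow> r\<^sup>*\<^sup>* a b \<Longrightarrow> s\<^sup>*\<^sup>* a b"
  by (metis mono_rtranclp)

text \<open>The first modification turns links between the ends of edge \<open>k\<close> into the
  edge itself; the second spends the unspent part \<open>q1\<close> of the same budget on members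
  that do not contain the edge. Adding an edge never harms connectivity, so the total can be raised
  to the exact value.\<close>

lemma edge_step:
  assumes E: "edge_inv n m end1 end2 x k l lam P" and k: "k < m"
    and ends: "\<And>e. e < m \<Longrightarrow> end1 e < n \<and> end2 e < n \<and> end1 e \<noteq> end2 e" and x: "\<And>e. e < m \<Longrightarrow> 0 \<le> x e"
    and r1: "retake l lam P (min (x k) 1) (\<lambda>p. link p (end1 k) (end2 k)) (place n end1 end2 k) l1 lam1 P1 q1"
    and r2: "retake l1 lam1 P1 q1 (\<lambda>p. p (n + k) = 0) (\<lambda>p. p(n + k := 1)) l2 lam2 P2 q2"
  shows "edge_inv n m end1 end2 x (Suc k) l2 lam2 P2"
proof -
  let ?a = "end1 k" and ?b = "end2 k" and ?r = "min (x k) 1"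
  let ?J = "joined n m end1 end2"
  define C where "C p \<longleftrightarrow> (\<forall>a<n. (?J p)\<^sup>*\<^sup>* a 0) \<and> (\<forall>e<m. p (n + e) \<le> 1) \<and>
     (\<forall>e<m. Suc k \<le> e \<longrightarrow> p (n + e) = 0)" for p
  define I where "I p \<longleftrightarrow> C p \<and> p (n + k) = 0" for p
  have ab: "?a < n" "?b < n" "?a \<noteq> ?b" "?a \<noteq> n + e" "?b \<noteq> n + e" for e using ends[OF k] by auto
  have I: "I (P i)" if "i < l" for i
    using E that k unfolding edge_inv_def I_def C_def by auto
  have I_C: "C (P i)" if "i < l" for i using I[OF that] unfolding I_def by simp
  have pl: "place n end1 end2 k p (n + e) = (if e = k then 1 else p (n + e))" for p e
    using ab(4)[of e, symmetric] ab(5)[of e, symmetric] unfolding place_def by simp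
  have C_mono: "C p'" if p: "C p" and J: "\<And>a b. ?J p a b \<Longrightarrow> ?J p' a b"
    and e: "\<And>e. p' (n + e) = (if e = k then 1 else p (n + e))" for p p'
  proof -
    have "(?J p')\<^sup>*\<^sup>* a 0" if "a < n" for a
      using p that rtranclp_le[of "?J p" "?J p'", OF J] unfolding C_def by blast
    then show ?thesis using p e unfolding C_def by simp
  qed
  have Cpl: "C (place n end1 end2 k p)" if p: "C p" for p
  proof (rule C_mono[OF p])
    show "place n end1 end2 k p (n + e) = (if e = k then 1 else p (n + e))" for e by (rule pl)
    fix a b assume J: "?J p a b"
    show "?J (place n end1 end2 k p) a b"
    proof (cases "{a, b} = {?a, ?b}")
      case True
      then show ?thesis using ab k J pl[of p k] unfolding joined_def by (auto intro!: exI[of _ k])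
    next
      case False
      have "link (place n end1 end2 k p) a b" if "link p a b" "a < n" "b < n"
        using that False ab unfolding link_def place_def by (auto simp: doubleton_eq_iff)
      then show ?thesis using J pl[of p] unfolding joined_def by (metis zero_less_one)
    qed
  qed
  have Cup: "C (p(n + k := 1))" if p: "C p" for p
  proof (rule C_mono[OF p])
    fix a b assume J: "?J p a b"
    show "?J (p(n + k := 1)) a b"
    proof (cases "link p a b")
      case True
      then show ?thesis using J unfolding joined_def link_def by auto
    next
      case False
      then obtain e where "e < m" "0 < p (n + e)" "{end1 e, end2 e} = {a, b}"
        using J unfolding joined_def by blast
      then show ?thesis using J unfolding joined_def by (intro conjI disjI2 exI[of _ e]) auto
    qed
  qed auto
  have C1: "C (P1 i)" if "i < l1" for i
    using retake_all[where I = C, OF r1 I_C Cpl that] by blast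
  have C2: "C (P2 i)" if "i < l2" for i
    using retake_all[where I = C, OF r2 C1 Cup that] by blast
  have q: "0 \<le> q1" "0 \<le> q2" using retake_nonneg r1 r2 by auto
  have s1: "(\<Sum>i<l. lam i) = 1" using E unfolding edge_inv_def by blast
  have s2: "(\<Sum>i<l2. lam2 i) = 1" using retake_sum[OF r1] retake_sum[OF r2] s1 by simp
  have pos: "0 < lam i" if "i < l" for i using E that unfolding edge_inv_def by blast
  have links: "total l2 lam2 P2 (\<lambda>p. of_bool (link p a b))
      \<le> (\<Sum>e\<in>{Suc k..<m}. if {end1 e, end2 e} = {a, b} then x e else 0)"
    if "a < n" "b < n" "a \<noteq> b" for a b
  proof -
    let ?L = "\<lambda>p. of_bool (link p a b) :: real"
    let ?R = "\<Sum>e\<in>{Suc k..<m}. if {end1 e, end2 e} = {a, b} then x e else 0"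
    have "total l2 lam2 P2 ?L \<le> total l1 lam1 P1 ?L + 0 * (q1 - q2)"
      by (rule retake_le[where I = C, OF r2 C1]) (use that in \<open>auto simp: link_def\<close>)
    moreover have old: "total l lam P ?L \<le> (if {?a, ?b} = {a, b} then x k else 0) + ?R"
    proof -
      have "total l lam P ?L \<le> (\<Sum>e\<in>{k..<m}. if {end1 e, end2 e} = {a, b} then x e else 0)"
        using E that unfolding edge_inv_def by blast
      then show ?thesis using k by (simp add: sum.atLeast_Suc_lessThan)
    qed
    moreover have R: "0 \<le> ?R" using x by (intro sum_nonneg) auto
    moreover have "total l1 lam1 P1 ?L \<le> ?R"
    proof (cases "{?a, ?b} = {a, b}")
      case False
      have "total l1 lam1 P1 ?L \<le> total l lam P ?L + 0 * (?r - q1)"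
        by (rule retake_le[where I = I, OF r1 I]) (use that False ab in \<open>auto simp: link_def place_def\<close>)
      then show ?thesis using old False by simp
    next
      case True
      have eq: "link p ?a ?b = link p a b" for p using True link_commute by (auto simp: doubleton_eq_iff)
      have npl: "\<not> link (place n end1 end2 k p) ?a ?b" for p
        using ab(1-3) unfolding link_def place_def by auto
      have npl': "\<not> link (place n end1 end2 k p) a b" for p
        using npl[of p] eq[of "place n end1 end2 k p"] by simp
      have "total l1 lam1 P1 ?L \<le> total l lam P ?L - ?r \<or> (\<forall>i<l1. \<not> link (P1 i) a b) \<and> total l1 lam1 P1 ?L = 0"
        by (rule retake_remove[where I = I, OF r1[unfolded eq] I])
           (simp_all add: npl')
      \<comment> \<open>Relevant for \<open>x k > 1\<close>: then the budget is 1, the weight of the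
        entire family, and every link between the ends of the edge is replaced.\<close>
      moreover have "total l lam P ?L \<le> total l lam P (\<lambda>_. 1)"
        by (rule total_mono) (use pos in auto)
      ultimately show ?thesis using old True R s1 by (auto simp: total_def min_def split: if_splits)
    qed
    ultimately show ?thesis by linarith
  qed
  have F: "total l2 lam2 P2 (\<lambda>p. real (p (n + e))) = min (x e) 1" if e: "e < k" for e
  proof -
    have "total l2 lam2 P2 (\<lambda>p. real (p (n + e))) = total l1 lam1 P1 (\<lambda>p. real (p (n + e))) + 0 * (q1 - q2)"
      by (rule retake_eq[where I = C, OF r2 C1]) (use e in auto)
    moreover have "total l1 lam1 P1 (\<lambda>p. real (p (n + e))) = total l lam P (\<lambda>p. real (p (n + e))) + 0 * (?r - q1)"
      by (rule retake_eq[where I = I, OF r1 I]) (use e pl in auto)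
    ultimately show ?thesis using E e unfolding edge_inv_def by auto
  qed
  have Fk: "total l2 lam2 P2 (\<lambda>p. real (p (n + k))) = ?r"
  proof -
    let ?F = "\<lambda>p. real (p (n + k))"
    have "total l2 lam2 P2 ?F = total l1 lam1 P1 ?F + 1 * (q1 - q2)"
      by (rule retake_eq[where I = C, OF r2 C1]) auto
    moreover have "total l1 lam1 P1 ?F = total l lam P ?F + 1 * (?r - q1)"
      by (rule retake_eq[where I = I, OF r1 I]) (use pl in \<open>auto simp: I_def\<close>)
    moreover have "total l lam P ?F = 0" unfolding total_def using I I_def by (intro sum.neutral) auto
    ultimately have t: "total l2 lam2 P2 ?F = ?r - q2" by simp
    \<comment> \<open>If some budget were left, every member would contain the edge, giving it
      weight 1, which already exhausts a budget of at most 1.\<close>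
    have "q2 = 0"
    proof (rule ccontr)
      assume "q2 \<noteq> 0"
      then have "P2 i (n + k) \<noteq> 0" if "i < l2" for i
        using retake_exhaust[where I = C, OF r2 _ C1 _ that] by auto
      moreover have "P2 i (n + k) \<le> 1" if "i < l2" for i using C2[OF that] k unfolding C_def by blast
      ultimately have "P2 i (n + k) = 1" if "i < l2" for i using that by (metis le_antisym less_one linorder_not_less)
      then have "total l2 lam2 P2 ?F = 1" unfolding total_def using s2 by simp
      then show False using t q \<open>q2 \<noteq> 0\<close> by auto
    qed
    then show ?thesis using t by simp
  qed
  have "\<forall>e<Suc k. total l2 lam2 P2 (\<lambda>p. real (p (n + e))) = min (x e) 1"
    using F Fk by (simp add: less_Suc_eq)
  then show ?thesis
    using C2 links s2 retake_pos[OF r2] unfolding edge_inv_def C_def by auto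
qed

section \<open>Two-edge cuts of the input graph and multiplicities of even parity\<close>

lemma delta_iff:
  assumes "finite_graph G" "e \<in> edges G" "ends G e = {a, b}"
  shows "e \<in> delta G S \<longleftrightarrow> (a \<in> S) \<noteq> (b \<in> S)"
proof -
  have "card {a, b} = 2" using assms unfolding finite_graph_def by metis
  then have "a \<noteq> b" by auto
  then have "{a, b} \<inter> S = (if a \<in> S then if b \<in> S then {a, b} else {a} else if b \<in> S then {b} else {})" by auto
  then show ?thesis using assms \<open>a \<noteq> b\<close> unfolding delta_def by auto
qed

lemma ends_pair:
  assumes "finite_graph G" "e \<in> edges G"
  obtains a b where "ends G e = {a, b}"
  using assms unfolding finite_graph_def by (meson card_2_iff)

lemma delta_sym_diff:
  assumes "finite_graph G"
  shows "delta G ((S - T) \<union> (T - S)) = (delta G S - delta G T) \<union> (delta G T - delta G S)"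
proof -
  have "e \<in> delta G ((S - T) \<union> (T - S)) \<longleftrightarrow> e \<in> (delta G S - delta G T) \<union> (delta G T - delta G S)"
    if e: "e \<in> edges G" for e
  proof -
    obtain a b where "ends G e = {a, b}" using ends_pair[OF assms e] .
    note d = delta_iff[OF assms e this]
    show ?thesis unfolding Un_iff Diff_iff d by blast
  qed
  then show ?thesis unfolding delta_def by blast
qed

lemma crossing_edge:
  assumes "spanning_connected G A" "A \<subseteq> edges G" "finite_graph G" "S \<noteq> {}" "S \<subset> verts G"
  shows "\<exists>e\<in>A. e \<in> delta G S"
proof (rule ccontr)
  assume no: "\<not> ?thesis"
  obtain u v where uv: "u \<in> S" "v \<in> verts G" "v \<notin> S" using assms(4,5) by blast
  then have "(adjacent_via G A)\<^sup>*\<^sup>* u v" using assms(1,5) unfolding spanning_connected_def by blast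
  then have "v \<in> S"
  proof (induction rule: rtranclp_induct)
    case (step y z)
    then obtain e where e: "e \<in> A" "ends G e = {y, z}" unfolding adjacent_via_def by blast
    then have "e \<notin> delta G S" "e \<in> edges G" using no assms(2) by auto
    then show ?case using delta_iff[OF assms(3) _ e(2), of S] step by blast
  qed (use uv in auto)
  then show False using uv by simp
qed

text \<open>Deleting the only edge of such a cut would disconnect the graph.\<close>

lemma delta_not_singleton:
  assumes "two_edge_connected G" "finite_graph G" "S \<noteq> {}" "S \<subset> verts G"
  shows "\<not> delta G S \<subseteq> {e}"
proof
  assume d: "delta G S \<subseteq> {e}"
  obtain e' where e': "e' \<in> edges G" "e' \<in> delta G S"
    using crossing_edge[of G "edges G" S] assms unfolding two_edge_connected_def by blast
  then have "e' = e" using d by blast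
  then have "spanning_connected G (edges G - {e})" using assms(1) e' unfolding two_edge_connected_def by blast
  then show False using crossing_edge[of G "edges G - {e}" S] assms d by blast
qed

text \<open>Stated by inclusion because that is what a connectivity test decides: deleting both
  edges disconnects the graph. In a 2-edge-connected graph inclusion forces equality and
  \<open>e \<noteq> f\<close>.\<close>

definition cut_pair :: "('v, 'e) graph \<Rightarrow> 'e \<Rightarrow> 'e \<Rightarrow> bool" where
  "cut_pair G e f \<longleftrightarrow> (\<exists>S. S \<noteq> {} \<and> S \<subset> verts G \<and> delta G S \<subseteq> {e, f})"

lemma cut_pairD:
  assumes "two_edge_connected G" "finite_graph G" "cut_pair G e f"
  obtains S where "S \<noteq> {}" "S \<subset> verts G" "delta G S = {e, f}" "e \<noteq> f"
proof -
  obtain S where S: "S \<noteq> {}" "S \<subset> verts G" "delta G S \<subseteq> {e, f}"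
    using assms(3) unfolding cut_pair_def by blast
  have "\<not> delta G S \<subseteq> {e}" "\<not> delta G S \<subseteq> {f}"
    using delta_not_singleton[OF assms(1,2) S(1,2)] by auto
  then show thesis using S by (intro that[of S]) auto
qed

lemma cut_pair_commute: "cut_pair G e f = cut_pair G f e"
  unfolding cut_pair_def by (simp add: insert_commute)

text \<open>The cut of a symmetric difference is the symmetric difference of the cuts, here
  \<open>{f, g}\<close>. The set is nonempty since the two cuts differ, and it is not the whole
  vertex set since its cut contains \<open>f\<close>.\<close>

lemma cut_pair_trans:
  assumes G: "two_edge_connected G" "finite_graph G" and c: "cut_pair G e f" "cut_pair G e g" and "f \<noteq> g"
  shows "cut_pair G f g"
proof -
  obtain S where S: "S \<noteq> {}" "S \<subset> verts G" "delta G S = {e, f}" "e \<noteq> f" using cut_pairD[OF G c(1)] .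
  obtain T where T: "T \<noteq> {}" "T \<subset> verts G" "delta G T = {e, g}" "e \<noteq> g" using cut_pairD[OF G c(2)] .
  let ?D = "(S - T) \<union> (T - S)"
  have d: "delta G ?D = {f, g}" unfolding delta_sym_diff[OF G(2)] using S T \<open>f \<noteq> g\<close> by auto
  have "?D \<noteq> {}"
  proof
    assume "?D = {}"
    then have "S = T" by blast
    then show False using S T \<open>f \<noteq> g\<close> by (auto simp: doubleton_eq_iff)
  qed
  moreover have "?D \<noteq> verts G"
  proof
    assume D: "?D = verts G"
    have f: "f \<in> delta G ?D" unfolding d by simp
    then have fe: "f \<in> edges G" unfolding delta_def by blast
    then have "ends G f \<subseteq> verts G" "card (ends G f) = 2" using G(2) unfolding finite_graph_def by auto
    then show False using f unfolding D delta_def by (simp add: inf.absorb1)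
  qed
  moreover have "?D \<subseteq> verts G" using S T by blast
  ultimately have "?D \<noteq> {} \<and> ?D \<subset> verts G \<and> delta G ?D \<subseteq> {f, g}"
    unfolding d psubset_eq by simp
  then show ?thesis unfolding cut_pair_def by (rule exI)
qed

lemma cut_pair_weight:
  assumes "two_edge_connected G" "finite_graph G" "x \<in> subtour G" "cut_pair G e f"
  shows "2 \<le> x e + x f"
proof -
  obtain S where S: "S \<noteq> {}" "S \<subset> verts G" "delta G S = {e, f}" "e \<noteq> f"
    using cut_pairD[OF assms(1,2,4)] .
  then have "2 \<le> (\<Sum>a\<in>delta G S. x a)" using assms(3) unfolding subtour_def by blast
  then show ?thesis unfolding S(3) using S(4) by simp
qed

text \<open>\<open>c\<close> is the 0-1 multiplicity in a member before doubling. An edge with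
  \<open>1 \<le> x e\<close> has total weight 1 there, so it already occurs in each member, and the
  default value 1 agrees with \<open>c e\<close>.\<close>

definition multiplicity_of :: "('v, 'e) graph \<Rightarrow> ('e \<Rightarrow> real) \<Rightarrow> ('e \<Rightarrow> nat) \<Rightarrow> 'e \<Rightarrow> nat" where
  "multiplicity_of G x c e =
     (if x e < 1 then c e
      else if \<exists>f\<in>edges G. x f < 1 \<and> cut_pair G e f \<and> c f = 0 then 2 else 1)"

text \<open>Two edges below 1 cannot form a cut. If only \<open>f\<close> is below 1, then
  \<open>e\<close> has multiplicity 2 when \<open>f\<close> is absent and 1 when \<open>f\<close> is
  present. If neither is below 1, transitivity gives both the same partners below 1 and hence the
  same multiplicity.\<close>

lemma multiplicity_parity:
  assumes G: "two_edge_connected G" "finite_graph G" and x: "x \<in> subtour G"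
    and c: "\<And>e. c e \<le> 1" and "cut_pair G e f" "e \<in> edges G" "f \<in> edges G"
  shows "even (multiplicity_of G x c e + multiplicity_of G x c f)"
proof -
  have *: "even (multiplicity_of G x c e + multiplicity_of G x c f)"
    if cp: "cut_pair G e f" and e: "1 \<le> x e" and f: "f \<in> edges G" "x f < 1" for e f
  proof -
    \<comment> \<open>Two partners of \<open>e\<close> below 1 would form a cut with each other, of
      weight less than 2.\<close>
    have uniq: "f' = f" if "x f' < 1" "cut_pair G e f'" for f'
    proof (rule ccontr)
      assume "f' \<noteq> f"
      then have "cut_pair G f f'" using cut_pair_trans[OF G cp that(2)] by simp
      then show False using cut_pair_weight[OF G x] that f by fastforce
    qed
    have "(\<exists>g\<in>edges G. x g < 1 \<and> cut_pair G e g \<and> c g = 0) \<longleftrightarrow> c f = 0"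
    proof
      show "c f = 0 \<Longrightarrow> \<exists>g\<in>edges G. x g < 1 \<and> cut_pair G e g \<and> c g = 0" using f cp by blast
      show "\<exists>g\<in>edges G. x g < 1 \<and> cut_pair G e g \<and> c g = 0 \<Longrightarrow> c f = 0" using uniq by metis
    qed
    then have "multiplicity_of G x c e = (if c f = 0 then 2 else 1)"
      unfolding multiplicity_of_def using e by simp
    moreover have "c f = 0 \<or> c f = 1" using c[of f] by linarith
    ultimately show ?thesis using f unfolding multiplicity_of_def by auto
  qed
  have sum: "2 \<le> x e + x f" using cut_pair_weight[OF G x assms(5)] .
  consider "1 \<le> x e" "x f < 1" | "1 \<le> x f" "x e < 1" | "1 \<le> x e" "1 \<le> x f" using sum by linarith
  then show ?thesis
  proof cases
    case 1
    then show ?thesis using * assms by blast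
  next
    case 2
    then show ?thesis using *[of f e] assms cut_pair_commute by (metis add.commute)
  next
    case 3
    have t: "cut_pair G b g" if "cut_pair G a b" "1 \<le> x b" "x g < 1" "cut_pair G a g" for a b g
    proof -
      have "b \<noteq> g" using that by auto
      then show ?thesis by (rule cut_pair_trans[OF G that(1,4)])
    qed
    have "cut_pair G f e" using assms(5) by (simp add: cut_pair_commute)
    then have "cut_pair G e g \<longleftrightarrow> cut_pair G f g" if "x g < 1" for g
      using t[of e f g] t[of f e g] assms(5) 3 that by blast
    then have "(\<exists>g\<in>edges G. x g < 1 \<and> cut_pair G e g \<and> c g = 0) \<longleftrightarrow> (\<exists>g\<in>edges G. x g < 1 \<and> cut_pair G f g \<and> c g = 0)"
      by (intro bex_cong) auto
    then have "multiplicity_of G x c e = multiplicity_of G x c f"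
      using 3 unfolding multiplicity_of_def by simp
    then show ?thesis by simp
  qed
qed

lemma multiplicity_weight:
  assumes G: "two_edge_connected G" "finite_graph G" and x: "x \<in> subtour G"
    and lam: "\<And>i. i < l \<Longrightarrow> 0 < lam i" "(\<Sum>i<l. lam i) = 1" and c: "\<And>i e. c i e \<le> 1"
    and F: "\<And>e. e \<in> edges G \<Longrightarrow> (\<Sum>i<l. lam i * real (c i e)) = min (x e) 1" and e: "e \<in> edges G"
  shows "(\<Sum>i<l. lam i * real (multiplicity_of G x (c i) e)) \<le> x e"
proof (cases "x e < 1")
  case True
  then show ?thesis using F[OF e] unfolding multiplicity_of_def by simp
next
  case False
  show ?thesis
  proof (cases "\<exists>f\<in>edges G. x f < 1 \<and> cut_pair G e f")
    case no: False
    then have "(\<Sum>i<l. lam i * real (multiplicity_of G x (c i) e)) = (\<Sum>i<l. lam i)"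
      using False unfolding multiplicity_of_def by (intro sum.cong refl) auto
    then show ?thesis using lam False by simp
  next
    case True
    then obtain f where f: "f \<in> edges G" "x f < 1" "cut_pair G e f" by blast
    have uniq: "f' = f" if "x f' < 1" "cut_pair G e f'" for f'
    proof (rule ccontr)
      assume "f' \<noteq> f"
      then have "cut_pair G f f'" using cut_pair_trans[OF G f(3) that(2)] by simp
      then show False using cut_pair_weight[OF G x] that f by fastforce
    qed
    \<comment> \<open>With a single partner below 1 the multiplicity is linear in the presence of
      \<open>f\<close>, so its average is exactly \<open>2 - x f\<close>. This uses that the weight
      of \<open>f\<close> is attained and not just bounded.\<close>
    have m: "multiplicity_of G x (c i) e = 2 - c i f" for i
    proof -
      have "(\<exists>g\<in>edges G. x g < 1 \<and> cut_pair G e g \<and> c i g = 0) \<longleftrightarrow> c i f = 0"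
      proof
        show "c i f = 0 \<Longrightarrow> \<exists>g\<in>edges G. x g < 1 \<and> cut_pair G e g \<and> c i g = 0" using f by blast
        show "\<exists>g\<in>edges G. x g < 1 \<and> cut_pair G e g \<and> c i g = 0 \<Longrightarrow> c i f = 0" using uniq by metis
      qed
      moreover have "c i f = 0 \<or> c i f = 1" using c[of i f] by linarith
      ultimately show ?thesis unfolding multiplicity_of_def using False by auto
    qed
    have "(\<Sum>i<l. lam i * real (multiplicity_of G x (c i) e)) = (\<Sum>i<l. 2 * lam i - lam i * real (c i f))"
    proof (intro sum.cong refl)
      fix i
      have "c i f \<le> 2" using c[of i f] by linarith
      then show "lam i * real (multiplicity_of G x (c i) e) = 2 * lam i - lam i * real (c i f)"
        unfolding m by (simp add: of_nat_diff algebra_simps)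
    qed
    also have "\<dots> = 2 - x f" using F[OF f(1)] f lam(2) by (simp add: sum_subtractf sum_distrib_left[symmetric])
    also have "\<dots> \<le> x e" using cut_pair_weight[OF G x f(3)] by simp
    finally show ?thesis .
  qed
qed

lemma multiplicity_pos:
  assumes "0 < c e"
  shows "0 < multiplicity_of G x c e"
  using assms unfolding multiplicity_of_def by simp

section \<open>The minimum cut program\<close>

definition beq :: "nexp \<Rightarrow> nexp \<Rightarrow> bexp" where
  "beq a b = BAnd (BNot (NLess a b)) (BNot (NLess b a))"

lemma bval_beq [simp]: "bval (beq a b) s \<longleftrightarrow> nval a s = nval b s"
  by (auto simp: beq_def)

text \<open>Two-dimensional arrays have rows of length \<open>K\<close>; the array \<open>T\<close> holds the multiples of \<open>K\<close>.\<close>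

abbreviation ix :: "nexp \<Rightarrow> nexp \<Rightarrow> nexp" where "ix i j \<equiv> NAdd (NCell ''T'' i) j"

text \<open>\<open>D\<close> marks vertices that are already ordered, \<open>g\<close> whether a
  candidate has been found, and \<open>q\<close> is the unordered vertex with the largest weight
  \<open>y\<close> to the ordered ones.\<close>

definition find_best :: prog where
  "find_best =
     nset ''g'' (NConst 0) ;;
     PFor ''j'' ''n''
       (PIf (beq (NCell ''D'' (nvar ''j'')) (NConst 0))
         (PIf (beq (nvar ''g'') (NConst 0))
           (nset ''g'' (NConst 1) ;; nset ''q'' (nvar ''j''))
           (PIf (RLess (RCell ''y'' (nvar ''q'')) (RCell ''y'' (nvar ''j'')))
             (nset ''q'' (nvar ''j'')) PSkip))
         PSkip)"

definition add_best :: prog where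
  "add_best =
     PIf (beq (nvar ''g'') (NConst 1))
       (nset ''s'' (nvar ''t'') ;; nset ''t'' (nvar ''q'') ;; PNat ''D'' (nvar ''q'') (NConst 1) ;;
        rset ''z'' (RCell ''y'' (nvar ''q'')) ;;
        PFor ''j'' ''n'' (PReal ''y'' (nvar ''j'')
          (RAdd (RCell ''y'' (nvar ''j'')) (RCell ''M'' (ix (nvar ''q'') (nvar ''j''))))))
       PSkip"

text \<open>The ordering starts at \<open>v\<close>. Inactive vertices, and \<open>v\<close> itself,
  have \<open>A\<close> equal to 0 and therefore count as ordered from the beginning.\<close>

definition ma_init :: prog where
  "ma_init =
     PFor ''i'' ''n''
       (PReal ''y'' (nvar ''i'') (RCell ''M'' (ix (nvar ''v'') (nvar ''i''))) ;;
        PNat ''D'' (nvar ''i'') (NSub (NConst 1) (NCell ''A'' (nvar ''i'')))) ;;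
     nset ''s'' (nvar ''v'') ;; nset ''t'' (nvar ''v'')"

definition merge :: prog where
  "merge =
     PIf (RLess (rvar ''z'') (rvar ''c'')) (rset ''c'' (rvar ''z'')) PSkip ;;
     PFor ''j'' ''n'' (PReal ''M'' (ix (nvar ''s'') (nvar ''j''))
       (RAdd (RCell ''M'' (ix (nvar ''s'') (nvar ''j''))) (RCell ''M'' (ix (nvar ''t'') (nvar ''j''))))) ;;
     PFor ''j'' ''n'' (PReal ''M'' (ix (nvar ''j'') (nvar ''s''))
       (RAdd (RCell ''M'' (ix (nvar ''j'') (nvar ''s''))) (RCell ''M'' (ix (nvar ''j'') (nvar ''t''))))) ;;
     PNat ''A'' (nvar ''t'') (NConst 0)"

text \<open>Since the ordering starts at \<open>v\<close>, the last but one vertex is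
  \<open>v\<close> only if a single active vertex is left; the remaining phases then change neither
  the weights nor \<open>c\<close>.\<close>

definition phase :: prog where
  "phase =
     ma_init ;; PFor ''i'' ''n'' (find_best ;; add_best) ;;
     PIf (beq (nvar ''s'') (nvar ''v'')) PSkip merge"

text \<open>Starting \<open>c\<close> at 2 caps the result: only cuts below 2 require a correction
  of the amount split off.\<close>

definition mincut_init :: prog where
  "mincut_init =
     PFor ''i'' ''n'' (PFor ''j'' ''n''
       (PReal ''M'' (ix (nvar ''i'') (nvar ''j'')) (RCell ''W'' (ix (nvar ''i'') (nvar ''j''))))) ;;
     PFor ''i'' ''n'' (PIf (NLess (nvar ''i'') (nvar ''v''))
       (PNat ''A'' (nvar ''i'') (NConst 1)) (PNat ''A'' (nvar ''i'') (NConst 0))) ;;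
     rset ''c'' (ROfNat (NConst 2))"

definition mincut :: prog where
  "mincut = mincut_init ;; PFor ''h'' ''n'' phase"

section \<open>Correctness of the minimum cut computation\<close>

lemma writes_find_best [simp]: "nwrites find_best = {''g'', ''j'', ''q''}" "rwrites find_best = {}"
  by (auto simp: find_best_def)

lemma writes_add_best [simp]:
  "nwrites add_best = {''s'', ''t'', ''D'', ''j''}" "rwrites add_best = {''y'', ''z''}"
  by (auto simp: add_best_def)

lemma writes_ma_init [simp]: "nwrites ma_init = {''i'', ''D'', ''s'', ''t''}" "rwrites ma_init = {''y''}"
  by (auto simp: ma_init_def)

lemma writes_merge [simp]: "nwrites merge = {''j'', ''A''}" "rwrites merge = {''c'', ''M''}"
  by (auto simp: merge_def)

lemma writes_phase [simp]:
  "nwrites phase = {''i'', ''D'', ''s'', ''t'', ''g'', ''j'', ''q'', ''A''}"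
  "rwrites phase = {''y'', ''z'', ''c'', ''M''}"
  by (auto simp: phase_def)

lemma writes_mincut_init [simp]: "nwrites mincut_init = {''i'', ''j'', ''A''}" "rwrites mincut_init = {''M'', ''c''}"
  by (auto simp: mincut_init_def)

lemma writes_mincut [simp]:
  "nwrites mincut = {''h'', ''i'', ''D'', ''s'', ''t'', ''g'', ''j'', ''q'', ''A''}"
  "rwrites mincut = {''y'', ''z'', ''c'', ''M''}"
  by (auto simp: mincut_def)

text \<open>Rows of length \<open>K\<close> hold \<open>n\<close> parents and \<open>m\<close>
  multiplicities. \<open>L\<close> bounds both the size of the family and the row indices; the
  summand 2 gives \<open>(n + 2) * K * K \<le> L\<close>, with room for the members appended for
  edges.\<close>

locale setting =
  fixes n m K L :: nat and end1 end2 :: "nat \<Rightarrow> nat" and x :: "nat \<Rightarrow> real"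
  assumes K: "K = n + m + 2" and L: "L = K * K * K" and n: "0 < n"
begin

definition base :: "state \<Rightarrow> bool" where
  "base s \<longleftrightarrow> nat_mem s ''n'' 0 = n \<and> nat_mem s ''m'' 0 = m \<and> nat_mem s ''K'' 0 = K \<and> nat_mem s ''L'' 0 = L \<and>
     (\<forall>i<L. nat_mem s ''T'' i = i * K) \<and>
     (\<forall>e<m. nat_mem s ''end1'' e = end1 e \<and> nat_mem s ''end2'' e = end2 e \<and> real_mem s ''x'' e = x e)"

lemma base_frame:
  "base s \<Longrightarrow> frame N R s t \<Longrightarrow>
   ''n'' \<notin> N \<and> ''m'' \<notin> N \<and> ''K'' \<notin> N \<and> ''L'' \<notin> N \<and> ''T'' \<notin> N \<and> ''end1'' \<notin> N \<and> ''end2'' \<notin> N \<and> ''x'' \<notin> R \<Longrightarrow>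
   base t"
  unfolding base_def frame_def by simp

lemma base_run:
  "base s \<Longrightarrow> let N = nwrites p in ''n'' \<notin> N \<and> ''m'' \<notin> N \<and> ''K'' \<notin> N \<and> ''L'' \<notin> N \<and> ''T'' \<notin> N \<and>
     ''end1'' \<notin> N \<and> ''end2'' \<notin> N \<and> ''x'' \<notin> rwrites p \<Longrightarrow> base (run p s)"
  unfolding Let_def by (rule base_frame[OF _ run_frame])

lemma base_nat_write [simp]:
  "a \<noteq> ''n'' \<Longrightarrow> a \<noteq> ''m'' \<Longrightarrow> a \<noteq> ''K'' \<Longrightarrow> a \<noteq> ''L'' \<Longrightarrow> a \<noteq> ''T'' \<Longrightarrow> a \<noteq> ''end1'' \<Longrightarrow> a \<noteq> ''end2'' \<Longrightarrow>
   base (nat_write a i k s) = base s"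
  unfolding base_def by simp

lemma base_real_write [simp]: "a \<noteq> ''x'' \<Longrightarrow> base (real_write a i r s) = base s"
  unfolding base_def by simp

lemma base_vals:
  assumes "base s"
  shows "nat_mem s ''n'' 0 = n" "nat_mem s ''m'' 0 = m" "nat_mem s ''K'' 0 = K" "nat_mem s ''L'' 0 = L"
    "\<And>i. i < L \<Longrightarrow> nat_mem s ''T'' i = i * K"
    "\<And>e. e < m \<Longrightarrow> nat_mem s ''end1'' e = end1 e" "\<And>e. e < m \<Longrightarrow> nat_mem s ''end2'' e = end2 e"
    "\<And>e. e < m \<Longrightarrow> real_mem s ''x'' e = x e"
  using assms unfolding base_def by auto

lemma KK_le_L: "K * K \<le> L" and K_le_L: "K \<le> L"
  unfolding L K by simp_all

lemma lt_K [simp]: "j < n \<Longrightarrow> j < K" and lt_L [simp]: "j < n \<Longrightarrow> j < L"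
  using K_le_L K by auto

lemma idx_eq [simp]: "b < K \<Longrightarrow> b' < K \<Longrightarrow> a * K + b = a' * K + b' \<longleftrightarrow> a = a' \<and> b = b'"
proof
  assume "b < K" "b' < K" and e: "a * K + b = a' * K + b'"
  have "(a * K + b) div K = a" using \<open>b < K\<close> by simp
  moreover have "(a' * K + b') div K = a'" using \<open>b' < K\<close> by simp
  ultimately have "a = a'" using e by metis
  then show "a = a' \<and> b = b'" using e by simp
qed simp

definition mat :: "state \<Rightarrow> string \<Rightarrow> nat \<Rightarrow> nat \<Rightarrow> real" where
  "mat s a i j = real_mem s a (i * K + j)"

lemma find_best:
  assumes b: "base s" and D: "D = nat_mem s ''D''" and y: "y = real_mem s ''y''"
  defines "s' \<equiv> run find_best s"
  shows "nat_mem s' ''g'' 0 = 0 \<and> (\<forall>j<n. D j \<noteq> 0) \<or>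
    nat_mem s' ''g'' 0 = 1 \<and> nat_mem s' ''q'' 0 < n \<and> D (nat_mem s' ''q'' 0) = 0 \<and>
      (\<forall>j<n. D j = 0 \<longrightarrow> y j \<le> y (nat_mem s' ''q'' 0))"
proof -
  let ?p = "PIf (beq (NCell ''D'' (nvar ''j'')) (NConst 0))
         (PIf (beq (nvar ''g'') (NConst 0))
           (nset ''g'' (NConst 1) ;; nset ''q'' (nvar ''j''))
           (PIf (RLess (RCell ''y'' (nvar ''q'')) (RCell ''y'' (nvar ''j'')))
             (nset ''q'' (nvar ''j'')) PSkip))
         PSkip"
  let ?s = "nat_write ''g'' 0 0 s"
  let ?Q = "\<lambda>k t. nat_mem t ''g'' 0 = 0 \<and> (\<forall>j<k. D j \<noteq> 0) \<or>
    nat_mem t ''g'' 0 = 1 \<and> nat_mem t ''q'' 0 < k \<and> D (nat_mem t ''q'' 0) = 0 \<and>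
      (\<forall>j<k. D j = 0 \<longrightarrow> y j \<le> y (nat_mem t ''q'' 0))"
  have N: "nat_mem ?s ''n'' 0 = n" using base_vals[OF b] by simp
  obtain t where t: "run (PFor ''j'' ''n'' ?p) ?s = nat_write ''j'' 0 (nat_mem ?s ''n'' 0) t" "?Q (nat_mem ?s ''n'' 0) t"
  proof (rule run_For[where Q = ?Q and s = ?s and p = ?p and i = "''j''" and a = "''n''"], goal_cases)
    case (2 k t)
    have [simp]: "nat_mem t ''D'' = D" "real_mem t ''y'' = y"
      using frame_nat[OF 2(4), of "''D''"] frame_real[OF 2(4), of "''y''"] D y by simp_all
    show ?case using 2(3)
      by (auto simp: less_Suc_eq)
  qed (use that in auto)
  then show ?thesis unfolding s'_def find_best_def using N by simp
qed

lemma add_best: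
  assumes b: "base s" and "nat_mem s ''g'' 0 = 1" and q: "q = nat_mem s ''q'' 0" "q < n"
  defines "s' \<equiv> run add_best s"
  shows "nat_mem s' ''s'' 0 = nat_mem s ''t'' 0" "nat_mem s' ''t'' 0 = q"
    "nat_mem s' ''D'' = (nat_mem s ''D'')(q := 1)" "real_mem s' ''z'' 0 = real_mem s ''y'' q"
    "\<And>j. j < n \<Longrightarrow> real_mem s' ''y'' j = real_mem s ''y'' j + mat s ''M'' q j"
proof -
  let ?p = "PReal ''y'' (nvar ''j'') (RAdd (RCell ''y'' (nvar ''j'')) (RCell ''M'' (ix (nvar ''q'') (nvar ''j''))))"
  let ?s = "real_write ''z'' 0 (real_mem s ''y'' q) (nat_write ''D'' q 1 (nat_write ''t'' 0 q (nat_write ''s'' 0 (nat_mem s ''t'' 0) s)))"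
  have bs: "base ?s" using b by simp
  have N: "nat_mem ?s ''n'' 0 = n" using base_vals[OF b] by simp
  let ?Q = "\<lambda>k t. \<forall>j<n. real_mem t ''y'' j = real_mem s ''y'' j + (if j < k then mat s ''M'' q j else 0)"
  obtain t where t: "run (PFor ''j'' ''n'' ?p) ?s = nat_write ''j'' 0 (nat_mem ?s ''n'' 0) t" "?Q (nat_mem ?s ''n'' 0) t"
      "frame (insert ''j'' (nwrites ?p)) (rwrites ?p) ?s t"
  proof (rule run_For[where Q = ?Q and s = ?s and p = ?p and i = "''j''" and a = "''n''"], goal_cases)
    case (2 k t)
    have "base t" using base_frame[OF bs 2(4)] by simp
    note bt = base_vals[OF this]
    have [simp]: "nat_mem t ''q'' 0 = q" "real_mem t ''M'' = real_mem s ''M''" "nat_mem s ''n'' 0 = n"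
      using frame_nat[OF 2(4), of "''q''"] frame_real[OF 2(4), of "''M''"] q N by simp_all
    show ?case using 2(2,3) q(2) by (auto simp: bt mat_def less_Suc_eq)
  qed (use that in auto)
  have run: "s' = nat_write ''j'' 0 n t"
    unfolding s'_def add_best_def using assms(2) t(1) N q by (simp del: run.simps(6))
  show "nat_mem s' ''s'' 0 = nat_mem s ''t'' 0" "nat_mem s' ''t'' 0 = q"
    "nat_mem s' ''D'' = (nat_mem s ''D'')(q := 1)" "real_mem s' ''z'' 0 = real_mem s ''y'' q"
    unfolding run using frame_nat[OF t(3)] frame_real[OF t(3)] by simp_all
  show "real_mem s' ''y'' j = real_mem s ''y'' j + mat s ''M'' q j" if "j < n" for j
    unfolding run using t(2) that N by simp
qed

lemma ma_init:
  assumes b: "base s" and v: "nat_mem s ''v'' 0 = v" "v < n"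
  defines "s' \<equiv> run ma_init s"
  shows "nat_mem s' ''s'' 0 = v" "nat_mem s' ''t'' 0 = v"
    "\<And>j. j < n \<Longrightarrow> real_mem s' ''y'' j = mat s ''M'' v j"
    "\<And>j. j < n \<Longrightarrow> nat_mem s' ''D'' j = 1 - nat_mem s ''A'' j"
proof -
  let ?p = "PReal ''y'' (nvar ''i'') (RCell ''M'' (ix (nvar ''v'') (nvar ''i''))) ;;
        PNat ''D'' (nvar ''i'') (NSub (NConst 1) (NCell ''A'' (nvar ''i'')))"
  have N: "nat_mem s ''n'' 0 = n" using base_vals[OF b] by simp
  let ?Q = "\<lambda>k t. \<forall>j<k. real_mem t ''y'' j = mat s ''M'' v j \<and> nat_mem t ''D'' j = 1 - nat_mem s ''A'' j"
  obtain t where t: "run (PFor ''i'' ''n'' ?p) s = nat_write ''i'' 0 (nat_mem s ''n'' 0) t" "?Q (nat_mem s ''n'' 0) t"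
      "frame (insert ''i'' (nwrites ?p)) (rwrites ?p) s t"
  proof (rule run_For[where Q = ?Q and s = s and p = ?p and i = "''i''" and a = "''n''"], goal_cases)
    case (2 k t)
    have "base t" using base_frame[OF b 2(4)] by simp
    note bt = base_vals[OF this]
    have [simp]: "nat_mem t ''v'' 0 = v" "real_mem t ''M'' = real_mem s ''M''" "nat_mem t ''A'' = nat_mem s ''A''"
        "nat_mem s ''n'' 0 = n"
      using frame_nat[OF 2(4)] frame_real[OF 2(4), of "''M''"] v N by simp_all
    show ?case using 2(2,3) v(2) by (auto simp: bt mat_def less_Suc_eq)
  qed (use that in auto)
  show "nat_mem s' ''s'' 0 = v" "nat_mem s' ''t'' 0 = v"
    unfolding s'_def ma_init_def using t(1) frame_nat[OF t(3)] v by (simp_all del: run.simps(6))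
  show "real_mem s' ''y'' j = mat s ''M'' v j" "nat_mem s' ''D'' j = 1 - nat_mem s ''A'' j" if "j < n" for j
    unfolding s'_def ma_init_def using t(1,2) that N by (simp_all del: run.simps(6))
qed

lemma merge:
  assumes b: "base s" and st: "nat_mem s ''s'' 0 = p" "nat_mem s ''t'' 0 = q" "p < n" "q < n" "p \<noteq> q"
  defines "s' \<equiv> run merge s"
  shows "real_mem s' ''c'' 0 = min (real_mem s ''c'' 0) (real_mem s ''z'' 0)"
    "nat_mem s' ''A'' = (nat_mem s ''A'')(q := 0)"
    "\<And>a b. a < n \<Longrightarrow> b < n \<Longrightarrow> a \<noteq> b \<Longrightarrow> mat s' ''M'' a b =
      mat s ''M'' a b + (if a = p then mat s ''M'' q b else 0) + (if b = p then mat s ''M'' a q else 0)"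
proof -
  let ?p1 = "PReal ''M'' (ix (nvar ''s'') (nvar ''j''))
       (RAdd (RCell ''M'' (ix (nvar ''s'') (nvar ''j''))) (RCell ''M'' (ix (nvar ''t'') (nvar ''j''))))"
  let ?p2 = "PReal ''M'' (ix (nvar ''j'') (nvar ''s''))
       (RAdd (RCell ''M'' (ix (nvar ''j'') (nvar ''s''))) (RCell ''M'' (ix (nvar ''j'') (nvar ''t''))))"
  let ?s0 = "run (PIf (RLess (rvar ''z'') (rvar ''c'')) (rset ''c'' (rvar ''z'')) PSkip) s"
  have b0: "base ?s0" using b by simp
  have N0: "nat_mem ?s0 ''n'' 0 = n" using base_vals[OF b] by simp
  let ?M = "mat s ''M''"
  let ?M1 = "\<lambda>k a b. ?M a b + (if a = p \<and> b < k then ?M q b else 0)"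
  let ?Q1 = "\<lambda>k t. \<forall>a<n. \<forall>b<n. mat t ''M'' a b = ?M1 k a b"
  obtain t1 where t1: "run (PFor ''j'' ''n'' ?p1) ?s0 = nat_write ''j'' 0 (nat_mem ?s0 ''n'' 0) t1" "?Q1 (nat_mem ?s0 ''n'' 0) t1"
      "frame (insert ''j'' (nwrites ?p1)) (rwrites ?p1) ?s0 t1"
  proof (rule run_For[where Q = ?Q1 and s = ?s0 and p = ?p1 and i = "''j''" and a = "''n''"], goal_cases)
    case (2 k t)
    have "base t" using base_frame[OF b0 2(4)] by simp
    note bt = base_vals[OF this]
    have [simp]: "nat_mem t ''s'' 0 = p" "nat_mem t ''t'' 0 = q"
      using frame_nat[OF 2(4), of "''s''"] frame_nat[OF 2(4), of "''t''"] st by simp_all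
    show ?case using 2(2,3) N0 st by (auto simp: bt mat_def less_Suc_eq)
  next
    case 1 show ?case by (simp add: mat_def)
  qed (use that in auto)
  let ?s1 = "nat_write ''j'' 0 n t1"
  have b1: "base t1" using base_frame[OF b0 t1(3)] by simp
  then have b1': "base ?s1" by simp
  have N1: "nat_mem ?s1 ''n'' 0 = n" using base_vals[OF b1] by simp
  have st1: "nat_mem t1 ''s'' 0 = p" "nat_mem t1 ''t'' 0 = q"
    using frame_nat[OF t1(3), of "''s''"] frame_nat[OF t1(3), of "''t''"] st by simp_all
  \<comment> \<open>The column pass reads entries of the row pass. They interfere only in the entry
    \<open>p\<close>, \<open>p\<close>, which no cut counts.\<close>
  let ?M2 = "\<lambda>k a b. ?M1 n a b + (if b = p \<and> a < k then ?M1 n a q else 0)"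
  let ?Q2 = "\<lambda>k t. \<forall>a<n. \<forall>b<n. mat t ''M'' a b = ?M2 k a b"
  obtain t2 where t2: "run (PFor ''j'' ''n'' ?p2) ?s1 = nat_write ''j'' 0 (nat_mem ?s1 ''n'' 0) t2" "?Q2 (nat_mem ?s1 ''n'' 0) t2"
      "frame (insert ''j'' (nwrites ?p2)) (rwrites ?p2) ?s1 t2"
  proof (rule run_For[where Q = ?Q2 and s = ?s1 and p = ?p2 and i = "''j''" and a = "''n''"], goal_cases)
    case (2 k t)
    have "base t" using base_frame[OF b1' 2(4)] by simp
    note bt = base_vals[OF this]
    have [simp]: "nat_mem t ''s'' 0 = p" "nat_mem t ''t'' 0 = q"
      using frame_nat[OF 2(4), of "''s''"] frame_nat[OF 2(4), of "''t''"] st1 by simp_all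
    show ?case using 2(2,3) N1 st by (auto simp: bt mat_def less_Suc_eq)
  next
    case 1 show ?case using t1(2) N0 by (simp add: mat_def)
  qed (use that in auto)
  have run: "s' = nat_write ''A'' q 0 (nat_write ''j'' 0 n t2)"
    unfolding s'_def merge_def using t1(1) t2(1) N0 N1 frame_nat[OF t2(3), of "''t''"] st1
    by (simp del: run.simps(5,6))
  show "real_mem s' ''c'' 0 = min (real_mem s ''c'' 0) (real_mem s ''z'' 0)"
    unfolding run using frame_real[OF t2(3), of "''c''"] frame_real[OF t1(3), of "''c''"] by (simp add: min_def)
  show "nat_mem s' ''A'' = (nat_mem s ''A'')(q := 0)"
    unfolding run using frame_nat[OF t2(3), of "''A''"] frame_nat[OF t1(3), of "''A''"] by simp
  show "mat s' ''M'' a b = ?M a b + (if a = p then ?M q b else 0) + (if b = p then ?M a q else 0)"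
    if "a < n" "b < n" "a \<noteq> b" for a b
    using t2(2) that N1 unfolding run mat_def by auto
qed

definition active :: "state \<Rightarrow> nat set" where
  "active s = {i. i < n \<and> nat_mem s ''A'' i = 1}"

text \<open>\<open>B\<close> is the set of ordered vertices, \<open>p\<close> and \<open>q\<close>
  are the last two. The invariant is also kept one step back, for \<open>B - {q}\<close> with last
  vertex \<open>p\<close>: applied to \<open>q\<close>, it bounds the cuts separating the last two
  vertices once the ordering is complete. The cardinality clause forces completion after
  sufficiently many rounds.\<close>

definition ma_state where
  "ma_state M A v k t \<longleftrightarrow>
     (let D = nat_mem t ''D''; y = real_mem t ''y''; p = nat_mem t ''s'' 0; q = nat_mem t ''t'' 0; B = insert v {j\<in>A. D j \<noteq> 0} in
      (\<forall>j<n. j \<notin> A \<longrightarrow> D j = 1) \<and> (\<forall>j\<in>A. D j = 0 \<longrightarrow> y j = (\<Sum>b\<in>B. M b j)) \<and>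
      ma_inv M (insert v A) B q \<and> min (card (insert v A)) (Suc k) \<le> card B \<and>
      (if B = {v} then q = v \<and> p = v
       else q \<in> A \<and> q \<in> B \<and> p \<in> B \<and> p \<noteq> q \<and> (p = v \<longrightarrow> B = {v, q}) \<and>
         real_mem t ''z'' 0 = (\<Sum>b\<in>B - {q}. M b q) \<and> ma_inv M (insert v A) (B - {q}) p))"

lemma ma_state_nat_write:
  "''D'' \<noteq> a \<Longrightarrow> ''s'' \<noteq> a \<Longrightarrow> ''t'' \<noteq> a \<Longrightarrow> ma_state M A v k (nat_write a i j t) = ma_state M A v k t"
  unfolding ma_state_def by (simp only: nat_mem_nat_write real_mem_nat_write fun_upd_other not_False_eq_True)

lemma ma_state_step:
  assumes b: "base s" and A: "A \<subseteq> {..<v}" "v < n" and M: "\<And>a b. a < n \<Longrightarrow> b < n \<Longrightarrow> mat s ''M'' a b = M a b"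
    and sn: "sym_nonneg M (insert v A)" and st: "ma_state M A v k s"
  shows "ma_state M A v (Suc k) (run add_best (run find_best s))"
proof -
  let ?s = "run find_best s"
  define D where "D = nat_mem s ''D''"
  define y where "y = real_mem s ''y''"
  define p where "p = nat_mem s ''s'' 0"
  define q where "q = nat_mem s ''t'' 0"
  define B where "B = insert v {j\<in>A. D j \<noteq> 0}"
  have b': "base ?s" using base_run[OF b] by simp
  have sts: "\<forall>j<n. j \<notin> A \<longrightarrow> D j = 1" "\<forall>j\<in>A. D j = 0 \<longrightarrow> y j = (\<Sum>b\<in>B. M b j)"
     "ma_inv M (insert v A) B q" "min (card (insert v A)) (Suc k) \<le> card B"
     "if B = {v} then q = v \<and> p = v
       else q \<in> A \<and> q \<in> B \<and> p \<in> B \<and> p \<noteq> q \<and> (p = v \<longrightarrow> B = {v, q}) \<and>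
         real_mem s ''z'' 0 = (\<Sum>b\<in>B - {q}. M b q) \<and> ma_inv M (insert v A) (B - {q}) p"
    using st unfolding ma_state_def Let_def D_def[symmetric] y_def[symmetric] p_def[symmetric] q_def[symmetric] B_def[symmetric]
    by blast+
  have finA: "finite A" "v \<notin> A" using A finite_subset by auto
  then have finB: "finite B" "B \<subseteq> insert v A" unfolding B_def by auto
  have D': "nat_mem ?s ''D'' = D" "real_mem ?s ''y'' = y" unfolding D_def y_def by simp_all
  from find_best[OF b D_def y_def] show ?thesis
  proof (elim disjE conjE)
    assume g: "nat_mem ?s ''g'' 0 = 0" and all: "\<forall>j<n. D j \<noteq> 0"
    have "run add_best ?s = ?s" using g unfolding add_best_def by simp
    moreover have "{j\<in>A. D j \<noteq> 0} = A" using all A by auto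
    then have "B = insert v A" unfolding B_def by simp
    moreover have "min (card (insert v A)) (Suc (Suc k)) \<le> card B" using calculation(2) by simp
    then have "ma_state M A v (Suc k) ?s"
      using sts(1-3,5) unfolding ma_state_def Let_def D' B_def[symmetric]
      by (simp add: p_def[symmetric] q_def[symmetric])
    ultimately show ?thesis by simp
  next
    define r where "r = nat_mem ?s ''q'' 0"
    assume g: "nat_mem ?s ''g'' 0 = 1" and "nat_mem ?s ''q'' 0 < n" "D (nat_mem ?s ''q'' 0) = 0"
      "\<forall>j<n. D j = 0 \<longrightarrow> y j \<le> y (nat_mem ?s ''q'' 0)"
    then have r: "r < n" "D r = 0" "\<forall>j<n. D j = 0 \<longrightarrow> y j \<le> y r" unfolding r_def by auto
    note ab = add_best[OF b' g r_def r(1)]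
    have rA: "r \<in> A" using r sts(1) by auto
    have rB: "r \<notin> B" "r \<noteq> v" using r rA finA unfolding B_def by auto
    let ?t = "run add_best ?s" and ?B = "insert r B"
    have Dt: "nat_mem ?t ''D'' = D(r := 1)" using ab(3) unfolding D'(1) .
    have Bt: "insert v {j\<in>A. (D(r := 1)) j \<noteq> 0} = ?B" using rA unfolding B_def by auto
    have qt: "nat_mem ?t ''s'' 0 = q" "nat_mem ?t ''t'' 0 = r" using ab unfolding q_def by simp_all
    have "v \<in> B" unfolding B_def by simp
    then have qB: "q \<in> B" using sts(5) by (cases "B = {v}") simp_all
    have "ma_inv M (insert v A) ?B r"
    proof (rule ma_inv_step[OF sn _ finB(2) qB _ _ sts(3)])
      fix z assume "z \<in> insert v A - B"
      then have "z \<in> A" "D z = 0" "z < n" using A unfolding B_def by auto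
      then show "(\<Sum>b\<in>B. M b z) \<le> (\<Sum>b\<in>B. M b r)" using sts(2) r rA by metis
    qed (use finA rA rB in auto)
    moreover have "\<forall>j<n. j \<notin> A \<longrightarrow> (D(r := 1)) j = 1" using sts(1) by simp
    moreover have "real_mem ?t ''y'' j = (\<Sum>b\<in>?B. M b j)" if "j \<in> A" "(D(r := 1)) j = 0" for j
    proof -
      have j: "j < n" "D j = 0" using that A by (auto split: if_splits)
      have "real_mem ?t ''y'' j = y j + M r j"
        using ab(5)[OF j(1)] M[OF r(1) j(1)] unfolding D'(2) by (simp add: mat_def)
      then show ?thesis using sts(2) that(1) j(2) rB finB by simp
    qed
    moreover have "min (card (insert v A)) (Suc (Suc k)) \<le> card ?B"
      using sts(4) rB finB by simp
    moreover have "?B \<noteq> {v}" using rB by auto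
    moreover have "?B - {r} = B" using rB by auto
    moreover have "real_mem ?t ''z'' 0 = (\<Sum>b\<in>B. M b r)"
      using ab(4) sts(2) rA r unfolding D'(2) by simp
    moreover have "q = v \<longrightarrow> ?B = {v, r}" using sts(5) finA by (cases "B = {v}") auto
    moreover have "q \<noteq> r" using qB rB by auto
    ultimately show ?thesis
      using rA qB sts(3) unfolding ma_state_def Let_def Dt Bt qt by simp
  qed
qed

text \<open>The running value is described by the numbers \<open>\<beta>\<close> below it and below
  all remaining cuts, rather than as a minimum over sets. In this form a phase preserves an
  equivalence, and phases compose by transitivity.\<close>

lemma phase:
  assumes b: "base s" and v: "nat_mem s ''v'' 0 = v" "v < n"
    and A: "A = active s" "A \<subseteq> {..<v}" "A \<noteq> {}" "\<forall>i<n. nat_mem s ''A'' i \<le> 1"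
    and sn: "sym_nonneg (mat s ''M'') (insert v A)"
  defines "s' \<equiv> run phase s"
  shows "active s' \<subseteq> A" "active s' \<noteq> {}" "card (active s') \<le> max 1 (card A - 1)"
    "\<forall>i<n. nat_mem s' ''A'' i \<le> 1" "sym_nonneg (mat s' ''M'') (insert v (active s'))"
    "\<beta> \<le> real_mem s ''c'' 0 \<and> (\<forall>Y. Y \<noteq> {} \<and> Y \<subset> A \<longrightarrow> \<beta> \<le> cut (mat s ''M'') (insert v A) Y) \<longleftrightarrow>
     \<beta> \<le> real_mem s' ''c'' 0 \<and> (\<forall>Y. Y \<noteq> {} \<and> Y \<subset> active s' \<longrightarrow> \<beta> \<le> cut (mat s' ''M'') (insert v (active s')) Y)"
proof -
  define M where "M = mat s ''M''"
  let ?s1 = "run ma_init s"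
  let ?p = "find_best ;; add_best"
  note i = ma_init[OF b v]
  have b1: "base ?s1" using base_run[OF b] by simp
  have N1: "nat_mem ?s1 ''n'' 0 = n" using base_vals[OF b1] by simp
  have finA: "finite A" "v \<notin> A" "A \<subseteq> {..<n}" using A v finite_subset by auto
  have A1: "nat_mem s ''A'' j = (if j \<in> A then 1 else 0)" if "j < n" for j
    using that A(1,4) unfolding active_def by (auto simp: le_Suc_eq)
  have init: "ma_state M A v 0 ?s1"
  proof -
    have Beq: "insert v {j\<in>A. nat_mem ?s1 ''D'' j \<noteq> 0} = {v}" using i(4) A1 finA by auto
    moreover have "ma_inv M (insert v A) {v} v" by (rule ma_inv_start) (use sn M_def in auto)
    moreover have "nat_mem ?s1 ''D'' j = 1" if "j < n" "j \<notin> A" for j using i(4) A1 that by simp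
    moreover have "real_mem ?s1 ''y'' j = M v j" if "j \<in> A" for j using i(3) that finA unfolding M_def by auto
    ultimately show ?thesis unfolding ma_state_def Let_def Beq using i(1,2) by simp
  qed
  obtain t where t: "run (PFor ''i'' ''n'' ?p) ?s1 = nat_write ''i'' 0 (nat_mem ?s1 ''n'' 0) t"
      "ma_state M A v (nat_mem ?s1 ''n'' 0) t" "frame (insert ''i'' (nwrites ?p)) (rwrites ?p) ?s1 t"
  proof (rule run_For[where Q = "ma_state M A v" and s = ?s1 and p = ?p and i = "''i''" and a = "''n''"], goal_cases)
    case (2 k t)
    have bt: "base t" using base_frame[OF b1 2(4)] by simp
    have "ma_state M A v k (nat_write ''i'' 0 k t)" using 2(3) by (simp add: ma_state_nat_write)
    moreover have "mat t ''M'' a b = M a b" for a b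
      using frame_real[OF 2(4), of "''M''"] unfolding M_def mat_def by simp
    ultimately have "ma_state M A v (Suc k) (run add_best (run find_best (nat_write ''i'' 0 k t)))"
      by (intro ma_state_step) (use bt A v sn M_def in \<open>auto simp: mat_def\<close>)
    then show ?case by simp
  qed (use that init in auto)
  let ?s2 = "nat_write ''i'' 0 n t"
  have b2: "base ?s2" using base_frame[OF b1 t(3)] by simp
  define p where "p = nat_mem t ''s'' 0"
  define q where "q = nat_mem t ''t'' 0"
  have s2: "mat ?s2 ''M'' = M" "nat_mem ?s2 ''A'' = nat_mem s ''A''" "real_mem ?s2 ''c'' = real_mem s ''c''" "nat_mem ?s2 ''v'' = nat_mem s ''v''"
    using frame_real[OF t(3)] frame_nat[OF t(3)] unfolding M_def by (auto simp: mat_def fun_eq_iff)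
  have s': "s' = (if p = v then ?s2 else run merge ?s2)"
    unfolding s'_def phase_def using t(1) N1 s2(4) v unfolding p_def by (simp del: run.simps(6))
  let ?U = "insert v A"
  \<comment> \<open>At most \<open>n\<close> vertices have to be ordered, so \<open>n\<close> rounds
    ordered all of them.\<close>
  have B: "insert v {j\<in>A. nat_mem t ''D'' j \<noteq> 0} = ?U"
  proof (rule card_subset_eq)
    have "card ?U \<le> n" using card_mono[of "{..<n}" ?U] finA v by auto
    then have "card ?U \<le> card (insert v {j\<in>A. nat_mem t ''D'' j \<noteq> 0})"
      using t(2) N1 unfolding ma_state_def Let_def by auto
    moreover have "card (insert v {j\<in>A. nat_mem t ''D'' j \<noteq> 0}) \<le> card ?U"
      by (rule card_mono) (use finA in auto)
    ultimately show "card (insert v {j\<in>A. nat_mem t ''D'' j \<noteq> 0}) = card ?U" by simp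
  qed (use finA in auto)
  have "?U \<noteq> {v}" using A finA by auto
  then have pq: "q \<in> A" "p \<in> ?U" "p \<noteq> q" "p = v \<longrightarrow> ?U = {v, q}" "real_mem t ''z'' 0 = (\<Sum>b\<in>?U - {q}. M b q)"
      "ma_inv M ?U (?U - {q}) p"
    using t(2) unfolding ma_state_def Let_def B p_def[symmetric] q_def[symmetric] by auto
  have act2: "active ?s2 = A" unfolding A(1) active_def s2(2) ..
  have main: "active s' \<subseteq> A \<and> active s' \<noteq> {} \<and> card (active s') \<le> max 1 (card A - 1) \<and>
      (\<forall>i<n. nat_mem s' ''A'' i \<le> 1) \<and> sym_nonneg (mat s' ''M'') (insert v (active s')) \<and>
      (\<beta> \<le> real_mem s ''c'' 0 \<and> (\<forall>Y. Y \<noteq> {} \<and> Y \<subset> A \<longrightarrow> \<beta> \<le> cut (mat s ''M'') (insert v A) Y) \<longleftrightarrow>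
     \<beta> \<le> real_mem s' ''c'' 0 \<and> (\<forall>Y. Y \<noteq> {} \<and> Y \<subset> active s' \<longrightarrow> \<beta> \<le> cut (mat s' ''M'') (insert v (active s')) Y))"
  \<comment> \<open>Here one active vertex is left; nothing is contracted, and it has no proper
    nonempty subset that could impose a bound.\<close>
  proof (cases "p = v")
    case True
    then have "s' = ?s2" using s' by simp
    moreover have "A = {q}" using pq True finA by auto
    ultimately show ?thesis
      using act2 s2 A sn M_def by (simp only:) simp
  next
    case False
    then have pA: "p \<in> A" and s'm: "s' = run merge ?s2" using pq s' by auto
    have pn: "p < n" "q < n" using pA pq finA by auto
    note mg = merge[OF b2 _ _ pn pq(3), folded s'm, unfolded s2]
    have mg1: "real_mem s' ''c'' 0 = min (real_mem s ''c'' 0) (real_mem t ''z'' 0)"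
        "nat_mem s' ''A'' = (nat_mem s ''A'')(q := 0)"
      using mg(1,2) unfolding p_def q_def by simp_all
    have mgM: "mat s' ''M'' a b = M a b + (if a = p then M q b else 0) + (if b = p then M a q else 0)"
      if "a < n" "b < n" "a \<noteq> b" for a b
      using mg(3)[OF _ _ that] unfolding p_def q_def by simp
    have act': "active s' = A - {q}" unfolding A(1) active_def mg1(2) by auto
    have "card A \<noteq> 0" using finA pA by auto
    then have c: "card (A - {q}) = card A - 1" using finA pq by simp
    have snM: "sym_nonneg M ?U" using sn unfolding M_def .
    have U: "a < n" if "a \<in> ?U" for a using that finA v by auto
    have sn': "sym_nonneg (mat s' ''M'') (insert v (A - {q}))"
      unfolding sym_nonneg_def
    proof (intro ballI impI)
      fix a b assume ab: "a \<in> insert v (A - {q})" "b \<in> insert v (A - {q})" "a \<noteq> b"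
      have qq: "q \<in> ?U" "a \<in> ?U" "b \<in> ?U" "a \<noteq> q" "b \<noteq> q" using ab pq finA by auto
      then have "M a b = M b a" "0 \<le> M a b" "M q a = M a q" "0 \<le> M a q" "M q b = M b q" "0 \<le> M b q"
        using snM ab(3) unfolding sym_nonneg_def by metis+
      then show "mat s' ''M'' a b = mat s' ''M'' b a \<and> 0 \<le> mat s' ''M'' a b"
        using mgM[of a b] mgM[of b a] U qq ab(3) by auto
    qed
    have "(\<forall>Y. Y \<noteq> {} \<and> Y \<subset> A \<longrightarrow> \<beta> \<le> cut M ?U Y) \<longleftrightarrow>
      \<beta> \<le> real_mem t ''z'' 0 \<and> (\<forall>Y. Y \<noteq> {} \<and> Y \<subset> A - {q} \<longrightarrow> \<beta> \<le> cut (mat s' ''M'') (insert v (A - {q})) Y)"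
      by (rule phase_cuts[OF snM finA(1,2) pA pq(1) pq(3) pq(6) _ pq(5)]) (rule mgM, use U in auto)
    then have "\<beta> \<le> real_mem s ''c'' 0 \<and> (\<forall>Y. Y \<noteq> {} \<and> Y \<subset> A \<longrightarrow> \<beta> \<le> cut (mat s ''M'') (insert v A) Y) \<longleftrightarrow>
     \<beta> \<le> real_mem s' ''c'' 0 \<and> (\<forall>Y. Y \<noteq> {} \<and> Y \<subset> active s' \<longrightarrow> \<beta> \<le> cut (mat s' ''M'') (insert v (active s')) Y)"
      unfolding mg1(1) act' M_def[symmetric] by auto
    moreover have "\<forall>i<n. nat_mem s' ''A'' i \<le> 1" using A(4) unfolding mg1(2) by simp
    moreover have "A - {q} \<noteq> {}" using pA pq by auto
    ultimately show ?thesis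
      using sn' c unfolding act' by auto
  qed
  show "active s' \<subseteq> A"
    using main by (elim conjE)
  show "active s' \<noteq> {}"
    using main by (elim conjE)
  show "card (active s') \<le> max 1 (card A - 1)"
    using main by (elim conjE)
  show "\<forall>i<n. nat_mem s' ''A'' i \<le> 1"
    using main by (elim conjE)
  show "sym_nonneg (mat s' ''M'') (insert v (active s'))"
    using main by (elim conjE)
  show "\<beta> \<le> real_mem s ''c'' 0 \<and> (\<forall>Y. Y \<noteq> {} \<and> Y \<subset> A \<longrightarrow> \<beta> \<le> cut (mat s ''M'') (insert v A) Y) \<longleftrightarrow>
     \<beta> \<le> real_mem s' ''c'' 0 \<and> (\<forall>Y. Y \<noteq> {} \<and> Y \<subset> active s' \<longrightarrow> \<beta> \<le> cut (mat s' ''M'') (insert v (active s')) Y)"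
    using main by (elim conjE)
qed

end

section \<open>The splitting-off program\<close>

definition adj :: "string \<Rightarrow> prog" where
  "adj a = (let upd = \<lambda>i j. PReal ''W'' (ix i j) (RSub (RCell ''W'' (ix i j)) (rvar a));
       add = \<lambda>i j. PReal ''W'' (ix i j) (RAdd (RCell ''W'' (ix i j)) (rvar a));
       v = nvar ''v''; u = nvar ''u''; w = nvar ''w''
     in upd v u ;; upd u v ;; upd v w ;; upd w v ;; add u w ;; add w u)"

abbreviation ix3 :: "nexp \<Rightarrow> nexp \<Rightarrow> nexp \<Rightarrow> nexp" where "ix3 h i j \<equiv> ix (ix h i) j"

text \<open>Splits off tentatively the largest amount \<open>a\<close> that the weights allow, then
  calls \<open>adj\<close> with the nonpositive \<open>b\<close> to take back half of the violation.
  \<open>S\<close> stores the net amount, to be undone later.\<close>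

definition split_one :: prog where
  "split_one =
     rset ''a'' (RCell ''W'' (ix (nvar ''v'') (nvar ''u''))) ;;
     PIf (RLess (RCell ''W'' (ix (nvar ''v'') (nvar ''w''))) (rvar ''a''))
       (rset ''a'' (RCell ''W'' (ix (nvar ''v'') (nvar ''w'')))) PSkip ;;
     adj ''a'' ;; mincut ;;
     rset ''b'' (RDiv (RSub (rvar ''c'') (ROfNat (NConst 2))) (NConst 2)) ;;
     adj ''b'' ;;
     PReal ''S'' (ix3 (nvar ''v'') (nvar ''u'') (nvar ''w'')) (RAdd (rvar ''a'') (rvar ''b''))"

definition split_row :: prog where
  "split_row = PFor ''w'' ''n''
     (PIf (BAnd (NLess (nvar ''u'') (nvar ''w'')) (NLess (nvar ''w'') (nvar ''v''))) split_one PSkip)"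

text \<open>\<open>C\<close> saves the row of \<open>v\<close> before it is changed; the capacities
  at \<open>v\<close> are needed again when \<open>v\<close> is put back.\<close>

definition split_vertex :: prog where
  "split_vertex =
     PFor ''u'' ''n'' (PReal ''C'' (ix (nvar ''v'') (nvar ''u'')) (RCell ''W'' (ix (nvar ''v'') (nvar ''u'')))) ;;
     PFor ''u'' ''n'' split_row"

definition split_all :: prog where
  "split_all = PFor ''k'' ''n'' (nset ''v'' (NSub (NSub (nvar ''n'') (NConst 1)) (nvar ''k'')) ;; split_vertex)"

section \<open>Correctness of splitting off\<close>

lemma writes_adj [simp]: "nwrites (adj a) = {}" "rwrites (adj a) = {''W''}"
  by (auto simp: adj_def Let_def)

lemma writes_split_one [simp]:
  "nwrites split_one = {''h'', ''i'', ''D'', ''s'', ''t'', ''g'', ''j'', ''q'', ''A''}"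
  "rwrites split_one = {''a'', ''W'', ''y'', ''z'', ''c'', ''M'', ''b'', ''S''}"
  by (auto simp: split_one_def)

lemma writes_split_row [simp]:
  "nwrites split_row = {''w'', ''h'', ''i'', ''D'', ''s'', ''t'', ''g'', ''j'', ''q'', ''A''}"
  "rwrites split_row = {''a'', ''W'', ''y'', ''z'', ''c'', ''M'', ''b'', ''S''}"
  by (auto simp: split_row_def)

lemma writes_split_vertex [simp]:
  "nwrites split_vertex = {''u'', ''w'', ''h'', ''i'', ''D'', ''s'', ''t'', ''g'', ''j'', ''q'', ''A''}"
  "rwrites split_vertex = {''C'', ''a'', ''W'', ''y'', ''z'', ''c'', ''M'', ''b'', ''S''}"
  by (auto simp: split_vertex_def)

lemma writes_split_all [simp]:
  "nwrites split_all = {''k'', ''v'', ''u'', ''w'', ''h'', ''i'', ''D'', ''s'', ''t'', ''g'', ''j'', ''q'', ''A''}"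
  "rwrites split_all = {''C'', ''a'', ''W'', ''y'', ''z'', ''c'', ''M'', ''b'', ''S''}"
  by (auto simp: split_all_def)

text \<open>The condition between two removals. In contrast to \<open>good\<close> it includes the
  cut of the last vertex alone, which provides the weight 2 at that vertex when the trees are
  lifted.\<close>

definition level :: "nat \<Rightarrow> (nat \<Rightarrow> nat \<Rightarrow> real) \<Rightarrow> bool" where
  "level v W \<longleftrightarrow> sym_nonneg W {..v} \<and> (\<forall>X. X \<noteq> {} \<and> X \<subset> {..v} \<longrightarrow> 2 \<le> cut W {..v} X)"

definition split_ok where
  "split_ok v W \<sigma> W' \<longleftrightarrow>
     (\<forall>a b. \<sigma> a b = \<sigma> b a \<and> 0 \<le> \<sigma> a b) \<and> (\<forall>a. \<sigma> a a = 0) \<and>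
     (\<forall>a<v. \<forall>b<v. a \<noteq> b \<longrightarrow> W' a b = W a b + \<sigma> a b) \<and> (\<forall>a<v. (\<Sum>b<v. \<sigma> a b) \<le> W v a)"

context setting
begin

lemma mincut_init:
  assumes b: "base s" and v: "nat_mem s ''v'' 0 = v"
  defines "s' \<equiv> run mincut_init s"
  shows "\<And>a b. a < n \<Longrightarrow> b < n \<Longrightarrow> mat s' ''M'' a b = mat s ''W'' a b"
    "\<And>i. i < n \<Longrightarrow> nat_mem s' ''A'' i = of_bool (i < v)" "real_mem s' ''c'' 0 = 2"
proof -
  let ?p0 = "PReal ''M'' (ix (nvar ''i'') (nvar ''j'')) (RCell ''W'' (ix (nvar ''i'') (nvar ''j'')))"
  let ?p1 = "PFor ''j'' ''n'' ?p0"
  let ?p2 = "PIf (NLess (nvar ''i'') (nvar ''v'')) (PNat ''A'' (nvar ''i'') (NConst 1)) (PNat ''A'' (nvar ''i'') (NConst 0))"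
  let ?W = "mat s ''W''"
  let ?Q1 = "\<lambda>k t. \<forall>a<k. \<forall>b<n. mat t ''M'' a b = ?W a b"
  have N: "nat_mem s ''n'' 0 = n" using base_vals[OF b] by simp
  obtain t1 where t1: "run (PFor ''i'' ''n'' ?p1) s = nat_write ''i'' 0 (nat_mem s ''n'' 0) t1" "?Q1 (nat_mem s ''n'' 0) t1"
      "frame (insert ''i'' (nwrites ?p1)) (rwrites ?p1) s t1"
  proof (rule run_For[where Q = ?Q1 and s = s and p = ?p1 and i = "''i''" and a = "''n''"], goal_cases)
    case (2 k t)
    let ?s = "nat_write ''i'' 0 k t"
    have k: "k < n" using 2(2) N by simp
    have bs: "base ?s" using base_frame[OF b 2(4)] by simp
    have N': "nat_mem ?s ''n'' 0 = n" using base_vals[OF bs] by simp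
    have W: "real_mem t ''W'' = real_mem s ''W''" using frame_real[OF 2(4), of "''W''"] by simp
    let ?Q0 = "\<lambda>l t. (\<forall>a<k. \<forall>b<n. mat t ''M'' a b = ?W a b) \<and> (\<forall>b<l. mat t ''M'' k b = ?W k b)"
    obtain t' where t': "run ?p1 ?s = nat_write ''j'' 0 (nat_mem ?s ''n'' 0) t'" "?Q0 (nat_mem ?s ''n'' 0) t'"
      "frame (insert ''j'' (nwrites ?p0)) (rwrites ?p0) ?s t'"
    proof (rule run_For[where Q = ?Q0 and s = ?s and p = ?p0 and i = "''j''" and a = "''n''"], goal_cases)
      case 1 show ?case using 2(3) by (simp add: mat_def)
    next
      case (2 l u)
      have "base u" using base_frame[OF bs 2(4)] by simp
      note bu = base_vals[OF this]
      have [simp]: "nat_mem u ''i'' 0 = k" "real_mem u ''W'' = real_mem s ''W''" "nat_mem s ''n'' 0 = n"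
        using frame_nat[OF 2(4), of "''i''"] frame_real[OF 2(4), of "''W''"] W N by simp_all
      have "l < n" using 2(2) N' by simp
      then show ?case using 2(3) k by (auto simp: bu mat_def less_Suc_eq)
    qed (use that in auto)
    show ?case unfolding t'(1) using t'(2) N' by (auto simp: mat_def less_Suc_eq)
  qed (use that in auto)
  let ?s1 = "nat_write ''i'' 0 n t1"
  have b1: "base ?s1" using base_frame[OF b t1(3)] by simp
  have N1: "nat_mem ?s1 ''n'' 0 = n" using base_vals[OF b1] by simp
  let ?Q2 = "\<lambda>k t. \<forall>i<k. nat_mem t ''A'' i = of_bool (i < v)"
  obtain t2 where t2: "run (PFor ''i'' ''n'' ?p2) ?s1 = nat_write ''i'' 0 (nat_mem ?s1 ''n'' 0) t2" "?Q2 (nat_mem ?s1 ''n'' 0) t2"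
      "frame (insert ''i'' (nwrites ?p2)) (rwrites ?p2) ?s1 t2"
  proof (rule run_For[where Q = ?Q2 and s = ?s1 and p = ?p2 and i = "''i''" and a = "''n''"], goal_cases)
    case (2 k t)
    have [simp]: "nat_mem t ''v'' 0 = v"
      using frame_nat[OF 2(4), of "''v''"] frame_nat[OF t1(3), of "''v''"] v by simp
    show ?case using 2(3) by (auto simp: less_Suc_eq)
  qed (use that in auto)
  have run: "s' = real_write ''c'' 0 2 (nat_write ''i'' 0 n t2)"
    unfolding s'_def mincut_init_def using t1(1) t2(1) N N1 by (simp del: run.simps(6))
  show "mat s' ''M'' a b = ?W a b" if "a < n" "b < n" for a b
    using t1(2) that N frame_real[OF t2(3), of "''M''"] unfolding run by (simp add: mat_def)
  show "nat_mem s' ''A'' i = of_bool (i < v)" if "i < n" for i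
    using t2(2) that N1 unfolding run by simp
  show "real_mem s' ''c'' 0 = 2" unfolding run by simp
qed

text \<open>Once a single active vertex is left there are no cuts to bound, and the equivalence
  preserved by the phases reduces to a statement about \<open>c\<close> alone.\<close>

lemma mincut:
  assumes b: "base s" and v: "nat_mem s ''v'' 0 = v" "v < n" "0 < v"
    and sn: "sym_nonneg (mat s ''W'') {..v}"
  shows "\<beta> \<le> real_mem (run mincut s) ''c'' 0 \<longleftrightarrow>
    \<beta> \<le> 2 \<and> (\<forall>X. X \<noteq> {} \<and> X \<subset> {..<v} \<longrightarrow> \<beta> \<le> cut (mat s ''W'') {..v} X)"
proof -
  let ?s = "run mincut_init s" and ?W = "mat s ''W''"
  note i = mincut_init[OF b v(1)]
  have bs: "base ?s" using base_run[OF b] by simp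
  have N: "nat_mem ?s ''n'' 0 = n" using base_vals[OF bs] by simp
  have vs: "nat_mem ?s ''v'' 0 = v" using v by simp
  have ins: "insert v {..<v} = {..v}" by auto
  have act: "active ?s = {..<v}" unfolding active_def using i(2) v(2) by (auto simp: of_bool_def split: if_splits)
  define goal where "goal \<longleftrightarrow> \<beta> \<le> 2 \<and> (\<forall>X. X \<noteq> {} \<and> X \<subset> {..<v} \<longrightarrow> \<beta> \<le> cut ?W {..v} X)"
  define Q where "Q k t \<longleftrightarrow> active t \<subseteq> {..<v} \<and> active t \<noteq> {} \<and> card (active t) \<le> max 1 (v - k) \<and>
      (\<forall>i<n. nat_mem t ''A'' i \<le> 1) \<and> sym_nonneg (mat t ''M'') (insert v (active t)) \<and>
      (\<beta> \<le> real_mem t ''c'' 0 \<and> (\<forall>Y. Y \<noteq> {} \<and> Y \<subset> active t \<longrightarrow> \<beta> \<le> cut (mat t ''M'') (insert v (active t)) Y) \<longleftrightarrow> goal)"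
    for k t
  have Qw: "Q k (nat_write ''h'' 0 j t) = Q k t" for k j t
    unfolding Q_def active_def mat_def by simp
  have cutM: "cut (mat ?s ''M'') {..v} X = cut ?W {..v} X" for X
    by (rule cut_cong) (use i(1) v in auto)
  have "sym_nonneg (mat ?s ''M'') {..v}"
    using sn i(1) v unfolding sym_nonneg_def by auto
  then have Q0: "Q 0 ?s"
    unfolding Q_def act ins cutM goal_def using v(2,3) i(2,3) by (auto simp: of_bool_def)
  obtain t where t: "run (PFor ''h'' ''n'' phase) ?s = nat_write ''h'' 0 (nat_mem ?s ''n'' 0) t"
      "Q (nat_mem ?s ''n'' 0) t"
  proof (rule run_For[where Q = Q and s = ?s and p = phase and i = "''h''" and a = "''n''"], goal_cases)
    case 1 show ?case by (rule Q0)
  next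
    case (2 k t)
    let ?t = "nat_write ''h'' 0 k t"
    have bt: "base ?t" using base_frame[OF bs 2(4)] by simp
    have vt: "nat_mem ?t ''v'' 0 = v" using frame_nat[OF 2(4), of "''v''"] vs by simp
    have Q: "Q k ?t" using 2(3) unfolding Qw .
    then have q: "active ?t \<subseteq> {..<v}" "active ?t \<noteq> {}" "card (active ?t) \<le> max 1 (v - k)"
      "\<forall>i<n. nat_mem ?t ''A'' i \<le> 1" "sym_nonneg (mat ?t ''M'') (insert v (active ?t))"
      "\<beta> \<le> real_mem ?t ''c'' 0 \<and> (\<forall>Y. Y \<noteq> {} \<and> Y \<subset> active ?t \<longrightarrow> \<beta> \<le> cut (mat ?t ''M'') (insert v (active ?t)) Y) \<longleftrightarrow> goal"
      unfolding Q_def by - (elim conjE; assumption)+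
    note ph = phase[OF bt vt v(2) refl q(1,2,4,5)]
    have "card (active (run phase ?t)) \<le> max 1 (v - Suc k)" using ph(3) q(3) by linarith
    then show ?case unfolding Q_def
      by (intro conjI order_trans[OF ph(1) q(1)] ph(2,4,5) trans[OF ph(6)[symmetric] q(6)])
  qed (use that in auto)
  have "card (active t) \<le> 1" using t(2) v N unfolding Q_def by simp
  moreover have "finite (active t)" unfolding active_def by simp
  ultimately have no: "\<not> (Y \<noteq> {} \<and> Y \<subset> active t)" for Y
  proof (intro notI, elim conjE)
    assume fin: "finite (active t)" and c: "card (active t) \<le> 1" and Y: "Y \<noteq> {}" "Y \<subset> active t"
    have "finite Y" using finite_subset[OF psubset_imp_subset[OF Y(2)] fin] .
    then have "0 < card Y" using Y(1) by (simp add: card_gt_0_iff)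
    then show False using psubset_card_mono[OF fin Y(2)] c by simp
  qed
  have "\<beta> \<le> real_mem t ''c'' 0 \<longleftrightarrow> goal" using t(2) no unfolding Q_def by blast
  moreover have "real_mem (run mincut s) ''c'' 0 = real_mem t ''c'' 0"
    unfolding mincut_def using t(1) by (simp del: run.simps(6))
  ultimately show ?thesis unfolding goal_def by simp
qed

lemma mat_write: "q < n \<Longrightarrow> b < n \<Longrightarrow>
    mat (real_write d (p * K + q) c t) d a b = (if a = p \<and> b = q then c else mat t d a b)"
  unfolding mat_def by simp

lemma adj_write:
  assumes "base t" "nval i t = p" "nval j t = q" "p < n" "q < n"
  shows "run (PReal ''W'' (ix i j) (RSub (RCell ''W'' (ix i j)) (rvar r))) t
      = real_write ''W'' (p * K + q) (mat t ''W'' p q - real_mem t r 0) t"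
    "run (PReal ''W'' (ix i j) (RAdd (RCell ''W'' (ix i j)) (rvar r))) t
      = real_write ''W'' (p * K + q) (mat t ''W'' p q + real_mem t r 0) t"
  using assms base_vals(5)[OF assms(1), of p] by (simp_all add: mat_def)

lemma adj:
  assumes b: "base s" and v: "nat_mem s ''v'' 0 = v" "v < n" and u: "nat_mem s ''u'' 0 = u" "u < w"
    and w: "nat_mem s ''w'' 0 = w" "w < v" and r: "r \<noteq> ''W''" "real_mem s r 0 = \<alpha>" and ab: "a < n" "b < n"
  shows "mat (run (adj r) s) ''W'' a b = split_pair (mat s ''W'') v u w \<alpha> a b"
proof -
  have lt: "u < n" "w < n" "u < v" "w < v" "u < w" using assms by auto
  have ne [simp]: "u \<noteq> v" "v \<noteq> u" "w \<noteq> v" "v \<noteq> w" "u \<noteq> w" "w \<noteq> u" using assms by auto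
  let ?W = "mat s ''W''"
  define ok where "ok t \<longleftrightarrow> base t \<and> nval (nvar ''v'') t = v \<and> nval (nvar ''u'') t = u \<and> nval (nvar ''w'') t = w \<and>
     real_mem t r 0 = \<alpha>" for t
  have okw: "ok (real_write ''W'' k c t)" if "ok t" for k c t using that r(1) unfolding ok_def by simp
  have ok0: "ok s" using assms unfolding ok_def by simp
  define s1 where "s1 = real_write ''W'' (v * K + u) (?W v u - \<alpha>) s"
  define s2 where "s2 = real_write ''W'' (u * K + v) (?W u v - \<alpha>) s1"
  define s3 where "s3 = real_write ''W'' (v * K + w) (?W v w - \<alpha>) s2"
  define s4 where "s4 = real_write ''W'' (w * K + v) (?W w v - \<alpha>) s3"
  define s5 where "s5 = real_write ''W'' (u * K + w) (?W u w + \<alpha>) s4"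
  define s6 where "s6 = real_write ''W'' (w * K + u) (?W w u + \<alpha>) s5"
  have oks: "ok s1" "ok s2" "ok s3" "ok s4" "ok s5"
    unfolding s5_def s4_def s3_def s2_def s1_def by (intro okw ok0)+
  have m1: "mat s1 ''W'' a b = (if a = v \<and> b = u then ?W v u - \<alpha> else ?W a b)" if "b < n" for a b
    unfolding s1_def using that lt by (simp add: mat_write)
  have m2: "mat s2 ''W'' a b = (if a = u \<and> b = v then ?W u v - \<alpha> else mat s1 ''W'' a b)" if "b < n" for a b
    unfolding s2_def using that v(2) by (simp add: mat_write)
  have m3: "mat s3 ''W'' a b = (if a = v \<and> b = w then ?W v w - \<alpha> else mat s2 ''W'' a b)" if "b < n" for a b
    unfolding s3_def using that lt by (simp add: mat_write)
  have m4: "mat s4 ''W'' a b = (if a = w \<and> b = v then ?W w v - \<alpha> else mat s3 ''W'' a b)" if "b < n" for a b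
    unfolding s4_def using that v(2) by (simp add: mat_write)
  have m5: "mat s5 ''W'' a b = (if a = u \<and> b = w then ?W u w + \<alpha> else mat s4 ''W'' a b)" if "b < n" for a b
    unfolding s5_def using that lt by (simp add: mat_write)
  have m6: "mat s6 ''W'' a b = (if a = w \<and> b = u then ?W w u + \<alpha> else mat s5 ''W'' a b)" if "b < n" for a b
    unfolding s6_def using that lt by (simp add: mat_write)
  have okD: "base t" "nval (nvar ''v'') t = v" "nval (nvar ''u'') t = u" "nval (nvar ''w'') t = w" "real_mem t r 0 = \<alpha>"
    if "ok t" for t using that unfolding ok_def by simp_all
  have sub: "run (PReal ''W'' (ix i j) (RSub (RCell ''W'' (ix i j)) (rvar r))) t = real_write ''W'' (p * K + q) (?W p q - \<alpha>) t"
    if "ok t" "nval i t = p" "nval j t = q" "p < n" "q < n" "mat t ''W'' p q = ?W p q" for t i j p q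
    using adj_write(1)[OF okD(1)[OF that(1)] that(2-5), of r] okD(5)[OF that(1)] that(6) by simp
  have add: "run (PReal ''W'' (ix i j) (RAdd (RCell ''W'' (ix i j)) (rvar r))) t = real_write ''W'' (p * K + q) (?W p q + \<alpha>) t"
    if "ok t" "nval i t = p" "nval j t = q" "p < n" "q < n" "mat t ''W'' p q = ?W p q" for t i j p q
    using adj_write(2)[OF okD(1)[OF that(1)] that(2-5), of r] okD(5)[OF that(1)] that(6) by simp
  \<comment> \<open>The six cells are distinct, so each still has its original value when it is
    read.\<close>
  have "mat s1 ''W'' u v = ?W u v" "mat s2 ''W'' v w = ?W v w" "mat s3 ''W'' w v = ?W w v"
      "mat s4 ''W'' u w = ?W u w" "mat s5 ''W'' w u = ?W w u"
    using lt v(2) by (simp_all add: m1 m2 m3 m4 m5)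
  note mm = this
  have "run (adj r) s = s6"
    unfolding adj_def Let_def run.simps(4) s6_def
    apply (subst sub[OF ok0 okD(2,3)[OF ok0] v(2) lt(1) refl], subst s1_def[symmetric])
    apply (subst sub[OF oks(1) okD(3,2)[OF oks(1)] lt(1) v(2) mm(1)], subst s2_def[symmetric])
    apply (subst sub[OF oks(2) okD(2,4)[OF oks(2)] v(2) lt(2) mm(2)], subst s3_def[symmetric])
    apply (subst sub[OF oks(3) okD(4,2)[OF oks(3)] lt(2) v(2) mm(3)], subst s4_def[symmetric])
    apply (subst add[OF oks(4) okD(3,4)[OF oks(4)] lt(1,2) mm(4)], subst s5_def[symmetric])
    by (rule add[OF oks(5) okD(4,3)[OF oks(5)] lt(2,1) mm(5)])
  then have e: "mat (run (adj r) s) ''W'' a b =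
      (if a = w \<and> b = u then ?W w u + \<alpha> else if a = u \<and> b = w then ?W u w + \<alpha>
       else if a = w \<and> b = v then ?W w v - \<alpha> else if a = v \<and> b = w then ?W v w - \<alpha>
       else if a = u \<and> b = v then ?W u v - \<alpha> else if a = v \<and> b = u then ?W v u - \<alpha> else ?W a b)"
    using ab by (simp only: m1 m2 m3 m4 m5 m6)
  consider "a = v" | "b = v" "a \<noteq> v" | "a \<noteq> v" "b \<noteq> v" by blast
  then show ?thesis
  proof cases
    case 1
    then show ?thesis unfolding e split_pair_def by (cases "b = u"; cases "b = w") simp_all
  next
    case 2
    then show ?thesis unfolding e split_pair_def by (cases "a = u"; cases "a = w") simp_all
  next
    case 3
    then show ?thesis unfolding e split_pair_def
      by (cases "a = u \<and> b = w"; cases "a = w \<and> b = u") auto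
  qed
qed

lemma split_pair_split_pair: "split_pair (split_pair W v u w \<alpha>) v u w \<beta> a b = split_pair W v u w (\<alpha> + \<beta>) a b"
  unfolding split_pair_def by (simp add: algebra_simps)

lemma split_pair_cong: "W a b = W' a b \<Longrightarrow> split_pair W v u w \<alpha> a b = split_pair W' v u w \<alpha> a b"
  unfolding split_pair_def by simp

lemma split_one:
  assumes b: "base s" and v: "nat_mem s ''v'' 0 = v" "v < n" and u: "nat_mem s ''u'' 0 = u" "u < w"
    and w: "nat_mem s ''w'' 0 = w" "w < v"
    and sn: "sym_nonneg (mat s ''W'') {..v}" and gd: "good (mat s ''W'') v"
  obtains \<gamma> where "0 \<le> \<gamma>" "\<gamma> \<le> mat s ''W'' v u" "\<gamma> \<le> mat s ''W'' v w"
    "good (split_pair (mat s ''W'') v u w \<gamma>) v" "blocked (split_pair (mat s ''W'') v u w \<gamma>) v u w"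
    "\<And>a b. a < n \<Longrightarrow> b < n \<Longrightarrow> mat (run split_one s) ''W'' a b = split_pair (mat s ''W'') v u w \<gamma> a b"
    "real_mem (run split_one s) ''S'' = (real_mem s ''S'')((v * K + u) * K + w := \<gamma>)"
proof -
  let ?W = "mat s ''W''"
  define \<alpha> where "\<alpha> = min (?W v u) (?W v w)"
  have lt: "u < n" "w < n" "u < v" "u \<noteq> w" using assms by auto
  note bv = base_vals[OF b]
  define s1 where "s1 = real_write ''a'' 0 \<alpha> s"
  have r1: "run (PIf (RLess (RCell ''W'' (ix (nvar ''v'') (nvar ''w''))) (rvar ''a''))
       (rset ''a'' (RCell ''W'' (ix (nvar ''v'') (nvar ''w'')))) PSkip)
       (run (rset ''a'' (RCell ''W'' (ix (nvar ''v'') (nvar ''u'')))) s) = s1"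
    unfolding s1_def \<alpha>_def using lt v by (auto simp: bv v u w mat_def min_def real_write_def)
  have W1: "mat s1 ''W'' = ?W" unfolding s1_def mat_def by simp
  have b1: "base s1" using b unfolding s1_def by simp
  have v1: "nat_mem s1 ''v'' 0 = v" "nat_mem s1 ''u'' 0 = u" "nat_mem s1 ''w'' 0 = w" "real_mem s1 ''a'' 0 = \<alpha>"
    using assms unfolding s1_def by simp_all
  define s2 where "s2 = run (adj ''a'') s1"
  have W2: "mat s2 ''W'' a b = split_pair ?W v u w \<alpha> a b" if "a < n" "b < n" for a b
    unfolding s2_def using adj[OF b1 v1(1) v(2) v1(2) u(2) v1(3) w(2) _ v1(4) that] W1 by simp
  have b2: "base s2" unfolding s2_def using base_run[OF b1] by simp
  have v2: "nat_mem s2 ''v'' 0 = v" "nat_mem s2 ''u'' 0 = u" "nat_mem s2 ''w'' 0 = w" "real_mem s2 ''a'' 0 = \<alpha>"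
    using v1 unfolding s2_def by simp_all
  have a: "0 \<le> \<alpha>" "\<alpha> \<le> ?W v u" "\<alpha> \<le> ?W v w"
    using sn lt w v unfolding \<alpha>_def sym_nonneg_def by auto
  have "sym_nonneg (split_pair ?W v u w \<alpha>) {..v}" by (rule sym_nonneg_split_pair) (use sn lt w a in auto)
  then have sn2: "sym_nonneg (mat s2 ''W'') {..v}" using W2 v unfolding sym_nonneg_def by simp
  define s3 where "s3 = run mincut s2"
  have cut2: "cut (mat s2 ''W'') {..v} X = cut (split_pair ?W v u w \<alpha>) {..v} X" for X
    by (rule cut_cong) (use W2 v in auto)
  have c3: "\<beta> \<le> real_mem s3 ''c'' 0 \<longleftrightarrow>
    \<beta> \<le> 2 \<and> (\<forall>X. X \<noteq> {} \<and> X \<subset> {..<v} \<longrightarrow> \<beta> \<le> cut (split_pair ?W v u w \<alpha>) {..v} X)" for \<beta>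
    unfolding s3_def using mincut[OF b2 v2(1) v(2) _ sn2] w unfolding cut2 by simp
  define \<beta> where "\<beta> = (real_mem s3 ''c'' 0 - 2) / 2"
  define \<gamma> where "\<gamma> = \<alpha> + \<beta>"
  note am = split_amount[OF sn gd lt(3) w(2) lt(4) \<alpha>_def c3 \<gamma>_def[unfolded \<beta>_def]]
  define s4 where "s4 = real_write ''b'' 0 \<beta> s3"
  have b3: "base s3" unfolding s3_def using base_run[OF b2] by simp
  then have b4: "base s4" unfolding s4_def by simp
  have v4: "nat_mem s4 ''v'' 0 = v" "nat_mem s4 ''u'' 0 = u" "nat_mem s4 ''w'' 0 = w" "real_mem s4 ''a'' 0 = \<alpha>" "real_mem s4 ''b'' 0 = \<beta>"
    using v2 unfolding s4_def s3_def by simp_all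
  have W4: "mat s4 ''W'' a b = mat s2 ''W'' a b" for a b unfolding s4_def s3_def mat_def by simp
  define s5 where "s5 = run (adj ''b'') s4"
  have W5: "mat s5 ''W'' a b = split_pair ?W v u w \<gamma> a b" if "a < n" "b < n" for a b
  proof -
    have "mat s5 ''W'' a b = split_pair (mat s4 ''W'') v u w \<beta> a b"
      unfolding s5_def by (rule adj[OF b4 v4(1) v(2) v4(2) u(2) v4(3) w(2) _ v4(5) that]) simp
    also have "\<dots> = split_pair (split_pair ?W v u w \<alpha>) v u w \<beta> a b"
      by (rule split_pair_cong) (simp add: W4 W2[OF that])
    finally show ?thesis unfolding split_pair_split_pair \<gamma>_def .
  qed
  have b5: "base s5" unfolding s5_def using base_run[OF b4] by simp
  have v5: "nat_mem s5 ''v'' 0 = v" "nat_mem s5 ''u'' 0 = u" "nat_mem s5 ''w'' 0 = w" "real_mem s5 ''a'' 0 = \<alpha>" "real_mem s5 ''b'' 0 = \<beta>"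
    using v4 unfolding s5_def by simp_all
  have idx: "v * K + u < L"
  proof -
    have "v * K + u < v * K + K" using lt by simp
    also have "\<dots> = (v + 1) * K" by simp
    also have "\<dots> \<le> K * K" using v K by (intro mult_right_mono) auto
    finally show ?thesis using KK_le_L by simp
  qed
  have "run split_one s = real_write ''S'' ((v * K + u) * K + w) \<gamma> s5"
  proof -
    have "run (rset ''b'' (RDiv (RSub (rvar ''c'') (ROfNat (NConst 2))) (NConst 2))) s3 = s4"
      unfolding s4_def \<beta>_def by simp
    moreover have "run (PReal ''S'' (ix3 (nvar ''v'') (nvar ''u'') (nvar ''w'')) (RAdd (rvar ''a'') (rvar ''b''))) s5
        = real_write ''S'' ((v * K + u) * K + w) \<gamma> s5"
      using v5 idx v unfolding \<gamma>_def by (simp add: base_vals[OF b5])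
    ultimately show ?thesis
      unfolding split_one_def run.simps(4) r1 s2_def[symmetric] s3_def[symmetric] by (simp add: s5_def)
  qed
  then have "\<And>a b. a < n \<Longrightarrow> b < n \<Longrightarrow> mat (run split_one s) ''W'' a b = split_pair ?W v u w \<gamma> a b"
    "real_mem (run split_one s) ''S'' = (real_mem s ''S'')((v * K + u) * K + w := \<gamma>)"
    using W5 unfolding s5_def s4_def s3_def s2_def s1_def by (simp_all add: mat_def)
  then show thesis using am a by (intro that[of \<gamma>]) auto
qed

definition split3 :: "state \<Rightarrow> nat \<Rightarrow> nat \<Rightarrow> nat \<Rightarrow> real" where
  "split3 t v a b = real_mem t ''S'' ((v * K + a) * K + b)"

text \<open>\<open>W0\<close> and \<open>S0\<close> are the weights and stored amounts before
  \<open>v\<close> is treated, and \<open>D\<close> is the set of treated pairs with the smaller end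
  first. \<open>\<sigma>\<close> is symmetric and vanishes outside \<open>D\<close>, whereas the
  array \<open>S\<close> holds one orientation only.\<close>

definition split_rel where
  "split_rel W0 S0 v D t \<sigma> \<longleftrightarrow> (let W = mat t ''W'' in
     sym_nonneg W {..v} \<and> good W v \<and> (\<forall>(a, b)\<in>D. blocked W v a b) \<and>
     (\<forall>v'. v' \<noteq> v \<longrightarrow> (\<forall>a<n. \<forall>b<n. split3 t v' a b = S0 v' a b)) \<and>
     (\<forall>a b. \<sigma> a b = \<sigma> b a \<and> 0 \<le> \<sigma> a b) \<and> (\<forall>a b. (a, b) \<notin> D \<and> (b, a) \<notin> D \<longrightarrow> \<sigma> a b = 0) \<and>
        (\<forall>a<v. \<forall>b<v. a \<noteq> b \<longrightarrow> W a b = W0 a b + \<sigma> a b) \<and>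
        (\<forall>a<v. W v a = W0 v a - (\<Sum>b<v. \<sigma> a b)) \<and>
        (\<forall>(a, b)\<in>D. split3 t v a b = \<sigma> a b))"

definition split_inv where
  "split_inv W0 S0 v D t \<longleftrightarrow> (\<exists>\<sigma>. split_rel W0 S0 v D t \<sigma>)"

text \<open>The new pair is blocked by the choice of the amount, and the earlier ones stay blocked
  by \<open>blocked_split_pair\<close>.\<close>

lemma split_inv_step:
  assumes I: "split_inv W0 S0 v D s" and D: "D \<subseteq> {(a, b). a < b \<and> b < v}" "(u, w) \<notin> D"
    and b: "base s" and v: "nat_mem s ''v'' 0 = v" "v < n" and u: "nat_mem s ''u'' 0 = u" "u < w"
    and w: "nat_mem s ''w'' 0 = w" "w < v"
  shows "split_inv W0 S0 v (insert (u, w) D) (run split_one s)"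
proof -
  let ?W = "mat s ''W''" and ?t = "run split_one s"
  from I obtain \<sigma> where R: "split_rel W0 S0 v D s \<sigma>" unfolding split_inv_def by blast
  then have I1: "sym_nonneg ?W {..v}" "good ?W v" "\<And>a b. (a, b) \<in> D \<Longrightarrow> blocked ?W v a b"
     "\<And>v' a b. v' \<noteq> v \<Longrightarrow> a < n \<Longrightarrow> b < n \<Longrightarrow> split3 s v' a b = S0 v' a b"
    unfolding split_rel_def Let_def by auto
  have
     \<sigma>: "\<And>a b. \<sigma> a b = \<sigma> b a" "\<And>a b. 0 \<le> \<sigma> a b" "\<And>a b. (a, b) \<notin> D \<Longrightarrow> (b, a) \<notin> D \<Longrightarrow> \<sigma> a b = 0"
      "\<And>a b. a < v \<Longrightarrow> b < v \<Longrightarrow> a \<noteq> b \<Longrightarrow> ?W a b = W0 a b + \<sigma> a b"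
      "\<And>a. a < v \<Longrightarrow> ?W v a = W0 v a - (\<Sum>b<v. \<sigma> a b)"
      "\<And>a b. (a, b) \<in> D \<Longrightarrow> split3 s v a b = \<sigma> a b"
    using R unfolding split_rel_def Let_def by auto
  obtain \<gamma> where g: "0 \<le> \<gamma>" "\<gamma> \<le> ?W v u" "\<gamma> \<le> ?W v w"
    "good (split_pair ?W v u w \<gamma>) v" "blocked (split_pair ?W v u w \<gamma>) v u w"
    and tW: "\<And>a b. a < n \<Longrightarrow> b < n \<Longrightarrow> mat ?t ''W'' a b = split_pair ?W v u w \<gamma> a b"
    and tS: "real_mem ?t ''S'' = (real_mem s ''S'')((v * K + u) * K + w := \<gamma>)"
    by (rule split_one[OF b v u w I1(1,2)]) (rule that)
  have lt: "u < v" "u < n" "w < n" "u \<noteq> w" using u w v by auto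
  have Dv: "a < b" "b < v" if "(a, b) \<in> D" for a b using that D by auto
  let ?P = "split_pair ?W v u w \<gamma>"
  have cutt: "cut (mat ?t ''W'') {..v} X = cut ?P {..v} X" for X
    by (rule cut_cong) (use tW v in auto)
  have snP: "sym_nonneg ?P {..v}" by (rule sym_nonneg_split_pair) (use I1 lt w g in auto)
  have 1: "sym_nonneg (mat ?t ''W'') {..v}" using snP tW v unfolding sym_nonneg_def by simp
  have 2: "good (mat ?t ''W'') v" using g(4) unfolding good_def cutt .
  have bl: "blocked (mat ?t ''W'') v a b" if "blocked ?P v a b" "a < v" "b < v" for a b
    using that tW[of v a] tW[of v b] v unfolding blocked_def cutt by auto
  have nn: "0 \<le> ?W v a" if "a < v" for a using I1(1) that unfolding sym_nonneg_def by auto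
  have 3: "blocked (mat ?t ''W'') v a b" if "(a, b) \<in> insert (u, w) D" for a b
  proof (cases "(a, b) \<in> D")
    case True
    then have "blocked ?P v a b"
      by (intro blocked_split_pair[OF g(4) lt(1) w(2) lt(4) g(1) I1(2) I1(3)]) (use Dv[OF True] g nn in auto)
    then show ?thesis by (rule bl) (use Dv[OF True] in auto)
  next
    case False
    then have "a = u" "b = w" using that by auto
    then show ?thesis using bl[OF g(5)] lt w by simp
  qed
  have s3: "split3 ?t v' a b = (if v' = v \<and> a = u \<and> b = w then \<gamma> else split3 s v' a b)" if "a < n" "b < n" for v' a b
    unfolding split3_def tS using that lt by simp
  define \<sigma>' where "\<sigma>' a b = \<sigma> a b + (if a = u \<and> b = w \<or> a = w \<and> b = u then \<gamma> else 0)" for a b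
  have wuD: "(w, u) \<notin> D" using D u by auto
  have 4: "\<sigma>' a b = \<sigma>' b a" "0 \<le> \<sigma>' a b" for a b using \<sigma>(1)[of a b] \<sigma>(2)[of a b] g(1) unfolding \<sigma>'_def by auto
  have 5: "\<sigma>' a b = 0" if "(a, b) \<notin> insert (u, w) D" "(b, a) \<notin> insert (u, w) D" for a b
    using \<sigma>(3)[of a b] that unfolding \<sigma>'_def by auto
  have 6: "mat ?t ''W'' a b = W0 a b + \<sigma>' a b" if "a < v" "b < v" "a \<noteq> b" for a b
    using tW[of a b] that v \<sigma>(4)[OF that] u unfolding \<sigma>'_def split_pair_def by auto
  have 7: "mat ?t ''W'' v a = W0 v a - (\<Sum>b<v. \<sigma>' a b)" if a: "a < v" for a
  proof -
    have "(\<Sum>b<v. \<sigma>' a b) = (\<Sum>b<v. \<sigma> a b + (if b = w then if a = u then \<gamma> else 0 else 0) + (if b = u then if a = w then \<gamma> else 0 else 0))"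
      unfolding \<sigma>'_def by (intro sum.cong refl) (use lt in auto)
    also have "\<dots> = (\<Sum>b<v. \<sigma> a b) + (if a = u \<or> a = w then \<gamma> else 0)"
      using lt w by (auto simp: sum.distrib)
    finally have "(\<Sum>b<v. \<sigma>' a b) = (\<Sum>b<v. \<sigma> a b) + (if a = u \<or> a = w then \<gamma> else 0)" .
    moreover have "mat ?t ''W'' v a = ?W v a - (if a = u \<or> a = w then \<gamma> else 0)"
      using tW[of v a] a v lt w unfolding split_pair_def by auto
    ultimately show ?thesis using \<sigma>(5)[OF a] by simp
  qed
  have 8: "split3 ?t v a b = \<sigma>' a b" if "(a, b) \<in> insert (u, w) D" for a b
  proof (cases "(a, b) \<in> D")
    case True
    then have "a < n" "b < n" "(a, b) \<noteq> (u, w)" "a < b" using Dv[OF True] v D by auto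
    then show ?thesis using s3[of a b v] \<sigma>(6)[OF True] u unfolding \<sigma>'_def by auto
  next
    case False
    then have "a = u" "b = w" using that by auto
    then show ?thesis using s3[of u w v] lt \<sigma>(3)[of u w] D(2) wuD unfolding \<sigma>'_def by auto
  qed
  have 9: "split3 ?t v' a b = S0 v' a b" if "v' \<noteq> v" "a < n" "b < n" for v' a b
    using s3[of a b v'] I1(4)[OF that] that by simp
  have "split_rel W0 S0 v (insert (u, w) D) ?t \<sigma>'"
    unfolding split_rel_def Let_def using 1 2 3 9 4 5 6 7 8 by (intro conjI) auto
  then show ?thesis unfolding split_inv_def by blast
qed

lemma split_inv_write: "split_inv W0 S0 v D (nat_write a i j t) = split_inv W0 S0 v D t"
  unfolding split_inv_def split_rel_def mat_def split3_def by simp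

lemma split_row:
  assumes I: "split_inv W0 S0 v {(a, b). a < b \<and> b < v \<and> a < u} s"
    and b: "base s" and v: "nat_mem s ''v'' 0 = v" "v < n" and u: "nat_mem s ''u'' 0 = u"
  shows "split_inv W0 S0 v {(a, b). a < b \<and> b < v \<and> a < Suc u} (run split_row s)"
proof -
  let ?p = "PIf (BAnd (NLess (nvar ''u'') (nvar ''w'')) (NLess (nvar ''w'') (nvar ''v''))) split_one PSkip"
  have N: "nat_mem s ''n'' 0 = n" using base_vals[OF b] by simp
  let ?D = "\<lambda>k. {(a, b). a < b \<and> b < v \<and> (a < u \<or> a = u \<and> b < k)}"
  obtain t where t: "run (PFor ''w'' ''n'' ?p) s = nat_write ''w'' 0 (nat_mem s ''n'' 0) t"
      "split_inv W0 S0 v (?D (nat_mem s ''n'' 0)) t"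
  proof (rule run_For[where Q = "\<lambda>k. split_inv W0 S0 v (?D k)" and s = s and p = ?p and i = "''w''" and a = "''n''"], goal_cases)
    case 1
    have "?D 0 = {(a, b). a < b \<and> b < v \<and> a < u}" by auto
    then show ?case using I by simp
  next
    case (2 k t)
    let ?t = "nat_write ''w'' 0 k t"
    have bt: "base ?t" using base_frame[OF b 2(4)] by simp
    have vt: "nat_mem ?t ''v'' 0 = v" "nat_mem ?t ''u'' 0 = u" "nat_mem ?t ''w'' 0 = k"
      using frame_nat[OF 2(4), of "''v''"] frame_nat[OF 2(4), of "''u''"] v u by simp_all
    have It: "split_inv W0 S0 v (?D k) ?t" using 2(3) unfolding split_inv_write .
    show ?case
    proof (cases "u < k \<and> k < v")
      case True
      then have D: "?D (Suc k) = insert (u, k) (?D k)" by auto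
      have "split_inv W0 S0 v (insert (u, k) (?D k)) (run split_one ?t)"
        by (rule split_inv_step[OF It _ _ bt vt(1) v(2) vt(2) _ vt(3)]) (use True in auto)
      then show ?thesis unfolding D using True vt by simp
    next
      case False
      then have "?D (Suc k) = ?D k" by (auto simp: less_Suc_eq)
      then show ?thesis using False vt It by auto
    qed
  qed (use that in auto)
  have "?D n = {(a, b). a < b \<and> b < v \<and> a < Suc u}" using v(2) by auto
  then show ?thesis unfolding split_row_def t(1) split_inv_write using t(2) N by simp
qed

lemma level_good:
  assumes "level v W"
  shows "good W v"
  unfolding good_def
proof (intro allI impI)
  fix X assume X: "X \<noteq> {} \<and> X \<subset> {..<v}"
  then have "X \<noteq> {} \<and> X \<subset> {..v}" by auto
  then show "2 \<le> cut W {..v} X" using assms unfolding level_def by blast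
qed

lemma split_vertex:
  assumes b: "base s" and v: "nat_mem s ''v'' 0 = v" "v < n" and lv: "level v (mat s ''W'')"
  defines "s' \<equiv> run split_vertex s"
  shows "\<And>v' a. a < n \<Longrightarrow> mat s' ''C'' v' a = (if v' = v then mat s ''W'' v a else mat s ''C'' v' a)"
    "\<And>v' a b. v' \<noteq> v \<Longrightarrow> a < n \<Longrightarrow> b < n \<Longrightarrow> split3 s' v' a b = split3 s v' a b"
    "0 < v \<Longrightarrow> level (v - 1) (mat s' ''W'')"
    "\<exists>\<sigma>. split_ok v (mat s ''W'') \<sigma> (mat s' ''W'') \<and> (\<forall>a b. a < b \<and> b < v \<longrightarrow> split3 s' v a b = \<sigma> a b)"
proof -
  let ?p = "PReal ''C'' (ix (nvar ''v'') (nvar ''u'')) (RCell ''W'' (ix (nvar ''v'') (nvar ''u'')))"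
  let ?W = "mat s ''W''"
  have N: "nat_mem s ''n'' 0 = n" using base_vals[OF b] by simp
  let ?Q = "\<lambda>k t. \<forall>v' a. a < n \<longrightarrow> mat t ''C'' v' a = (if v' = v \<and> a < k then ?W v a else mat s ''C'' v' a)"
  obtain t where t: "run (PFor ''u'' ''n'' ?p) s = nat_write ''u'' 0 (nat_mem s ''n'' 0) t" "?Q (nat_mem s ''n'' 0) t"
      "frame (insert ''u'' (nwrites ?p)) (rwrites ?p) s t"
  proof (rule run_For[where Q = ?Q and s = s and p = ?p and i = "''u''" and a = "''n''"], goal_cases)
    case (2 k t)
    have "base t" using base_frame[OF b 2(4)] by simp
    note bt = base_vals[OF this]
    have [simp]: "nat_mem t ''v'' 0 = v" "real_mem t ''W'' = real_mem s ''W''" "nat_mem s ''n'' 0 = n"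
      using frame_nat[OF 2(4), of "''v''"] frame_real[OF 2(4), of "''W''"] v N by simp_all
    show ?case using 2(2,3) v(2) by (auto simp: bt mat_def less_Suc_eq)
  qed (use that in auto)
  let ?s = "nat_write ''u'' 0 n t"
  have bs: "base ?s" using base_frame[OF b t(3)] by simp
  have Ns: "nat_mem ?s ''n'' 0 = n" using base_vals[OF bs] by simp
  have vs: "nat_mem ?s ''v'' 0 = v" using frame_nat[OF t(3), of "''v''"] v by simp
  have WS: "mat ?s ''W'' = ?W" "split3 ?s = split3 s"
    using frame_real[OF t(3), of "''W''"] frame_real[OF t(3), of "''S''"] by (auto simp: mat_def split3_def fun_eq_iff)
  let ?I = "\<lambda>k. split_inv ?W (split3 s) v {(a, b). a < b \<and> b < v \<and> a < k}"
  have I0: "?I 0 ?s"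
    unfolding split_inv_def split_rel_def Let_def WS using lv level_good[OF lv] unfolding level_def
    by (auto intro!: exI[of _ "\<lambda>_ _. 0"])
  obtain t' where t': "run (PFor ''u'' ''n'' split_row) ?s = nat_write ''u'' 0 (nat_mem ?s ''n'' 0) t'"
      "?I (nat_mem ?s ''n'' 0) t'" "frame (insert ''u'' (nwrites split_row)) (rwrites split_row) ?s t'"
  proof (rule run_For[where Q = ?I and s = ?s and p = split_row and i = "''u''" and a = "''n''"], goal_cases)
    case 1 show ?case by (rule I0)
  next
    case (2 k t)
    show ?case
      by (rule split_row) (use 2(3) base_frame[OF bs 2(4)] frame_nat[OF 2(4), of "''v''"] vs v in \<open>auto simp: split_inv_write\<close>)
  qed (use that in auto)
  have s': "s' = nat_write ''u'' 0 n t'"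
    unfolding s'_def split_vertex_def using t(1) t'(1) N Ns by (simp del: run.simps(6))
  have "?I n s'" using t'(2) Ns unfolding s' split_inv_write by simp
  then obtain \<sigma> where R: "split_rel ?W (split3 s) v {(a, b). a < b \<and> b < v \<and> a < n} s' \<sigma>"
    unfolding split_inv_def by blast
  then have I1: "sym_nonneg (mat s' ''W'') {..v}" "good (mat s' ''W'') v"
     "\<And>a b. a < b \<Longrightarrow> b < v \<Longrightarrow> a < n \<Longrightarrow> blocked (mat s' ''W'') v a b"
     "\<And>v' a b. v' \<noteq> v \<Longrightarrow> a < n \<Longrightarrow> b < n \<Longrightarrow> split3 s' v' a b = split3 s v' a b"
    unfolding split_rel_def Let_def by auto
  have
     \<sigma>: "\<And>a b. \<sigma> a b = \<sigma> b a" "\<And>a b. 0 \<le> \<sigma> a b" "\<And>a b. \<not> a < b \<Longrightarrow> \<not> b < a \<Longrightarrow> \<sigma> a b = 0"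
      "\<And>a b. a < v \<Longrightarrow> b < v \<Longrightarrow> a \<noteq> b \<Longrightarrow> mat s' ''W'' a b = ?W a b + \<sigma> a b"
      "\<And>a. a < v \<Longrightarrow> mat s' ''W'' v a = ?W v a - (\<Sum>b<v. \<sigma> a b)"
      "\<And>a b. a < b \<Longrightarrow> b < v \<Longrightarrow> a < n \<Longrightarrow> split3 s' v a b = \<sigma> a b"
    using R unfolding split_rel_def Let_def by auto
  show "mat s' ''C'' v' a = (if v' = v then ?W v a else mat s ''C'' v' a)" if "a < n" for v' a
    using t(2) that N frame_real[OF t'(3), of "''C''"] unfolding s' by (simp add: mat_def)
  show "split3 s' v' a b = split3 s v' a b" if "v' \<noteq> v" "a < n" "b < n" for v' a b by (rule I1(4)[OF that])
  show "level (v - 1) (mat s' ''W'')" if v0: "0 < v"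
  proof -
    have e: "{..v - 1} = {..<v}" using v0 by auto
    have "sym_nonneg (mat s' ''W'') {..<v}" by (rule sym_nonneg_mono[OF I1(1)]) auto
    moreover have "2 \<le> cut (mat s' ''W'') {..<v} X" if "X \<noteq> {}" "X \<subset> {..<v}" for X
      by (rule splitting_off[OF I1(1,2) _ that]) (use I1(3) v in auto)
    ultimately show ?thesis unfolding level_def e by blast
  qed
  have "(\<Sum>b<v. \<sigma> a b) \<le> ?W v a" if "a < v" for a
  proof -
    have "0 \<le> mat s' ''W'' v a" using I1(1) that unfolding sym_nonneg_def by auto
    then show ?thesis using \<sigma>(5)[OF that] by simp
  qed
  moreover have "split3 s' v a b = \<sigma> a b" if "a < b" "b < v" for a b using \<sigma>(6)[OF that] that v by simp
  ultimately show "\<exists>\<sigma>. split_ok v ?W \<sigma> (mat s' ''W'') \<and> (\<forall>a b. a < b \<and> b < v \<longrightarrow> split3 s' v a b = \<sigma> a b)"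
    unfolding split_ok_def using \<sigma> by (intro exI[of _ \<sigma>]) auto
qed

text \<open>\<open>Wf v\<close> is the weighting on \<open>0, \<dots>, v\<close> just before
  \<open>v\<close> is removed. The condition \<open>n \<le> v + k\<close> picks the \<open>k\<close>
  largest vertices, those treated so far.\<close>

definition split_result where
  "split_result Wf k t \<longleftrightarrow> (\<forall>v. 0 < v \<and> v < n \<and> n \<le> v + k \<longrightarrow>
     level v (Wf v) \<and> (\<forall>a<v. mat t ''C'' v a = Wf v v a) \<and>
     (\<exists>\<sigma>. split_ok v (Wf v) \<sigma> (Wf (v - 1)) \<and> (\<forall>a b. a < b \<and> b < v \<longrightarrow> split3 t v a b = \<sigma> a b)))"

lemma split_all:
  assumes b: "base s" and lv: "level (n - 1) (mat s ''W'')"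
  obtains Wf where "Wf (n - 1) = mat s ''W''" "split_result Wf n (run split_all s)"
proof -
  let ?p = "nset ''v'' (NSub (NSub (nvar ''n'') (NConst 1)) (nvar ''k'')) ;; split_vertex"
  let ?Q = "\<lambda>k t. \<exists>Wf. Wf (n - 1) = mat s ''W'' \<and> split_result Wf k t \<and>
     (k < n \<longrightarrow> Wf (n - 1 - k) = mat t ''W'' \<and> level (n - 1 - k) (mat t ''W''))"
  have N: "nat_mem s ''n'' 0 = n" using base_vals[OF b] by simp
  obtain t where t: "run (PFor ''k'' ''n'' ?p) s = nat_write ''k'' 0 (nat_mem s ''n'' 0) t" "?Q (nat_mem s ''n'' 0) t"
  proof (rule run_For[where Q = ?Q and s = s and p = ?p and i = "''k''" and a = "''n''"], goal_cases)
    case 1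
    show ?case using lv n by (intro exI[of _ "\<lambda>_. mat s ''W''"]) (auto simp: split_result_def)
  next
    case (2 k t)
    have k: "k < n" using 2(2) N by simp
    define v where "v = n - 1 - k"
    have v: "v < n" "v + Suc k = n" using k unfolding v_def by auto
    obtain Wf where Wf: "Wf (n - 1) = mat s ''W''" "split_result Wf k t" "Wf v = mat t ''W''" "level v (mat t ''W'')"
      using 2(3) k unfolding v_def by blast
    define u where "u = nat_write ''v'' 0 v (nat_write ''k'' 0 k t)"
    have bu: "base u" using base_frame[OF b 2(4)] unfolding u_def by simp
    have bt: "base t" using base_frame[OF b 2(4)] by simp
    have r: "run ?p (nat_write ''k'' 0 k t) = run split_vertex u"
      unfolding u_def v_def using base_vals[OF bt] by simp
    have uW: "mat u a = mat t a" "split3 u = split3 t" for a unfolding u_def mat_def split3_def by (simp_all add: fun_eq_iff)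
    have vu: "nat_mem u ''v'' 0 = v" unfolding u_def by simp
    note sv = split_vertex[OF bu vu v(1), unfolded uW, OF Wf(4)]
    let ?u = "run split_vertex u"
    \<comment> \<open>Removing \<open>v\<close> fixes the history one level further down and keeps
      it from \<open>v\<close> upwards; below \<open>0\<close> there is no level to fix.\<close>
    define Wg where "Wg = (if v = 0 then Wf else Wf(v - 1 := mat ?u ''W''))"
    have Wg: "Wg v' = Wf v'" if "v \<le> v'" for v' using that unfolding Wg_def by auto
    have Wg': "Wg (v - 1) = mat ?u ''W''" if "0 < v" using that unfolding Wg_def by simp
    have "split_result Wg (Suc k) ?u"
      unfolding split_result_def
    proof (intro allI impI, elim conjE)
      fix v' assume v': "0 < v'" "v' < n" "n \<le> v' + Suc k"
      show "level v' (Wg v') \<and> (\<forall>a<v'. mat ?u ''C'' v' a = Wg v' v' a) \<and>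
        (\<exists>\<sigma>. split_ok v' (Wg v') \<sigma> (Wg (v' - 1)) \<and> (\<forall>a b. a < b \<and> b < v' \<longrightarrow> split3 ?u v' a b = \<sigma> a b))"
      proof (cases "v' = v")
        case True
        have "mat ?u ''C'' v a = Wf v v a" if "a < v" for a using sv(1)[of a v] that v Wf(3) by simp
        then show ?thesis using True v' Wf(3,4) sv(4) Wg[of v] Wg' by auto
      next
        case False
        then have gt: "v < v'" "n \<le> v' + k" using v' v by auto
        have "mat ?u ''C'' v' a = mat t ''C'' v' a" if "a < v'" for a using sv(1)[of a v'] that v' False by simp
        moreover have "split3 ?u v' a b = split3 t v' a b" if "a < b" "b < v'" for a b
          using sv(2)[of v' a b] False that v' by simp
        moreover have "Wg v' = Wf v'" "Wg (v' - 1) = Wf (v' - 1)" using gt by (auto intro!: Wg)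
        ultimately show ?thesis using Wf(2) v' gt(2) unfolding split_result_def by auto
      qed
    qed
    moreover have "Wg (n - 1) = mat s ''W''" using Wg[of "n - 1"] v Wf(1) by auto
    moreover have "Wg (n - 1 - Suc k) = mat ?u ''W'' \<and> level (n - 1 - Suc k) (mat ?u ''W'')" if "Suc k < n"
    proof -
      have "0 < v" "n - 1 - Suc k = v - 1" using that unfolding v_def by auto
      then show ?thesis using Wg' sv(3) by simp
    qed
    ultimately show ?case unfolding r by blast
  qed (use that in auto)
  then obtain Wf where "Wf (n - 1) = mat s ''W''" "split_result Wf n t" using N by auto
  moreover have "split_result Wf n (run split_all s) = split_result Wf n t"
    unfolding split_all_def t(1) by (simp add: split_result_def mat_def split3_def)
  ultimately show thesis using that by blast
qed

end

section \<open>The program modifying part of a weighted family\<close>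

text \<open>Row \<open>i\<close> of the array \<open>p\<close> is the \<open>i\<close>-th member of the family, \<open>lambda\<close> its weight and \<open>l\<close> the
  number of members.\<close>

definition split_member :: prog where
  "split_member =
     PFor ''c'' ''K'' (PNat ''p'' (ix (nvar ''l'') (nvar ''c'')) (NCell ''p'' (ix (nvar ''i'') (nvar ''c'')))) ;;
     PReal ''lambda'' (nvar ''l'') (RSub (RCell ''lambda'' (nvar ''i'')) (rvar ''r'')) ;;
     PReal ''lambda'' (nvar ''i'') (rvar ''r'') ;;
     rset ''r'' (ROfNat (NConst 0)) ;; nset ''l'' (NAdd (nvar ''l'') (NConst 1))"

definition take_step :: "prog \<Rightarrow> prog \<Rightarrow> prog" where
  "take_step test md =
     PIf (BAnd (NLess (nvar ''i'') (nvar ''l'')) (RLess (ROfNat (NConst 0)) (rvar ''r'')))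
       (test ;; PIf (beq (nvar ''g'') (NConst 1))
          (PIf (RLess (rvar ''r'') (RCell ''lambda'' (nvar ''i''))) split_member
             (rset ''r'' (RSub (rvar ''r'') (RCell ''lambda'' (nvar ''i'')))) ;; md) PSkip)
       PSkip"

text \<open>The loop runs to the constant \<open>L\<close> with a guard, because \<open>l\<close>
  grows in the body and a loop bound must not be written.\<close>

definition take_weight :: "prog \<Rightarrow> prog \<Rightarrow> prog" where
  "take_weight test md = PFor ''i'' ''L'' (take_step test md)"

section \<open>Correctness of modifying part of a family\<close>

lemma writes_split_member [simp]: "nwrites split_member = {''c'', ''p'', ''l''}" "rwrites split_member = {''lambda'', ''r''}"
  by (auto simp: split_member_def)

lemma writes_take_step [simp]:
  "nwrites (take_step test md) = {''c'', ''p'', ''l''} \<union> nwrites test \<union> nwrites md"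
  "rwrites (take_step test md) = {''lambda'', ''r''} \<union> rwrites test \<union> rwrites md"
  by (auto simp: take_step_def)

lemma writes_take_weight [simp]:
  "nwrites (take_weight test md) = {''i'', ''c'', ''p'', ''l''} \<union> nwrites test \<union> nwrites md"
  "rwrites (take_weight test md) = {''lambda'', ''r''} \<union> rwrites test \<union> rwrites md"
  by (auto simp: take_weight_def)

lemma sum_change:
  fixes h :: "nat \<Rightarrow> real"
  assumes "k < l" "\<And>i. i < l \<Longrightarrow> i \<noteq> k \<Longrightarrow> h' i = h i"
  shows "(\<Sum>i<l. h' i) = (\<Sum>i<l. h i) + (h' k - h k)"
proof -
  have "(\<Sum>i<l. h' i) = h' k + (\<Sum>i\<in>{..<l} - {k}. h' i)" using assms(1) by (simp add: sum.remove)
  also have "(\<Sum>i\<in>{..<l} - {k}. h' i) = (\<Sum>i\<in>{..<l} - {k}. h i)" by (intro sum.cong) (use assms(2) in auto)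
  finally show ?thesis using assms(1) by (simp add: sum.remove)
qed

context setting
begin

definition row :: "state \<Rightarrow> nat \<Rightarrow> nat \<Rightarrow> nat" where
  "row s i a = (if a < K then nat_mem s ''p'' (i * K + a) else 0)"

lemma row_write: "a < K \<Longrightarrow> row (nat_write ''p'' (i * K + a) z t) j = (if j = i then (row t i)(a := z) else row t j)"
  by (auto simp: row_def fun_eq_iff)

lemma row_nat_write [simp]: "d \<noteq> ''p'' \<Longrightarrow> row (nat_write d i k t) = row t"
  and row_real_write [simp]: "row (real_write e i r t) = row t"
  by (auto simp: row_def fun_eq_iff)

lemma row_run [simp]: "''p'' \<notin> nwrites q \<Longrightarrow> row (run q t) = row t"
  by (auto simp: row_def fun_eq_iff)

lemma row_val: "a < K \<Longrightarrow> nat_mem t ''p'' (i * K + a) = row t i a"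
  by (simp add: row_def)

lemma row_frame: "frame N R s t \<Longrightarrow> ''p'' \<notin> N \<Longrightarrow> row t = row s"
  by (auto simp: row_def frame_def fun_eq_iff)

lemma split_member:
  assumes b: "base s" and i: "nat_mem s ''i'' 0 = i" "i < l" and l: "nat_mem s ''l'' 0 = l" "l < L"
  defines "s' \<equiv> run split_member s"
  shows "row s' j = (if j = l then row s i else row s j)" "nat_mem s' ''l'' 0 = Suc l"
    "real_mem s' ''lambda'' = (real_mem s ''lambda'')(l := real_mem s ''lambda'' i - real_mem s ''r'' 0, i := real_mem s ''r'' 0)"
    "real_mem s' ''r'' 0 = 0"
proof -
  let ?p = "PNat ''p'' (ix (nvar ''l'') (nvar ''c'')) (NCell ''p'' (ix (nvar ''i'') (nvar ''c'')))"
  have NK: "nat_mem s ''K'' 0 = K" using base_vals[OF b] by simp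
  let ?Q = "\<lambda>k t. \<forall>j a. a < K \<longrightarrow> row t j a = (if j = l \<and> a < k then row s i a else row s j a)"
  obtain t where t: "run (PFor ''c'' ''K'' ?p) s = nat_write ''c'' 0 (nat_mem s ''K'' 0) t" "?Q (nat_mem s ''K'' 0) t"
      "frame (insert ''c'' (nwrites ?p)) (rwrites ?p) s t"
  proof (rule run_For[where Q = ?Q and s = s and p = ?p and i = "''c''" and a = "''K''"], goal_cases)
    case (2 k t)
    have "base t" using base_frame[OF b 2(4)] by simp
    note bt = base_vals[OF this]
    have k: "k < K" using 2(2) NK by simp
    have [simp]: "nat_mem t ''l'' 0 = l" "nat_mem t ''i'' 0 = i"
      using frame_nat[OF 2(4), of "''l''"] frame_nat[OF 2(4), of "''i''"] i l by simp_all
    have T: "nat_mem t ''T'' l = l * K" "nat_mem t ''T'' i = i * K" using bt(5) i l by auto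
    let ?t = "nat_write ''c'' 0 k t"
    have e: "run ?p ?t = nat_write ''p'' (l * K + k) (row t i k) ?t"
      using k T by (simp add: row_val)
    have "row (run ?p ?t) j = (if j = l then (row t l)(k := row t i k) else row t j)" for j
      unfolding e using row_write[OF k, of l "row t i k" ?t j] by simp
    then show ?case using 2(3) k i(2) by (auto simp: less_Suc_eq)
  qed (use that in auto)
  have lt: "nat_mem t ''l'' 0 = l" "nat_mem t ''i'' 0 = i"
    using frame_nat[OF t(3), of "''l''"] frame_nat[OF t(3), of "''i''"] i l by simp_all
  have rt: "real_mem t = real_mem s" using frame_real[OF t(3)] by (auto simp: fun_eq_iff)
  have run: "s' = nat_write ''l'' 0 (Suc l) (real_write ''r'' 0 0 (real_write ''lambda'' i (real_mem s ''r'' 0)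
     (real_write ''lambda'' l (real_mem s ''lambda'' i - real_mem s ''r'' 0) (nat_write ''c'' 0 K t))))"
    unfolding s'_def split_member_def using t(1) NK lt rt by (simp del: run.simps(6))
  show "row s' j = (if j = l then row s i else row s j)"
    unfolding run using t(2) NK by (auto simp: row_def fun_eq_iff)
  show "nat_mem s' ''l'' 0 = Suc l" "real_mem s' ''r'' 0 = 0"
    "real_mem s' ''lambda'' = (real_mem s ''lambda'')(l := real_mem s ''lambda'' i - real_mem s ''r'' 0, i := real_mem s ''r'' 0)"
    unfolding run using rt by simp_all
qed

text \<open>The conditions of \<open>retake\<close> restricted to the first \<open>k\<close>
  members: \<open>mv\<close> marks those already modified, \<open>org\<close> remembers what each
  row was. A member can have been appended only if the budget is exhausted.\<close>

definition take_rel where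
  "take_rel l0 lam0 P0 r0 pr f k t mv org \<longleftrightarrow>
     (let l = nat_mem t ''l'' 0; lam = real_mem t ''lambda''; r = real_mem t ''r'' 0 in
      (l = l0 \<or> l = Suc l0 \<and> r = 0) \<and>
      (\<forall>i<l. 0 < lam i \<and> (\<exists>j<l0. org i = P0 j) \<and> row t i = (if mv i then f (org i) else org i) \<and>
         (mv i \<longrightarrow> pr (org i)) \<and> (k \<le> i \<longrightarrow> \<not> mv i)) \<and>
      (\<forall>g. total l lam org g = total l0 lam0 P0 g) \<and>
      r = r0 - (\<Sum>i<l. if mv i then lam i else 0) \<and> 0 \<le> r \<and>
      (r = 0 \<or> (\<forall>i<l. i < k \<longrightarrow> pr (org i) \<longrightarrow> mv i)))"

lemma take_relI:
  assumes "nat_mem t ''l'' 0 = l" "real_mem t ''lambda'' = lam" "real_mem t ''r'' 0 = r"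
    and "l = l0 \<or> l = Suc l0 \<and> r = 0" "\<And>i. i < l \<Longrightarrow> 0 < lam i" "\<And>i. i < l \<Longrightarrow> \<exists>j<l0. org i = P0 j"
    and "\<And>i. i < l \<Longrightarrow> row t i = (if mv i then f (org i) else org i)" "\<And>i. i < l \<Longrightarrow> mv i \<Longrightarrow> pr (org i)"
    and "\<And>i. i < l \<Longrightarrow> k \<le> i \<Longrightarrow> \<not> mv i" "\<And>g. total l lam org g = total l0 lam0 P0 g"
    and "r = r0 - (\<Sum>i<l. if mv i then lam i else 0)" "0 \<le> r"
    and "\<And>i. r \<noteq> 0 \<Longrightarrow> i < l \<Longrightarrow> i < k \<Longrightarrow> pr (org i) \<Longrightarrow> mv i"
  shows "take_rel l0 lam0 P0 r0 pr f k t mv org"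
  unfolding take_rel_def Let_def assms(1-3)
  using assms(4) assms(5-10) assms(11,12) assms(13) by blast

text \<open>\<open>test\<close> and \<open>md\<close> may write the scratch arrays \<open>X\<close>,
  and \<open>md\<close> also the rows; \<open>Ctx\<close> collects what they rely on and survives
  these writes. They have to be correct only on rows with the property \<open>I\<close>. The
  appended remainder is never modified, because the budget is zero when its index comes up.\<close>

lemma take_weight:
  assumes b: "base s" and l0: "nat_mem s ''l'' 0 = l0" "l0 < L" and r0: "real_mem s ''r'' 0 = r0" "0 \<le> r0"
    and lam0: "real_mem s ''lambda'' = lam0" "\<And>i. i < l0 \<Longrightarrow> 0 < lam0 i"
    and I0: "\<And>j. j < l0 \<Longrightarrow> I (row s j)" and If: "\<And>p. I p \<Longrightarrow> pr p \<Longrightarrow> I (f p)"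
    and wr: "rwrites test = {}" "rwrites md = {}" "nwrites test \<subseteq> X" "nwrites md \<subseteq> insert ''p'' X"
    and X: "''i'' \<notin> X" "''c'' \<notin> X" "''l'' \<notin> X" "''p'' \<notin> X" "''n'' \<notin> X" "''m'' \<notin> X" "''K'' \<notin> X" "''L'' \<notin> X"
      "''T'' \<notin> X" "''end1'' \<notin> X" "''end2'' \<notin> X"
    and Ctx: "Ctx s" "\<And>t t'. Ctx t \<Longrightarrow> frame ({''i'', ''c'', ''l'', ''p''} \<union> X) {''lambda'', ''r''} t t' \<Longrightarrow> Ctx t'"
    and test: "\<And>t i. base t \<Longrightarrow> Ctx t \<Longrightarrow> nat_mem t ''i'' 0 = i \<Longrightarrow> i < L \<Longrightarrow> I (row t i) \<Longrightarrow>
      nat_mem (run test t) ''g'' 0 = of_bool (pr (row t i))"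
    and md: "\<And>t i j. base t \<Longrightarrow> Ctx t \<Longrightarrow> nat_mem t ''i'' 0 = i \<Longrightarrow> i < L \<Longrightarrow> I (row t i) \<Longrightarrow> pr (row t i) \<Longrightarrow>
      row (run md t) j = (if j = i then f (row t i) else row t j)"
  defines "s' \<equiv> run (take_weight test md) s"
  shows "retake l0 lam0 (row s) r0 pr f (nat_mem s' ''l'' 0) (real_mem s' ''lambda'') (row s') (real_mem s' ''r'' 0) \<and>
    nat_mem s' ''l'' 0 \<le> Suc l0"
proof -
  let ?p = "take_step test md" and ?P = "row s"
  let ?Q = "\<lambda>k t. \<exists>mv org. take_rel l0 lam0 ?P r0 pr f k t mv org"
  have NL: "nat_mem s ''L'' 0 = L" using base_vals[OF b] by simp
  note X [simp]
  have nt [simp]: "a \<notin> nwrites test" if "a \<notin> X" for a using wr(3) that by blast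
  have nm [simp]: "a \<notin> nwrites md" if "a \<notin> X" "a \<noteq> ''p''" for a using wr(4) that by blast
  obtain t where t: "run (PFor ''i'' ''L'' ?p) s = nat_write ''i'' 0 (nat_mem s ''L'' 0) t" "?Q (nat_mem s ''L'' 0) t"
      "frame (insert ''i'' (nwrites ?p)) (rwrites ?p) s t"
  proof (rule run_For[where Q = ?Q and s = s and p = ?p and i = "''i''" and a = "''L''"], goal_cases)
    case 1
    show ?case unfolding take_rel_def Let_def l0 lam0 r0
      using lam0(2) r0(2) by (intro exI[of _ "\<lambda>_. False"] exI[of _ ?P]) auto
  next
    case (2 k t)
    have k: "k < L" using 2(2) NL by simp
    have fr: "frame ({''i'', ''c'', ''l'', ''p''} \<union> X) {''lambda'', ''r''} s t"
      by (rule frame_mono[OF 2(4)]) (use wr in auto)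
    define u where "u = nat_write ''i'' 0 k t"
    have fu: "frame ({''i'', ''c'', ''l'', ''p''} \<union> X) {''lambda'', ''r''} s u"
      unfolding u_def by (rule frame_nat_write[OF _ fr]) simp
    have bu: "base u" by (rule base_frame[OF b fu]) simp
    have Cu: "Ctx u" by (rule Ctx(2)[OF Ctx(1) fu])
    define l where "l = nat_mem t ''l'' 0"
    define lam where "lam = real_mem t ''lambda''"
    define r where "r = real_mem t ''r'' 0"
    obtain mv org where R: "take_rel l0 lam0 ?P r0 pr f k t mv org" using 2(3) by (elim exE)
    note R1 = R[unfolded take_rel_def Let_def, folded l_def lam_def r_def]
    note R2 = conjunct2[OF R1]
    note R3 = conjunct2[OF R2]
    note R4 = conjunct2[OF R3]
    note R5 = conjunct2[OF R4]
    have rel: "l = l0 \<or> l = Suc l0 \<and> r = 0"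
      "\<And>i. i < l \<Longrightarrow> 0 < lam i \<and> (\<exists>j<l0. org i = ?P j) \<and> row t i = (if mv i then f (org i) else org i) \<and>
         (mv i \<longrightarrow> pr (org i)) \<and> (k \<le> i \<longrightarrow> \<not> mv i)"
      "\<And>g. total l lam org g = total l0 lam0 ?P g"
      "r = r0 - (\<Sum>i<l. if mv i then lam i else 0)" "0 \<le> r"
      "r = 0 \<or> (\<forall>i<l. i < k \<longrightarrow> pr (org i) \<longrightarrow> mv i)"
      by (fact conjunct1[OF R1], use conjunct1[OF R2] in blast, fact spec[OF conjunct1[OF R3]], fact conjunct1[OF R4],
          fact conjunct1[OF R5], fact conjunct2[OF R5])
    have uv: "nat_mem u ''i'' 0 = k" "nat_mem u ''l'' 0 = l" "real_mem u ''lambda'' = lam" "real_mem u ''r'' 0 = r" "row u = row t"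
      unfolding u_def l_def lam_def r_def by simp_all
    have same: "\<exists>mv org. take_rel l0 lam0 ?P r0 pr f (Suc k) w mv org"
      if w: "nat_mem w ''l'' 0 = l" "real_mem w ''lambda'' = lam" "real_mem w ''r'' 0 = r" "row w = row t"
        and c: "r = 0 \<or> \<not> k < l \<or> \<not> pr (org k)" for w
      unfolding take_rel_def Let_def w
      using rel c by (intro exI[of _ mv] exI[of _ org]) (auto simp: less_Suc_eq)
    show ?case
    proof (cases "k < l \<and> 0 < r")
      case False
      then have "run ?p u = u" unfolding take_step_def using uv by auto
      moreover have "r = 0 \<or> \<not> k < l" using False rel(5) by auto
      ultimately show ?thesis using same[of u] uv unfolding u_def by auto
    next
      case True
      then have ll: "l = l0" using rel(1) by auto
      have rk: "row t k = org k" "\<not> mv k" "\<exists>j<l0. org k = ?P j" using rel(2)[of k] True by auto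
      then have Ik: "I (row u k)" using I0 uv by auto
      define u1 where "u1 = run test u"
      have fu1: "frame ({''i'', ''c'', ''l'', ''p''} \<union> X) {''lambda'', ''r''} u u1"
        unfolding u1_def by (rule frame_mono[OF run_frame]) (use wr in auto)
      have g: "nat_mem u1 ''g'' 0 = of_bool (pr (org k))"
        using test[OF bu Cu uv(1) k Ik] rk uv unfolding u1_def by simp
      have u1v: "nat_mem u1 ''i'' 0 = k" "nat_mem u1 ''l'' 0 = l" "real_mem u1 ''lambda'' = lam" "real_mem u1 ''r'' 0 = r" "row u1 = row t"
        using uv wr(1) unfolding u1_def by simp_all
      have bu1: "base u1" by (rule base_frame[OF bu fu1]) simp
      have r1: "run ?p u = (if pr (org k) then run md (if r < lam k then run split_member u1 else
          real_write ''r'' 0 (r - lam k) u1) else u1)"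
        unfolding take_step_def using True uv u1v g u1_def[symmetric] by simp
      show ?thesis
      proof (cases "pr (org k)")
        case False
        then show ?thesis using same[of u1] r1 u1v unfolding u_def by auto
      next
        case prk: True
        have If': "I (org k)" using Ik rk uv by simp
        show ?thesis
        proof (cases "r < lam k")
          case False
          define u2 where "u2 = real_write ''r'' 0 (r - lam k) u1"
          have fu2: "frame ({''i'', ''c'', ''l'', ''p''} \<union> X) {''lambda'', ''r''} u u2"
            unfolding u2_def by (rule frame_real_write[OF _ fu1]) simp
          have bu2: "base u2" by (rule base_frame[OF bu fu2]) simp
          have u2v: "nat_mem u2 ''i'' 0 = k" "row u2 = row t"
            using u1v unfolding u2_def by simp_all
          have ru: "run ?p u = run md u2" using r1 prk False unfolding u2_def by simp
          have rm: "row (run md u2) j = (if j = k then f (org k) else row t j)" for j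
            using md[OF bu2 Ctx(2)[OF Cu fu2] u2v(1) k, of j] u2v rk prk If' by simp
          have fin: "nat_mem (run md u2) ''l'' 0 = l" "real_mem (run md u2) ''lambda'' = lam" "real_mem (run md u2) ''r'' 0 = r - lam k"
            using u1v wr(2) unfolding u2_def by simp_all
          let ?mv = "mv(k := True)"
          have s: "(\<Sum>i<l. if ?mv i then lam i else 0) = (\<Sum>i<l. if mv i then lam i else 0) + lam k"
            using sum_change[of k l "\<lambda>i. if ?mv i then lam i else 0" "\<lambda>i. if mv i then lam i else 0"] True rk by simp
          have "take_rel l0 lam0 ?P r0 pr f (Suc k) (run md u2) ?mv org"
          proof (rule take_relI[OF fin])
            show "l = l0 \<or> l = Suc l0 \<and> r - lam k = 0" using ll by simp
            show "row (run md u2) i = (if ?mv i then f (org i) else org i)" if "i < l" for i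
              using rm[of i] rel(2)[OF that] rk by (cases "i = k") simp_all
            show "r - lam k = r0 - (\<Sum>i<l. if ?mv i then lam i else 0)" unfolding s using rel(4) by simp
            show "?mv i" if "r - lam k \<noteq> 0" "i < l" "i < Suc k" "pr (org i)" for i
              using that rel(6) True by (cases "i = k") auto
            show "pr (org i)" if "i < l" "?mv i" for i
              using that rel(2)[OF that(1)] prk by (cases "i = k") simp_all
            show "\<not> ?mv i" if "i < l" "Suc k \<le> i" for i using that rel(2)[OF that(1)] by simp
          qed (use rel(2,3) False in auto)
          then show ?thesis using ru unfolding u_def by auto
        next
          case less: True
          define u2 where "u2 = run split_member u1"
          note sm = split_member[OF bu1 u1v(1) conjunct1[OF True] u1v(2) l0(2)[folded ll], folded u2_def, unfolded u1v]
          have fu2: "frame ({''i'', ''c'', ''l'', ''p''} \<union> X) {''lambda'', ''r''} u u2"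
            unfolding u2_def by (rule frame_trans[OF fu1], rule frame_mono[OF run_frame]) auto
          have bu2: "base u2" by (rule base_frame[OF bu fu2]) simp
          have u2v: "nat_mem u2 ''i'' 0 = k" using u1v unfolding u2_def by simp
          have ru: "run ?p u = run md u2" using r1 prk less unfolding u2_def by simp
          have kl: "k \<noteq> l" "k < l" using True by auto
          have rk2: "row u2 k = org k" using sm(1)[of k] kl rk by simp
          have rm: "row (run md u2) j = (if j = k then f (org k) else if j = l then org k else row t j)" for j
            using md[OF bu2 Ctx(2)[OF Cu fu2] u2v(1) k, of j] sm(1)[of j] rk2 rk prk If' by simp
          have fin: "nat_mem (run md u2) ''l'' 0 = Suc l" "real_mem (run md u2) ''lambda'' = lam(l := lam k - r, k := r)" "real_mem (run md u2) ''r'' 0 = 0"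
            using sm wr(2) by simp_all
          \<comment> \<open>The part to be modified stays at index \<open>k\<close> with weight
            \<open>r\<close>; the unmodified remainder goes to the new index \<open>l\<close>, with
            the same original row.\<close>
          let ?mv = "mv(k := True, l := False)" and ?lam = "lam(l := lam k - r, k := r)" and ?org = "org(l := org k)"
          have s: "(\<Sum>i<Suc l. if ?mv i then ?lam i else 0) = (\<Sum>i<l. if mv i then lam i else 0) + r"
            using sum_change[of k l "\<lambda>i. if ?mv i then ?lam i else 0" "\<lambda>i. if mv i then lam i else 0"] True rk kl by simp
          have tt: "total (Suc l) ?lam ?org g = total l lam org g" for g
          proof -
            have "(\<Sum>i<l. ?lam i * g (?org i)) = (\<Sum>i<l. lam i * g (org i)) + (r * g (org k) - lam k * g (org k))"
              using sum_change[of k l "\<lambda>i. ?lam i * g (?org i)" "\<lambda>i. lam i * g (org i)"] kl by simp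
            then show ?thesis unfolding total_def using kl by (simp add: algebra_simps)
          qed
          have "0 < ?lam i \<and> (\<exists>j<l0. ?org i = ?P j) \<and> row (run md u2) i = (if ?mv i then f (?org i) else ?org i) \<and>
               (?mv i \<longrightarrow> pr (?org i)) \<and> (Suc k \<le> i \<longrightarrow> \<not> ?mv i)" if "i < Suc l" for i
          proof -
            consider "i = l" | "i = k" | "i < l" "i \<noteq> k" "i \<noteq> l" using \<open>i < Suc l\<close> by linarith
            then show ?thesis
            proof cases
              case 1
              then show ?thesis using rm[of l] less rk(3) kl by simp
            next
              case 2
              then show ?thesis using rm[of k] True rk(3) kl prk by simp
            next
              case 3
              then show ?thesis using rm[of i] rel(2)[of i] by simp
            qed
          qed
          then have "take_rel l0 lam0 ?P r0 pr f (Suc k) (run md u2) ?mv ?org"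
            unfolding take_rel_def Let_def fin s tt
            using rel(3,4) ll by simp
          then show ?thesis using ru unfolding u_def by auto
        qed
      qed
    qed
  qed (use that in auto)
  then obtain mv org where T: "take_rel l0 lam0 ?P r0 pr f L t mv org" using NL by auto
  have s': "s' = nat_write ''i'' 0 L t" unfolding s'_def take_weight_def using t(1) NL by simp
  have rs: "row s' = row t" "nat_mem s' ''l'' 0 = nat_mem t ''l'' 0" "real_mem s' = real_mem t"
    unfolding s' by simp_all
  have le: "nat_mem s' ''l'' 0 \<le> Suc l0" using T unfolding rs take_rel_def Let_def by auto
  then have "i < L" if "i < nat_mem t ''l'' 0" for i using that l0(2) rs(2) by simp
  then have "retake l0 lam0 ?P r0 pr f (nat_mem s' ''l'' 0) (real_mem s' ''lambda'') (row s') (real_mem s' ''r'' 0)"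
    using T unfolding retake_def rs take_rel_def Let_def
    by (intro exI[of _ mv] exI[of _ org]) blast
  with le show ?thesis by simp
qed

end

section \<open>The tree lifting program\<close>

abbreviation pcell :: "nexp \<Rightarrow> nexp" where "pcell a \<equiv> NCell ''p'' (ix (nvar ''i'') a)"

definition test_pair :: prog where
  "test_pair = nset ''g'' (NConst 0) ;;
     PIf (beq (pcell (nvar ''w'')) (nvar ''u'')) (nset ''g'' (NConst 1))
       (PIf (beq (pcell (nvar ''u'')) (nvar ''w'')) (nset ''g'' (NConst 1)) PSkip)"

text \<open>One step of a walk from \<open>v\<close> towards the root that looks for
  \<open>d\<close>. The root is its own parent, so running on after reaching it does no
  harm.\<close>

definition search_step :: prog where
  "search_step = PIf (beq (nvar ''y'') (nvar ''d'')) (nset ''h'' (NConst 1)) PSkip ;; nset ''y'' (pcell (nvar ''y''))"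

definition reroute_member :: prog where
  "reroute_member =
     PIf (beq (pcell (nvar ''w'')) (nvar ''u''))
       (nset ''d'' (nvar ''w'') ;; nset ''f'' (nvar ''u'')) (nset ''d'' (nvar ''u'') ;; nset ''f'' (nvar ''w'')) ;;
     nset ''y'' (nvar ''v'') ;; nset ''h'' (NConst 0) ;;
     PIf (beq (pcell (nvar ''v'')) (nvar ''v'')) (nset ''h'' (NConst 1)) PSkip ;;
     PFor ''j'' ''n'' search_step ;;
     PNat ''p'' (ix (nvar ''i'') (nvar ''d'')) (nvar ''v'') ;;
     PIf (beq (nvar ''h'') (NConst 1)) (PNat ''p'' (ix (nvar ''i'') (nvar ''v'')) (nvar ''f'')) PSkip"

definition undo_pair :: prog where
  "undo_pair = rset ''r'' (RCell ''S'' (ix3 (nvar ''v'') (nvar ''u'') (nvar ''w''))) ;; take_weight test_pair reroute_member"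

definition undo_row :: prog where
  "undo_row = PFor ''w'' ''n''
     (PIf (BAnd (NLess (nvar ''u'') (nvar ''w'')) (NLess (nvar ''w'') (nvar ''v''))) undo_pair PSkip)"

definition isolate :: prog where
  "isolate = PFor ''i'' ''L'' (PNat ''p'' (ix (nvar ''i'') (nvar ''v'')) (nvar ''v''))"

definition test_isolated :: prog where
  "test_isolated = nset ''g'' (NConst 0) ;; PIf (beq (pcell (nvar ''v'')) (nvar ''v'')) (nset ''g'' (NConst 1)) PSkip"

definition attach_member :: prog where
  "attach_member = PNat ''p'' (ix (nvar ''i'') (nvar ''v'')) (nvar ''u'')"

text \<open>The free capacity of the pair: the saved weight minus the weight of all trees that use
  the pair in either direction.\<close>

definition residual :: prog where
  "residual = rset ''r'' (RCell ''C'' (ix (nvar ''v'') (nvar ''u''))) ;;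
     PFor ''i'' ''L'' (PIf (NLess (nvar ''i'') (nvar ''l''))
       (PIf (beq (pcell (nvar ''v'')) (nvar ''u'')) (rset ''r'' (RSub (rvar ''r'') (RCell ''lambda'' (nvar ''i''))))
         (PIf (beq (pcell (nvar ''u'')) (nvar ''v'')) (rset ''r'' (RSub (rvar ''r'') (RCell ''lambda'' (nvar ''i'')))) PSkip))
       PSkip)"

definition attach_all :: prog where
  "attach_all = PFor ''u'' ''n'' (PIf (NLess (nvar ''u'') (nvar ''v'')) (residual ;; take_weight test_isolated attach_member) PSkip)"

definition lift_vertex :: prog where
  "lift_vertex = isolate ;; PFor ''u'' ''n'' undo_row ;; attach_all"

text \<open>The family begins with one member of weight 1. Its row is the zeroed memory, which
  encodes the tree on the single vertex 0.\<close>

definition lift_all :: prog where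
  "lift_all = nset ''l'' (NConst 1) ;; rset ''lambda'' (ROfNat (NConst 1)) ;;
     PFor ''v'' ''n'' (PIf (NLess (NConst 0) (nvar ''v'')) lift_vertex PSkip)"

section \<open>Correctness of lifting the trees\<close>

lemma writes_test_pair [simp]: "nwrites test_pair = {''g''}" "rwrites test_pair = {}"
  by (auto simp: test_pair_def)

lemma writes_search_step [simp]: "nwrites search_step = {''h'', ''y''}" "rwrites search_step = {}"
  by (auto simp: search_step_def)

lemma writes_reroute_member [simp]:
  "nwrites reroute_member = {''p'', ''d'', ''f'', ''y'', ''h'', ''j''}" "rwrites reroute_member = {}"
  by (auto simp: reroute_member_def)

lemma writes_undo_pair [simp]:
  "nwrites undo_pair = {''i'', ''c'', ''p'', ''l'', ''g'', ''d'', ''f'', ''y'', ''h'', ''j''}"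
  "rwrites undo_pair = {''lambda'', ''r''}"
  by (auto simp: undo_pair_def)

lemma writes_undo_row [simp]:
  "nwrites undo_row = {''w'', ''i'', ''c'', ''p'', ''l'', ''g'', ''d'', ''f'', ''y'', ''h'', ''j''}"
  "rwrites undo_row = {''lambda'', ''r''}"
  by (auto simp: undo_row_def)

lemma writes_isolate [simp]: "nwrites isolate = {''i'', ''p''}" "rwrites isolate = {}"
  by (auto simp: isolate_def)

lemma writes_test_isolated [simp]: "nwrites test_isolated = {''g''}" "rwrites test_isolated = {}"
  by (auto simp: test_isolated_def)

lemma writes_attach_member [simp]: "nwrites attach_member = {''p''}" "rwrites attach_member = {}"
  by (auto simp: attach_member_def)

lemma writes_residual [simp]: "nwrites residual = {''i''}" "rwrites residual = {''r''}"
  by (auto simp: residual_def)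

lemma writes_attach_all [simp]:
  "nwrites attach_all = {''u'', ''i'', ''c'', ''p'', ''l'', ''g''}" "rwrites attach_all = {''lambda'', ''r''}"
  by (auto simp: attach_all_def)

lemma writes_lift_vertex [simp]:
  "nwrites lift_vertex = {''u'', ''w'', ''i'', ''c'', ''p'', ''l'', ''g'', ''d'', ''f'', ''y'', ''h'', ''j''}"
  "rwrites lift_vertex = {''lambda'', ''r''}"
  by (auto simp: lift_vertex_def)

lemma writes_lift_all [simp]:
  "nwrites lift_all = {''v'', ''u'', ''w'', ''i'', ''c'', ''p'', ''l'', ''g'', ''d'', ''f'', ''y'', ''h'', ''j''}"
  "rwrites lift_all = {''lambda'', ''r''}"
  by (auto simp: lift_all_def)

context setting
begin

lemma idx3_lt: "v < n \<Longrightarrow> u < n \<Longrightarrow> v * K + u < L"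
proof -
  assume "v < n" "u < n"
  then have "v * K + u < v * K + K" by simp
  also have "\<dots> = (v + 1) * K" by simp
  also have "\<dots> \<le> K * K" using \<open>v < n\<close> K by (intro mult_right_mono) auto
  finally show ?thesis using KK_le_L by simp
qed

lemma pcell_val:
  "base t \<Longrightarrow> nat_mem t ''i'' 0 = i \<Longrightarrow> i < L \<Longrightarrow> nval a t = z \<Longrightarrow> z < K \<Longrightarrow> nval (pcell a) t = row t i z"
  using base_vals(5)[of t i] by (simp add: row_val)

lemma test_pair:
  assumes "base t" "nat_mem t ''u'' 0 = u" "nat_mem t ''w'' 0 = w" "u < n" "w < n" "nat_mem t ''i'' 0 = i" "i < L"
  shows "nat_mem (run test_pair t) ''g'' 0 = of_bool (link (row t i) u w)"
proof -
  let ?t = "nat_write ''g'' 0 0 t"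
  have b: "base ?t" "nat_mem ?t ''i'' 0 = i" using assms by simp_all
  have c: "nval (pcell (nvar ''w'')) ?t = row t i w" "nval (pcell (nvar ''u'')) ?t = row t i u"
      "nval (nvar ''w'') ?t = w" "nval (nvar ''u'') ?t = u"
    using pcell_val[OF b assms(7), of "nvar ''w''" w] pcell_val[OF b assms(7), of "nvar ''u''" u] assms by simp_all
  have "run (nset ''g'' (NConst 0)) t = ?t" by simp
  then show ?thesis unfolding test_pair_def link_def run.simps(4,5) bval_beq by (simp only: c) auto
qed

text \<open>The walk from \<open>v\<close> visits the iterates of the parent function one per round,
  so after \<open>n\<close> rounds the flag \<open>h\<close> holds exactly the condition in
  \<open>reroute\<close>. It is complete before the row is changed.\<close>

lemma reroute_member:
  assumes b: "base t" and vuw: "nat_mem t ''v'' 0 = v" "nat_mem t ''u'' 0 = u" "nat_mem t ''w'' 0 = w"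
    and lt: "v < n" "u < v" "w < v" "u \<noteq> w" and i: "nat_mem t ''i'' 0 = i" "i < L"
    and I: "\<And>a. a \<le> v \<Longrightarrow> row t i a \<le> v"
  shows "row (run reroute_member t) j = (if j = i then reroute n v u w (row t i) else row t j)"
proof -
  let ?p = "row t i"
  define d where "d = (if ?p w = u then w else u)"
  define f where "f = (if ?p w = u then u else w)"
  have dn: "d < n" "d < K" "d \<noteq> v" using lt unfolding d_def by auto
  let ?s0 = "nat_write ''f'' 0 f (nat_write ''d'' 0 d t)"
  have cw: "nval (pcell (nvar ''w'')) t = ?p w"
    using pcell_val[OF b i, of "nvar ''w''" w] vuw lt by simp
  let ?h0 = "if ?p v = v then 1 else 0 :: nat"
  define s1 where "s1 = nat_write ''y'' 0 v ?s0"
  define s2 where "s2 = nat_write ''h'' 0 0 s1"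
  define s3 where "s3 = (if ?p v = v then nat_write ''h'' 0 1 s2 else s2)"
  have c2: "nval (pcell (nvar ''v'')) s2 = ?p v"
    using pcell_val[of s2 i "nvar ''v''" v] b i vuw lt unfolding s2_def s1_def by simp
  have b3: "base s3" using b unfolding s3_def s2_def s1_def by simp
  have v3: "nat_mem s3 ''v'' 0 = v" "nat_mem s3 ''d'' 0 = d" "nat_mem s3 ''f'' 0 = f" "nat_mem s3 ''i'' 0 = i"
    "nat_mem s3 ''y'' 0 = v" "nat_mem s3 ''h'' 0 = ?h0" "row s3 = row t"
    using vuw i unfolding s3_def s2_def s1_def by simp_all
  have N3: "nat_mem s3 ''n'' 0 = n" using base_vals[OF b3] by simp
  let ?Q = "\<lambda>k s. nat_mem s ''y'' 0 = (?p ^^ k) v \<and> nat_mem s ''h'' 0 = of_bool (?p v = v \<or> (\<exists>j<k. (?p ^^ j) v = d))"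
  have chain: "(?p ^^ k) v \<le> v" for k by (induction k) (use I in auto)
  obtain s4 where s4: "run (PFor ''j'' ''n'' search_step) s3 = nat_write ''j'' 0 (nat_mem s3 ''n'' 0) s4" "?Q (nat_mem s3 ''n'' 0) s4"
      "frame (insert ''j'' (nwrites search_step)) (rwrites search_step) s3 s4"
  proof (rule run_For[where Q = ?Q and s = s3 and p = search_step and i = "''j''" and a = "''n''"], goal_cases)
    case 1 show ?case using v3 by simp
  next
    case (2 k s)
    let ?s = "nat_write ''j'' 0 k s"
    have bs: "base ?s" using base_frame[OF b3 2(4)] by simp
    have vs: "nat_mem ?s ''d'' 0 = d" "nat_mem ?s ''i'' 0 = i" "row ?s = row t"
      using frame_nat[OF 2(4)] row_frame[OF 2(4)] v3 by simp_all
    let ?s' = "run (PIf (beq (nvar ''y'') (nvar ''d'')) (nset ''h'' (NConst 1)) PSkip) ?s"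
    have y: "nat_mem ?s' ''y'' 0 = (?p ^^ k) v" using 2(3) by simp
    have bs': "base ?s'" "nat_mem ?s' ''i'' 0 = i" "row ?s' = row t" using bs vs by simp_all
    have c: "nval (pcell (nvar ''y'')) ?s' = ?p ((?p ^^ k) v)"
      using pcell_val[OF bs'(1,2) i(2), of "nvar ''y''" "(?p ^^ k) v"] y chain[of k] lt bs'(3) by simp
    have h: "nat_mem ?s' ''h'' 0 = of_bool (?p v = v \<or> (\<exists>j<Suc k. (?p ^^ j) v = d))"
    proof -
      have "(\<exists>j<Suc k. (?p ^^ j) v = d) \<longleftrightarrow> (\<exists>j<k. (?p ^^ j) v = d) \<or> (?p ^^ k) v = d" by (auto simp: less_Suc_eq)
      then show ?thesis using 2(3) vs by simp
    qed
    have "run search_step ?s = nat_write ''y'' 0 (?p ((?p ^^ k) v)) ?s'"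
      unfolding search_step_def run.simps(4) using c by (simp only: run.simps(2) nval.simps(1))
    then show ?case using h by simp
  qed (use that in auto)
  have r3: "run reroute_member t = run (PFor ''j'' ''n'' search_step ;;
     PNat ''p'' (ix (nvar ''i'') (nvar ''d'')) (nvar ''v'') ;;
     PIf (beq (nvar ''h'') (NConst 1)) (PNat ''p'' (ix (nvar ''i'') (nvar ''v'')) (nvar ''f'')) PSkip) s3"
  proof -
    have 0: "run (PIf (beq (pcell (nvar ''w'')) (nvar ''u''))
       (nset ''d'' (nvar ''w'') ;; nset ''f'' (nvar ''u'')) (nset ''d'' (nvar ''u'') ;; nset ''f'' (nvar ''w''))) t = ?s0"
      using cw vuw unfolding d_def f_def by (simp del: nval.simps(2,3)) (simp add: vuw)
    have 1: "run (nset ''y'' (nvar ''v'')) ?s0 = s1" unfolding s1_def using vuw by simp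
    have 2: "run (nset ''h'' (NConst 0)) s1 = s2" unfolding s2_def by simp
    have v2: "nval (nvar ''v'') s2 = v" unfolding s2_def s1_def using vuw by simp
    have 3: "run (PIf (beq (pcell (nvar ''v'')) (nvar ''v'')) (nset ''h'' (NConst 1)) PSkip) s2 = s3"
      unfolding s3_def run.simps(5) bval_beq c2 v2 by simp
    show ?thesis unfolding reroute_member_def run.simps(4) 0 1 2 3 ..
  qed
  let ?s5 = "nat_write ''j'' 0 n s4"
  have b5: "base ?s5" using base_frame[OF b3 s4(3)] by simp
  have v5: "nat_mem ?s5 ''v'' 0 = v" "nat_mem ?s5 ''d'' 0 = d" "nat_mem ?s5 ''f'' 0 = f" "nat_mem ?s5 ''i'' 0 = i"
      "row ?s5 = row t" "nat_mem ?s5 ''h'' 0 = of_bool (?p v = v \<or> (\<exists>j<n. (?p ^^ j) v = d))"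
    using frame_nat[OF s4(3)] row_frame[OF s4(3)] v3 s4(2) N3 by simp_all
  have T: "nat_mem ?s5 ''T'' i = i * K" using base_vals(5)[OF b5 i(2)] .
  let ?s6 = "nat_write ''p'' (i * K + d) v ?s5"
  have r6: "row ?s6 j = (if j = i then ?p(d := v) else row t j)" for j
    using row_write[OF dn(2), of i v ?s5 j] v5(5) by simp
  define h where "h \<longleftrightarrow> ?p v = v \<or> (\<exists>j<n. (?p ^^ j) v = d)"
  have h5: "nat_mem ?s5 ''h'' 0 = of_bool h" unfolding h_def by (rule v5(6))
  have run: "run reroute_member t = (if h then nat_write ''p'' (i * K + v) f ?s6 else ?s6)"
    unfolding r3 run.simps(4) s4(1) N3 using v5(1-5) T h5 by (cases h) simp_all
  have r7: "row (nat_write ''p'' (i * K + v) f ?s6) j = (if j = i then ?p(d := v, v := f) else row t j)" for j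
    using row_write[of v i f ?s6 j] r6[of i] r6[of j] lt by (simp add: lt_K)
  have "reroute n v u w ?p = ?p(d := v, v := if h then f else ?p v)"
    unfolding reroute_def d_def f_def h_def Let_def by simp
  also have "\<dots> = (if h then ?p(d := v, v := f) else ?p(d := v))" using dn(3) by (auto simp: fun_eq_iff)
  finally show ?thesis unfolding run using r6[of j] r7[of j] by (cases h; cases "j = i") simp_all
qed

text \<open>The loop position read as a number in base \<open>K\<close>, plus the initial member.
  One modification is made per position at most, so this also bounds the size of the family.\<close>

definition bound3 :: "nat \<Rightarrow> nat \<Rightarrow> nat \<Rightarrow> nat" where
  "bound3 v u w = 1 + v * K * K + u * K + w"

lemma bound3_L: "v < n \<Longrightarrow> u \<le> n \<Longrightarrow> w \<le> n \<Longrightarrow> bound3 v u w < L"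
proof -
  assume a: "v < n" "u \<le> n" "w \<le> n"
  have "u * K + w + 1 < n * K + K" using a K by (intro add_le_less_mono[of "u * K" "n * K" "w + 1" K, simplified add.assoc[symmetric]] mult_right_mono) auto
  also have "\<dots> = (n + 1) * K" by simp
  also have "\<dots> \<le> K * K" using K by (intro mult_right_mono) auto
  finally have "bound3 v u w < (v + 1) * K * K" unfolding bound3_def by (simp add: algebra_simps)
  also have "\<dots> \<le> L" unfolding L using a K by (intro mult_right_mono) auto
  finally show ?thesis .
qed

text \<open>The matrix \<open>\<tau>\<close> of the invariant when \<open>D\<close> lists the undone
  pairs in one orientation.\<close>

definition undone :: "(nat \<times> nat) set \<Rightarrow> (nat \<Rightarrow> nat \<Rightarrow> real) \<Rightarrow> nat \<Rightarrow> nat \<Rightarrow> real" where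
  "undone D \<sigma> a b = (if (a, b) \<in> D \<or> (b, a) \<in> D then \<sigma> a b else 0)"

definition undo_state where
  "undo_state v W \<sigma> D N t \<longleftrightarrow>
     undo_inv n v W \<sigma> (undone D \<sigma>) (nat_mem t ''l'' 0) (real_mem t ''lambda'') (row t) \<and> nat_mem t ''l'' 0 \<le> N"

lemma undo_state_write: "a \<noteq> ''l'' \<Longrightarrow> a \<noteq> ''p'' \<Longrightarrow> undo_state v W \<sigma> D N (nat_write a i j t) = undo_state v W \<sigma> D N t"
  unfolding undo_state_def by simp

lemma undo_pair:
  assumes U: "undo_state v W \<sigma> D N s" and N: "N < L" and D: "D \<subseteq> {(a, b). a < b \<and> b < v}" "(u, w) \<notin> D"
    and b: "base s" and vuw: "nat_mem s ''v'' 0 = v" "nat_mem s ''u'' 0 = u" "nat_mem s ''w'' 0 = w"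
    and lt: "v < n" "u < w" "w < v" and S: "split3 s v u w = \<sigma> u w"
    and ok: "split_ok v W \<sigma> W'" and W: "sym_nonneg W {..v}"
  shows "undo_state v W \<sigma> (insert (u, w) D) (Suc N) (run undo_pair s)"
proof -
  let ?l = "nat_mem s ''l'' 0" and ?lam = "real_mem s ''lambda''" and ?P = "row s"
  have lt': "u < n" "w < n" "u < v" "u \<noteq> w" using lt by auto
  have U': "undo_inv n v W \<sigma> (undone D \<sigma>) ?l ?lam ?P" "?l < L" using U N unfolding undo_state_def by auto
  have \<sigma>: "\<sigma> a b = \<sigma> b a" "0 \<le> \<sigma> a b" for a b using ok unfolding split_ok_def by auto
  let ?s = "real_write ''r'' 0 (\<sigma> u w) s"
  have r: "run (rset ''r'' (RCell ''S'' (ix3 (nvar ''v'') (nvar ''u'') (nvar ''w'')))) s = ?s"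
    using S idx3_lt[of v u] lt lt' base_vals(5)[OF b] vuw unfolding split3_def by simp
  have bs: "base ?s" using b by simp
  define Ctx where "Ctx t \<longleftrightarrow> nat_mem t ''v'' 0 = v \<and> nat_mem t ''u'' 0 = u \<and> nat_mem t ''w'' 0 = w" for t :: state
  \<comment> \<open>Rows must stay within \<open>0, \<dots>, v\<close> so that the walk along
    parents addresses valid cells.\<close>
  define I where "I p \<longleftrightarrow> (\<forall>a\<le>v. p a \<le> v)" for p :: "nat \<Rightarrow> nat"
  have st: "semitree v (?P i)" "0 < ?lam i" if "i < ?l" for i using U' that unfolding undo_inv_def by auto
  let ?t = "run (take_weight test_pair reroute_member) ?s"
  have rt: "retake ?l ?lam (row ?s) (\<sigma> u w) (\<lambda>p. link p u w) (reroute n v u w)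
      (nat_mem ?t ''l'' 0) (real_mem ?t ''lambda'') (row ?t) (real_mem ?t ''r'' 0) \<and> nat_mem ?t ''l'' 0 \<le> Suc ?l"
  proof (rule take_weight[where s = ?s and I = I and X = "{''g'', ''d'', ''f'', ''y'', ''h'', ''j''}" and Ctx = Ctx])
    show "I (row ?s j)" if "j < ?l" for j
      using st(1)[OF that] unfolding I_def semitree_def by (auto simp: le_less)
    show "I (reroute n v u w p)" if "I p" "link p u w" for p
      using that lt lt' unfolding I_def reroute_def Let_def by auto
    show "Ctx ?s" unfolding Ctx_def using vuw by simp
    show "Ctx t'" if "Ctx t" "frame ({''i'', ''c'', ''l'', ''p''} \<union> {''g'', ''d'', ''f'', ''y'', ''h'', ''j''}) {''lambda'', ''r''} t t'" for t t'
      using that(1) frame_nat[OF that(2)] unfolding Ctx_def by simp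
    show "nat_mem (run test_pair t) ''g'' 0 = of_bool (link (row t i) u w)"
      if "base t" "Ctx t" "nat_mem t ''i'' 0 = i" "i < L" for t i
      using test_pair[OF that(1) _ _ lt'(1,2) that(3,4)] that(2) unfolding Ctx_def by simp
    show "row (run reroute_member t) j = (if j = i then reroute n v u w (row t i) else row t j)"
      if "base t" "Ctx t" "nat_mem t ''i'' 0 = i" "i < L" "I (row t i)" for t i j
      using reroute_member[OF that(1) _ _ _ lt(1) lt'(3) lt(3) lt'(4) that(3,4)] that(2,5) unfolding Ctx_def I_def by simp
  qed (use U' bs \<sigma> st in simp_all)
  have "undo_inv n v W \<sigma> (undone (insert (u, w) D) \<sigma>) (nat_mem ?t ''l'' 0) (real_mem ?t ''lambda'') (row ?t)"
  proof (rule undo_step[OF U'(1) lt])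
    show "retake ?l ?lam ?P (\<sigma> u w) (\<lambda>p. link p u w) (reroute n v u w) (nat_mem ?t ''l'' 0) (real_mem ?t ''lambda'') (row ?t) (real_mem ?t ''r'' 0)"
      using rt by simp
    have "(w, u) \<notin> D" using D lt by auto
    then show "undone D \<sigma> u w = 0" "undone D \<sigma> w u = 0"
      "undone (insert (u, w) D) \<sigma> a b = undone D \<sigma> a b + (if a = u \<and> b = w \<or> a = w \<and> b = u then \<sigma> u w else 0)" for a b
      using D(2) \<sigma>(1) unfolding undone_def by auto
    show "0 \<le> W u w" "W w u = W u w" using W lt lt' unfolding sym_nonneg_def by auto
  qed (use \<sigma> in auto)
  moreover have "run undo_pair s = ?t" unfolding undo_pair_def run.simps(4) r ..
  ultimately show ?thesis using rt U unfolding undo_state_def by simp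
qed

lemma undo_row:
  assumes U: "undo_state v W \<sigma> {(a, b). a < b \<and> b < v \<and> a < u} (bound3 v u 0) s"
    and b: "base s" and vu: "nat_mem s ''v'' 0 = v" "nat_mem s ''u'' 0 = u"
    and lt: "v < n" "u < n" and S: "\<And>a b. a < b \<Longrightarrow> b < v \<Longrightarrow> split3 s v a b = \<sigma> a b"
    and ok: "split_ok v W \<sigma> W'" and W: "sym_nonneg W {..v}"
  shows "undo_state v W \<sigma> {(a, b). a < b \<and> b < v \<and> a < Suc u} (bound3 v (Suc u) 0) (run undo_row s)"
proof -
  let ?p = "PIf (BAnd (NLess (nvar ''u'') (nvar ''w'')) (NLess (nvar ''w'') (nvar ''v''))) undo_pair PSkip"
  have N: "nat_mem s ''n'' 0 = n" using base_vals[OF b] by simp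
  let ?D = "\<lambda>k. {(a, b). a < b \<and> b < v \<and> (a < u \<or> a = u \<and> b < k)}"
  let ?Q = "\<lambda>k. undo_state v W \<sigma> (?D k) (bound3 v u k)"
  have mono: "undo_state v W \<sigma> D M t" if "undo_state v W \<sigma> D M' t" "M' \<le> M" for D M M' t
    using that unfolding undo_state_def by auto
  obtain t where t: "run (PFor ''w'' ''n'' ?p) s = nat_write ''w'' 0 (nat_mem s ''n'' 0) t" "?Q (nat_mem s ''n'' 0) t"
  proof (rule run_For[where Q = ?Q and s = s and p = ?p and i = "''w''" and a = "''n''"], goal_cases)
    case 1
    have "?D 0 = {(a, b). a < b \<and> b < v \<and> a < u}" by auto
    then show ?case using U by simp
  next
    case (2 k t)
    let ?t = "nat_write ''w'' 0 k t"
    have k: "k < n" using 2(2) N by simp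
    have bt: "base ?t" using base_frame[OF b 2(4)] by simp
    have vt: "nat_mem ?t ''v'' 0 = v" "nat_mem ?t ''u'' 0 = u" "nat_mem ?t ''w'' 0 = k"
      using frame_nat[OF 2(4), of "''v''"] frame_nat[OF 2(4), of "''u''"] vu by simp_all
    have St: "split3 ?t = split3 s" using frame_real[OF 2(4), of "''S''"] by (simp add: split3_def fun_eq_iff)
    have Ut: "undo_state v W \<sigma> (?D k) (bound3 v u k) ?t" using 2(3) by (simp add: undo_state_write)
    have bk: "bound3 v u (Suc k) = Suc (bound3 v u k)" unfolding bound3_def by simp
    show ?case
    proof (cases "u < k \<and> k < v")
      case True
      then have D: "?D (Suc k) = insert (u, k) (?D k)" by auto
      have "undo_state v W \<sigma> (insert (u, k) (?D k)) (Suc (bound3 v u k)) (run undo_pair ?t)"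
        by (rule undo_pair[OF Ut _ _ _ bt vt lt(1) _ _ _ ok W]) (use True S St bound3_L[of v u k] lt k in auto)
      then show ?thesis unfolding D bk using True vt by simp
    next
      case False
      then have D: "?D (Suc k) = ?D k" by (auto simp: less_Suc_eq)
      have "run ?p ?t = ?t" using False vt by auto
      then show ?thesis unfolding D using mono[OF Ut] bk by simp
    qed
  qed (use that in auto)
  have "?D n = {(a, b). a < b \<and> b < v \<and> a < Suc u}" using lt by auto
  moreover have "bound3 v u n \<le> bound3 v (Suc u) 0" using K unfolding bound3_def by simp
  ultimately have "undo_state v W \<sigma> {(a, b). a < b \<and> b < v \<and> a < Suc u} (bound3 v (Suc u) 0) t"
    using t(2) N mono by simp
  then show ?thesis unfolding undo_row_def t(1) by (simp add: undo_state_write)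
qed

lemma isolate:
  assumes b: "base s" and v: "nat_mem s ''v'' 0 = v" "v < n"
  shows "i < L \<Longrightarrow> row (run isolate s) i = (row s i)(v := v)"
proof -
  let ?p = "PNat ''p'' (ix (nvar ''i'') (nvar ''v'')) (nvar ''v'')"
  have NL: "nat_mem s ''L'' 0 = L" using base_vals[OF b] by simp
  let ?Q = "\<lambda>k t. \<forall>i. row t i = (if i < k then (row s i)(v := v) else row s i)"
  obtain t where t: "run (PFor ''i'' ''L'' ?p) s = nat_write ''i'' 0 (nat_mem s ''L'' 0) t" "?Q (nat_mem s ''L'' 0) t"
  proof (rule run_For[where Q = ?Q and s = s and p = ?p and i = "''i''" and a = "''L''"], goal_cases)
    case (2 k t)
    let ?t = "nat_write ''i'' 0 k t"
    have k: "k < L" using 2(2) NL by simp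
    have bt: "base t" using base_frame[OF b 2(4)] by simp
    have vt: "nat_mem t ''v'' 0 = v" using frame_nat[OF 2(4), of "''v''"] v by simp
    have e: "run ?p ?t = nat_write ''p'' (k * K + v) v ?t" using base_vals(5)[OF bt k] vt by simp
    have "row (run ?p ?t) i = (if i = k then (row t k)(v := v) else row t i)" for i
      unfolding e using row_write[OF lt_K[OF v(2)], of k v ?t i] by simp
    then show ?case using 2(3) by (auto simp: less_Suc_eq)
  qed (use that in auto)
  show "i < L \<Longrightarrow> row (run isolate s) i = (row s i)(v := v)"
    unfolding isolate_def t(1) using t(2) NL by simp
qed

lemma test_isolated:
  assumes "base t" "nat_mem t ''v'' 0 = v" "v < n" "nat_mem t ''i'' 0 = i" "i < L"
  shows "nat_mem (run test_isolated t) ''g'' 0 = of_bool (row t i v = v)"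
proof -
  let ?t = "nat_write ''g'' 0 0 t"
  have b: "base ?t" "nat_mem ?t ''i'' 0 = i" using assms by simp_all
  have c: "nval (pcell (nvar ''v'')) ?t = row t i v" "nval (nvar ''v'') ?t = v"
    using pcell_val[OF b assms(5), of "nvar ''v''" v] assms by simp_all
  have "run (nset ''g'' (NConst 0)) t = ?t" by simp
  then show ?thesis unfolding test_isolated_def run.simps(4,5) bval_beq by (simp only: c) simp
qed

lemma attach_member:
  assumes "base t" "nat_mem t ''v'' 0 = v" "nat_mem t ''u'' 0 = u" "v < n" "nat_mem t ''i'' 0 = i" "i < L"
  shows "row (run attach_member t) j = (if j = i then (row t i)(v := u) else row t j)"
  unfolding attach_member_def using assms base_vals(5)[OF assms(1,6)] row_write[OF lt_K[OF assms(4)], of i u t j] by simp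

lemma residual:
  assumes b: "base s" and vu: "nat_mem s ''v'' 0 = v" "nat_mem s ''u'' 0 = u" "v < n" "u < v"
    and l: "nat_mem s ''l'' 0 = l" "l < L"
  shows "run residual s = nat_write ''i'' 0 L (real_write ''r'' 0
     (mat s ''C'' v u - total l (real_mem s ''lambda'') (row s) (\<lambda>p. of_bool (link p v u))) s)"
proof -
  let ?p = "PIf (NLess (nvar ''i'') (nvar ''l''))
       (PIf (beq (pcell (nvar ''v'')) (nvar ''u'')) (rset ''r'' (RSub (rvar ''r'') (RCell ''lambda'' (nvar ''i''))))
         (PIf (beq (pcell (nvar ''u'')) (nvar ''v'')) (rset ''r'' (RSub (rvar ''r'') (RCell ''lambda'' (nvar ''i'')))) PSkip))
       PSkip"
  let ?c = "mat s ''C'' v u" and ?lam = "real_mem s ''lambda''"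
  have un: "u < n" using vu by simp
  have NL: "nat_mem s ''L'' 0 = L" using base_vals[OF b] by simp
  let ?s = "real_write ''r'' 0 ?c s"
  have r0: "run (rset ''r'' (RCell ''C'' (ix (nvar ''v'') (nvar ''u'')))) s = ?s"
    using vu base_vals(5)[OF b, of v] by (simp add: mat_def)
  have Ns: "nat_mem ?s ''L'' 0 = L" using NL by simp
  define h where "h i = (if i < l \<and> link (row s i) v u then ?lam i else 0)" for i
  let ?Q = "\<lambda>k t. \<exists>j. t = (if k = 0 then ?s else nat_write ''i'' 0 j (real_write ''r'' 0 (?c - (\<Sum>i<k. h i)) s))"
  have ww: "nat_write a i x (nat_write a i y t) = nat_write a i x t" for a i x y t
    by (simp add: nat_write_def)
  have wr: "real_write a i x (nat_write c j y t) = nat_write c j y (real_write a i x t)" for a i x c j y t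
    by (simp add: nat_write_def real_write_def)
  have rr: "real_write a i x (real_write a i y t) = real_write a i x t" for a i x y t
    by (simp add: real_write_def)
  obtain t where t: "run (PFor ''i'' ''L'' ?p) ?s = nat_write ''i'' 0 (nat_mem ?s ''L'' 0) t" "?Q (nat_mem ?s ''L'' 0) t"
  proof (rule run_For[where Q = ?Q and s = ?s and p = ?p and i = "''i''" and a = "''L''"], goal_cases)
    case (2 k t)
    have k: "k < L" using 2(2) NL by simp
    let ?t = "nat_write ''i'' 0 k (real_write ''r'' 0 (?c - (\<Sum>i<k. h i)) s)"
    have t: "nat_write ''i'' 0 k t = ?t" using 2(3) by (auto simp: ww split: if_splits)
    have bt: "base ?t" "nat_mem ?t ''i'' 0 = k" using b by simp_all
    have c: "nval (pcell (nvar ''v'')) ?t = row s k v" "nval (pcell (nvar ''u'')) ?t = row s k u"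
      using pcell_val[OF bt k, of "nvar ''v''" v] pcell_val[OF bt k, of "nvar ''u''" u] vu un by simp_all
    have vt: "nval (nvar ''v'') ?t = v" "nval (nvar ''u'') ?t = u" "nval (nvar ''l'') ?t = l" "nval (nvar ''i'') ?t = k"
      using vu l by simp_all
    have up: "run (rset ''r'' (RSub (rvar ''r'') (RCell ''lambda'' (nvar ''i'')))) ?t
        = nat_write ''i'' 0 k (real_write ''r'' 0 (?c - (\<Sum>i<k. h i) - ?lam k) s)"
      by (simp add: wr rr)
    have "run ?p ?t = nat_write ''i'' 0 k (real_write ''r'' 0 (?c - (\<Sum>i<Suc k. h i)) s)"
      unfolding run.simps(5) bval_beq bval.simps(1) c vt up unfolding h_def link_def by (simp add: algebra_simps)
    then show ?case unfolding t by auto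
  qed (use that in auto)
  have "L \<noteq> 0" using l by simp
  then obtain j where tt: "t = nat_write ''i'' 0 j (real_write ''r'' 0 (?c - (\<Sum>i<L. h i)) s)" using t(2) NL by auto
  have "(\<Sum>i<L. h i) = (\<Sum>i<l. h i)"
    by (rule sum.mono_neutral_right) (use l in \<open>auto simp: h_def\<close>)
  also have "\<dots> = total l ?lam (row s) (\<lambda>p. of_bool (link p v u))"
    unfolding total_def by (intro sum.cong) (auto simp: h_def)
  finally have "(\<Sum>i<L. h i) = total l ?lam (row s) (\<lambda>p. of_bool (link p v u))" .
  then show ?thesis unfolding residual_def run.simps(4) r0 t(1) Ns tt ww by simp
qed

definition attach_state where
  "attach_state v W U u N t \<longleftrightarrow>
     attach_inv n v W U u (nat_mem t ''l'' 0) (real_mem t ''lambda'') (row t) \<and> nat_mem t ''l'' 0 \<le> N"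

lemma attach_all:
  assumes A: "attach_state v W U 0 N s" and N: "N + n < L"
    and b: "base s" and v: "nat_mem s ''v'' 0 = v" "v < n" "0 < v"
    and C: "\<And>a. a < v \<Longrightarrow> mat s ''C'' v a = W v a" and U: "\<And>a. a < v \<Longrightarrow> U a \<le> W v a"
  shows "attach_state v W U v (N + n) (run attach_all s)"
proof -
  let ?p = "PIf (NLess (nvar ''u'') (nvar ''v'')) (residual ;; take_weight test_isolated attach_member) PSkip"
  have Nn: "nat_mem s ''n'' 0 = n" using base_vals[OF b] by simp
  let ?Q = "\<lambda>k. attach_state v W U (min k v) (N + k)"
  obtain t where t: "run (PFor ''u'' ''n'' ?p) s = nat_write ''u'' 0 (nat_mem s ''n'' 0) t" "?Q (nat_mem s ''n'' 0) t"
  proof (rule run_For[where Q = ?Q and s = s and p = ?p and i = "''u''" and a = "''n''"], goal_cases)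
    case 1 show ?case using A by simp
  next
    case (2 k t)
    let ?t = "nat_write ''u'' 0 k t"
    have k: "k < n" using 2(2) Nn by simp
    have bt: "base ?t" using base_frame[OF b 2(4)] by simp
    have vt: "nat_mem ?t ''v'' 0 = v" "nat_mem ?t ''u'' 0 = k" using frame_nat[OF 2(4), of "''v''"] v by simp_all
    have Ct: "mat ?t ''C'' = mat s ''C''" using frame_real[OF 2(4), of "''C''"] by (simp add: mat_def fun_eq_iff)
    have At: "attach_state v W U (min k v) (N + k) ?t" using 2(3) unfolding attach_state_def by simp
    show ?case
    proof (cases "k < v")
      case False
      then have "run ?p ?t = ?t" using vt by simp
      moreover have "min k v = v" "min (Suc k) v = v" using False by auto
      ultimately show ?thesis using At unfolding attach_state_def by (simp only:) simp
    next
      case True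
      let ?l = "nat_mem ?t ''l'' 0" and ?lam = "real_mem ?t ''lambda''" and ?P = "row ?t"
      have I: "attach_inv n v W U k ?l ?lam ?P" "?l \<le> N + k" using At True unfolding attach_state_def by (simp_all add: min_def)
      have lL: "?l < L" using I(2) N k by simp
      \<comment> \<open>The free capacity is measured only now, but attaching \<open>v\<close> to
        smaller vertices has not changed the weight of links between \<open>v\<close> and
        \<open>k\<close>.\<close>
      have Uk: "total ?l ?lam ?P (\<lambda>p. of_bool (link p v k)) = U k"
      proof -
        have "if k < k then total ?l ?lam ?P (\<lambda>p. of_bool (link p v k)) \<le> W v k
            else total ?l ?lam ?P (\<lambda>p. of_bool (link p v k)) = U k"
          using I(1) True unfolding attach_inv_def by blast
        then show ?thesis by simp
      qed
      let ?r = "W v k - U k"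
      let ?s = "nat_write ''i'' 0 L (real_write ''r'' 0 ?r ?t)"
      have rs: "run residual ?t = ?s"
        using residual[OF bt vt v(2) True refl lL] C[OF True] unfolding Ct Uk by simp
      have bs: "base ?s" using bt by simp
      have pos: "0 < ?lam i" if "i < ?l" for i using I(1) that unfolding attach_inv_def by auto
      define Ctx where "Ctx t \<longleftrightarrow> nat_mem t ''v'' 0 = v \<and> nat_mem t ''u'' 0 = k" for t :: state
      let ?w = "run (take_weight test_isolated attach_member) ?s"
      have rt: "retake ?l ?lam (row ?s) ?r (\<lambda>p. p v = v) (\<lambda>p. p(v := k))
          (nat_mem ?w ''l'' 0) (real_mem ?w ''lambda'') (row ?w) (real_mem ?w ''r'' 0) \<and> nat_mem ?w ''l'' 0 \<le> Suc ?l"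
      proof (rule take_weight[where s = ?s and I = "\<lambda>_. True" and X = "{''g''}" and Ctx = Ctx])
        show "Ctx ?s" unfolding Ctx_def using vt by simp
        show "Ctx t'" if "Ctx t" "frame ({''i'', ''c'', ''l'', ''p''} \<union> {''g''}) {''lambda'', ''r''} t t'" for t t'
          using that(1) frame_nat[OF that(2)] unfolding Ctx_def by simp
        show "nat_mem (run test_isolated t) ''g'' 0 = of_bool (row t i v = v)"
          if "base t" "Ctx t" "nat_mem t ''i'' 0 = i" "i < L" for t i
          using test_isolated[OF that(1) _ v(2) that(3,4)] that(2) unfolding Ctx_def by simp
        show "row (run attach_member t) j = (if j = i then (row t i)(v := k) else row t j)"
          if "base t" "Ctx t" "nat_mem t ''i'' 0 = i" "i < L" for t i j
          using attach_member[OF that(1) _ _ v(2) that(3,4)] that(2) unfolding Ctx_def by simp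
      qed (use bs lL pos U[OF True] in simp_all)
      have "attach_inv n v W U (Suc k) (nat_mem ?w ''l'' 0) (real_mem ?w ''lambda'') (row ?w)"
        by (rule attach_step[OF I(1) v(3,2) True]) (use rt U[OF True] in auto)
      moreover have "run ?p ?t = ?w" using vt True rs by simp
      ultimately show ?thesis using rt I(2) True unfolding attach_state_def by (simp add: min_def)
    qed
  qed (use that in auto)
  then show ?thesis unfolding attach_all_def t(1) attach_state_def using v Nn by (simp add: min_def)
qed

lemma lift_vertex:
  assumes T: "tree_inv n (v - 1) W' (nat_mem s ''l'' 0) (real_mem s ''lambda'') (row s)"
    and l: "nat_mem s ''l'' 0 \<le> bound3 v 0 0"
    and b: "base s" and v: "nat_mem s ''v'' 0 = v" "v < n" "0 < v"
    and C: "\<And>a. a < v \<Longrightarrow> mat s ''C'' v a = W v a" and S: "\<And>a b. a < b \<Longrightarrow> b < v \<Longrightarrow> split3 s v a b = \<sigma> a b"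
    and ok: "split_ok v W \<sigma> W'" and lv: "level v W"
  defines "s' \<equiv> run lift_vertex s"
  shows "tree_inv n v W (nat_mem s' ''l'' 0) (real_mem s' ''lambda'') (row s') \<and> nat_mem s' ''l'' 0 \<le> bound3 (Suc v) 0 0"
proof -
  have W: "sym_nonneg W {..v}" using lv unfolding level_def by blast
  have \<sigma>: "\<sigma> a b = \<sigma> b a" "0 \<le> \<sigma> a b" "\<sigma> a a = 0" for a b using ok unfolding split_ok_def by auto
  have ok': "\<And>a b. a < v \<Longrightarrow> b < v \<Longrightarrow> a \<noteq> b \<Longrightarrow> W' a b = W a b + \<sigma> a b" "\<And>a. a < v \<Longrightarrow> (\<Sum>b<v. \<sigma> a b) \<le> W v a"
    using ok unfolding split_ok_def by auto
  let ?s1 = "run isolate s"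
  have b1: "base ?s1" using base_run[OF b] by simp
  have v1: "nat_mem ?s1 ''v'' 0 = v" "nat_mem ?s1 ''l'' 0 = nat_mem s ''l'' 0" "real_mem ?s1 = real_mem s"
    using v by (auto simp: fun_eq_iff)
  have "nat_mem s ''l'' 0 < L" using l bound3_L[of v 0 0] v by simp
  then have U1: "undo_inv n v W \<sigma> (\<lambda>_ _. 0) (nat_mem ?s1 ''l'' 0) (real_mem ?s1 ''lambda'') (row ?s1)"
    unfolding v1 by (intro undo_start[OF T v(3,2)] ok') (auto intro: isolate[OF b v(1,2)])
  let ?Q = "\<lambda>u. undo_state v W \<sigma> {(a, b). a < b \<and> b < v \<and> a < u} (bound3 v u 0)"
  have N1: "nat_mem ?s1 ''n'' 0 = n" using base_vals[OF b1] by simp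
  obtain t where t: "run (PFor ''u'' ''n'' undo_row) ?s1 = nat_write ''u'' 0 (nat_mem ?s1 ''n'' 0) t" "?Q (nat_mem ?s1 ''n'' 0) t"
     "frame (insert ''u'' (nwrites undo_row)) (rwrites undo_row) ?s1 t"
  proof (rule run_For[where Q = ?Q and s = ?s1 and p = undo_row and i = "''u''" and a = "''n''"], goal_cases)
    case 1
    have "undone {(a, b). a < b \<and> b < v \<and> a < 0} \<sigma> = (\<lambda>_ _. 0)" unfolding undone_def by (auto simp: fun_eq_iff)
    then show ?case using U1 l v1 unfolding undo_state_def by simp
  next
    case (2 k t)
    let ?t = "nat_write ''u'' 0 k t"
    have "split3 ?t = split3 s" using frame_real[OF 2(4), of "''S''"] by (simp add: split3_def fun_eq_iff v1)
    then show ?case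
      by (intro undo_row[OF _ _ _ _ v(2) _ _ ok W])
         (use 2(2,3) base_frame[OF b1 2(4)] frame_nat[OF 2(4), of "''v''"] v1 N1 S in \<open>auto simp: undo_state_write\<close>)
  qed (use that in auto)
  let ?t = "nat_write ''u'' 0 n t"
  have bt: "base ?t" using base_frame[OF b1 t(3)] by simp
  have vt: "nat_mem ?t ''v'' 0 = v" using frame_nat[OF t(3), of "''v''"] v1 by simp
  have Ct: "mat ?t ''C'' = mat s ''C''" using frame_real[OF t(3), of "''C''"] by (simp add: mat_def fun_eq_iff v1)
  have Ut: "undo_state v W \<sigma> {(a, b). a < b \<and> b < v \<and> a < n} (bound3 v n 0) ?t"
    using t(2) N1 by (simp add: undo_state_write)
  let ?l = "nat_mem ?t ''l'' 0" and ?lam = "real_mem ?t ''lambda''" and ?P = "row ?t"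
  have eqs: "undone {(a, b). a < b \<and> b < v \<and> a < n} \<sigma> a b = \<sigma> a b" if "a < v" "b < v" for a b
    using that v(2) \<sigma>(3) unfolding undone_def by auto
  have Uf: "undo_inv n v W \<sigma> \<sigma> ?l ?lam ?P"
  proof -
    have "(\<Sum>b<v. undone {(a, b). a < b \<and> b < v \<and> a < n} \<sigma> a b) = (\<Sum>b<v. \<sigma> a b)" if "a < v" for a
      using that by (intro sum.cong) (auto simp: eqs)
    then show ?thesis using Ut unfolding undo_state_def undo_inv_def by (simp add: eqs)
  qed
  define U where "U a = total ?l ?lam ?P (\<lambda>p. of_bool (link p v a))" for a
  \<comment> \<open>The cut of \<open>v\<close> alone, available from \<open>level\<close>.\<close>
  have two: "2 \<le> (\<Sum>a<v. W v a)"
  proof -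
    have "2 \<le> cut W {..v} {v}"
    proof -
      have "0 \<in> {..v}" "0 \<notin> {v}" using v(3) by simp_all
      then have "{v} \<subset> {..v}" by blast
      then show ?thesis using lv unfolding level_def by blast
    qed
    also have "cut W {..v} {v} = cut W (insert v {..<v}) {v}" by (rule arg_cong[of _ _ "\<lambda>X. cut W X {v}"]) auto
    also have "\<dots> = cut W {..<v} {v} + (\<Sum>b<v. if b \<notin> {v} then W v b else 0)"
      by (subst cut_insert) auto
    also have "cut W {..<v} {v} = 0" unfolding cut_def by (intro sum.neutral ballI) auto
    also have "0 + (\<Sum>b<v. if b \<notin> {v} then W v b else 0) = (\<Sum>a<v. W v a)" by (auto intro!: sum.cong)
    finally show ?thesis .
  qed
  have As: "attach_state v W U 0 (bound3 v n 0) ?t"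
    using attach_start[OF Uf v(3,2) ok'(2) two] Ut unfolding attach_state_def undo_state_def U_def by simp
  have UW: "U a \<le> W v a" if "a < v" for a
    using Uf ok'(2)[OF that] that unfolding undo_inv_def U_def by (meson order.trans)
  have bn: "bound3 v n 0 + n = bound3 v n n" unfolding bound3_def by simp
  have A: "attach_state v W U v (bound3 v n n) (run attach_all ?t)"
    using attach_all[OF As _ bt vt v(2,3) _ UW] bound3_L[of v n n] v C unfolding bn Ct by simp
  have s': "s' = run attach_all ?t" unfolding s'_def lift_vertex_def run.simps(4) t(1) N1 ..
  \<comment> \<open>One vertex consumes at most \<open>n * K + n\<close> positions, which fit into
    the \<open>K * K\<close> positions between \<open>v\<close> and \<open>Suc v\<close>.\<close>
  have "bound3 v n n \<le> bound3 (Suc v) 0 0"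
  proof -
    have "n * K + n \<le> n * K + K" using K by simp
    also have "\<dots> = (n + 1) * K" by simp
    also have "\<dots> \<le> K * K" using K by (intro mult_right_mono) auto
    finally show ?thesis unfolding bound3_def by (simp add: algebra_simps)
  qed
  moreover have "tree_inv n v W (nat_mem s' ''l'' 0) (real_mem s' ''lambda'') (row s')"
    using A W unfolding s' attach_state_def by (intro attach_end) (auto simp: sym_nonneg_def)
  ultimately show ?thesis using A unfolding s' attach_state_def by simp
qed

lemma lift_all:
  assumes b: "base s" and p: "\<And>i a. nat_mem s ''p'' i = 0" and S: "split_result Wf n s"
  defines "s' \<equiv> run lift_all s"
  shows "tree_inv n (n - 1) (Wf (n - 1)) (nat_mem s' ''l'' 0) (real_mem s' ''lambda'') (row s')"
    "nat_mem s' ''l'' 0 \<le> bound3 n 0 0"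
proof -
  let ?p = "PIf (NLess (NConst 0) (nvar ''v'')) lift_vertex PSkip"
  let ?s = "real_write ''lambda'' 0 1 (nat_write ''l'' 0 1 s)"
  have bs: "base ?s" using b by simp
  have N: "nat_mem ?s ''n'' 0 = n" using base_vals[OF bs] by simp
  let ?Q = "\<lambda>k t. tree_inv n (k - 1) (Wf (k - 1)) (nat_mem t ''l'' 0) (real_mem t ''lambda'') (row t) \<and>
     nat_mem t ''l'' 0 \<le> bound3 k 0 0"
  obtain t where t: "run (PFor ''v'' ''n'' ?p) ?s = nat_write ''v'' 0 (nat_mem ?s ''n'' 0) t" "?Q (nat_mem ?s ''n'' 0) t"
  proof (rule run_For[where Q = ?Q and s = ?s and p = ?p and i = "''v''" and a = "''n''"], goal_cases)
    case 1
    have "row ?s = (\<lambda>_ _. 0)" using p by (auto simp: row_def fun_eq_iff)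
    then show ?case unfolding tree_inv_def tree_def bound3_def by simp
  next
    case (2 k t)
    let ?t = "nat_write ''v'' 0 k t"
    have k: "k < n" using 2(2) N by simp
    show ?case
    proof (cases "0 < k")
      case False
      then show ?thesis using 2(3) unfolding bound3_def by simp
    next
      case True
      have fr: "real_mem ?t ''C'' = real_mem s ''C''" "real_mem ?t ''S'' = real_mem s ''S''"
        using frame_real[OF 2(4), of "''C''"] frame_real[OF 2(4), of "''S''"] by simp_all
      obtain \<sigma> where \<sigma>: "level k (Wf k)" "\<And>a. a < k \<Longrightarrow> mat ?t ''C'' k a = Wf k k a"
        "split_ok k (Wf k) \<sigma> (Wf (k - 1))" "\<And>a b. a < b \<Longrightarrow> b < k \<Longrightarrow> split3 ?t k a b = \<sigma> a b"
        using S k True unfolding split_result_def mat_def split3_def fr by auto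
      have "base ?t" using base_frame[OF bs 2(4)] by simp
      then have "tree_inv n k (Wf k) (nat_mem (run lift_vertex ?t) ''l'' 0) (real_mem (run lift_vertex ?t) ''lambda'') (row (run lift_vertex ?t))
          \<and> nat_mem (run lift_vertex ?t) ''l'' 0 \<le> bound3 (Suc k) 0 0"
        by (intro lift_vertex[OF _ _ _ _ k True \<sigma>(2,4,3,1)]) (use 2(3) in auto)
      then show ?thesis using True by simp
    qed
  qed (use that in auto)
  have "s' = nat_write ''v'' 0 n t" unfolding s'_def lift_all_def using t(1) N by simp
  then show "tree_inv n (n - 1) (Wf (n - 1)) (nat_mem s' ''l'' 0) (real_mem s' ''lambda'') (row s')"
    "nat_mem s' ''l'' 0 \<le> bound3 n 0 0" using t(2) N by simp_all
qed

end

section \<open>The connector program\<close>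

definition build_weights :: prog where
  "build_weights = PFor ''e'' ''m''
     (PReal ''W'' (ix (NCell ''end1'' (nvar ''e'')) (NCell ''end2'' (nvar ''e'')))
        (RAdd (RCell ''W'' (ix (NCell ''end1'' (nvar ''e'')) (NCell ''end2'' (nvar ''e'')))) (RCell ''x'' (nvar ''e''))) ;;
      PReal ''W'' (ix (NCell ''end2'' (nvar ''e'')) (NCell ''end1'' (nvar ''e'')))
        (RAdd (RCell ''W'' (ix (NCell ''end2'' (nvar ''e'')) (NCell ''end1'' (nvar ''e'')))) (RCell ''x'' (nvar ''e''))))"

abbreviation ecell :: "string \<Rightarrow> nexp" where "ecell e \<equiv> pcell (NAdd (nvar ''n'') (nvar e))"

definition place_member :: prog where
  "place_member =
     PIf (beq (pcell (nvar ''u'')) (nvar ''w'')) (PNat ''p'' (ix (nvar ''i'') (nvar ''u'')) (nvar ''u'')) PSkip ;;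
     PIf (beq (pcell (nvar ''w'')) (nvar ''u'')) (PNat ''p'' (ix (nvar ''i'') (nvar ''w'')) (nvar ''w'')) PSkip ;;
     PNat ''p'' (ix (nvar ''i'') (NAdd (nvar ''n'') (nvar ''e''))) (NConst 1)"

definition test_absent :: prog where
  "test_absent = nset ''g'' (NConst 0) ;; PIf (beq (ecell ''e'') (NConst 0)) (nset ''g'' (NConst 1)) PSkip"

definition add_member :: prog where
  "add_member = PNat ''p'' (ix (nvar ''i'') (NAdd (nvar ''n'') (nvar ''e''))) (NConst 1)"

definition edge_start :: prog where
  "edge_start =
     rset ''r'' (RCell ''x'' (nvar ''e'')) ;;
     PIf (RLess (ROfNat (NConst 1)) (rvar ''r'')) (rset ''r'' (ROfNat (NConst 1))) PSkip ;;
     nset ''u'' (NCell ''end1'' (nvar ''e'')) ;; nset ''w'' (NCell ''end2'' (nvar ''e''))"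

text \<open>The second \<open>take_weight\<close> continues with the budget \<open>r\<close> that
  the first one left.\<close>

definition place_edges :: prog where
  "place_edges = PFor ''e'' ''m''
     (edge_start ;; take_weight test_pair place_member ;; take_weight test_absent add_member)"

text \<open>Merges two classes of the labelling \<open>B\<close>. Both labels are saved beforehand
  because the loop overwrites entries of \<open>B\<close>.\<close>

definition relabel :: prog where
  "relabel =
     nset ''u'' (NCell ''B'' (NCell ''end1'' (nvar ''k''))) ;; nset ''w'' (NCell ''B'' (NCell ''end2'' (nvar ''k''))) ;;
     PFor ''j'' ''n'' (PIf (beq (NCell ''B'' (nvar ''j'')) (nvar ''u'')) (PNat ''B'' (nvar ''j'') (nvar ''w'')) PSkip)"

definition label :: prog where
  "label =
     PFor ''j'' ''n'' (PNat ''B'' (nvar ''j'') (nvar ''j'')) ;;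
     PFor ''k'' ''m'' (PIf (BAnd (BNot (beq (nvar ''k'') (nvar ''e''))) (BNot (beq (nvar ''k'') (nvar ''f'')))) relabel PSkip)"

definition cut_test :: prog where
  "cut_test = label ;;
     PNat ''Q'' (ix (nvar ''e'') (nvar ''f'')) (NConst 0) ;;
     PFor ''j'' ''n'' (PIf (beq (NCell ''B'' (nvar ''j'')) (NCell ''B'' (NConst 0))) PSkip
       (PNat ''Q'' (ix (nvar ''e'') (nvar ''f'')) (NConst 1)))"

definition cut_pairs :: prog where
  "cut_pairs = PFor ''e'' ''m'' (PFor ''f'' ''m'' cut_test)"

text \<open>The running index \<open>q\<close> takes the place of a product of row number and
  \<open>m\<close>, which the machine cannot form.\<close>

definition write_edge :: prog where
  "write_edge =
     PIf (RLess (RCell ''x'' (nvar ''e'')) (ROfNat (NConst 1)))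
       (PNat ''F'' (nvar ''q'') (ecell ''e''))
       (PNat ''F'' (nvar ''q'') (NConst 1) ;;
        PFor ''f'' ''m''
          (PIf (BAnd (RLess (RCell ''x'' (nvar ''f'')) (ROfNat (NConst 1)))
                 (BAnd (beq (NCell ''Q'' (ix (nvar ''e'') (nvar ''f''))) (NConst 1)) (beq (ecell ''f'') (NConst 0))))
             (PNat ''F'' (nvar ''q'') (NConst 2)) PSkip)) ;;
     nset ''q'' (NAdd (nvar ''q'') (NConst 1))"

definition write_output :: prog where
  "write_output = nset ''q'' (NConst 0) ;;
     PFor ''i'' ''L'' (PIf (NLess (nvar ''i'') (nvar ''l'')) (PFor ''e'' ''m'' write_edge) PSkip)"

section \<open>Correctness of replacing tree links by edges\<close>

lemma writes_build_weights [simp]: "nwrites build_weights = {''e''}" "rwrites build_weights = {''W''}"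
  by (auto simp: build_weights_def)

lemma writes_place_member [simp]: "nwrites place_member = {''p''}" "rwrites place_member = {}"
  by (auto simp: place_member_def)

lemma writes_test_absent [simp]: "nwrites test_absent = {''g''}" "rwrites test_absent = {}"
  by (auto simp: test_absent_def)

lemma writes_add_member [simp]: "nwrites add_member = {''p''}" "rwrites add_member = {}"
  by (auto simp: add_member_def)

lemma writes_edge_start [simp]: "nwrites edge_start = {''u'', ''w''}" "rwrites edge_start = {''r''}"
  by (auto simp: edge_start_def)

lemma writes_place_edges [simp]:
  "nwrites place_edges = {''e'', ''u'', ''w'', ''i'', ''c'', ''p'', ''l'', ''g''}" "rwrites place_edges = {''r'', ''lambda''}"
  by (auto simp: place_edges_def)

lemma writes_relabel [simp]: "nwrites relabel = {''u'', ''w'', ''j'', ''B''}" "rwrites relabel = {}"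
  by (auto simp: relabel_def)

lemma writes_label [simp]: "nwrites label = {''u'', ''w'', ''j'', ''B'', ''k''}" "rwrites label = {}"
  by (auto simp: label_def)

lemma writes_cut_test [simp]: "nwrites cut_test = {''u'', ''w'', ''j'', ''B'', ''k'', ''Q''}" "rwrites cut_test = {}"
  by (auto simp: cut_test_def)

lemma writes_cut_pairs [simp]:
  "nwrites cut_pairs = {''e'', ''f'', ''u'', ''w'', ''j'', ''B'', ''k'', ''Q''}" "rwrites cut_pairs = {}"
  by (auto simp: cut_pairs_def)

lemma writes_write_edge [simp]: "nwrites write_edge = {''F'', ''f'', ''q''}" "rwrites write_edge = {}"
  by (auto simp: write_edge_def)

lemma writes_write_output [simp]: "nwrites write_output = {''q'', ''i'', ''e'', ''F'', ''f''}" "rwrites write_output = {}"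
  by (auto simp: write_output_def)

context setting
begin

lemma edge_lt [simp]: "e < m \<Longrightarrow> n + e < K" "e < m \<Longrightarrow> e < K" "e < m \<Longrightarrow> e < L"
  using K K_le_L by auto

definition ends_ok :: bool where
  "ends_ok \<longleftrightarrow> (\<forall>e<m. end1 e < n \<and> end2 e < n \<and> end1 e \<noteq> end2 e \<and> 0 \<le> x e)"

definition pair_weight :: "nat \<Rightarrow> nat \<Rightarrow> real" where
  "pair_weight a b = (\<Sum>e<m. if {end1 e, end2 e} = {a, b} then x e else 0)"

lemma build_weights:
  assumes b: "base s" and ends: ends_ok and W0: "\<And>i. real_mem s ''W'' i = 0" and ab: "a < n" "b < n"
  shows "mat (run build_weights s) ''W'' a b = pair_weight a b"
proof -
  let ?i = "NCell ''end1'' (nvar ''e'')" and ?j = "NCell ''end2'' (nvar ''e'')"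
  let ?p1 = "PReal ''W'' (ix ?i ?j) (RAdd (RCell ''W'' (ix ?i ?j)) (RCell ''x'' (nvar ''e'')))"
  let ?p2 = "PReal ''W'' (ix ?j ?i) (RAdd (RCell ''W'' (ix ?j ?i)) (RCell ''x'' (nvar ''e'')))"
  let ?p = "?p1 ;; ?p2"
  have N: "nat_mem s ''m'' 0 = m" using base_vals[OF b] by simp
  let ?Q = "\<lambda>k t. \<forall>a<n. \<forall>b<n. mat t ''W'' a b = (\<Sum>e<k. if {end1 e, end2 e} = {a, b} then x e else 0)"
  obtain t where t: "run (PFor ''e'' ''m'' ?p) s = nat_write ''e'' 0 (nat_mem s ''m'' 0) t" "?Q (nat_mem s ''m'' 0) t"
  proof (rule run_For[where Q = ?Q and s = s and p = ?p and i = "''e''" and a = "''m''"], goal_cases)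
    case 1 show ?case using W0 by (simp add: mat_def)
  next
    case (2 k t)
    let ?t = "nat_write ''e'' 0 k t"
    have k: "k < m" using 2(2) N by simp
    have e: "end1 k < n" "end2 k < n" "end1 k \<noteq> end2 k" using ends k unfolding ends_ok_def by auto
    have bt: "base ?t" using base_frame[OF b 2(4)] by simp
    note bv = base_vals[OF bt]
    let ?M = "mat t ''W''"
    let ?t1 = "real_write ''W'' (end1 k * K + end2 k) (?M (end1 k) (end2 k) + x k) ?t"
    have r1: "run ?p1 ?t = ?t1"
      using bv(5)[of "end1 k"] bv(6-8)[OF k] e by (simp add: mat_def)
    have b1: "base ?t1" using bt by simp
    note bv1 = base_vals[OF b1]
    have "mat ?t1 ''W'' (end2 k) (end1 k) = ?M (end2 k) (end1 k)"
      using e by (simp add: mat_def)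
    then have r2: "run ?p2 ?t1 = real_write ''W'' (end2 k * K + end1 k) (?M (end2 k) (end1 k) + x k) ?t1"
      using bv1(5)[of "end2 k"] bv1(6-8)[OF k] e by (simp add: mat_def)
    have "mat (run ?p ?t) ''W'' a b = ?M a b + (if {end1 k, end2 k} = {a, b} then x k else 0)" if "a < n" "b < n" for a b
    proof -
      have "{end1 k, end2 k} = {a, b} \<longleftrightarrow> a = end1 k \<and> b = end2 k \<or> a = end2 k \<and> b = end1 k" by (auto simp: doubleton_eq_iff)
      then show ?thesis unfolding run.simps(4) r1 r2 using that e by (auto simp: mat_def)
    qed
    then show ?case using 2(3) by simp
  qed (use that in auto)
  show ?thesis unfolding build_weights_def t(1) pair_weight_def using t(2) ab N by (simp add: mat_def)
qed

lemma place_member: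
  assumes b: "base t" and e: "nat_mem t ''e'' 0 = e" "e < m" "nat_mem t ''u'' 0 = end1 e" "nat_mem t ''w'' 0 = end2 e"
    and ends: ends_ok and i: "nat_mem t ''i'' 0 = i" "i < L"
  shows "row (run place_member t) j = (if j = i then place n end1 end2 e (row t i) else row t j)"
proof -
  let ?u = "end1 e" and ?w = "end2 e" and ?p = "row t i"
  have lt: "?u < n" "?w < n" "?u \<noteq> ?w" using ends e(2) unfolding ends_ok_def by auto
  have T: "nat_mem t ''T'' i = i * K" "nat_mem t ''n'' 0 = n" using base_vals[OF b] i by auto
  let ?t1 = "if ?p ?u = ?w then nat_write ''p'' (i * K + ?u) ?u t else t"
  have c: "nval (pcell (nvar ''u'')) t = ?p ?u" "nval (nvar ''w'') t = ?w"
    using pcell_val[OF b i, of "nvar ''u''" ?u] e lt by simp_all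
  have r1: "run (PIf (beq (pcell (nvar ''u'')) (nvar ''w'')) (PNat ''p'' (ix (nvar ''i'') (nvar ''u'')) (nvar ''u'')) PSkip) t = ?t1"
    unfolding run.simps(5) bval_beq c using T e i by simp
  have t1: "row ?t1 j = (if j = i then ?p(?u := if ?p ?u = ?w then ?u else ?p ?u) else row t j)" for j
    using row_write[of ?u i ?u t j] lt by (auto simp: fun_eq_iff)
  have b1: "base ?t1" "nat_mem ?t1 ''i'' 0 = i" using b i by simp_all
  have v1: "nat_mem ?t1 ''u'' 0 = ?u" "nat_mem ?t1 ''w'' 0 = ?w" "nat_mem ?t1 ''e'' 0 = e" using e by simp_all
  have T1: "nat_mem ?t1 ''T'' i = i * K" "nat_mem ?t1 ''n'' 0 = n" using T by simp_all
  let ?t2 = "if ?p ?w = ?u then nat_write ''p'' (i * K + ?w) ?w ?t1 else ?t1"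
  have c2: "nval (pcell (nvar ''w'')) ?t1 = ?p ?w" "nval (nvar ''u'') ?t1 = ?u"
    using pcell_val[OF b1 i(2), of "nvar ''w''" ?w] v1 lt t1[of i] by simp_all
  have r2: "run (PIf (beq (pcell (nvar ''w'')) (nvar ''u'')) (PNat ''p'' (ix (nvar ''i'') (nvar ''w'')) (nvar ''w'')) PSkip) ?t1 = ?t2"
    unfolding run.simps(5) bval_beq c2 using T1 v1 b1(2) by simp
  have t2: "row ?t2 j = (if j = i then ?p(?u := if ?p ?u = ?w then ?u else ?p ?u, ?w := if ?p ?w = ?u then ?w else ?p ?w) else row t j)" for j
    using row_write[of ?w i ?w ?t1 j] lt t1[of j] t1[of i] by (auto simp: fun_eq_iff)
  have v2: "nat_mem ?t2 ''i'' 0 = i" "nat_mem ?t2 ''e'' 0 = e" "nat_mem ?t2 ''T'' i = i * K" "nat_mem ?t2 ''n'' 0 = n"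
    using v1 b1(2) T1 by simp_all
  have r3: "run (PNat ''p'' (ix (nvar ''i'') (NAdd (nvar ''n'') (nvar ''e''))) (NConst 1)) ?t2
      = nat_write ''p'' (i * K + (n + e)) 1 ?t2"
    unfolding run.simps(2) nval.simps v2 ..
  show ?thesis
    unfolding place_member_def run.simps(4) r1 r2 r3 row_write[OF edge_lt(1)[OF e(2)]]
    using t2[of j] t2[of i] unfolding place_def by simp
qed

lemma test_absent:
  assumes "base t" "nat_mem t ''e'' 0 = e" "e < m" "nat_mem t ''i'' 0 = i" "i < L"
  shows "nat_mem (run test_absent t) ''g'' 0 = of_bool (row t i (n + e) = 0)"
proof -
  let ?t = "nat_write ''g'' 0 0 t"
  have b: "base ?t" "nat_mem ?t ''i'' 0 = i" using assms by simp_all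
  have c: "nval (ecell ''e'') ?t = row t i (n + e)"
    using pcell_val[OF b assms(5), of "NAdd (nvar ''n'') (nvar ''e'')" "n + e"] assms base_vals[OF b(1)] by simp
  have "run (nset ''g'' (NConst 0)) t = ?t" by simp
  then show ?thesis unfolding test_absent_def run.simps(4,5) bval_beq by (simp only: c nval.simps(1)) simp
qed

lemma add_member:
  assumes "base t" "nat_mem t ''e'' 0 = e" "e < m" "nat_mem t ''i'' 0 = i" "i < L"
  shows "row (run add_member t) j = (if j = i then (row t i)(n + e := 1) else row t j)"
proof -
  have "run add_member t = nat_write ''p'' (i * K + (n + e)) 1 t"
    unfolding add_member_def using assms base_vals[OF assms(1)] by simp
  then show ?thesis using row_write[OF edge_lt(1)[OF assms(3)], of i 1 t j] by simp
qed

text \<open>Each edge triggers two modifications, hence at most two additional members.\<close>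

definition edge_state where
  "edge_state k t \<longleftrightarrow>
     edge_inv n m end1 end2 x k (nat_mem t ''l'' 0) (real_mem t ''lambda'') (row t) \<and>
     nat_mem t ''l'' 0 \<le> bound3 n 0 0 + 2 * k"

lemma place_edges:
  assumes b: "base s" and ends: ends_ok and E0: "edge_state 0 s"
  shows "edge_state m (run place_edges s)"
proof -
  let ?p = "edge_start ;; take_weight test_pair place_member ;; take_weight test_absent add_member"
  have N: "nat_mem s ''m'' 0 = m" using base_vals[OF b] by simp
  obtain t where t: "run (PFor ''e'' ''m'' ?p) s = nat_write ''e'' 0 (nat_mem s ''m'' 0) t" "edge_state (nat_mem s ''m'' 0) t"
  proof (rule run_For[where Q = edge_state and s = s and p = ?p and i = "''e''" and a = "''m''"], goal_cases)
    case 1 show ?case by (rule E0)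
  next
    case (2 k t)
    let ?t = "nat_write ''e'' 0 k t"
    have k: "k < m" using 2(2) N by simp
    have e: "end1 k < n" "end2 k < n" "end1 k \<noteq> end2 k" "0 \<le> x k" using ends k unfolding ends_ok_def by auto
    have bt: "base ?t" using base_frame[OF b 2(4)] by simp
    note bv = base_vals[OF bt]
    let ?l = "nat_mem t ''l'' 0" and ?lam = "real_mem t ''lambda''" and ?P = "row t"
    have I: "edge_inv n m end1 end2 x k ?l ?lam ?P" "?l \<le> bound3 n 0 0 + 2 * k"
      using 2(3) unfolding edge_state_def by auto
    \<comment> \<open>The 2 in the definition of \<open>K\<close> pays for the members appended
      here.\<close>
    have L2: "bound3 n 0 0 + 2 * m < L"
    proof -
      have "bound3 n 0 0 + 2 * m < n * K * K + 2 * K" using K unfolding bound3_def by simp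
      also have "\<dots> \<le> n * K * K + 2 * K * K" using K by simp
      also have "\<dots> = (n + 2) * K * K" by (simp add: algebra_simps)
      also have "\<dots> \<le> L" unfolding L using K by (intro mult_right_mono) auto
      finally show ?thesis .
    qed
    let ?r = "min (x k) 1"
    define s1 where "s1 = run edge_start ?t"
    have bs1: "base s1" unfolding s1_def by (rule base_run[OF bt]) simp
    have s1: "nat_mem s1 ''e'' 0 = k" "nat_mem s1 ''u'' 0 = end1 k" "nat_mem s1 ''w'' 0 = end2 k"
      "nat_mem s1 ''l'' 0 = ?l" "real_mem s1 ''lambda'' = ?lam" "row s1 = ?P" "real_mem s1 ''r'' 0 = ?r"
      using bv(6-8)[OF k] unfolding s1_def
      by (simp_all add: edge_start_def min_def)
    have pos: "0 < ?lam i" if "i < ?l" for i using I(1) that unfolding edge_inv_def by auto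
    define Ctx where "Ctx t \<longleftrightarrow> nat_mem t ''e'' 0 = k \<and> nat_mem t ''u'' 0 = end1 k \<and> nat_mem t ''w'' 0 = end2 k" for t :: state
    have Ctx: "Ctx t'" if "Ctx t" "frame ({''i'', ''c'', ''l'', ''p''} \<union> {''g''}) {''lambda'', ''r''} t t'" for t t'
      using that(1) frame_nat[OF that(2)] unfolding Ctx_def by simp
    define s2 where "s2 = run (take_weight test_pair place_member) s1"
    have C1: "Ctx s1" unfolding Ctx_def using s1 by simp
    have rt1: "retake ?l ?lam (row s1) ?r (\<lambda>p. link p (end1 k) (end2 k)) (place n end1 end2 k)
        (nat_mem s2 ''l'' 0) (real_mem s2 ''lambda'') (row s2) (real_mem s2 ''r'' 0) \<and> nat_mem s2 ''l'' 0 \<le> Suc ?l"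
      unfolding s2_def
    proof (rule take_weight[where I = "\<lambda>_. True" and X = "{''g''}" and Ctx = Ctx])
      show "nat_mem (run test_pair t) ''g'' 0 = of_bool (link (row t i) (end1 k) (end2 k))"
        if "base t" "Ctx t" "nat_mem t ''i'' 0 = i" "i < L" for t i
        using test_pair[OF that(1) _ _ e(1,2) that(3,4)] that(2) unfolding Ctx_def by simp
      show "row (run place_member t) j = (if j = i then place n end1 end2 k (row t i) else row t j)"
        if "base t" "Ctx t" "nat_mem t ''i'' 0 = i" "i < L" for t i j
        using place_member[OF that(1) _ k _ _ ends that(3,4)] that(2) unfolding Ctx_def by simp
    qed (use bs1 s1 C1 Ctx e pos I(2) L2 k in simp_all)
    have fr2: "frame ({''i'', ''c'', ''l'', ''p''} \<union> {''g''}) {''lambda'', ''r''} s1 s2"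
      unfolding s2_def by (rule frame_mono[OF run_frame]) auto
    have b2: "base s2" by (rule base_frame[OF bs1 fr2]) simp
    define s3 where "s3 = run (take_weight test_absent add_member) s2"
    let ?l2 = "nat_mem s2 ''l'' 0" and ?lam2 = "real_mem s2 ''lambda''"
    have rt2: "retake ?l2 ?lam2 (row s2) (real_mem s2 ''r'' 0) (\<lambda>p. p (n + k) = 0) (\<lambda>p. p(n + k := 1))
        (nat_mem s3 ''l'' 0) (real_mem s3 ''lambda'') (row s3) (real_mem s3 ''r'' 0) \<and> nat_mem s3 ''l'' 0 \<le> Suc ?l2"
      unfolding s3_def
    proof (rule take_weight[where I = "\<lambda>_. True" and X = "{''g''}" and Ctx = Ctx])
      show "nat_mem (run test_absent t) ''g'' 0 = of_bool (row t i (n + k) = 0)"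
        if "base t" "Ctx t" "nat_mem t ''i'' 0 = i" "i < L" for t i
        using test_absent[OF that(1) _ k that(3,4)] that(2) unfolding Ctx_def by simp
      show "row (run add_member t) j = (if j = i then (row t i)(n + k := 1) else row t j)"
        if "base t" "Ctx t" "nat_mem t ''i'' 0 = i" "i < L" for t i j
        using add_member[OF that(1) _ k that(3,4)] that(2) unfolding Ctx_def by simp
      show "0 < ?lam2 i" if "i < ?l2" for i using retake_pos[OF conjunct1[OF rt1] that] .
      show "0 \<le> real_mem s2 ''r'' 0" using retake_nonneg[OF conjunct1[OF rt1]] .
      show "?l2 < L" using rt1 I(2) L2 k by linarith
    qed (use b2 Ctx Ctx[OF C1 fr2] in simp_all)
    have "edge_inv n m end1 end2 x (Suc k) (nat_mem s3 ''l'' 0) (real_mem s3 ''lambda'') (row s3)"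
      by (rule edge_step[OF I(1) k]) (use ends rt1 rt2 s1(6) in \<open>auto simp: ends_ok_def\<close>)
    moreover have "run ?p ?t = s3" unfolding s3_def s2_def s1_def by simp
    ultimately show ?case using rt1 rt2 I(2) unfolding edge_state_def by simp
  qed (use that in auto)
  show ?thesis unfolding place_edges_def t(1) using t(2) N unfolding edge_state_def by simp
qed

section \<open>Deciding which pairs of edges form cuts\<close>

definition crossing_free :: "nat \<Rightarrow> nat \<Rightarrow> nat \<Rightarrow> nat set \<Rightarrow> bool" where
  "crossing_free e f l S \<longleftrightarrow> (\<forall>k<l. k \<noteq> e \<longrightarrow> k \<noteq> f \<longrightarrow> (end1 k \<in> S \<longleftrightarrow> end2 k \<in> S))"

definition separating :: "nat \<Rightarrow> nat \<Rightarrow> bool" where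
  "separating e f \<longleftrightarrow> (\<exists>S. S \<noteq> {} \<and> S \<subset> {..<n} \<and> crossing_free e f m S)"

text \<open>Labels are the components of the graph without \<open>e\<close> and \<open>f\<close>:
  the ends of a processed edge share a label, and vertices sharing a label are inseparable by sets
  without crossing edges. Sets are used in place of paths because cuts are what is asked
  for.\<close>

definition labelled where
  "labelled e f l B \<longleftrightarrow> (\<forall>k<l. k \<noteq> e \<longrightarrow> k \<noteq> f \<longrightarrow> B (end1 k) = B (end2 k)) \<and>
     (\<forall>S. crossing_free e f l S \<longrightarrow> (\<forall>a<n. \<forall>b<n. B a = B b \<longrightarrow> (a \<in> S \<longleftrightarrow> b \<in> S)))"

lemma relabel:
  assumes b: "base s" and k: "nat_mem s ''k'' 0 = k" "k < m" and ends: ends_ok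
  defines "B \<equiv> nat_mem s ''B''"
  shows "\<And>a. a < n \<Longrightarrow> nat_mem (run relabel s) ''B'' a = (if B a = B (end1 k) then B (end2 k) else B a)"
proof -
  let ?p = "PIf (beq (NCell ''B'' (nvar ''j'')) (nvar ''u'')) (PNat ''B'' (nvar ''j'') (nvar ''w'')) PSkip"
  let ?s = "nat_write ''w'' 0 (B (end2 k)) (nat_write ''u'' 0 (B (end1 k)) s)"
  have r: "run (nset ''w'' (NCell ''B'' (NCell ''end2'' (nvar ''k'')))) (run (nset ''u'' (NCell ''B'' (NCell ''end1'' (nvar ''k'')))) s) = ?s"
    using base_vals(6,7)[OF b k(2)] k unfolding B_def by simp
  have N: "nat_mem ?s ''n'' 0 = n" using base_vals[OF b] by simp
  let ?Q = "\<lambda>l t. \<forall>a<n. nat_mem t ''B'' a = (if a < l \<and> B a = B (end1 k) then B (end2 k) else B a)"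
  obtain t where t: "run (PFor ''j'' ''n'' ?p) ?s = nat_write ''j'' 0 (nat_mem ?s ''n'' 0) t" "?Q (nat_mem ?s ''n'' 0) t"
  proof (rule run_For[where Q = ?Q and s = ?s and p = ?p and i = "''j''" and a = "''n''"], goal_cases)
    case 1 show ?case unfolding B_def by simp
  next
    case (2 l t)
    have l: "l < n" using 2(2) N by simp
    have [simp]: "nat_mem t ''u'' 0 = B (end1 k)" "nat_mem t ''w'' 0 = B (end2 k)"
      using frame_nat[OF 2(4), of "''u''"] frame_nat[OF 2(4), of "''w''"] by simp_all
    have [simp]: "nat_mem t ''B'' l = B l" using 2(3) l by simp
    show ?case using 2(3) by (auto simp: less_Suc_eq)
  qed (use that in auto)
  show "nat_mem (run relabel s) ''B'' a = (if B a = B (end1 k) then B (end2 k) else B a)" if "a < n" for a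
    unfolding relabel_def run.simps(4) r t(1) using t(2) that N by simp
qed

lemma label:
  assumes b: "base s" and ef: "nat_mem s ''e'' 0 = e" "nat_mem s ''f'' 0 = f" and ends: ends_ok
  shows "labelled e f m (nat_mem (run label s) ''B'')"
proof -
  let ?p1 = "PNat ''B'' (nvar ''j'') (nvar ''j'')"
  let ?p2 = "PIf (BAnd (BNot (beq (nvar ''k'') (nvar ''e''))) (BNot (beq (nvar ''k'') (nvar ''f'')))) relabel PSkip"
  have N: "nat_mem s ''n'' 0 = n" using base_vals[OF b] by simp
  obtain t1 where t1: "run (PFor ''j'' ''n'' ?p1) s = nat_write ''j'' 0 (nat_mem s ''n'' 0) t1" "\<forall>a<nat_mem s ''n'' 0. nat_mem t1 ''B'' a = a"
     "frame (insert ''j'' (nwrites ?p1)) (rwrites ?p1) s t1"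
  proof (rule run_For[where Q = "\<lambda>k t. \<forall>a<k. nat_mem t ''B'' a = a" and s = s and p = ?p1 and i = "''j''" and a = "''n''"], goal_cases)
    case (2 l t)
    show ?case using 2(3) by (auto simp: less_Suc_eq)
  qed (use that in auto)
  let ?s1 = "nat_write ''j'' 0 n t1"
  have b1: "base ?s1" using base_frame[OF b t1(3)] by simp
  have M: "nat_mem ?s1 ''m'' 0 = m" using base_vals[OF b1] by simp
  have ef1: "nat_mem ?s1 ''e'' 0 = e" "nat_mem ?s1 ''f'' 0 = f"
    using frame_nat[OF t1(3), of "''e''"] frame_nat[OF t1(3), of "''f''"] ef by simp_all
  let ?Q = "\<lambda>l t. labelled e f l (nat_mem t ''B'')"
  obtain t2 where t2: "run (PFor ''k'' ''m'' ?p2) ?s1 = nat_write ''k'' 0 (nat_mem ?s1 ''m'' 0) t2" "?Q (nat_mem ?s1 ''m'' 0) t2"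
  proof (rule run_For[where Q = ?Q and s = ?s1 and p = ?p2 and i = "''k''" and a = "''m''"], goal_cases)
    case 1 show ?case using t1(2) N unfolding labelled_def by simp
  next
    case (2 k t)
    let ?t = "nat_write ''k'' 0 k t"
    have k: "k < m" using 2(2) M by simp
    have bt: "base ?t" using base_frame[OF b1 2(4)] by simp
    have eft: "nat_mem ?t ''e'' 0 = e" "nat_mem ?t ''f'' 0 = f"
      using frame_nat[OF 2(4), of "''e''"] frame_nat[OF 2(4), of "''f''"] ef1 by simp_all
    show ?case
    proof (cases "k = e \<or> k = f")
      case True
      then have r: "run ?p2 ?t = ?t" using eft by auto
      have c1: "crossing_free e f (Suc k) S = crossing_free e f k S" for S
        using True unfolding crossing_free_def by (auto simp: less_Suc_eq)
      have c2: "(\<forall>l<Suc k. l \<noteq> e \<longrightarrow> l \<noteq> f \<longrightarrow> B (end1 l) = B (end2 l)) \<longleftrightarrow> (\<forall>l<k. l \<noteq> e \<longrightarrow> l \<noteq> f \<longrightarrow> B (end1 l) = B (end2 l))"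
        for B :: "nat \<Rightarrow> nat" using True by (auto simp: less_Suc_eq)
      have BB: "nat_mem ?t ''B'' = nat_mem t ''B''" by simp
      show ?thesis unfolding r labelled_def c1 c2 BB by (rule 2(3)[unfolded labelled_def])
    next
      case False
      let ?B = "nat_mem t ''B''" and ?B' = "nat_mem (run relabel ?t) ''B''"
      have B': "?B' a = (if ?B a = ?B (end1 k) then ?B (end2 k) else ?B a)" if "a < n" for a
        using relabel[OF bt _ k ends that] by simp
      have en: "end1 l < n" "end2 l < n" if "l < m" for l using ends that unfolding ends_ok_def by auto
      have 1: "\<And>l. l < k \<Longrightarrow> l \<noteq> e \<Longrightarrow> l \<noteq> f \<Longrightarrow> ?B (end1 l) = ?B (end2 l)"
        and 2: "\<And>S a b. crossing_free e f k S \<Longrightarrow> a < n \<Longrightarrow> b < n \<Longrightarrow> ?B a = ?B b \<Longrightarrow> (a \<in> S \<longleftrightarrow> b \<in> S)"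
        using 2(3) unfolding labelled_def by blast+
      have "labelled e f (Suc k) ?B'"
        unfolding labelled_def
      proof (intro conjI allI impI)
        fix l assume l: "l < Suc k" "l \<noteq> e" "l \<noteq> f"
        then have lm: "l < m" using k by simp
        show "?B' (end1 l) = ?B' (end2 l)"
        proof (cases "l = k")
          case True
          then show ?thesis using B' en[OF k] by simp
        next
          case False
          then show ?thesis using 1[of l] l B' en[OF lm] by simp
        qed
      next
        fix S a b assume S: "crossing_free e f (Suc k) S" and ab: "a < n" "b < n" "?B' a = ?B' b"
        have S': "crossing_free e f k S" "end1 k \<in> S \<longleftrightarrow> end2 k \<in> S"
          using S False unfolding crossing_free_def by auto
        note two = 2[OF S'(1)]
        show "a \<in> S \<longleftrightarrow> b \<in> S"
          using ab(3) B'[OF ab(1)] B'[OF ab(2)] S'(2) two[OF ab(1,2)] two[OF ab(1) en(1)[OF k]] two[OF ab(1) en(2)[OF k]]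
            two[OF ab(2) en(1)[OF k]] two[OF ab(2) en(2)[OF k]]
          by (cases "?B a = ?B (end1 k)"; cases "?B b = ?B (end1 k)") simp_all
      qed
      moreover have "run ?p2 ?t = run relabel ?t" using False eft by simp
      ultimately show ?thesis by simp
    qed
  qed (use that in auto)
  show ?thesis unfolding label_def run.simps(4) t1(1) N t2(1) using t2(2) M by simp
qed

text \<open>The class of vertex \<open>0\<close> is a separating set unless it contains every
  vertex; conversely a separating set splits two labels, one of which differs from that of
  \<open>0\<close>.\<close>

lemma labelled_separating:
  assumes "labelled e f m B" ends_ok
  shows "separating e f \<longleftrightarrow> (\<exists>a<n. B a \<noteq> B 0)"
proof
  assume "separating e f"
  then obtain S where S: "S \<noteq> {}" "S \<subset> {..<n}" "crossing_free e f m S" unfolding separating_def by blast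
  then obtain a b where ab: "a \<in> S" "b < n" "b \<notin> S" "a < n" by blast
  have "\<not> (B a = B b)" using assms(1) S(3) ab unfolding labelled_def by blast
  then show "\<exists>a<n. B a \<noteq> B 0" using ab by metis
next
  assume "\<exists>a<n. B a \<noteq> B 0"
  then obtain a where a: "a < n" "B a \<noteq> B 0" by blast
  let ?S = "{b. b < n \<and> B b = B 0}"
  have cf: "crossing_free e f m ?S"
    using assms unfolding crossing_free_def labelled_def ends_ok_def by auto
  have "0 \<in> ?S" using n by simp
  then have ne: "?S \<noteq> {}" by blast
  have "?S \<subset> {..<n}" using a by auto
  then show "separating e f" unfolding separating_def by (intro exI[of _ ?S] conjI ne cf)
qed

definition cutm :: "state \<Rightarrow> nat \<Rightarrow> nat \<Rightarrow> nat" where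
  "cutm s e f = nat_mem s ''Q'' (e * K + f)"

lemma cut_test:
  assumes b: "base s" and ef: "nat_mem s ''e'' 0 = e" "nat_mem s ''f'' 0 = f" "e < m" "f < m" and ends: ends_ok and g: "f' < m"
  shows "cutm (run cut_test s) e' f' = (if e' = e \<and> f' = f then of_bool (separating e f) else cutm s e' f')"
proof -
  let ?p = "PIf (beq (NCell ''B'' (nvar ''j'')) (NCell ''B'' (NConst 0))) PSkip
       (PNat ''Q'' (ix (nvar ''e'') (nvar ''f'')) (NConst 1))"
  let ?s1 = "run label s"
  define B where "B = nat_mem ?s1 ''B''"
  have lab: "labelled e f m B" unfolding B_def by (rule label[OF b ef(1,2) ends])
  have b1: "base ?s1" using base_run[OF b] by simp
  let ?s = "nat_write ''Q'' (e * K + f) 0 ?s1"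
  have r: "run (PNat ''Q'' (ix (nvar ''e'') (nvar ''f'')) (NConst 0)) ?s1 = ?s"
    using ef base_vals(5)[OF b1, of e] by simp
  have bs: "base ?s" using b1 by simp
  have N: "nat_mem ?s ''n'' 0 = n" using base_vals[OF bs] by simp
  let ?Q = "\<lambda>k t. \<forall>e' f'. f' < m \<longrightarrow> cutm t e' f' = (if e' = e \<and> f' = f then of_bool (\<exists>a<k. B a \<noteq> B 0) else cutm s e' f')"
  obtain t where t: "run (PFor ''j'' ''n'' ?p) ?s = nat_write ''j'' 0 (nat_mem ?s ''n'' 0) t" "?Q (nat_mem ?s ''n'' 0) t"
  proof (rule run_For[where Q = ?Q and s = ?s and p = ?p and i = "''j''" and a = "''n''"], goal_cases)
    case 1 show ?case using ef by (auto simp: cutm_def)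
  next
    case (2 k t)
    have bt: "base t" using base_frame[OF bs 2(4)] by simp
    have [simp]: "nat_mem t ''e'' 0 = e" "nat_mem t ''f'' 0 = f" "nat_mem t ''B'' = B" "nat_mem t ''T'' e = e * K"
      using frame_nat[OF 2(4), of "''e''"] frame_nat[OF 2(4), of "''f''"] frame_nat[OF 2(4), of "''B''"] ef B_def
        base_vals(5)[OF bt, of e] by simp_all
    have ex: "(\<exists>a<Suc k. B a \<noteq> B 0) \<longleftrightarrow> (\<exists>a<k. B a \<noteq> B 0) \<or> B k \<noteq> B 0" by (auto simp: less_Suc_eq)
    show ?case using 2(3) ef(4) unfolding ex by (simp add: cutm_def)
  qed (use that in auto)
  have "cutm (run cut_test s) e' f' = cutm t e' f'"
    unfolding cut_test_def run.simps(4) r t(1) by (simp add: cutm_def)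
  then show ?thesis using t(2) g N labelled_separating[OF lab ends] by simp
qed

lemma cut_pairs:
  assumes b: "base s" and ends: ends_ok and ef: "e < m" "f < m"
  shows "cutm (run cut_pairs s) e f = of_bool (separating e f)"
proof -
  let ?p = "PFor ''f'' ''m'' cut_test"
  have M: "nat_mem s ''m'' 0 = m" using base_vals[OF b] by simp
  let ?Q = "\<lambda>k t. \<forall>e<k. \<forall>f<m. cutm t e f = of_bool (separating e f)"
  obtain t where t: "run (PFor ''e'' ''m'' ?p) s = nat_write ''e'' 0 (nat_mem s ''m'' 0) t" "?Q (nat_mem s ''m'' 0) t"
  proof (rule run_For[where Q = ?Q and s = s and p = ?p and i = "''e''" and a = "''m''"], goal_cases)
    case (2 k t)
    let ?t = "nat_write ''e'' 0 k t"
    have k: "k < m" using 2(2) M by simp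
    have bt: "base ?t" using base_frame[OF b 2(4)] by simp
    have Mt: "nat_mem ?t ''m'' 0 = m" using base_vals[OF bt] by simp
    let ?R = "\<lambda>l u. (\<forall>e<k. \<forall>f<m. cutm u e f = of_bool (separating e f)) \<and> (\<forall>f<l. cutm u k f = of_bool (separating k f))"
    obtain u where u: "run ?p ?t = nat_write ''f'' 0 (nat_mem ?t ''m'' 0) u" "?R (nat_mem ?t ''m'' 0) u"
    proof (rule run_For[where Q = ?R and s = ?t and p = cut_test and i = "''f''" and a = "''m''"], goal_cases)
      case 1 show ?case using 2(3) by (simp add: cutm_def)
    next
      case (2 l u)
      let ?u = "nat_write ''f'' 0 l u"
      have l: "l < m" using 2(2) Mt by simp
      have bu: "base ?u" using base_frame[OF bt 2(4)] by simp
      have eu: "nat_mem ?u ''e'' 0 = k" using frame_nat[OF 2(4), of "''e''"] by simp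
      have "cutm (run cut_test ?u) e' f' = (if e' = k \<and> f' = l then of_bool (separating k l) else cutm u e' f')" if "f' < m" for e' f'
        using cut_test[OF bu eu _ k l ends that, of e'] by (simp add: cutm_def)
      then show ?case using 2(3) k l by (auto simp: less_Suc_eq)
    qed (use that in auto)
    show ?case unfolding u(1) using u(2) Mt by (auto simp: less_Suc_eq cutm_def)
  qed (use that in auto)
  show ?thesis unfolding cut_pairs_def t(1) using t(2) ef M by (simp add: cutm_def)
qed

section \<open>Final multiplicities and their output\<close>

definition copies :: "(nat \<Rightarrow> nat) \<Rightarrow> nat \<Rightarrow> nat" where
  "copies p e = (if x e < 1 then p (n + e)
     else if \<exists>f<m. x f < 1 \<and> separating e f \<and> p (n + f) = 0 then 2 else 1)"

lemma write_edge:
  assumes b: "base s" and e: "nat_mem s ''e'' 0 = e" "e < m" and i: "nat_mem s ''i'' 0 = i" "i < L"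
    and Q: "\<And>f. f < m \<Longrightarrow> cutm s e f = of_bool (separating e f)" and q: "nat_mem s ''q'' 0 = q"
  shows "nat_mem (run write_edge s) ''F'' = (nat_mem s ''F'')(q := copies (row s i) e)"
    "nat_mem (run write_edge s) ''q'' 0 = Suc q"
proof -
  let ?p = "PIf (BAnd (RLess (RCell ''x'' (nvar ''f'')) (ROfNat (NConst 1)))
                 (BAnd (beq (NCell ''Q'' (ix (nvar ''e'') (nvar ''f''))) (NConst 1)) (beq (ecell ''f'') (NConst 0))))
             (PNat ''F'' (nvar ''q'') (NConst 2)) PSkip"
  note bv = base_vals[OF b]
  have *: "nat_mem (run write_edge s) ''F'' = (nat_mem s ''F'')(q := copies (row s i) e) \<and> nat_mem (run write_edge s) ''q'' 0 = Suc q"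
  proof (cases "x e < 1")
    case True
    have c: "nval (ecell ''e'') s = row s i (n + e)"
      using pcell_val[OF b i, of "NAdd (nvar ''n'') (nvar ''e'')" "n + e"] e bv by simp
    have "run write_edge s = nat_write ''q'' 0 (Suc q) (nat_write ''F'' q (row s i (n + e)) s)"
      unfolding write_edge_def run.simps(4,5) using True bv(8)[OF e(2)] e q c by (simp del: nval.simps(2,3)) simp
    then show ?thesis using True unfolding copies_def by simp
  next
    case False
    let ?s = "nat_write ''F'' q 1 s"
    have bs: "base ?s" using b by simp
    have M: "nat_mem ?s ''m'' 0 = m" using bv by simp
    let ?c = "\<lambda>f. x f < 1 \<and> separating e f \<and> row s i (n + f) = 0"
    define cc where "cc f \<longleftrightarrow> ?c f" for f
    define E where "E k \<longleftrightarrow> (\<exists>f<k. cc f)" for k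
    have E: "\<not> E 0" "E (Suc k) \<longleftrightarrow> E k \<or> cc k" for k unfolding E_def by (auto simp: less_Suc_eq)
    let ?R = "\<lambda>k t. nat_mem t ''F'' = (nat_mem s ''F'')(q := if E k then 2 else 1)"
    obtain t where t: "run (PFor ''f'' ''m'' ?p) ?s = nat_write ''f'' 0 (nat_mem ?s ''m'' 0) t" "?R (nat_mem ?s ''m'' 0) t"
       "frame (insert ''f'' (nwrites ?p)) (rwrites ?p) ?s t"
    proof (rule run_For[where Q = ?R and s = ?s and p = ?p and i = "''f''" and a = "''m''"], goal_cases)
      case 1 show ?case using E by simp
    next
      case (2 k t)
      let ?t = "nat_write ''f'' 0 k t"
      have k: "k < m" using 2(2) M by simp
      have bt: "base ?t" using base_frame[OF bs 2(4)] by simp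
      note bvt = base_vals[OF bt]
      have it: "nat_mem ?t ''i'' 0 = i" "nat_mem ?t ''e'' 0 = e" "nat_mem ?t ''q'' 0 = q" "nat_mem ?t ''f'' 0 = k"
        "cutm ?t = cutm s" "row ?t = row s"
        using frame_nat[OF 2(4), of "''i''"] frame_nat[OF 2(4), of "''e''"] frame_nat[OF 2(4), of "''q''"]
          frame_nat[OF 2(4), of "''Q''"] row_frame[OF 2(4)] e i q by (simp_all add: cutm_def fun_eq_iff)
      have c1: "nval (ecell ''f'') ?t = row s i (n + k)"
        using pcell_val[OF bt it(1) i(2), of "NAdd (nvar ''n'') (nvar ''f'')" "n + k"] bvt it k by simp
      have c2: "nval (NCell ''Q'' (ix (nvar ''e'') (nvar ''f''))) ?t = of_bool (separating e k)"
        using Q[OF k] it(2,4) frame_nat[OF 2(4), of "''Q''"] bvt(5)[of e] e by (simp add: cutm_def)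
      have c3: "rval (RCell ''x'' (nvar ''f'')) ?t = x k" using bvt(8)[OF k] it by simp
      have r: "run ?p ?t = (if cc k then nat_write ''F'' q 2 ?t else ?t)"
        unfolding cc_def run.simps(5) bval.simps bval_beq c1 c2 c3 using it by simp
      show ?case unfolding r E(2) using 2(3) by (cases "cc k"; cases "E k") simp_all
    qed (use that in auto)
    have qt: "nat_mem t ''q'' 0 = q" using frame_nat[OF t(3), of "''q''"] q by simp
    have r1: "run (PNat ''F'' (nvar ''q'') (NConst 1)) s = ?s" using q by simp
    have "\<not> bval (RLess (RCell ''x'' (nvar ''e'')) (ROfNat (NConst 1))) s" using False bv(8)[OF e(2)] e by simp
    then have "run write_edge s = nat_write ''q'' 0 (Suc q) (nat_write ''f'' 0 m t)"
      unfolding write_edge_def run.simps(4,5) r1 t(1) M using qt by simp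
    then show ?thesis using t(2) M False unfolding copies_def E_def cc_def by simp
  qed
  then show "nat_mem (run write_edge s) ''F'' = (nat_mem s ''F'')(q := copies (row s i) e)"
    "nat_mem (run write_edge s) ''q'' 0 = Suc q" by blast+
qed

lemma write_output:
  assumes b: "base s" and Q: "\<And>e f. e < m \<Longrightarrow> f < m \<Longrightarrow> cutm s e f = of_bool (separating e f)"
    and l: "nat_mem s ''l'' 0 = l" "l < L" and ie: "i < l" "e < m"
  shows "nat_mem (run write_output s) ''F'' (i * m + e) = copies (row s i) e"
proof -
  let ?p = "PIf (NLess (nvar ''i'') (nvar ''l'')) (PFor ''e'' ''m'' write_edge) PSkip"
  let ?s = "nat_write ''q'' 0 0 s"
  have bs: "base ?s" using b by simp
  have NL: "nat_mem ?s ''L'' 0 = L" using base_vals[OF bs] by simp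
  let ?R = "\<lambda>k t. (k \<le> l \<longrightarrow> nat_mem t ''q'' 0 = k * m) \<and>
     (\<forall>i<k. i < l \<longrightarrow> (\<forall>e<m. nat_mem t ''F'' (i * m + e) = copies (row s i) e))"
  obtain t where t: "run (PFor ''i'' ''L'' ?p) ?s = nat_write ''i'' 0 (nat_mem ?s ''L'' 0) t" "?R (nat_mem ?s ''L'' 0) t"
  proof (rule run_For[where Q = ?R and s = ?s and p = ?p and i = "''i''" and a = "''L''"], goal_cases)
    case 1 show ?case by simp
  next
    case (2 k t)
    let ?t = "nat_write ''i'' 0 k t"
    have k: "k < L" using 2(2) NL by simp
    have bt: "base ?t" using base_frame[OF bs 2(4)] by simp
    have M: "nat_mem ?t ''m'' 0 = m" using base_vals[OF bt] by simp
    have lt: "nat_mem ?t ''l'' 0 = l" "cutm ?t = cutm s" "row ?t = row s"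
      using frame_nat[OF 2(4), of "''l''"] frame_nat[OF 2(4), of "''Q''"] row_frame[OF 2(4)] l by (simp_all add: cutm_def fun_eq_iff)
    show ?case
    proof (cases "k < l")
      case False
      then have "run ?p ?t = ?t" using lt by simp
      then show ?thesis using 2(3) False by auto
    next
      case True
      \<comment> \<open>Cells of earlier members lie below the current row and are not
        overwritten.\<close>
      have old: "i * m + e < k * m" if "i < k" "e < m" for i e
      proof -
        have "i * m + e < (i + 1) * m" using that by simp
        also have "\<dots> \<le> k * m" using that by (intro mult_right_mono) auto
        finally show ?thesis .
      qed
      let ?S = "\<lambda>h u. nat_mem u ''q'' 0 = k * m + h \<and>
        (\<forall>i<k. \<forall>e<m. nat_mem u ''F'' (i * m + e) = copies (row s i) e) \<and>
        (\<forall>e<h. nat_mem u ''F'' (k * m + e) = copies (row s k) e)"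
      obtain u where u: "run (PFor ''e'' ''m'' write_edge) ?t = nat_write ''e'' 0 (nat_mem ?t ''m'' 0) u" "?S (nat_mem ?t ''m'' 0) u"
      proof (rule run_For[where Q = ?S and s = ?t and p = write_edge and i = "''e''" and a = "''m''"], goal_cases)
        case 1 show ?case using 2(3) True by simp
      next
        case (2 h u)
        let ?u = "nat_write ''e'' 0 h u"
        have h: "h < m" using 2(2) M by simp
        have bu: "base ?u" using base_frame[OF bt 2(4)] by simp
        have iu: "nat_mem ?u ''i'' 0 = k" "cutm ?u = cutm s" "row ?u = row s"
          using frame_nat[OF 2(4), of "''i''"] frame_nat[OF 2(4), of "''Q''"] row_frame[OF 2(4)] lt by (simp_all add: cutm_def fun_eq_iff)
        have q: "nat_mem ?u ''q'' 0 = k * m + h" using 2(3) by simp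
        note we = write_edge[OF bu _ h iu(1) k _ q, unfolded iu]
        have F: "nat_mem (run write_edge ?u) ''F'' = (nat_mem u ''F'')(k * m + h := copies (row s k) h)"
          "nat_mem (run write_edge ?u) ''q'' 0 = Suc (k * m + h)"
          using we Q[OF h] by simp_all
        have "i * m + e \<noteq> k * m + h" if "i < k" "e < m" for i e using old[OF that] by simp
        then show ?case using 2(3) F by (auto simp: less_Suc_eq)
      qed (use that in auto)
      have "run ?p ?t = nat_write ''e'' 0 m u" using True lt u(1) M by simp
      then show ?thesis using u(2) M by (auto simp: less_Suc_eq)
    qed
  qed (use that in auto)
  have "run write_output s = nat_write ''i'' 0 L t" unfolding write_output_def using t(1) NL by simp
  then show ?thesis using t(2) ie l NL by simp
qed

end

section \<open>The complete program\<close>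

definition set_stride :: prog where
  "set_stride = nset ''K'' (NAdd (NAdd (nvar ''n'') (nvar ''m'')) (NConst 2))"

definition set_size :: prog where
  "set_size = PFor ''i'' ''K'' (PFor ''j'' ''K'' (PFor ''k'' ''K'' (nset ''L'' (NAdd (nvar ''L'') (NConst 1)))))"

definition set_table :: prog where
  "set_table = PFor ''i'' ''L'' (PNat ''T'' (nvar ''i'') (nvar ''t'') ;; nset ''t'' (NAdd (nvar ''t'') (nvar ''K'')))"

definition solve :: prog where
  "solve = set_table ;; build_weights ;; split_all ;; lift_all ;; place_edges ;; cut_pairs ;; write_output"

text \<open>\<open>K\<close> and \<open>L\<close> serve as loop bounds, which
  \<open>exec_comp\<close> forbids a program to write. They are therefore computed by separate
  programs, and the executions are concatenated.\<close>

definition whole :: com where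
  "whole = Seq (comp set_stride) (Seq (comp set_size) (comp solve))"

text \<open>\<open>[:2, 1:]\<close> maps the input size \<open>n + m\<close> to \<open>K\<close>,
  and its cube gives \<open>L\<close>, the largest loop bound of \<open>solve\<close>. The 1 is the
  assignment to \<open>K\<close>.\<close>

definition whole_time :: "nat poly" where
  "whole_time = 1 + (pcompose (cost set_size) [:2, 1:] + pcompose (cost solve) ([:2, 1:] ^ 3))"

lemma writes_set_size [simp]: "nwrites set_size = {''i'', ''j'', ''k'', ''L''}" "rwrites set_size = {}"
  by (auto simp: set_size_def)

lemma writes_set_table [simp]: "nwrites set_table = {''i'', ''T'', ''t''}" "rwrites set_table = {}"
  by (auto simp: set_table_def)

lemma writes_solve: "nwrites solve \<inter> {''n'', ''m'', ''K'', ''L''} = {}"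
  by (auto simp: solve_def)

lemma wf_programs [simp]:
  "wf_loops find_best" "wf_loops add_best" "wf_loops ma_init" "wf_loops merge" "wf_loops phase" "wf_loops mincut_init"
  "wf_loops mincut" "wf_loops (adj a)" "wf_loops split_one" "wf_loops split_row" "wf_loops split_vertex" "wf_loops split_all"
  "wf_loops split_member" "wf_loops test_pair" "wf_loops search_step" "wf_loops reroute_member" "wf_loops isolate"
  "wf_loops test_isolated" "wf_loops attach_member" "wf_loops residual" "wf_loops place_member" "wf_loops test_absent"
  "wf_loops add_member" "wf_loops edge_start" "wf_loops relabel" "wf_loops label" "wf_loops cut_test" "wf_loops cut_pairs"
  "wf_loops write_edge" "wf_loops write_output" "wf_loops build_weights" "wf_loops set_table" "wf_loops set_size"
  by (simp_all add: find_best_def add_best_def ma_init_def merge_def phase_def mincut_init_def mincut_def adj_def Let_def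
      split_one_def split_row_def split_vertex_def split_all_def split_member_def test_pair_def search_step_def
      reroute_member_def isolate_def test_isolated_def attach_member_def residual_def place_member_def test_absent_def
      add_member_def edge_start_def relabel_def label_def cut_test_def cut_pairs_def write_edge_def write_output_def
      build_weights_def set_table_def set_size_def)

lemma wf_take_weight [simp]:
  "''i'' \<notin> nwrites test \<Longrightarrow> ''i'' \<notin> nwrites md \<Longrightarrow> wf_loops test \<Longrightarrow> wf_loops md \<Longrightarrow> wf_loops (take_weight test md)"
  by (simp add: take_weight_def take_step_def)

lemma wf_solve: "wf_loops solve"
  by (simp add: solve_def lift_all_def lift_vertex_def undo_row_def undo_pair_def attach_all_def place_edges_def)

lemma bounds_solve: "bounds solve \<subseteq> {''n'', ''m'', ''K'', ''L''}"
  by (simp add: solve_def lift_all_def lift_vertex_def undo_row_def undo_pair_def attach_all_def place_edges_def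
      take_weight_def take_step_def
      find_best_def add_best_def ma_init_def merge_def phase_def mincut_init_def mincut_def adj_def Let_def
      split_one_def split_row_def split_vertex_def split_all_def split_member_def test_pair_def search_step_def
      reroute_member_def isolate_def test_isolated_def attach_member_def residual_def place_member_def test_absent_def
      add_member_def edge_start_def relabel_def label_def cut_test_def cut_pairs_def write_edge_def write_output_def
      build_weights_def set_table_def)

lemma run_set_size:
  assumes "nat_mem s ''K'' 0 = K" "nat_mem s ''L'' 0 = 0"
  shows "nat_mem (run set_size s) ''L'' 0 = K * K * K"
proof -
  let ?p1 = "nset ''L'' (NAdd (nvar ''L'') (NConst 1))"
  have inner: "nat_mem (run (PFor ''k'' ''K'' ?p1) s) ''L'' 0 = nat_mem s ''L'' 0 + nat_mem s ''K'' 0" for s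
  proof -
    obtain t where "run (PFor ''k'' ''K'' ?p1) s = nat_write ''k'' 0 (nat_mem s ''K'' 0) t"
      "nat_mem t ''L'' 0 = nat_mem s ''L'' 0 + nat_mem s ''K'' 0"
      by (rule run_For[where Q = "\<lambda>k t. nat_mem t ''L'' 0 = nat_mem s ''L'' 0 + k"
            and s = s and p = ?p1 and i = "''k''" and a = "''K''"]) (use that in auto)
    then show ?thesis by simp
  qed
  let ?p2 = "PFor ''k'' ''K'' ?p1"
  have middle: "nat_mem (run (PFor ''j'' ''K'' ?p2) s) ''L'' 0 = nat_mem s ''L'' 0 + nat_mem s ''K'' 0 * nat_mem s ''K'' 0" for s
  proof -
    obtain t where "run (PFor ''j'' ''K'' ?p2) s = nat_write ''j'' 0 (nat_mem s ''K'' 0) t"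
      "nat_mem t ''L'' 0 = nat_mem s ''L'' 0 + nat_mem s ''K'' 0 * nat_mem s ''K'' 0"
    proof (rule run_For[where Q = "\<lambda>k t. nat_mem t ''L'' 0 = nat_mem s ''L'' 0 + k * nat_mem s ''K'' 0"
            and s = s and p = ?p2 and i = "''j''" and a = "''K''"], goal_cases)
      case (2 k t)
      then show ?case using inner[of "nat_write ''j'' 0 k t"] frame_nat[OF 2(4), of "''K''"] by simp
    qed (use that in auto)
    then show ?thesis by simp
  qed
  let ?p3 = "PFor ''j'' ''K'' ?p2"
  obtain t where "run (PFor ''i'' ''K'' ?p3) s = nat_write ''i'' 0 (nat_mem s ''K'' 0) t"
      "nat_mem t ''L'' 0 = nat_mem s ''K'' 0 * (K * K)"
  proof (rule run_For[where Q = "\<lambda>k t. nat_mem t ''L'' 0 = k * (K * K)"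
            and s = s and p = ?p3 and i = "''i''" and a = "''K''"], goal_cases)
    case 1 show ?case using assms by simp
  next
    case (2 k t)
    then show ?case using middle[of "nat_write ''i'' 0 k t"] frame_nat[OF 2(4), of "''K''"] assms by simp
  qed (use that in auto)
  then show ?thesis unfolding set_size_def using assms by simp
qed

lemma run_set_table:
  assumes "nat_mem s ''K'' 0 = K" "nat_mem s ''L'' 0 = L" "nat_mem s ''t'' 0 = 0" "i < L"
  shows "nat_mem (run set_table s) ''T'' i = i * K"
proof -
  let ?p = "PNat ''T'' (nvar ''i'') (nvar ''t'') ;; nset ''t'' (NAdd (nvar ''t'') (nvar ''K''))"
  obtain t where "run (PFor ''i'' ''L'' ?p) s = nat_write ''i'' 0 (nat_mem s ''L'' 0) t"
      "(\<forall>i<nat_mem s ''L'' 0. nat_mem t ''T'' i = i * K) \<and> nat_mem t ''t'' 0 = nat_mem s ''L'' 0 * K"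
  proof (rule run_For[where Q = "\<lambda>k t. (\<forall>i<k. nat_mem t ''T'' i = i * K) \<and> nat_mem t ''t'' 0 = k * K"
            and s = s and p = ?p and i = "''i''" and a = "''L''"], goal_cases)
    case 1 show ?case using assms by simp
  next
    case (2 k t)
    then show ?case using frame_nat[OF 2(4), of "''K''"] assms(1) by (auto simp: less_Suc_eq)
  qed (use that in auto)
  then show ?thesis unfolding set_table_def using assms by simp
qed

lemma count_sum_replicate:
  fixes k e' :: nat
  shows "count (\<Sum>e<k. replicate_mset (f e) e) e' = (if e' < k then f e' else (0::nat))"
  by (induction k) (auto simp: less_Suc_eq)

lemma size_filter_pair:
  assumes "e \<noteq> f"
  shows "size {#a \<in># M. a \<in> {e, f}#} = count M e + count M f"
proof -
  have "{#a \<in># M. a \<in> {e, f}#} = replicate_mset (count M e) e + replicate_mset (count M f) f"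
    by (rule multiset_eqI) (use assms in auto)
  then show ?thesis by simp
qed

lemma rtranclp_sym:
  assumes "\<And>a b. r a b \<Longrightarrow> r b a" "r\<^sup>*\<^sup>* a b"
  shows "r\<^sup>*\<^sup>* b a"
  using assms(2) by (induction rule: rtranclp_induct) (auto intro: assms(1) converse_rtranclp_into_rtranclp)

section \<open>The input graph as a weighting and the resulting connectors\<close>

locale instance_setting = setting +
  fixes G :: "(nat, nat) graph"
  assumes G: "finite_graph G" "two_edge_connected G" and x: "x \<in> subtour G" and pres: "presents n m end1 end2 G"
begin

lemma graph [simp]: "verts G = {..<n}" "edges G = {..<m}" "e < m \<Longrightarrow> ends G e = {end1 e, end2 e}"
  using pres unfolding presents_def by auto

lemma ends_ok: ends_ok
  unfolding ends_ok_def
proof (intro allI impI)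
  fix e assume e: "e < m"
  then have "{end1 e, end2 e} \<subseteq> {..<n}" "card {end1 e, end2 e} = 2"
    using G(1) unfolding finite_graph_def by auto
  moreover have "0 \<le> x e" using x e unfolding subtour_def by auto
  ultimately show "end1 e < n \<and> end2 e < n \<and> end1 e \<noteq> end2 e \<and> 0 \<le> x e" by auto
qed

lemma delta_eq: "delta G S = {e. e < m \<and> (end1 e \<in> S) \<noteq> (end2 e \<in> S)}"
proof -
  have "e \<in> delta G S \<longleftrightarrow> (end1 e \<in> S) \<noteq> (end2 e \<in> S)" if "e < m" for e
    using delta_iff[OF G(1), of e "end1 e" "end2 e" S] that by simp
  moreover have "e \<in> delta G S \<Longrightarrow> e < m" for e unfolding delta_def by simp
  ultimately show ?thesis by blast
qed

text \<open>Edges are added one at a time: each contributes its weight to two opposite entries of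
  the matrix, of which a cut counts one if it separates the ends. Parallel edges just
  accumulate.\<close>

lemma cut_pair_weight_matrix:
  "cut pair_weight {..<n} X = (\<Sum>e\<in>delta G X. x e)"
proof -
  have "k \<le> m \<Longrightarrow> cut (\<lambda>a b. \<Sum>e<k. if {end1 e, end2 e} = {a, b} then x e else 0) {..<n} X
    = (\<Sum>e<k. if (end1 e \<in> X) \<noteq> (end2 e \<in> X) then x e else 0)" for k
  proof (induction k)
    case 0
    show ?case by (simp add: cut_def)
  next
    case (Suc k)
    have e: "end1 k < n" "end2 k < n" "end1 k \<noteq> end2 k" using ends_ok Suc.prems unfolding ends_ok_def by auto
    have "cut (\<lambda>a b. \<Sum>e<Suc k. if {end1 e, end2 e} = {a, b} then x e else 0) {..<n} X =
      cut (\<lambda>a b. (\<Sum>e<k. if {end1 e, end2 e} = {a, b} then x e else 0) +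
        x k * (of_bool (a = end1 k \<and> b = end2 k) + of_bool (a = end2 k \<and> b = end1 k))) {..<n} X"
      by (rule cut_cong) (use e in \<open>auto simp: doubleton_eq_iff\<close>)
    then show ?case using Suc e by (simp add: cut_add cut_scale cut_entry)
  qed
  from this[of m] have "cut pair_weight {..<n} X = (\<Sum>e<m. if (end1 e \<in> X) \<noteq> (end2 e \<in> X) then x e else 0)"
    unfolding pair_weight_def[abs_def] by simp
  also have "\<dots> = (\<Sum>e\<in>delta G X. x e)"
    unfolding delta_eq by (simp add: sum.If_cases Int_def)
  finally show ?thesis .
qed

lemma level_pair_weight:
  assumes "\<And>a b. a < n \<Longrightarrow> b < n \<Longrightarrow> W a b = pair_weight a b"
  shows "level (n - 1) W"
proof -
  have e: "{..n - 1} = {..<n}" using n by auto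
  have "sym_nonneg W {..<n}"
    unfolding sym_nonneg_def
  proof (intro ballI impI)
    fix a b assume "a \<in> {..<n}" "b \<in> {..<n}"
    moreover have "pair_weight a b = pair_weight b a" unfolding pair_weight_def by (simp add: insert_commute)
    moreover have "0 \<le> pair_weight a b"
      unfolding pair_weight_def using ends_ok by (intro sum_nonneg) (auto simp: ends_ok_def)
    ultimately show "W a b = W b a \<and> 0 \<le> W a b" using assms by simp
  qed
  moreover have "2 \<le> cut W {..<n} X" if "X \<noteq> {}" "X \<subset> {..<n}" for X
  proof -
    have "cut W {..<n} X = cut pair_weight {..<n} X" by (rule cut_cong) (use assms in auto)
    also have "\<dots> = (\<Sum>e\<in>delta G X. x e)" by (rule cut_pair_weight_matrix)
    finally show ?thesis using x that unfolding subtour_def by simp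
  qed
  ultimately show ?thesis unfolding level_def e by blast
qed

lemma separating_iff: "separating e f \<longleftrightarrow> cut_pair G e f"
proof -
  have "crossing_free e f m S \<longleftrightarrow> delta G S \<subseteq> {e, f}" for S
    unfolding crossing_free_def delta_eq by blast
  then show ?thesis unfolding separating_def cut_pair_def by simp
qed

lemma solve:
  assumes b: "base s" and W: "\<And>i. real_mem s ''W'' i = 0" and p: "\<And>i. nat_mem s ''p'' i = 0"
  defines "s' \<equiv> run write_output (run cut_pairs (run place_edges (run lift_all (run split_all (run build_weights s)))))"
  shows "\<exists>P l lam. nat_mem s' ''l'' 0 = l \<and> real_mem s' ''lambda'' = lam \<and> edge_inv n m end1 end2 x m l lam P \<and>
    (\<forall>i<l. \<forall>e<m. nat_mem s' ''F'' (i * m + e) = copies (P i) e)"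
proof -
  define s1 where "s1 = run build_weights s"
  define s2 where "s2 = run split_all s1"
  define s3 where "s3 = run lift_all s2"
  define s4 where "s4 = run place_edges s3"
  define s5 where "s5 = run cut_pairs s4"
  have b1: "base s1" unfolding s1_def by (rule base_run[OF b]) simp
  have b2: "base s2" unfolding s2_def by (rule base_run[OF b1]) simp
  have b3: "base s3" unfolding s3_def by (rule base_run[OF b2]) simp
  have b4: "base s4" unfolding s4_def by (rule base_run[OF b3]) simp
  have b5: "base s5" unfolding s5_def by (rule base_run[OF b4]) simp
  have W1: "mat s1 ''W'' a b = pair_weight a b" if "a < n" "b < n" for a b
    unfolding s1_def by (rule build_weights[OF b ends_ok W that])
  obtain Wf where Wf: "Wf (n - 1) = mat s1 ''W''" "split_result Wf n s2"
    using split_all[OF b1 level_pair_weight[OF W1]] unfolding s2_def by blast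
  have p2: "nat_mem s2 ''p'' i = 0" for i unfolding s2_def s1_def using p by simp
  note la = lift_all[OF b2 p2 Wf(2), folded s3_def, unfolded Wf(1)]
  have "edge_inv n m end1 end2 x 0 (nat_mem s3 ''l'' 0) (real_mem s3 ''lambda'') (row s3)"
    by (rule edge_start[OF la(1) n]) (use W1 in \<open>simp add: pair_weight_def\<close>)
  then have E3: "edge_state 0 s3" using la(2) unfolding edge_state_def by simp
  have E4: "edge_state m s4" unfolding s4_def by (rule place_edges[OF b3 ends_ok E3])
  let ?l = "nat_mem s4 ''l'' 0" and ?lam = "real_mem s4 ''lambda''"
  have lL: "?l < L"
  proof -
    have "bound3 n 0 0 + 2 * m < n * K * K + 2 * K" using K unfolding bound3_def by simp
    also have "\<dots> \<le> n * K * K + 2 * K * K" using K by simp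
    also have "\<dots> = (n + 2) * K * K" by (simp add: algebra_simps)
    also have "\<dots> \<le> L" unfolding L using K by (intro mult_right_mono) auto
    finally show ?thesis using E4 unfolding edge_state_def by simp
  qed
  have s': "s' = run write_output s5" unfolding s'_def s5_def s4_def s3_def s2_def s1_def ..
  have Q5: "cutm s5 e f = of_bool (separating e f)" if "e < m" "f < m" for e f
    unfolding s5_def by (rule cut_pairs[OF b4 ends_ok that])
  have l5: "nat_mem s5 ''l'' 0 = ?l" "row s5 = row s4" "real_mem s5 = real_mem s4" unfolding s5_def by (simp_all add: fun_eq_iff)
  have "nat_mem s' ''F'' (i * m + e) = copies (row s4 i) e" if "i < ?l" "e < m" for i e
    using write_output[OF b5 Q5 l5(1) lL that] unfolding s' l5 .
  moreover have "nat_mem s' ''l'' 0 = ?l" "real_mem s' ''lambda'' = ?lam" unfolding s' using l5 by simp_all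
  ultimately show ?thesis using E4 unfolding edge_state_def by blast
qed

text \<open>No member has links between distinct vertices any more, so connectivity rests on edges
  alone; \<open>multiplicity_of\<close> keeps every edge that is present. Weight and parity are the
  statements about \<open>multiplicity_of\<close>.\<close>

lemma connectors:
  assumes E: "edge_inv n m end1 end2 x m l lam P"
  obtains F where "\<And>i e. e < m \<Longrightarrow> count (F i) e = copies (P i) e" "\<And>i. i < l \<Longrightarrow> connector G (F i)"
    "\<And>e. e < m \<Longrightarrow> (\<Sum>i<l. lam i * incidence (F i) e) \<le> x e"
    "(\<Sum>i<l. lam i) = 1" "\<And>i. i < l \<Longrightarrow> 0 < lam i"
    "\<And>i D. i < l \<Longrightarrow> two_edge_cut G D \<Longrightarrow> even (size {#e \<in># F i. e \<in> D#})"
proof -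
  \<comment> \<open>Set to zero outside the valid indices, so that \<open>c i e \<le> 1\<close>
    holds without side conditions.\<close>
  define c where "c i e = (if i < l \<and> e < m then P i (n + e) else 0)" for i e
  have E1: "0 < lam i" "\<And>a. a < n \<Longrightarrow> (joined n m end1 end2 (P i))\<^sup>*\<^sup>* a 0" "\<And>e. e < m \<Longrightarrow> P i (n + e) \<le> 1"
    if "i < l" for i using E that unfolding edge_inv_def by blast+
  have E2: "(\<Sum>i<l. lam i) = 1" using E unfolding edge_inv_def by blast
  have E3: "total l lam P (\<lambda>p. of_bool (link p a b)) \<le> 0" if "a < n" "b < n" "a \<noteq> b" for a b
    using E that unfolding edge_inv_def by simp
  have E4: "(\<Sum>i<l. lam i * real (P i (n + e))) = min (x e) 1" if "e < m" for e
    using E that unfolding edge_inv_def total_def by blast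
  have c1: "c i e \<le> 1" for i e using E1(3) unfolding c_def by simp
  have co: "copies (P i) e = multiplicity_of G x (c i) e" if "i < l" "e < m" for i e
  proof -
    have "(\<exists>f<m. x f < 1 \<and> separating e f \<and> P i (n + f) = 0) \<longleftrightarrow> (\<exists>f\<in>edges G. x f < 1 \<and> cut_pair G e f \<and> c i f = 0)"
      unfolding separating_iff c_def using that by auto
    then show ?thesis unfolding copies_def multiplicity_of_def using that by (simp add: c_def)
  qed
  define F where "F i = (\<Sum>e<m. replicate_mset (copies (P i) e) e)" for i
  have cF: "count (F i) e = (if e < m then copies (P i) e else 0)" for i e
    unfolding F_def by (rule count_sum_replicate)
  have "connector G (F i)" if i: "i < l" for i
  proof -
    have set: "set_mset (F i) = {e. e < m \<and> 0 < copies (P i) e}"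
      unfolding set_mset_def cF by auto
    have le2: "count (F i) e \<le> 2" for e
    proof -
      have "multiplicity_of G x (c i) e \<le> 2" using c1[of i e] unfolding multiplicity_of_def by simp
      then show ?thesis unfolding cF using co[OF i, of e] by simp
    qed
    let ?r = "adjacent_via G (set_mset (F i))"
    have sym: "?r a b \<Longrightarrow> ?r b a" for a b unfolding adjacent_via_def by (simp add: insert_commute)
    \<comment> \<open>All edges are settled, so the bound on the links of a pair is an empty sum,
      while a member with a link would contribute positive weight.\<close>
    have nolink: "\<not> link (P i) a b" if ab: "a < n" "b < n" "a \<noteq> b" for a b
    proof
      assume lk: "link (P i) a b"
      have "0 < (\<Sum>j<l. lam j * of_bool (link (P j) a b))"
        by (rule sum_pos2[of _ i]) (use i lk E1(1) in \<open>auto simp: less_imp_le\<close>)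
      then show False using E3[OF ab] unfolding total_def by simp
    qed
    \<comment> \<open>Vertices that are their own parents are joined to themselves; such loops are
      harmless and are treated separately.\<close>
    have step: "?r\<^sup>*\<^sup>* a b" if j: "joined n m end1 end2 (P i) a b" for a b
    proof (cases "a = b")
      case False
      have "\<not> link (P i) a b" using nolink False j unfolding joined_def by blast
      then obtain e where e: "e < m" "0 < P i (n + e)" "{end1 e, end2 e} = {a, b}" using j unfolding joined_def by blast
      have "0 < c i e" using e i unfolding c_def by simp
      then have "0 < copies (P i) e" unfolding co[OF i e(1)] by (rule multiplicity_pos)
      then have "?r a b" unfolding adjacent_via_def set using e by auto
      then show ?thesis by blast
    qed simp
    have reach: "?r\<^sup>*\<^sup>* a 0" if "a < n" for a
    proof -
      have "(joined n m end1 end2 (P i))\<^sup>*\<^sup>* a 0" by (rule E1(2)[OF i that])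
      then show ?thesis by (induction rule: rtranclp_induct) (use step in \<open>auto intro: rtranclp_trans\<close>)
    qed
    have "?r\<^sup>*\<^sup>* u v" if "u < n" "v < n" for u v
      using reach[OF that(1)] rtranclp_sym[of ?r v 0, OF sym reach[OF that(2)]] by (rule rtranclp_trans)
    then have "spanning_connected G (set_mset (F i))" unfolding spanning_connected_def by simp
    moreover have "set_mset (F i) \<subseteq> edges G" unfolding set by auto
    ultimately show ?thesis unfolding connector_def using le2 by blast
  qed
  moreover have "(\<Sum>i<l. lam i * incidence (F i) e) \<le> x e" if e: "e < m" for e
  proof -
    have "(\<Sum>i<l. lam i * incidence (F i) e) = (\<Sum>i<l. lam i * real (multiplicity_of G x (c i) e))"
      unfolding incidence_def cF using e by (intro sum.cong refl) (simp add: co)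
    also have "\<dots> \<le> x e"
    proof (rule multiplicity_weight[OF G(2,1) x E1(1) E2 c1])
      fix f assume "f \<in> edges G"
      then have f: "f < m" by simp
      have "(\<Sum>i<l. lam i * real (c i f)) = (\<Sum>i<l. lam i * real (P i (n + f)))"
        by (intro sum.cong refl) (use f in \<open>simp add: c_def\<close>)
      then show "(\<Sum>i<l. lam i * real (c i f)) = min (x f) 1" using E4[OF f] by simp
    qed (use e in auto)
    finally show ?thesis .
  qed
  moreover have "even (size {#e \<in># F i. e \<in> D#})" if i: "i < l" and D: "two_edge_cut G D" for i D
  proof -
    obtain S where S: "S \<noteq> {}" "S \<subset> verts G" "D = delta G S" "card D = 2" using D unfolding two_edge_cut_def by blast
    obtain e f where ef: "D = {e, f}" "e \<noteq> f" using S(4) by (meson card_2_iff)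
    then have "e < m" "f < m" using S(3) unfolding delta_def by auto
    moreover have "cut_pair G e f" unfolding cut_pair_def using S ef by (intro exI[of _ S]) auto
    ultimately have "even (multiplicity_of G x (c i) e + multiplicity_of G x (c i) f)"
      by (intro multiplicity_parity[OF G(2,1) x c1]) auto
    then show ?thesis unfolding ef(1) size_filter_pair[OF ef(2)] cF using \<open>e < m\<close> \<open>f < m\<close> co[OF i] by simp
  qed
  ultimately show thesis using that[of F] cF E1(1) E2 by simp
qed

lemma whole:
  "\<exists>t s l F \<mu>. exec whole (input_state n m end1 end2 x) t s \<and> t \<le> poly whole_time (n + m) \<and> outputs s m l F \<mu> \<and>
     (\<forall>i<l. connector G (F i)) \<and> (\<forall>e\<in>edges G. x e \<ge> (\<Sum>i<l. \<mu> i * incidence (F i) e)) \<and>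
     (\<Sum>i<l. \<mu> i) = 1 \<and> (\<forall>i<l. \<mu> i > 0) \<and>
     (\<forall>i<l. \<forall>D. two_edge_cut G D \<longrightarrow> even (size {#e \<in># F i. e \<in> D#}))"
proof -
  let ?s = "input_state n m end1 end2 x"
  let ?s1 = "nat_write ''K'' 0 K ?s"
  let ?s2 = "run set_size ?s1"
  let ?s3 = "run set_table ?s2"
  have e1: "exec (comp set_stride) ?s 1 ?s1"
    using exec.NAssign[of "''K''" "NConst 0" "NAdd (NAdd (nvar ''n'') (nvar ''m'')) (NConst 2)" ?s]
    unfolding set_stride_def K by (simp add: input_state_def)
  have in1: "nat_mem ?s1 ''K'' 0 = K" "nat_mem ?s1 ''L'' 0 = 0" by (simp_all add: input_state_def)
  obtain t2 where e2: "exec (comp set_size) ?s1 t2 ?s2" "t2 \<le> poly (cost set_size) K"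
    using exec_comp[of set_size "nwrites set_size" ?s1 K] in1 by (auto simp: set_size_def)
  have in2: "nat_mem ?s2 ''K'' 0 = K" "nat_mem ?s2 ''L'' 0 = L" "nat_mem ?s2 ''t'' 0 = 0" "nat_mem ?s2 ''n'' 0 = n"
      "nat_mem ?s2 ''m'' 0 = m"
    using run_set_size[OF in1] unfolding L by (simp_all add: input_state_def)
  have BL: "n \<le> L" "m \<le> L" "K \<le> L" using K K_le_L by auto
  have "nat_mem ?s2 a 0 \<le> L" if "a \<in> bounds solve" for a
  proof -
    have "a \<in> {''n'', ''m'', ''K'', ''L''}" using that bounds_solve by blast
    then show ?thesis using in2 BL by auto
  qed
  then obtain t3 where e3: "exec (comp solve) ?s2 t3 (run solve ?s2)" "t3 \<le> poly (cost solve) L"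
    using exec_comp[of solve "nwrites solve" ?s2 L] wf_solve bounds_solve writes_solve by blast
  have base: "base ?s3"
    unfolding base_def using in2 run_set_table[OF in2(1-3)] by (simp add: input_state_def)
  have run: "run solve ?s2 = run write_output (run cut_pairs (run place_edges (run lift_all (run split_all (run build_weights ?s3)))))"
    unfolding solve_def by simp
  obtain P l lam where out: "nat_mem (run solve ?s2) ''l'' 0 = l" "real_mem (run solve ?s2) ''lambda'' = lam"
      "edge_inv n m end1 end2 x m l lam P"
      "\<forall>i<l. \<forall>e<m. nat_mem (run solve ?s2) ''F'' (i * m + e) = copies (P i) e"
    using solve[OF base] unfolding run by (auto simp: input_state_def)
  obtain F where F: "\<And>i e. e < m \<Longrightarrow> count (F i) e = copies (P i) e" "\<And>i. i < l \<Longrightarrow> connector G (F i)"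
    "\<And>e. e < m \<Longrightarrow> (\<Sum>i<l. lam i * incidence (F i) e) \<le> x e"
    "(\<Sum>i<l. lam i) = 1" "\<And>i. i < l \<Longrightarrow> 0 < lam i"
    "\<And>i D. i < l \<Longrightarrow> two_edge_cut G D \<Longrightarrow> even (size {#e \<in># F i. e \<in> D#})"
    using connectors[OF out(3)] by blast
  have "exec whole ?s (1 + (t2 + t3)) (run solve ?s2)"
    unfolding whole_def by (rule exec.Seq[OF e1 exec.Seq[OF e2(1) e3(1)]])
  moreover have "1 + (t2 + t3) \<le> poly whole_time (n + m)"
  proof -
    have "poly [:2, 1:] (n + m) = K" unfolding K by simp
    moreover have "K ^ 3 = L" unfolding L by (simp add: power3_eq_cube)
    ultimately have "poly whole_time (n + m) = 1 + (poly (cost set_size) K + poly (cost solve) L)"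
      unfolding whole_time_def by (simp add: poly_pcompose poly_power)
    then show ?thesis using e2(2) e3(2) by simp
  qed
  moreover have "outputs (run solve ?s2) m l F lam"
    unfolding outputs_def using out F(1) by auto
  ultimately show ?thesis using F(2-6) by (intro exI[of _ "1 + (t2 + t3)"] exI[of _ "run solve ?s2"] exI[of _ l] exI[of _ F] exI[of _ lam]) auto
qed

end

theorem theorem14:
  "\<exists>(prog :: com) (time :: nat poly).
     \<forall>(G :: (nat, nat) graph) n m end1 end2 (x :: nat \<Rightarrow> real).
       finite_graph G \<and> two_edge_connected G \<and> x \<in> subtour G \<and> presents n m end1 end2 G \<longrightarrow>
       (\<exists>t s l F \<mu>.
          exec prog (input_state n m end1 end2 x) t s \<and> t \<le> poly time (n + m) \<and>
          outputs s m l F \<mu> \<and>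
          (\<forall>i<l. connector G (F i)) \<and>
          (\<forall>e\<in>edges G. x e \<ge> (\<Sum>i<l. \<mu> i * incidence (F i) e)) \<and>
          (\<Sum>i<l. \<mu> i) = 1 \<and> (\<forall>i<l. \<mu> i > 0) \<and>
          (\<forall>i<l. \<forall>D. two_edge_cut G D \<longrightarrow> even (size {#e \<in># F i. e \<in> D#})))"
proof (rule exI[of _ whole], rule exI[of _ whole_time], intro allI impI, elim conjE)
  fix G :: "(nat, nat) graph" and n m end1 end2 and x :: "nat \<Rightarrow> real"
  assume a: "finite_graph G" "two_edge_connected G" "x \<in> subtour G" "presents n m end1 end2 G"
  have "verts G \<noteq> {}" "verts G = {..<n}" using a unfolding finite_graph_def presents_def by auto
  then have "0 < n" by auto
  then interpret instance_setting n m "n + m + 2" "(n + m + 2) * (n + m + 2) * (n + m + 2)" end1 end2 x G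
    by unfold_locales (use a in auto)
  show "\<exists>t s l F \<mu>.
          exec whole (input_state n m end1 end2 x) t s \<and> t \<le> poly whole_time (n + m) \<and>
          outputs s m l F \<mu> \<and>
          (\<forall>i<l. connector G (F i)) \<and>
          (\<forall>e\<in>edges G. x e \<ge> (\<Sum>i<l. \<mu> i * incidence (F i) e)) \<and>
          (\<Sum>i<l. \<mu> i) = 1 \<and> (\<forall>i<l. \<mu> i > 0) \<and>
          (\<forall>i<l. \<forall>D. two_edge_cut G D \<longrightarrow> even (size {#e \<in># F i. e \<in> D#}))"
    by (rule whole)
qed

end
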